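(* Let $M=\bigoplus_{n\ge0}M_n=\mathbb{Z}[x,y]$ be the graded $SL_2(\mathbb{Z})$-module described in the context. For $i>1$ the cohomology $H^i(SL_2(\mathbb{Z});M)$ is 2-periodic in $i$, i.e. $H^{i}(SL_2(\mathbb{Z});M_n)\cong H^{i+2}(SL_2(\mathbb{Z});M_n)$ for all $i>1$ and all $n$. For $i>1$ its free part is zero, it has no $p$-torsion for primes $p\ne 2,3$, it has no $2^k$-torsion (no elements of order $2^k$) for $k>2$ and no $3^k$-torsion for $k>1$. For $j\ge 1$ and $m\ge 0$, the group $H^{2j}(SL_2(\mathbb{Z});M_{8m})$ has 4-torsion of rank one (exactly one cyclic summand of order 4 in its 2-primary component); all the other groups $H^i(SL_2(\mathbb{Z});M_n)$, $i>1$, have no 4-torsion. Finally, the 2- and 3-torsion components are determined by the Poincaré series $$P^{2}_{SL_2(\mathbb{Z}),2}(t)=\frac{1-t^4+2t^6-t^8+t^{12}}{(1-t^2)(1+t^6)(1-t^8)},\qquad P^{3}_{SL_2(\mathbb{Z}),2}(t)=\frac{t^4(2-t^2+t^4+t^6-t^8)}{(1-t^2)(1+t^6)(1-t^8)},$$ $$P^{2}_{SL_2(\mathbb{Z}),3}(t)=\frac{1}{1-t^{12}},\qquad P^{3}_{SL_2(\mathbb{Z}),3}(t)=\frac{t^8}{1-t^{12}}.$$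
   Context: The group $SL_2(\mathbb{Z})$ acts on $M=\mathbb{Z}[x,y]$ by graded ring automorphisms determined by $\begin{bmatrix}1&0\\-1&1\end{bmatrix}:x\mapsto x-y,\ y\mapsto y$ and $\begin{bmatrix}1&1\\0&1\end{bmatrix}:x\mapsto x,\ y\mapsto x+y$. The grading is $\deg x=\deg y=2$, $M_n$ is the component of degree $n$ (zero for $n$ odd), and $H^*(SL_2(\mathbb{Z});M)=\bigoplus_nH^*(SL_2(\mathbb{Z});M_n)$. For a subgroup $G\subset SL_2(\mathbb{Z})$ and a prime $p$, $$P^i_{G,p}(t)=\sum_{n=0}^\infty\dim_{\mathbb{F}_p}\big(H^i(G;M_n)\otimes\mathbb{F}_p\big)t^n.$$ *)

theory Defs
  imports
    "HOL-Analysis.Analysis"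
    "HOL-Algebra.Algebra"
    "HOL-Number_Theory.Residues"
    "HOL-Computational_Algebra.Formal_Power_Series"
    "Jordan_Normal_Form.Missing_VectorSpace"
begin

section \<open>Group cohomology\<close>

text \<open>
  Here \<open>A\<close> is an abelian group, written multiplicatively as is usual for \<open>monoid\<close> records, and
  \<open>act\<close> is an action of \<open>G\<close> on \<open>A\<close> by automorphisms.  Cohomology is that of the complex of
  \<open>G\<close>-homomorphisms from the homogeneous bar resolution of the integers to \<open>A\<close>: an \<open>n\<close>-cochain is
  an equivariant function on \<open>(n + 1)\<close>-tuples of elements of \<open>G\<close>, where \<open>G\<close> translates tuples
  diagonally.
\<close>

definition tuples :: "('g, 'm) monoid_scheme \<Rightarrow> nat \<Rightarrow> 'g list set" where
  "tuples G n = {gs. length gs = n \<and> set gs \<subseteq> carrier G}"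

definition cochain_group ::
  "('g, 'm) monoid_scheme \<Rightarrow> ('a, 'k) monoid_scheme \<Rightarrow> ('g \<Rightarrow> 'a \<Rightarrow> 'a) \<Rightarrow> nat
    \<Rightarrow> ('g list \<Rightarrow> 'a) monoid" where
  "cochain_group G A act n =
     (product_group (tuples G (n + 1)) (\<lambda>_. A))
       \<lparr>carrier := {f \<in> tuples G (n + 1) \<rightarrow>\<^sub>E carrier A.
          \<forall>g \<in> carrier G. \<forall>gs \<in> tuples G (n + 1).
            f (map (\<lambda>h. g \<otimes>\<^bsub>G\<^esub> h) gs) = act g (f gs)}\<rparr>"

text \<open>The alternating sum over the \<open>n + 2\<close> faces, which omit one entry of the tuple.\<close>

definition coboundary_map ::
  "('g, 'm) monoid_scheme \<Rightarrow> ('a, 'k) monoid_scheme \<Rightarrow> nat \<Rightarrow> ('g list \<Rightarrow> 'a)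
    \<Rightarrow> ('g list \<Rightarrow> 'a)" where
  "coboundary_map G A n f =
     (\<lambda>gs \<in> tuples G (n + 2).
        finprod A (\<lambda>i. let a = f (take i gs @ drop (Suc i) gs)
                       in if even i then a else inv\<^bsub>A\<^esub> a) {..n + 1})"

definition cocycles ::
  "('g, 'm) monoid_scheme \<Rightarrow> ('a, 'k) monoid_scheme \<Rightarrow> ('g \<Rightarrow> 'a \<Rightarrow> 'a) \<Rightarrow> nat
    \<Rightarrow> ('g list \<Rightarrow> 'a) set" where
  "cocycles G A act n =
     kernel (cochain_group G A act n) (cochain_group G A act (Suc n)) (coboundary_map G A n)"

fun coboundaries ::
  "('g, 'm) monoid_scheme \<Rightarrow> ('a, 'k) monoid_scheme \<Rightarrow> ('g \<Rightarrow> 'a \<Rightarrow> 'a) \<Rightarrow> nat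
    \<Rightarrow> ('g list \<Rightarrow> 'a) set" where
  "coboundaries G A act 0 = {\<one>\<^bsub>cochain_group G A act 0\<^esub>}"
| "coboundaries G A act (Suc n) = coboundary_map G A n ` carrier (cochain_group G A act n)"

definition group_cohomology ::
  "('g, 'm) monoid_scheme \<Rightarrow> ('a, 'k) monoid_scheme \<Rightarrow> ('g \<Rightarrow> 'a \<Rightarrow> 'a) \<Rightarrow> nat
    \<Rightarrow> ('g list \<Rightarrow> 'a) set monoid" where
  "group_cohomology G A act n =
     (cochain_group G A act n)\<lparr>carrier := cocycles G A act n\<rparr> Mod coboundaries G A act n"


section \<open>Abelian groups\<close>

definition torsion_subgroup :: "('a, 'm) monoid_scheme \<Rightarrow> 'a set" where
  "torsion_subgroup A = {a \<in> carrier A. \<exists>k::nat. 0 < k \<and> a [^]\<^bsub>A\<^esub> k = \<one>\<^bsub>A\<^esub>}"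

definition free_part :: "('a, 'm) monoid_scheme \<Rightarrow> 'a set monoid" where
  "free_part A = A Mod torsion_subgroup A"

definition has_element_of_order :: "('a, 'm) monoid_scheme \<Rightarrow> nat \<Rightarrow> bool" where
  "has_element_of_order A d \<longleftrightarrow> (\<exists>a \<in> carrier A. group.ord A a = d)"

definition primary_component :: "('a, 'm) monoid_scheme \<Rightarrow> nat \<Rightarrow> ('a, 'm) monoid_scheme" where
  "primary_component A p =
     A\<lparr>carrier := {a \<in> carrier A. \<exists>k::nat. a [^]\<^bsub>A\<^esub> (p ^ k) = \<one>\<^bsub>A\<^esub>}\<rparr>"

text \<open>
  The \<open>p\<close>-primary component is finite, and \<open>r\<close> of the summands in its decomposition into nontrivial
  cyclic groups have order \<open>p ^ k\<close>.  Such a decomposition is unique up to order, so it does not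
  matter which one is taken.
\<close>

definition cyclic_summand_count :: "('a, 'm) monoid_scheme \<Rightarrow> nat \<Rightarrow> nat \<Rightarrow> nat \<Rightarrow> bool" where
  "cyclic_summand_count A p k r \<longleftrightarrow>
     (\<exists>(N::nat) e. (\<forall>i<N. 0 < e i) \<and>
        primary_component A p \<cong> product_group {..<N} (\<lambda>i. integer_mod_group (p ^ e i)) \<and>
        card {i. i < N \<and> e i = k} = r)"

definition tensor_relations ::
  "('a, 'm) monoid_scheme \<Rightarrow> ('b, 'k) monoid_scheme \<Rightarrow> ('a \<times> 'b \<Rightarrow>\<^sub>0 int) set" where
  "tensor_relations A B =
     {frag_of (a \<otimes>\<^bsub>A\<^esub> a', b) - frag_of (a, b) - frag_of (a', b) | a a' b.
        a \<in> carrier A \<and> a' \<in> carrier A \<and> b \<in> carrier B} \<union>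
     {frag_of (a, b \<otimes>\<^bsub>B\<^esub> b') - frag_of (a, b) - frag_of (a, b') | a b b'.
        a \<in> carrier A \<and> b \<in> carrier B \<and> b' \<in> carrier B}"

definition tensor_group ::
  "('a, 'm) monoid_scheme \<Rightarrow> ('b, 'k) monoid_scheme \<Rightarrow> ('a \<times> 'b \<Rightarrow>\<^sub>0 int) set monoid" where
  "tensor_group A B =
     (let F = free_Abelian_group (carrier A \<times> carrier B)
      in F Mod generate F (tensor_relations A B))"

text \<open>
  The tensor product of \<open>A\<close> with the field of \<open>p\<close> elements, as a vector space over
  \<open>residue_ring p\<close>.  By bilinearity the scalar action on the second factor, which sends
  \<open>a \<otimes> b\<close> to \<open>a \<otimes> k b\<close>, is the \<open>k\<close>-th power map of the group.  The ring multiplication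
  that a \<open>module\<close> record also carries plays no role, as for the library's \<open>direct_sum\<close>.
\<close>

definition tensor_Fp ::
  "('a, 'm) monoid_scheme \<Rightarrow> nat \<Rightarrow> (int, ('a \<times> int \<Rightarrow>\<^sub>0 int) set) module" where
  "tensor_Fp A p =
     (let T = tensor_group A (integer_mod_group p)
      in \<lparr>carrier = carrier T, monoid.mult = (\<lambda>_ _. \<one>\<^bsub>T\<^esub>), monoid.one = \<one>\<^bsub>T\<^esub>,
          ring.zero = \<one>\<^bsub>T\<^esub>, ring.add = (\<lambda>u v. u \<otimes>\<^bsub>T\<^esub> v), smult = (\<lambda>k u. u [^]\<^bsub>T\<^esub> k)\<rparr>)"


section \<open>The special linear group and its action on polynomials\<close>

definition SL2Z :: "(int^2^2) monoid" where
  "SL2Z = \<lparr>carrier = {g. det g = 1}, monoid.mult = (**), one = mat 1\<rparr>"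

lemma group_SL2Z: "group SL2Z"
proof (rule groupI)
  fix g assume "g \<in> carrier SL2Z"
  then have det: "g $ 1 $ 1 * g $ 2 $ 2 - g $ 1 $ 2 * g $ 2 $ 1 = 1"
    by (simp add: SL2Z_def det_2)
  define h :: "int^2^2" where
    "h = vector [vector [g $ 2 $ 2, - g $ 1 $ 2], vector [- g $ 2 $ 1, g $ 1 $ 1]]"
  have "h ** g = mat 1"
    using det by (simp add: h_def vec_eq_iff forall_2 matrix_matrix_mult_def mat_def sum_2 algebra_simps)
  moreover have "det h = 1"
    using det by (simp add: h_def det_2 algebra_simps)
  ultimately show "\<exists>h \<in> carrier SL2Z. h \<otimes>\<^bsub>SL2Z\<^esub> g = \<one>\<^bsub>SL2Z\<^esub>"
    by (auto simp: SL2Z_def)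
qed (auto simp: SL2Z_def det_mul matrix_mul_assoc)

text \<open>
  The ring of integer polynomials in \<open>x\<close> and \<open>y\<close> is \<open>int poly poly\<close>: polynomials in \<open>y\<close> whose
  coefficients are polynomials in \<open>x\<close>.
\<close>

definition var_x :: "int poly poly" where "var_x = [:[:0, 1:]:]"

definition var_y :: "int poly poly" where "var_y = [:0, 1:]"

definition substitute :: "int poly poly \<Rightarrow> int poly poly \<Rightarrow> int poly poly \<Rightarrow> int poly poly" where
  "substitute u v f = poly (map_poly (\<lambda>q. poly (map_poly of_int q) u) f) v"

text \<open>
  A matrix acts by substitution, its first column giving the image of \<open>x\<close> and its second column the
  image of \<open>y\<close>.
\<close>

definition poly_act :: "int^2^2 \<Rightarrow> int poly poly \<Rightarrow> int poly poly" where
  "poly_act g =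
     substitute (of_int (g $ 1 $ 1) * var_x + of_int (g $ 2 $ 1) * var_y)
                (of_int (g $ 1 $ 2) * var_x + of_int (g $ 2 $ 2) * var_y)"

text \<open>The component of degree \<open>n\<close>, where \<open>x\<close> and \<open>y\<close> have degree 2.\<close>

definition graded_component :: "nat \<Rightarrow> int poly poly monoid" where
  "graded_component n =
     \<lparr>carrier = {f. \<forall>i j. Polynomial.coeff (Polynomial.coeff f j) i \<noteq> 0 \<longrightarrow> 2 * i + 2 * j = n},
      monoid.mult = (+), one = 0\<rparr>"

text \<open>
  The cohomology of a subgroup \<open>G\<close> of \<open>SL2Z\<close> (given by its carrier) in the degree \<open>n\<close> component,
  and its total cohomology in the polynomial ring.
\<close>

definition cohomology_component ::
  "(int^2^2) set \<Rightarrow> nat \<Rightarrow> nat \<Rightarrow> ((int^2^2) list \<Rightarrow> int poly poly) set monoid" where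
  "cohomology_component G i n =
     group_cohomology (SL2Z\<lparr>carrier := G\<rparr>) (graded_component n) poly_act i"

definition cohomology_total ::
  "(int^2^2) set \<Rightarrow> nat \<Rightarrow> (nat \<Rightarrow> ((int^2^2) list \<Rightarrow> int poly poly) set) monoid" where
  "cohomology_total G i = sum_group UNIV (cohomology_component G i)"

text \<open>
  The dimension in \<open>poincare_series\<close> is meaningful only if the spaces are finite-dimensional, since
  \<open>vectorspace.dim\<close> is unspecified otherwise.
\<close>

definition has_poincare_series :: "(int^2^2) set \<Rightarrow> nat \<Rightarrow> nat \<Rightarrow> bool" where
  "has_poincare_series G i p \<longleftrightarrow>
     (\<forall>n. vectorspace.fin_dim (residue_ring (int p)) (tensor_Fp (cohomology_component G i n) p))"

definition poincare_series :: "(int^2^2) set \<Rightarrow> nat \<Rightarrow> nat \<Rightarrow> rat fps" where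
  "poincare_series G i p =
     Abs_fps (\<lambda>n. of_nat
       (vectorspace.dim (residue_ring (int p)) (tensor_Fp (cohomology_component G i n) p)))"


section \<open>The action is by ring automorphisms\<close>

lemma eval_int_poly_pCons:
  "poly (map_poly of_int (pCons c q)) u = of_int c + u * poly (map_poly of_int q) (u :: int poly poly)"
  by (cases "c = 0 \<and> q = 0") (auto simp: map_poly_pCons)

lemma eval_int_poly_add:
  "poly (map_poly of_int (p + q)) (u :: int poly poly)
     = poly (map_poly of_int p) u + poly (map_poly of_int q) u"
  by (induction p q rule: poly_induct2) (simp_all add: eval_int_poly_pCons algebra_simps)

lemma eval_int_poly_smult:
  "poly (map_poly of_int (Polynomial.smult c q)) (u :: int poly poly) = of_int c * poly (map_poly of_int q) u"
  by (induction q) (simp_all add: eval_int_poly_pCons algebra_simps)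

lemma eval_int_poly_mult:
  "poly (map_poly of_int (p * q)) (u :: int poly poly)
     = poly (map_poly of_int p) u * poly (map_poly of_int q) u"
  by (induction p)
    (simp_all add: eval_int_poly_pCons eval_int_poly_add eval_int_poly_smult algebra_simps)

lemma substitute_0 [simp]: "substitute u v 0 = 0"
  by (simp add: substitute_def)

lemma substitute_pCons:
  "substitute u v (pCons q f) = poly (map_poly of_int q) u + v * substitute u v f"
  by (cases "q = 0 \<and> f = 0") (auto simp: substitute_def map_poly_pCons)

lemma substitute_1 [simp]: "substitute u v 1 = 1"
  by (simp add: one_pCons substitute_pCons eval_int_poly_pCons)

lemma substitute_add: "substitute u v (f + h) = substitute u v f + substitute u v h"
  by (induction f h rule: poly_induct2)
    (simp_all add: substitute_pCons eval_int_poly_add algebra_simps)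

lemma substitute_smult:
  "substitute u v (Polynomial.smult q f) = poly (map_poly of_int q) u * substitute u v f"
  by (induction f) (simp_all add: substitute_pCons eval_int_poly_mult algebra_simps)

lemma substitute_mult: "substitute u v (f * h) = substitute u v f * substitute u v h"
  by (induction f) (simp_all add: substitute_pCons substitute_add substitute_smult algebra_simps)

lemma substitute_of_int: "substitute u v (of_int c) = of_int c"
  by (simp add: of_int_poly substitute_pCons eval_int_poly_pCons)

lemma substitute_var_x [simp]: "substitute u v var_x = u"
  and substitute_var_y [simp]: "substitute u v var_y = v"
  by (simp_all add: var_x_def var_y_def substitute_pCons eval_int_poly_pCons)

lemma poly_act_1 [simp]: "poly_act g 1 = 1"
  by (simp add: poly_act_def)

lemma poly_act_add: "poly_act g (f + h) = poly_act g f + poly_act g h"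
  by (simp add: poly_act_def substitute_add)

lemma poly_act_mult: "poly_act g (f * h) = poly_act g f * poly_act g h"
  by (simp add: poly_act_def substitute_mult)

lemma poly_act_of_int [simp]: "poly_act g (of_int c) = of_int c"
  by (simp add: poly_act_def substitute_of_int)

lemma poly_act_generators:
  "poly_act (vector [vector [1, 0], vector [-1, 1]]) var_x = var_x - var_y"
  "poly_act (vector [vector [1, 0], vector [-1, 1]]) var_y = var_y"
  "poly_act (vector [vector [1, 1], vector [0, 1]]) var_x = var_x"
  "poly_act (vector [vector [1, 1], vector [0, 1]]) var_y = var_x + var_y"
  by (simp_all add: poly_act_def)

text \<open>Ring homomorphisms out of the polynomial ring are determined by the images of the variables.\<close>

lemma poly_hom_unique:
  fixes \<phi> \<psi> :: "int poly poly \<Rightarrow> int poly poly"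
  assumes add: "\<And>f h. \<phi> (f + h) = \<phi> f + \<phi> h" "\<And>f h. \<psi> (f + h) = \<psi> f + \<psi> h"
    and mult: "\<And>f h. \<phi> (f * h) = \<phi> f * \<phi> h" "\<And>f h. \<psi> (f * h) = \<psi> f * \<psi> h"
    and const: "\<And>c. \<phi> (of_int c) = of_int c" "\<And>c. \<psi> (of_int c) = of_int c"
    and vars: "\<phi> var_x = \<psi> var_x" "\<phi> var_y = \<psi> var_y"
  shows "\<phi> = \<psi>"
proof
  have inner: "\<phi> [:q:] = \<psi> [:q:]" for q
  proof (induction q)
    case 0
    show ?case using const(1)[of 0] const(2)[of 0] by simp
  next
    case (pCons c q)
    have "[:pCons c q:] = of_int c + var_x * [:q:]"
      by (simp add: var_x_def of_int_poly)
    then show ?case by (simp only: add mult const vars pCons.IH)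
  qed
  fix f show "\<phi> f = \<psi> f"
  proof (induction f)
    case 0
    show ?case using const(1)[of 0] const(2)[of 0] by simp
  next
    case (pCons q f)
    have "pCons q f = [:q:] + var_y * f"
      by (simp add: var_y_def)
    then show ?case by (simp only: add mult vars inner pCons.IH)
  qed
qed

lemma poly_act_mat_1: "poly_act (mat 1) f = f"
proof -
  have "poly_act (mat 1) = (\<lambda>f. f)"
    by (rule poly_hom_unique) (simp_all add: poly_act_add poly_act_mult, simp_all add: poly_act_def mat_def)
  then show ?thesis by simp
qed

lemma poly_act_matrix_mult: "poly_act (g ** h) f = poly_act g (poly_act h f)"
proof -
  have "poly_act (g ** h) = (\<lambda>f. poly_act g (poly_act h f))"
    by (rule poly_hom_unique)
      (simp_all add: poly_act_add poly_act_mult,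
       simp_all add: poly_act_def substitute_add substitute_mult substitute_of_int
         matrix_matrix_mult_def sum_2 algebra_simps)
  then show ?thesis by metis
qed

end

theory Submission
  imports Defs "HOL-Library.Z2"
begin

text \<open>SL_2(Z) is the amalgam of the cyclic groups generated by \<open>matS\<close> (order 4)
  and \<open>matT\<close> (order 6) over {1, -1}: it acts on a tree whose vertex stabilizers are
  conjugate to these two groups and whose edge stabilizers are {1, -1}. The tree is handled as the
  topograph of bases of the plane lattice; a height function on its edges gives connectedness
  (\<open>SL2Z_induct\<close>) and acyclicity (\<open>topograph_acyclic\<close>). Splicing the
  periodic resolutions of the stabilizers along the tree yields a free resolution
  (\<open>free_resolution_cells\<close>) whose boundary has period 2 from dimension 2 on. By the
  comparison theorem (\<open>complex_cohomology_unique\<close>) it may replace the bar resolution. A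
  class of degree i > 1 then is a triple (a, b, c): a and b come from the groups of order 4 and 6 in
  degree i, and c from {1, -1} in degree i - 1 (\<open>complex_cohomology_cells\<close>).
  Periodicity is visible from this form, and \<open>cohomology_component_presentation\<close>
  reduces the rest to binary forms of degree d, where n = 2 d.

  Let S be the action of \<open>matS\<close>, and R the substitution of order 3 that agrees with the
  action of \<open>matT\<close> up to the sign (-1)^d. If d is odd, then -1 acts as -1, every class
  is killed by 2 (\<open>cobs_odd_double\<close>), and the groups are described by forms modulo 2.

  If d is even, S is an involution that permutes the monomials up to sign, with (xy)^(d/2) as the
  only fixed line (\<open>actS_eigenvector\<close>). For R, one subtracts a norm to make a form
  vanish at the three points that R permutes, divides by the invariant cubic xy(x+y) and inducts on
  the degree: the only obstruction to being a norm, or to having the form R f - f, is the value at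
  (1, 1) modulo 3, and it occurs in one residue class of d modulo 3
  (\<open>actR_invariant_norm\<close>, \<open>normR_kernel\<close>). Hence 12 kills the cohomology
  and the 3-rank is at most one.

  The order 4 comes from (xy)^(d/2), which is fixed by S exactly if d/2 is even, that is, if 8
  divides n. In even cohomological degree a power of the Dickson invariant x^2 + xy + y^2 then lifts
  to a class whose double is the nonzero class u of (2 (xy)^(d/2), 0, (xy)^(d/2)). The double of
  every class killed by 4 is 0 or u, so the 2-primary part is one group of order 4 times an
  elementary abelian group (\<open>cyclic_summand_count_4\<close>, \<open>order_4_summand\<close>).
  In all other cases 6 kills the group (\<open>even_degree_multiples\<close>).

  For the Poincare series, A tensor F_p is A/pA. For p = 2 its rank is assembled from the dimensions
  of four spaces of forms over F_2: all forms, the invariants of S, those of R, and those of both.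
  They are counted by evaluating at a rational point and dividing by the product of the linear forms
  through the orbit of that point. The ranks grow linearly along residue classes modulo 24, so
  multiplication by the denominator leaves a finite check.\<close>

section \<open>Evaluation of formal integer combinations\<close>

text \<open>The values lie in a ring so that integer coefficients can act by multiplication;
  coefficient modules will be additive subgroups of such a ring.\<close>

definition feval :: "('x \<Rightarrow> 'a::ring_1) \<Rightarrow> ('x \<Rightarrow>\<^sub>0 int) \<Rightarrow> 'a" where
  "feval f c = (\<Sum>x\<in>Poly_Mapping.keys c. of_int (Poly_Mapping.lookup c x) * f x)"

lemma feval_superset:
  assumes "finite S" "Poly_Mapping.keys c \<subseteq> S"
  shows "feval f c = (\<Sum>x\<in>S. of_int (Poly_Mapping.lookup c x) * f x)"
  unfolding feval_def using assms
  by (intro sum.mono_neutral_left) (auto simp: in_keys_iff)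

lemma feval_0 [simp]: "feval f 0 = 0"
  by (simp add: feval_def)

lemma feval_frag_of [simp]: "feval f (frag_of x) = f x"
  by (simp add: feval_def)

lemma feval_add: "feval f (c + d) = feval f c + feval f d"
proof -
  let ?S = "Poly_Mapping.keys c \<union> Poly_Mapping.keys d"
  have "feval f (c + d) = (\<Sum>x\<in>?S. of_int (Poly_Mapping.lookup (c + d) x) * f x)"
    by (rule feval_superset) (auto simp: Poly_Mapping.keys_add)
  also have "\<dots> = (\<Sum>x\<in>?S. of_int (Poly_Mapping.lookup c x) * f x)
      + (\<Sum>x\<in>?S. of_int (Poly_Mapping.lookup d x) * f x)"
    by (simp add: lookup_add distrib_right sum.distrib)
  also have "\<dots> = feval f c + feval f d"
    by (subst (1 2) feval_superset[symmetric]) auto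
  finally show ?thesis .
qed

lemma feval_minus: "feval f (- c) = - feval f c"
  by (metis add.right_inverse add_eq_0_iff feval_0 feval_add)

lemma feval_diff: "feval f (c - d) = feval f c - feval f d"
  by (metis add_uminus_conv_diff feval_add feval_minus)

lemma feval_sum: "feval f (\<Sum>i\<in>I. c i) = (\<Sum>i\<in>I. feval f (c i))"
  by (induction I rule: infinite_finite_induct) (simp_all add: feval_add)

lemma feval_cong: "(\<And>x. x \<in> Poly_Mapping.keys c \<Longrightarrow> f x = g x) \<Longrightarrow> feval f c = feval g c"
  by (simp add: feval_def)

lemma frag_induct [case_names zero one diff]:
  assumes "P 0" "\<And>x. P (frag_of x)" "\<And>a b. P a \<Longrightarrow> P b \<Longrightarrow> P (a - b)"
  shows "P c"
  by (rule frag_induction[where S = UNIV and c = c]) (use assms in auto)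

lemma feval_frag_extend: "feval f (frag_extend \<phi> c) = feval (\<lambda>x. feval f (\<phi> x)) c"
  by (induction c rule: frag_induct)
    (simp_all add: frag_extend_diff feval_diff)

lemma feval_fun_add: "feval (\<lambda>x. f x + g x) c = feval f c + feval g c"
  by (simp add: feval_def distrib_left sum.distrib)

lemma feval_fun_zero [simp]: "feval (\<lambda>x. 0) c = 0"
  by (simp add: feval_def)

lemma frag_extend_frag_extend:
  "frag_extend f (frag_extend g c) = frag_extend (\<lambda>x. frag_extend f (g x)) c"
  by (induction c rule: frag_induct) (simp_all add: frag_extend_diff)

lemma frag_extend_fun_diff:
  "frag_extend (\<lambda>x. f x - g x) c = frag_extend f c - frag_extend g c"
  by (induction c rule: frag_induct) (simp_all add: frag_extend_diff)

lemma frag_extend_fun_add: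
  "frag_extend (\<lambda>x. f x + g x) c = frag_extend f c + frag_extend g c"
  by (induction c rule: frag_induct) (simp_all add: frag_extend_diff)

lemma frag_extend_frag_of [simp]: "frag_extend frag_of c = c"
  by (metis frag_expansion)

lemma keys_frag_extend_subset:
  assumes "\<And>x. x \<in> Poly_Mapping.keys c \<Longrightarrow> Poly_Mapping.keys (f x) \<subseteq> S"
  shows "Poly_Mapping.keys (frag_extend f c) \<subseteq> S"
  using keys_frag_extend[of f c] assms by blast

lemma keys_diff_subset:
  "Poly_Mapping.keys a \<subseteq> S \<Longrightarrow> Poly_Mapping.keys b \<subseteq> S \<Longrightarrow> Poly_Mapping.keys (a - b) \<subseteq> S"
  using keys_diff[of a b] by blast

lemma keys_add_subset:
  "Poly_Mapping.keys a \<subseteq> S \<Longrightarrow> Poly_Mapping.keys b \<subseteq> S \<Longrightarrow> Poly_Mapping.keys (a + b) \<subseteq> S"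
  using Poly_Mapping.keys_add[of a b] by blast

abbreviation frag_map :: "('x \<Rightarrow> 'y) \<Rightarrow> ('x \<Rightarrow>\<^sub>0 int) \<Rightarrow> 'y \<Rightarrow>\<^sub>0 int" where
  "frag_map h \<equiv> frag_extend (\<lambda>x. frag_of (h x))"


section \<open>Free resolutions and the comparison theorem\<close>

text \<open>
  An augmented complex of free abelian groups with a group action: level 0 consists of the single
  generator \<open>pt\<close> and level \<open>n + 1\<close> is spanned by the cells of dimension \<open>n\<close>, on which the group
  acts freely because of the equivariant map \<open>base\<close> to the group.
\<close>

locale free_resolution = group G for G :: "('g, 'm) monoid_scheme" (structure) +
  fixes K :: "nat \<Rightarrow> 'x set" and act :: "'g \<Rightarrow> 'x \<Rightarrow> 'x"
    and bd :: "nat \<Rightarrow> 'x \<Rightarrow> 'x \<Rightarrow>\<^sub>0 int" and pt :: 'x and base :: "'x \<Rightarrow> 'g"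
  assumes K_0: "K 0 = {pt}"
    and act_closed: "g \<in> carrier G \<Longrightarrow> x \<in> K n \<Longrightarrow> act g x \<in> K n"
    and act_one: "x \<in> K n \<Longrightarrow> act \<one> x = x"
    and act_mult: "g \<in> carrier G \<Longrightarrow> h \<in> carrier G \<Longrightarrow> x \<in> K n \<Longrightarrow> act (g \<otimes> h) x = act g (act h x)"
    and bd_0: "x \<in> K 0 \<Longrightarrow> bd 0 x = 0"
    and bd_keys: "x \<in> K (Suc n) \<Longrightarrow> Poly_Mapping.keys (bd (Suc n) x) \<subseteq> K n"
    and bd_act: "g \<in> carrier G \<Longrightarrow> x \<in> K n \<Longrightarrow> bd n (act g x) = frag_map (act g) (bd n x)"
    and bd_bd: "x \<in> K (Suc n) \<Longrightarrow> frag_extend (bd n) (bd (Suc n) x) = 0"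
    and exact: "Poly_Mapping.keys c \<subseteq> K n \<Longrightarrow> frag_extend (bd n) c = 0 \<Longrightarrow>
      \<exists>c'. Poly_Mapping.keys c' \<subseteq> K (Suc n) \<and> frag_extend (bd (Suc n)) c' = c"
    and base_closed: "x \<in> K (Suc n) \<Longrightarrow> base x \<in> carrier G"
    and base_act: "g \<in> carrier G \<Longrightarrow> x \<in> K (Suc n) \<Longrightarrow> base (act g x) = g \<otimes> base x"

definition equivariant_map ::
  "('g, 'm) monoid_scheme \<Rightarrow> ('g \<Rightarrow> 'x \<Rightarrow> 'x) \<Rightarrow> ('g \<Rightarrow> 'y \<Rightarrow> 'y) \<Rightarrow> 'x set \<Rightarrow> 'y set
     \<Rightarrow> ('x \<Rightarrow> 'y \<Rightarrow>\<^sub>0 int) \<Rightarrow> bool" where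
  "equivariant_map G actS actT S T \<phi> \<longleftrightarrow> (\<forall>x\<in>S. Poly_Mapping.keys (\<phi> x) \<subseteq> T \<and>
     (\<forall>g\<in>carrier G. \<phi> (actS g x) = frag_map (actT g) (\<phi> x)))"

lemma equivariant_map_diff:
  assumes "equivariant_map G actS actT S T f" "equivariant_map G actS actT S T g"
  shows "equivariant_map G actS actT S T (\<lambda>x. f x - g x)"
  using assms by (simp add: equivariant_map_def frag_extend_diff keys_diff_subset)

definition chain_map where
  "chain_map G K actK bdK L actL bdL \<phi> \<longleftrightarrow>
     (\<forall>n. equivariant_map G actK actL (K n) (L n) (\<phi> n)) \<and>
     (\<forall>n. \<forall>x\<in>K (Suc n). frag_extend (bdL (Suc n)) (\<phi> (Suc n) x)
        = frag_extend (\<phi> n) (bdK (Suc n) x))"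

locale resolution_pair =
  K: free_resolution G K actK bdK ptK baseK + L: free_resolution G L actL bdL ptL baseL
  for G :: "('g, 'm) monoid_scheme" (structure)
    and K :: "nat \<Rightarrow> 'x set" and actK bdK ptK baseK
    and L :: "nat \<Rightarrow> 'y set" and actL bdL ptL baseL
begin

text \<open>The map \<open>baseK\<close> makes the action free: a cell is moved to base point
  \<open>\<one>\<close>, its cycle is filled there by exactness of \<open>L\<close>, and the filling
  is moved back. The filling then depends on the orbit alone up to translation, which is
  equivariance.\<close>

lemma equivariant_lift:
  assumes r: "equivariant_map G actK actL (K (Suc n)) (L m) r"
    and cyc: "\<And>x. x \<in> K (Suc n) \<Longrightarrow> frag_extend (bdL m) (r x) = 0"
  shows "\<exists>w. equivariant_map G actK actL (K (Suc n)) (L (Suc m)) w \<and>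
    (\<forall>x\<in>K (Suc n). frag_extend (bdL (Suc m)) (w x) = r x)"
proof -
  define v where "v x = (SOME c'. Poly_Mapping.keys c' \<subseteq> L (Suc m) \<and> frag_extend (bdL (Suc m)) c' = r x)" for x
  have v: "Poly_Mapping.keys (v x) \<subseteq> L (Suc m)" "frag_extend (bdL (Suc m)) (v x) = r x"
    if "x \<in> K (Suc n)" for x
  proof -
    have "\<exists>c'. Poly_Mapping.keys c' \<subseteq> L (Suc m) \<and> frag_extend (bdL (Suc m)) c' = r x"
      using r that cyc by (intro L.exact) (auto simp: equivariant_map_def)
    from someI_ex[OF this] show "Poly_Mapping.keys (v x) \<subseteq> L (Suc m)" "frag_extend (bdL (Suc m)) (v x) = r x"
      by (auto simp: v_def)
  qed
  define w where "w x = frag_map (actL (baseK x)) (v (actK (inv (baseK x)) x))" for x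
  have "equivariant_map G actK actL (K (Suc n)) (L (Suc m)) w"
    unfolding equivariant_map_def
  proof (intro ballI conjI)
    fix x assume x: "x \<in> K (Suc n)"
    let ?b = "baseK x" and ?y = "actK (inv (baseK x)) x"
    have b: "?b \<in> carrier G" using K.base_closed x .
    have y: "?y \<in> K (Suc n)" using K.act_closed b x by simp
    show "Poly_Mapping.keys (w x) \<subseteq> L (Suc m)"
      unfolding w_def using v(1)[OF y] L.act_closed b
      by (intro keys_frag_extend_subset) auto
    fix g assume g: "g \<in> carrier G"
    have "actK (inv (baseK (actK g x))) (actK g x) = actK (inv (g \<otimes> ?b) \<otimes> g) x"
      using g b x by (simp add: K.base_act K.act_mult[symmetric])
    also have "inv (g \<otimes> ?b) \<otimes> g = inv ?b"
      using g b by (simp add: K.inv_mult_group K.m_assoc)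
    finally have "w (actK g x) = frag_map (actL (g \<otimes> ?b)) (v ?y)"
      using g x by (simp add: w_def K.base_act)
    also have "\<dots> = frag_map (actL g) (w x)"
      unfolding w_def frag_extend_frag_extend
      using v(1)[OF y] g b by (intro frag_extend_eq) (auto simp: L.act_mult)
    finally show "w (actK g x) = frag_map (actL g) (w x)" .
  qed
  moreover have "frag_extend (bdL (Suc m)) (w x) = r x" if x: "x \<in> K (Suc n)" for x
  proof -
    let ?b = "baseK x" and ?y = "actK (inv (baseK x)) x"
    have b: "?b \<in> carrier G" using K.base_closed x .
    have y: "?y \<in> K (Suc n)" using K.act_closed b x by simp
    have "frag_extend (bdL (Suc m)) (w x) = frag_extend (\<lambda>z. frag_map (actL ?b) (bdL (Suc m) z)) (v ?y)"
      unfolding w_def frag_extend_frag_extend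
      using v(1)[OF y] b by (intro frag_extend_eq) (auto simp: L.bd_act)
    also have "\<dots> = frag_map (actL ?b) (r ?y)"
      using v(2)[OF y] by (simp add: frag_extend_frag_extend[symmetric])
    also have "\<dots> = r (actK ?b ?y)"
      using r b y by (simp add: equivariant_map_def)
    also have "actK ?b ?y = x"
      using b x by (simp add: K.act_mult[symmetric] K.act_one)
    finally show ?thesis .
  qed
  ultimately show ?thesis by blast
qed

lemma equivariant_compose_bd:
  assumes "equivariant_map G actK actL (K n) T \<phi>"
  shows "equivariant_map G actK actL (K (Suc n)) T (\<lambda>x. frag_extend \<phi> (bdK (Suc n) x))"
  unfolding equivariant_map_def
proof (intro ballI conjI)
  fix x assume x: "x \<in> K (Suc n)"
  show "Poly_Mapping.keys (frag_extend \<phi> (bdK (Suc n) x)) \<subseteq> T"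
    using assms K.bd_keys[OF x] by (intro keys_frag_extend_subset) (auto simp: equivariant_map_def)
  fix g assume g: "g \<in> carrier G"
  have "frag_extend \<phi> (bdK (Suc n) (actK g x)) = frag_extend (\<lambda>y. \<phi> (actK g y)) (bdK (Suc n) x)"
    by (simp add: K.bd_act[OF g x] frag_extend_frag_extend)
  also have "\<dots> = frag_extend (\<lambda>y. frag_map (actL g) (\<phi> y)) (bdK (Suc n) x)"
    using assms K.bd_keys[OF x] g by (intro frag_extend_eq) (auto simp: equivariant_map_def)
  finally show "frag_extend \<phi> (bdK (Suc n) (actK g x))
      = frag_map (actL g) (frag_extend \<phi> (bdK (Suc n) x))"
    by (simp add: frag_extend_frag_extend)
qed

text \<open>The existence half of the comparison theorem, level by level. The recursion has to
  remember that cycles go to cycles: the boundary of a new cell is a cycle, and its image must be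
  one for the next lift to exist.\<close>

lemma chain_map_exists:
  "\<exists>\<phi>. chain_map G K actK bdK L actL bdL \<phi> \<and> \<phi> 0 ptK = frag_of ptL"
proof -
  define P where "P n \<phi> \<longleftrightarrow> equivariant_map G actK actL (K n) (L n) \<phi> \<and>
     (\<forall>c. Poly_Mapping.keys c \<subseteq> K n \<longrightarrow> frag_extend (bdK n) c = 0 \<longrightarrow> frag_extend (bdL n) (frag_extend \<phi> c) = 0)
     \<and> (n = 0 \<longrightarrow> \<phi> ptK = frag_of ptL)" for n \<phi>
  define Q where "Q n \<phi> \<psi> \<longleftrightarrow> (\<forall>x\<in>K (Suc n). frag_extend (bdL (Suc n)) (\<psi> x)
        = frag_extend \<phi> (bdK (Suc n) x))" for n \<phi> \<psi>
  have "\<exists>f. \<forall>n. P n (f n) \<and> Q n (f n) (f (Suc n))"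
  proof (rule dependent_nat_choice)
    have act_pt: "actK g ptK = ptK" "actL g ptL = ptL" if "g \<in> carrier G" for g
      using K.act_closed[OF that, of ptK 0] L.act_closed[OF that, of ptL 0] by (auto simp: K.K_0 L.K_0)
    have "P 0 (\<lambda>_. frag_of ptL)"
      unfolding P_def equivariant_map_def frag_extend_frag_extend
      by (auto simp: L.K_0 L.bd_0 act_pt intro: frag_extend_eq_0)
    then show "\<exists>x. P 0 x" by blast
    fix \<phi> n assume P: "P n \<phi>"
    have "\<exists>w. equivariant_map G actK actL (K (Suc n)) (L (Suc n)) w \<and>
      (\<forall>x\<in>K (Suc n). frag_extend (bdL (Suc n)) (w x) = frag_extend \<phi> (bdK (Suc n) x))"
      using P K.bd_keys K.bd_bd by (intro equivariant_lift equivariant_compose_bd) (auto simp: P_def)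
    then obtain w where w: "equivariant_map G actK actL (K (Suc n)) (L (Suc n)) w"
      "\<And>x. x\<in>K (Suc n) \<Longrightarrow> frag_extend (bdL (Suc n)) (w x) = frag_extend \<phi> (bdK (Suc n) x)"
      by blast
    have "frag_extend (bdL (Suc n)) (frag_extend w c) = 0"
      if "Poly_Mapping.keys c \<subseteq> K (Suc n)" "frag_extend (bdK (Suc n)) c = 0" for c
    proof -
      have "frag_extend (bdL (Suc n)) (frag_extend w c) = frag_extend (\<lambda>x. frag_extend \<phi> (bdK (Suc n) x)) c"
        unfolding frag_extend_frag_extend using that w(2) by (intro frag_extend_eq) auto
      also have "\<dots> = 0"
        using that by (simp add: frag_extend_frag_extend[symmetric])
      finally show ?thesis .
    qed
    with w show "\<exists>y. P (Suc n) y \<and> Q n \<phi> y"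
      by (auto simp: P_def Q_def)
  qed
  then obtain f where "\<forall>n. P n (f n) \<and> Q n (f n) (f (Suc n))" ..
  then show ?thesis
    by (intro exI[of _ f]) (auto simp: P_def Q_def chain_map_def)
qed

text \<open>The uniqueness half. The homotopy starts with 0 because both maps agree on the
  augmentation. On cycles the term with the lower homotopy disappears, and that special case of the
  homotopy identity is what the recursion carries.\<close>

lemma chain_homotopy_exists:
  assumes f: "chain_map G K actK bdK L actL bdL f" and g: "chain_map G K actK bdK L actL bdL g"
    and 0: "f 0 ptK = g 0 ptK"
  shows "\<exists>h. (\<forall>n. equivariant_map G actK actL (K n) (L (Suc n)) (h n)) \<and>
    (\<forall>n. \<forall>x\<in>K (Suc n). frag_extend (bdL (Suc (Suc n))) (h (Suc n) x)
       = f (Suc n) x - g (Suc n) x - frag_extend (h n) (bdK (Suc n) x))"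
proof -
  define P where "P n h \<longleftrightarrow> equivariant_map G actK actL (K n) (L (Suc n)) h \<and>
     (\<forall>c. Poly_Mapping.keys c \<subseteq> K n \<longrightarrow> frag_extend (bdK n) c = 0 \<longrightarrow>
        frag_extend (bdL (Suc n)) (frag_extend h c) = frag_extend (f n) c - frag_extend (g n) c)" for n h
  define Q where "Q n h h' \<longleftrightarrow> (\<forall>x\<in>K (Suc n). frag_extend (bdL (Suc (Suc n))) (h' x)
        = f (Suc n) x - g (Suc n) x - frag_extend h (bdK (Suc n) x))" for n h h'
  have "\<exists>h. \<forall>n. P n (h n) \<and> Q n (h n) (h (Suc n))"
  proof (rule dependent_nat_choice)
    have "frag_extend (f 0) c = frag_extend (g 0) c" if "Poly_Mapping.keys c \<subseteq> K 0" for c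
      using that 0 by (intro frag_extend_eq) (auto simp: K.K_0)
    then have "P 0 (\<lambda>_. 0)"
      by (auto simp: P_def equivariant_map_def frag_extend_eq_0)
    then show "\<exists>h. P 0 h" by blast
    fix h n assume P: "P n h"
    define r where "r x = f (Suc n) x - g (Suc n) x - frag_extend h (bdK (Suc n) x)" for x
    have h: "equivariant_map G actK actL (K (Suc n)) (L (Suc n)) (\<lambda>x. frag_extend h (bdK (Suc n) x))"
      using P by (intro equivariant_compose_bd) (auto simp: P_def)
    have "equivariant_map G actK actL (K (Suc n)) (L (Suc n)) r"
      using f g h unfolding r_def chain_map_def by (intro equivariant_map_diff) auto
    moreover have "frag_extend (bdL (Suc n)) (r x) = 0" if x: "x \<in> K (Suc n)" for x
      using f g P x K.bd_keys[OF x] K.bd_bd[OF x]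
      by (auto simp: chain_map_def r_def frag_extend_diff P_def)
    ultimately have "\<exists>w. equivariant_map G actK actL (K (Suc n)) (L (Suc (Suc n))) w \<and>
      (\<forall>x\<in>K (Suc n). frag_extend (bdL (Suc (Suc n))) (w x) = r x)"
      by (rule equivariant_lift)
    then obtain w where w: "equivariant_map G actK actL (K (Suc n)) (L (Suc (Suc n))) w"
      "\<And>x. x\<in>K (Suc n) \<Longrightarrow> frag_extend (bdL (Suc (Suc n))) (w x) = r x"
      by blast
    have "frag_extend (bdL (Suc (Suc n))) (frag_extend w c) = frag_extend (f (Suc n)) c - frag_extend (g (Suc n)) c"
      if "Poly_Mapping.keys c \<subseteq> K (Suc n)" "frag_extend (bdK (Suc n)) c = 0" for c
    proof -
      have "frag_extend (bdL (Suc (Suc n))) (frag_extend w c) = frag_extend r c"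
        unfolding frag_extend_frag_extend using that w(2) by (intro frag_extend_eq) auto
      also have "\<dots> = frag_extend (f (Suc n)) c - frag_extend (g (Suc n)) c
         - frag_extend h (frag_extend (bdK (Suc n)) c)"
        unfolding r_def by (simp add: frag_extend_fun_diff frag_extend_frag_extend)
      finally show ?thesis using that by simp
    qed
    with w show "\<exists>h'. P (Suc n) h' \<and> Q n h h'"
      by (auto simp: P_def Q_def r_def)
  qed
  then obtain h where "\<forall>n. P n (h n) \<and> Q n (h n) (h (Suc n))" ..
  then show ?thesis
    by (intro exI[of _ h]) (auto simp: P_def Q_def)
qed

end

section \<open>Cohomology computed from a free resolution\<close>

text \<open>Level 0 of a resolution holds the augmentation, so cochains of degree \<open>n\<close>
  live on level \<open>n + 1\<close>; the same shift by one appears in all indices below.\<close>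

definition equivariant_cochains ::
  "('g, 'm) monoid_scheme \<Rightarrow> (nat \<Rightarrow> 'x set) \<Rightarrow> ('g \<Rightarrow> 'x \<Rightarrow> 'x) \<Rightarrow> 'a set \<Rightarrow> ('g \<Rightarrow> 'a \<Rightarrow> 'a)
    \<Rightarrow> nat \<Rightarrow> ('x \<Rightarrow> 'a::ring_1) set" where
  "equivariant_cochains G K act A \<rho> n =
     {f \<in> K (Suc n) \<rightarrow>\<^sub>E A. \<forall>g\<in>carrier G. \<forall>x\<in>K (Suc n). f (act g x) = \<rho> g (f x)}"

definition cochain_bd ::
  "(nat \<Rightarrow> 'x set) \<Rightarrow> (nat \<Rightarrow> 'x \<Rightarrow> 'x \<Rightarrow>\<^sub>0 int) \<Rightarrow> nat \<Rightarrow> ('x \<Rightarrow> 'a::ring_1) \<Rightarrow> 'x \<Rightarrow> 'a" where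
  "cochain_bd K bd n f = (\<lambda>x\<in>K (Suc (Suc n)). feval f (bd (Suc (Suc n)) x))"

definition equivariant_cocycles where
  "equivariant_cocycles G K act bd A \<rho> n =
     {f \<in> equivariant_cochains G K act A \<rho> n. \<forall>x\<in>K (Suc (Suc n)). feval f (bd (Suc (Suc n)) x) = 0}"

definition fun_group :: "'x set \<Rightarrow> ('x \<Rightarrow> 'a::ab_group_add) set \<Rightarrow> ('x \<Rightarrow> 'a) monoid" where
  "fun_group S F = \<lparr>carrier = F, monoid.mult = (\<lambda>f g. \<lambda>x\<in>S. f x + g x), one = (\<lambda>x\<in>S. 0)\<rparr>"

lemma comm_group_fun_group:
  assumes "F \<subseteq> extensional S" "(\<lambda>x\<in>S. 0) \<in> F"
    and "\<And>f g. f \<in> F \<Longrightarrow> g \<in> F \<Longrightarrow> (\<lambda>x\<in>S. f x + g x) \<in> F"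
    and "\<And>f. f \<in> F \<Longrightarrow> (\<lambda>x\<in>S. - f x) \<in> F"
  shows "comm_group (fun_group S F)"
proof (rule comm_groupI)
  fix f assume f: "f \<in> carrier (fun_group S F)"
  then show "\<exists>g\<in>carrier (fun_group S F). g \<otimes>\<^bsub>fun_group S F\<^esub> f = \<one>\<^bsub>fun_group S F\<^esub>"
    using assms by (intro bexI[of _ "\<lambda>x\<in>S. - f x"]) (auto simp: fun_group_def fun_eq_iff)
  show "\<one>\<^bsub>fun_group S F\<^esub> \<otimes>\<^bsub>fun_group S F\<^esub> f = f"
    using assms(1) f by (auto simp: fun_group_def fun_eq_iff extensional_def)
qed (use assms in \<open>auto simp: fun_group_def algebra_simps fun_eq_iff\<close>)

text \<open>In positive degree \<open>n + 1\<close> only.\<close>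

definition complex_cohomology where
  "complex_cohomology G K act bd A \<rho> n =
     fun_group (K (Suc (Suc n))) (equivariant_cocycles G K act bd A \<rho> (Suc n))
       Mod cochain_bd K bd n ` equivariant_cochains G K act A \<rho> n"

text \<open>The composite of \<open>\<theta>\<close> with the projection to \<open>H Mod N\<close>
  has kernel \<open>M\<close> and is onto, so no inverse on representatives is needed. It serves for
  the change of resolution, for the passage to triples, and for the computation of quotients
  A/pA.\<close>

lemma FactGroup_iso_FactGroup:
  assumes "group G" "group H" "N \<lhd> H" and \<theta>: "\<theta> \<in> hom G H"
    and M: "M \<subseteq> carrier G" "\<And>x. x \<in> carrier G \<Longrightarrow> \<theta> x \<in> N \<longleftrightarrow> x \<in> M"
    and surj: "\<And>y. y \<in> carrier H \<Longrightarrow> \<exists>x\<in>carrier G. \<exists>n\<in>N. y = n \<otimes>\<^bsub>H\<^esub> \<theta> x"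
  shows "G Mod M \<cong> H Mod N"
proof -
  interpret G: group G by fact
  interpret N: normal N H by fact
  let ?f = "\<lambda>x. N #>\<^bsub>H\<^esub> \<theta> x"
  have "?f \<in> hom G (H Mod N)"
    using hom_compose[OF \<theta> N.r_coset_hom_Mod] by (simp add: o_def)
  then interpret f: group_hom G "H Mod N" ?f
    by (simp add: group_hom_def group_hom_axioms_def G.is_group N.factorgroup_is_group)
  have \<theta>_closed: "\<theta> x \<in> carrier H" if "x \<in> carrier G" for x
    using \<theta> that by (auto simp: hom_def)
  have coset: "N #>\<^bsub>H\<^esub> y = N \<longleftrightarrow> y \<in> N" if "y \<in> carrier H" for y
    using that N.subset N.subgroup_axioms
    by (metis N.coset_join1 N.coset_join2)
  have "kernel G (H Mod N) ?f = M"
    using M coset[OF \<theta>_closed] by (force simp: kernel_def)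
  moreover have "?f ` carrier G = carrier (H Mod N)"
  proof
    show "?f ` carrier G \<subseteq> carrier (H Mod N)"
      using f.hom_closed by blast
    show "carrier (H Mod N) \<subseteq> ?f ` carrier G"
    proof
      fix U assume "U \<in> carrier (H Mod N)"
      then obtain y where y: "y \<in> carrier H" "U = N #>\<^bsub>H\<^esub> y"
        by (auto simp: carrier_FactGroup)
      then obtain x n where "x \<in> carrier G" "n \<in> N" "y = n \<otimes>\<^bsub>H\<^esub> \<theta> x"
        using surj by blast
      moreover then have "N #>\<^bsub>H\<^esub> y = N #>\<^bsub>H\<^esub> \<theta> x"
        by (metis N.coset_mult_assoc N.coset_join2 N.subgroup_axioms N.mem_carrier N.subset \<theta>_closed)
      ultimately show "U \<in> ?f ` carrier G" using y by blast
    qed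
  qed
  ultimately show ?thesis
    using f.FactGroup_iso by simp
qed

locale coefficient_module = group G for G :: "('g, 'm) monoid_scheme" (structure) +
  fixes A :: "'a::ring_1 set" and \<rho> :: "'g \<Rightarrow> 'a \<Rightarrow> 'a"
  assumes zero_closed: "0 \<in> A"
    and diff_closed: "a \<in> A \<Longrightarrow> b \<in> A \<Longrightarrow> a - b \<in> A"
    and action_closed: "g \<in> carrier G \<Longrightarrow> a \<in> A \<Longrightarrow> \<rho> g a \<in> A"
    and action_add: "\<rho> g (a + b) = \<rho> g a + \<rho> g b"
    and action_one: "a \<in> A \<Longrightarrow> \<rho> \<one> a = a"
    and action_mult: "g \<in> carrier G \<Longrightarrow> h \<in> carrier G \<Longrightarrow> a \<in> A \<Longrightarrow> \<rho> (g \<otimes> h) a = \<rho> g (\<rho> h a)"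
begin

lemma minus_closed: "a \<in> A \<Longrightarrow> - a \<in> A"
  using diff_closed[OF zero_closed] by simp

lemma add_closed: "a \<in> A \<Longrightarrow> b \<in> A \<Longrightarrow> a + b \<in> A"
  using diff_closed[of a "- b"] minus_closed by simp

lemma action_zero: "\<rho> g 0 = 0"
  using action_add[of g 0 0] by simp

lemma action_diff: "\<rho> g (a - b) = \<rho> g a - \<rho> g b"
  using action_add[of g "a - b" b] by simp

lemma action_minus: "\<rho> g (- a) = - \<rho> g a"
  using action_diff[of g 0 a] by (simp add: action_zero)

lemma feval_closed:
  assumes "Poly_Mapping.keys c \<subseteq> S" "\<And>x. x \<in> S \<Longrightarrow> f x \<in> A"
  shows "feval f c \<in> A"
  using assms(1) by (induction rule: frag_induction) (auto simp: zero_closed assms(2) feval_diff diff_closed)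

lemma action_feval: "\<rho> g (feval f c) = feval (\<lambda>x. \<rho> g (f x)) c"
  by (induction c rule: frag_induct) (simp_all add: action_zero feval_diff action_diff)

end

locale resolution_cohomology =
  K: free_resolution G K act bd pt base + M: coefficient_module G A \<rho>
  for G :: "('g, 'm) monoid_scheme" (structure)
    and K :: "nat \<Rightarrow> 'x set" and act bd pt base and A :: "'a::ring_1 set" and \<rho>
begin

abbreviation "C \<equiv> equivariant_cochains G K act A \<rho>"
abbreviation "Z \<equiv> equivariant_cocycles G K act bd A \<rho>"
abbreviation "\<delta> \<equiv> cochain_bd K bd"

lemma cochains_closed:
  shows "(\<lambda>x\<in>K (Suc n). 0) \<in> C n"
    and "f \<in> C n \<Longrightarrow> g \<in> C n \<Longrightarrow> (\<lambda>x\<in>K (Suc n). f x + g x) \<in> C n"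
    and "f \<in> C n \<Longrightarrow> (\<lambda>x\<in>K (Suc n). - f x) \<in> C n"
  unfolding equivariant_cochains_def
  by (auto simp: M.zero_closed M.action_zero K.act_closed M.action_add M.action_minus
     intro!: M.add_closed M.minus_closed dest: PiE_mem)

lemma feval_restrict_bd: "x \<in> K (Suc n) \<Longrightarrow> feval (\<lambda>y\<in>K n. f y) (bd (Suc n) x) = feval f (bd (Suc n) x)"
  using K.bd_keys[of x n] by (intro feval_cong) auto

lemma cochain_bd_closed: "f \<in> C n \<Longrightarrow> \<delta> n f \<in> Z (Suc n)"
proof -
  assume f: "f \<in> C n"
  have "feval f (bd (Suc (Suc n)) x) \<in> A" if "x \<in> K (Suc (Suc n))" for x
    using f by (intro M.feval_closed[OF K.bd_keys[OF that]]) (auto simp: equivariant_cochains_def dest: PiE_mem)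
  moreover have "feval f (bd (Suc (Suc n)) (act g x)) = \<rho> g (feval f (bd (Suc (Suc n)) x))"
    if x: "x \<in> K (Suc (Suc n))" and g: "g \<in> carrier G" for x g
    using K.bd_keys[OF x] f g
    by (auto simp: K.bd_act[OF g x] feval_frag_extend M.action_feval equivariant_cochains_def intro!: feval_cong)
  moreover have "feval f (frag_extend (bd (Suc (Suc n))) (bd (Suc (Suc (Suc n))) x)) = 0"
    if x: "x \<in> K (Suc (Suc (Suc n)))" for x
    using K.bd_bd[OF x] by simp
  ultimately show ?thesis
    unfolding equivariant_cocycles_def cochain_bd_def
    by (auto simp: equivariant_cochains_def K.act_closed feval_restrict_bd feval_frag_extend)
qed

lemma comm_group_cocycles: "comm_group (fun_group (K (Suc n)) (Z n))"
proof (rule comm_group_fun_group)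
  have *: "feval (\<lambda>y\<in>K (Suc n). - f y) (bd (Suc (Suc n)) x) = - feval f (bd (Suc (Suc n)) x)"
    if "x \<in> K (Suc (Suc n))" for f :: "'x \<Rightarrow> 'a" and x
    using that feval_fun_add[of f "\<lambda>y. - f y" "bd (Suc (Suc n)) x"]
    by (simp add: feval_restrict_bd eq_neg_iff_add_eq_0 add.commute)
  show "Z n \<subseteq> extensional (K (Suc n))"
    by (auto simp: equivariant_cocycles_def equivariant_cochains_def PiE_def)
  show "(\<lambda>x\<in>K (Suc n). 0) \<in> Z n"
    by (simp add: equivariant_cocycles_def cochains_closed feval_restrict_bd)
  show "\<And>f g. f \<in> Z n \<Longrightarrow> g \<in> Z n \<Longrightarrow> (\<lambda>x\<in>K (Suc n). f x + g x) \<in> Z n"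
    by (auto simp: equivariant_cocycles_def cochains_closed feval_restrict_bd feval_fun_add)
  show "\<And>f. f \<in> Z n \<Longrightarrow> (\<lambda>x\<in>K (Suc n). - f x) \<in> Z n"
    by (auto simp: equivariant_cocycles_def cochains_closed *)
qed

lemma coboundaries_normal: "\<delta> n ` C n \<lhd> fun_group (K (Suc (Suc n))) (Z (Suc n))"
proof -
  interpret Z: comm_group "fun_group (K (Suc (Suc n))) (Z (Suc n))"
    by (rule comm_group_cocycles)
  have "subgroup (\<delta> n ` C n) (fun_group (K (Suc (Suc n))) (Z (Suc n)))"
  proof (rule Z.subgroupI)
    show "\<delta> n ` C n \<subseteq> carrier (fun_group (K (Suc (Suc n))) (Z (Suc n)))"
      using cochain_bd_closed by (auto simp: fun_group_def)
    show "\<delta> n ` C n \<noteq> {}"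
      using cochains_closed(1) by blast
    have add: "(\<lambda>x\<in>K (Suc (Suc n)). \<delta> n f x + \<delta> n g x) = \<delta> n (\<lambda>x\<in>K (Suc n). f x + g x)" for f g
      by (auto simp: fun_eq_iff cochain_bd_def feval_restrict_bd feval_fun_add)
    show "a \<otimes>\<^bsub>fun_group (K (Suc (Suc n))) (Z (Suc n))\<^esub> b \<in> \<delta> n ` C n"
      if ab: "a \<in> \<delta> n ` C n" "b \<in> \<delta> n ` C n" for a b
    proof -
      from ab obtain f g where "f \<in> C n" "a = \<delta> n f" "g \<in> C n" "b = \<delta> n g" by auto
      then show ?thesis
        using cochains_closed(2)[of f n g] by (simp add: fun_group_def add)
    qed
    fix a assume "a \<in> \<delta> n ` C n"
    then obtain f where f: "f \<in> C n" "a = \<delta> n f" by auto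
    let ?b = "\<delta> n (\<lambda>x\<in>K (Suc n). - f x)"
    have "(\<lambda>x\<in>K (Suc n). (\<lambda>x\<in>K (Suc n). - f x) x + f x) = (\<lambda>x\<in>K (Suc n). 0)"
      by (auto simp: fun_eq_iff)
    then have "?b \<otimes>\<^bsub>fun_group (K (Suc (Suc n))) (Z (Suc n))\<^esub> a = \<one>\<^bsub>fun_group (K (Suc (Suc n))) (Z (Suc n))\<^esub>"
      unfolding f fun_group_def
      by (simp add: add) (simp add: cochain_bd_def feval_restrict_bd fun_eq_iff)
    then have "inv\<^bsub>fun_group (K (Suc (Suc n))) (Z (Suc n))\<^esub> a = ?b"
      using cochain_bd_closed f cochains_closed(3)[OF f(1)]
      by (intro Z.inv_equality) (auto simp: fun_group_def)
    then show "inv\<^bsub>fun_group (K (Suc (Suc n))) (Z (Suc n))\<^esub> a \<in> \<delta> n ` C n"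
      using cochains_closed(3)[OF f(1)] by auto
  qed
  then show ?thesis by (rule Z.subgroup_imp_normal)
qed

lemma group_cohomology: "group (complex_cohomology G K act bd A \<rho> n)"
  unfolding complex_cohomology_def using coboundaries_normal by (rule normal.factorgroup_is_group)

end

lemma equivariant_map_keys:
  "equivariant_map G actS actT S T \<phi> \<Longrightarrow> x \<in> S \<Longrightarrow> Poly_Mapping.keys (\<phi> x) \<subseteq> T"
  by (simp add: equivariant_map_def)

lemma chain_map_keys:
  "chain_map G K actK bdK L actL bdL \<phi> \<Longrightarrow> x \<in> K n \<Longrightarrow> Poly_Mapping.keys (\<phi> n x) \<subseteq> L n"
  by (simp add: chain_map_def equivariant_map_def)

locale resolution_pair_cohomology =
  resolution_pair G K actK bdK ptK baseK L actL bdL ptL baseL + coefficient_module G A \<rho>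
  for G :: "('g, 'm) monoid_scheme" (structure)
    and K :: "nat \<Rightarrow> 'x set" and actK bdK ptK baseK
    and L :: "nat \<Rightarrow> 'y set" and actL bdL ptL baseL
    and A :: "'a::ring_1 set" and \<rho>
begin

sublocale HK: resolution_cohomology G K actK bdK ptK baseK A \<rho> ..
sublocale HL: resolution_cohomology G L actL bdL ptL baseL A \<rho> ..

definition pullback :: "nat \<Rightarrow> ('x \<Rightarrow> 'y \<Rightarrow>\<^sub>0 int) \<Rightarrow> ('y \<Rightarrow> 'a) \<Rightarrow> 'x \<Rightarrow> 'a" where
  "pullback n \<phi> f = (\<lambda>x\<in>K (Suc n). feval f (\<phi> x))"

lemma pullback_cochain:
  assumes \<phi>: "equivariant_map G actK actL (K (Suc n)) (L (Suc m)) \<phi>" and f: "f \<in> HL.C m"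
  shows "pullback n \<phi> f \<in> HK.C n"
proof -
  have keys: "Poly_Mapping.keys (\<phi> x) \<subseteq> L (Suc m)" if "x \<in> K (Suc n)" for x
    using \<phi> that by (simp add: equivariant_map_def)
  have "feval f (\<phi> x) \<in> A" if "x \<in> K (Suc n)" for x
    using f by (intro feval_closed[OF keys[OF that]]) (auto simp: equivariant_cochains_def dest: PiE_mem)
  moreover have "feval f (\<phi> (actK g x)) = \<rho> g (feval f (\<phi> x))" if x: "x \<in> K (Suc n)" and g: "g \<in> carrier G" for x g
  proof -
    have "\<phi> (actK g x) = frag_map (actL g) (\<phi> x)"
      using \<phi> x g by (simp add: equivariant_map_def)
    then show ?thesis
      using keys[OF x] f g
      by (auto simp: feval_frag_extend action_feval equivariant_cochains_def intro!: feval_cong)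
  qed
  ultimately show ?thesis
    by (auto simp: equivariant_cochains_def pullback_def K.act_closed)
qed

lemma feval_pullback:
  assumes "Poly_Mapping.keys c \<subseteq> K (Suc n)"
  shows "feval (pullback n \<phi> f) c = feval f (frag_extend \<phi> c)"
  using assms by (auto simp: feval_frag_extend pullback_def intro!: feval_cong)

lemma pullback_cocycle:
  assumes \<phi>: "chain_map G K actK bdK L actL bdL \<phi>" and f: "f \<in> HL.Z n"
  shows "pullback n (\<phi> (Suc n)) f \<in> HK.Z n"
proof -
  have "feval (pullback n (\<phi> (Suc n)) f) (bdK (Suc (Suc n)) x) = 0" if x: "x \<in> K (Suc (Suc n))" for x
  proof -
    have "feval (pullback n (\<phi> (Suc n)) f) (bdK (Suc (Suc n)) x)
        = feval f (frag_extend (bdL (Suc (Suc n))) (\<phi> (Suc (Suc n)) x))"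
      using \<phi> x by (simp add: feval_pullback[OF K.bd_keys[OF x]] chain_map_def)
    also have "\<dots> = feval (\<lambda>y. 0) (\<phi> (Suc (Suc n)) x)"
      unfolding feval_frag_extend using chain_map_keys[OF \<phi> x] f
      by (intro feval_cong) (auto simp: equivariant_cocycles_def)
    finally show ?thesis by simp
  qed
  moreover have "pullback n (\<phi> (Suc n)) f \<in> HK.C n"
    using \<phi> f by (intro pullback_cochain) (auto simp: chain_map_def equivariant_cocycles_def)
  ultimately show ?thesis by (simp add: equivariant_cocycles_def)
qed

lemma pullback_coboundary:
  assumes \<phi>: "chain_map G K actK bdK L actL bdL \<phi>"
  shows "pullback (Suc n) (\<phi> (Suc (Suc n))) (HL.\<delta> n f) = HK.\<delta> n (pullback n (\<phi> (Suc n)) f)"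
proof -
  have "feval (HL.\<delta> n f) (\<phi> (Suc (Suc n)) x) = feval (pullback n (\<phi> (Suc n)) f) (bdK (Suc (Suc n)) x)"
    if x: "x \<in> K (Suc (Suc n))" for x
  proof -
    have "feval (pullback n (\<phi> (Suc n)) f) (bdK (Suc (Suc n)) x)
        = feval f (frag_extend (bdL (Suc (Suc n))) (\<phi> (Suc (Suc n)) x))"
      using \<phi> x by (simp add: feval_pullback[OF K.bd_keys[OF x]] chain_map_def)
    also have "\<dots> = feval (HL.\<delta> n f) (\<phi> (Suc (Suc n)) x)"
      unfolding feval_frag_extend cochain_bd_def using chain_map_keys[OF \<phi> x]
      by (intro feval_cong) auto
    finally show ?thesis ..
  qed
  then show ?thesis by (auto simp: pullback_def cochain_bd_def fun_eq_iff)
qed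

lemma pullback_hom:
  assumes "chain_map G K actK bdK L actL bdL \<phi>"
  shows "pullback n (\<phi> (Suc n)) \<in> hom (fun_group (L (Suc n)) (HL.Z n)) (fun_group (K (Suc n)) (HK.Z n))"
proof -
  have "feval (\<lambda>y\<in>L (Suc n). f y + g y) (\<phi> (Suc n) x) = feval f (\<phi> (Suc n) x) + feval g (\<phi> (Suc n) x)"
    if x: "x \<in> K (Suc n)" for f g :: "'y \<Rightarrow> 'a" and x
    unfolding feval_fun_add[symmetric] using chain_map_keys[OF assms x]
    by (intro feval_cong) auto
  then show ?thesis
    using pullback_cocycle[OF assms] by (auto simp: hom_def fun_group_def pullback_def fun_eq_iff)
qed

end

locale resolution_endo = resolution_pair_cohomology G K act bd pt base K act bd pt base A \<rho>
  for G :: "('g, 'm) monoid_scheme" (structure)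
    and K :: "nat \<Rightarrow> 'x set" and act bd pt base and A :: "'a::ring_1 set" and \<rho>
begin

text \<open>A chain self-map over the identity of the augmentation is homotopic to the identity.
  Evaluating the cocycle \<open>f\<close> on the homotopy identity kills the term that passes
  through the higher boundary; what is left exhibits the difference as the coboundary of
  \<open>f\<close> composed with the homotopy.\<close>

lemma pullback_homotopic_id:
  assumes \<phi>: "chain_map G K act bd K act bd \<phi>" "\<phi> 0 pt = frag_of pt" and f: "f \<in> HK.Z (Suc n)"
  shows "\<exists>h\<in>HK.C n. f = (\<lambda>x\<in>K (Suc (Suc n)). HK.\<delta> n h x + pullback (Suc n) (\<phi> (Suc (Suc n))) f x)"
proof -
  have "chain_map G K act bd K act bd (\<lambda>n. frag_of)"
    using K.bd_keys by (auto simp: chain_map_def equivariant_map_def)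
  then obtain h where h: "\<And>n. equivariant_map G act act (K n) (K (Suc n)) (h n)"
    and eq: "\<And>n x. x \<in> K (Suc n) \<Longrightarrow> frag_extend (bd (Suc (Suc n))) (h (Suc n) x)
       = frag_of x - \<phi> (Suc n) x - frag_extend (h n) (bd (Suc n) x)"
    using chain_homotopy_exists[of "\<lambda>n. frag_of" \<phi>] \<phi> by auto
  have "f x = feval (pullback n (h (Suc n)) f) (bd (Suc (Suc n)) x) + feval f (\<phi> (Suc (Suc n)) x)"
    if x: "x \<in> K (Suc (Suc n))" for x
  proof -
    have "feval f (frag_extend (bd (Suc (Suc (Suc n)))) (h (Suc (Suc n)) x)) = feval (\<lambda>y. 0) (h (Suc (Suc n)) x)"
      unfolding feval_frag_extend using equivariant_map_keys[OF h x] f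
      by (intro feval_cong) (auto simp: equivariant_cocycles_def)
    then have "f x - feval f (\<phi> (Suc (Suc n)) x) - feval f (frag_extend (h (Suc n)) (bd (Suc (Suc n)) x)) = 0"
      by (simp add: eq[OF x] feval_diff)
    then show ?thesis
      by (simp add: feval_pullback[OF K.bd_keys[OF x]] algebra_simps)
  qed
  moreover have "f \<in> extensional (K (Suc (Suc n)))"
    using f by (auto simp: equivariant_cocycles_def equivariant_cochains_def PiE_def)
  ultimately have "f = (\<lambda>x\<in>K (Suc (Suc n)). HK.\<delta> n (pullback n (h (Suc n)) f) x + pullback (Suc n) (\<phi> (Suc (Suc n))) f x)"
    by (auto simp: fun_eq_iff cochain_bd_def pullback_def extensional_def)
  moreover have "pullback n (h (Suc n)) f \<in> HK.C n"
    using h f by (intro pullback_cochain) (auto simp: equivariant_cocycles_def)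
  ultimately show ?thesis by blast
qed

end

lemma chain_map_compose:
  assumes \<phi>: "chain_map G K actK bdK L actL bdL \<phi>" and \<psi>: "chain_map G L actL bdL K' actK' bdK' \<psi>"
    and keys: "\<And>n x. x \<in> K (Suc n) \<Longrightarrow> Poly_Mapping.keys (bdK (Suc n) x) \<subseteq> K n"
  shows "chain_map G K actK bdK K' actK' bdK' (\<lambda>n x. frag_extend (\<psi> n) (\<phi> n x))"
  unfolding chain_map_def
proof (intro allI ballI conjI)
  fix n
  show "equivariant_map G actK actK' (K n) (K' n) (\<lambda>x. frag_extend (\<psi> n) (\<phi> n x))"
    unfolding equivariant_map_def
  proof (intro ballI conjI)
    fix x assume x: "x \<in> K n"
    then have keys: "Poly_Mapping.keys (\<phi> n x) \<subseteq> L n"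
      using \<phi> by (auto simp: chain_map_def equivariant_map_def)
    then show "Poly_Mapping.keys (frag_extend (\<psi> n) (\<phi> n x)) \<subseteq> K' n"
      using \<psi> by (intro keys_frag_extend_subset) (auto simp: chain_map_def equivariant_map_def)
    fix g assume g: "g \<in> carrier G"
    then have "\<phi> n (actK g x) = frag_map (actL g) (\<phi> n x)"
      using \<phi> x by (simp add: chain_map_def equivariant_map_def)
    then show "frag_extend (\<psi> n) (\<phi> n (actK g x)) = frag_map (actK' g) (frag_extend (\<psi> n) (\<phi> n x))"
      using \<psi> keys g by (auto simp: frag_extend_frag_extend chain_map_def equivariant_map_def intro!: frag_extend_eq)
  qed
  fix x assume x: "x \<in> K (Suc n)"
  then have keys: "Poly_Mapping.keys (\<phi> (Suc n) x) \<subseteq> L (Suc n)"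
    using \<phi> by (auto simp: chain_map_def equivariant_map_def)
  have "frag_extend (bdK' (Suc n)) (frag_extend (\<psi> (Suc n)) (\<phi> (Suc n) x))
      = frag_extend (\<lambda>y. frag_extend (\<psi> n) (bdL (Suc n) y)) (\<phi> (Suc n) x)"
    unfolding frag_extend_frag_extend using \<psi> keys
    by (intro frag_extend_eq) (auto simp: chain_map_def)
  also have "\<dots> = frag_extend (\<psi> n) (frag_extend (bdL (Suc n)) (\<phi> (Suc n) x))"
    by (simp add: frag_extend_frag_extend)
  also have "frag_extend (bdL (Suc n)) (\<phi> (Suc n) x) = frag_extend (\<phi> n) (bdK (Suc n) x)"
    using \<phi> x by (simp add: chain_map_def)
  finally show "frag_extend (bdK' (Suc n)) (frag_extend (\<psi> (Suc n)) (\<phi> (Suc n) x))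
      = frag_extend (\<lambda>x. frag_extend (\<psi> n) (\<phi> n x)) (bdK (Suc n) x)"
    by (simp add: frag_extend_frag_extend)
qed

text \<open>There are chain maps in both directions over the identity of the augmentation. Both
  composites are homotopic to the identity, so pulling back along one of them is bijective modulo
  coboundaries.\<close>

theorem complex_cohomology_unique:
  fixes A :: "'a::ring_1 set"
  assumes "free_resolution G K actK bdK ptK baseK" "free_resolution G L actL bdL ptL baseL"
    and "coefficient_module G A \<rho>"
  shows "complex_cohomology G K actK bdK A \<rho> n \<cong> complex_cohomology G L actL bdL A \<rho> n"
proof -
  interpret KL: resolution_pair_cohomology G K actK bdK ptK baseK L actL bdL ptL baseL A \<rho>
    using assms by (simp add: resolution_pair_cohomology_def resolution_pair_def)
  interpret LK: resolution_pair_cohomology G L actL bdL ptL baseL K actK bdK ptK baseK A \<rho>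
    using assms by (simp add: resolution_pair_cohomology_def resolution_pair_def)
  interpret KK: resolution_endo G K actK bdK ptK baseK A \<rho> ..
  interpret LL: resolution_endo G L actL bdL ptL baseL A \<rho> ..
  obtain \<phi> where \<phi>: "chain_map G K actK bdK L actL bdL \<phi>" "\<phi> 0 ptK = frag_of ptL"
    using KL.chain_map_exists by blast
  obtain \<psi> where \<psi>: "chain_map G L actL bdL K actK bdK \<psi>" "\<psi> 0 ptL = frag_of ptK"
    using LK.chain_map_exists by blast
  note \<psi>\<phi> = chain_map_compose[OF \<phi>(1) \<psi>(1) KL.K.bd_keys]
  note \<phi>\<psi> = chain_map_compose[OF \<psi>(1) \<phi>(1) KL.L.bd_keys]
  define \<theta> where "\<theta> = LK.pullback (Suc n) (\<psi> (Suc (Suc n)))"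
  define \<eta> where "\<eta> = KL.pullback (Suc n) (\<phi> (Suc (Suc n)))"
  let ?ZK = "fun_group (K (Suc (Suc n))) (KL.HK.Z (Suc n))" and ?ZL = "fun_group (L (Suc (Suc n))) (KL.HL.Z (Suc n))"
  let ?BK = "KL.HK.\<delta> n ` KL.HK.C n" and ?BL = "KL.HL.\<delta> n ` KL.HL.C n"
  have keys\<phi>: "Poly_Mapping.keys (\<phi> m x) \<subseteq> L m" if "x \<in> K m" for x m
    using \<phi>(1) that by (auto simp: chain_map_def equivariant_map_def)
  have keys\<psi>: "Poly_Mapping.keys (\<psi> m x) \<subseteq> K m" if "x \<in> L m" for x m
    using \<psi>(1) that by (auto simp: chain_map_def equivariant_map_def)
  have \<eta>\<theta>: "\<eta> (\<theta> f) = KK.pullback (Suc n) (\<lambda>x. frag_extend (\<psi> (Suc (Suc n))) (\<phi> (Suc (Suc n)) x)) f" for f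
    using keys\<phi> by (auto simp: fun_eq_iff \<eta>_def \<theta>_def KK.pullback_def KL.pullback_def LK.feval_pullback)
  have \<theta>\<eta>: "\<theta> (\<eta> f) = LL.pullback (Suc n) (\<lambda>x. frag_extend (\<phi> (Suc (Suc n))) (\<psi> (Suc (Suc n)) x)) f" for f
    using keys\<psi> by (auto simp: fun_eq_iff \<eta>_def \<theta>_def LL.pullback_def LK.pullback_def KL.feval_pullback)
  have \<theta>_bd: "\<theta> f \<in> ?BL" if f: "f \<in> ?BK" for f
  proof -
    obtain h where "h \<in> KL.HK.C n" "f = KL.HK.\<delta> n h" using f by blast
    moreover have "LK.pullback n (\<psi> (Suc n)) h \<in> KL.HL.C n" if "h \<in> KL.HK.C n" for h
      using that \<psi>(1) by (intro LK.pullback_cochain) (auto simp: chain_map_def)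
    ultimately show ?thesis
      by (simp add: \<theta>_def LK.pullback_coboundary[OF \<psi>(1)])
  qed
  have \<eta>_bd: "\<eta> f \<in> ?BK" if f: "f \<in> ?BL" for f
  proof -
    obtain h where "h \<in> KL.HL.C n" "f = KL.HL.\<delta> n h" using f by blast
    moreover have "KL.pullback n (\<phi> (Suc n)) h \<in> KL.HK.C n" if "h \<in> KL.HL.C n" for h
      using that \<phi>(1) by (intro KL.pullback_cochain) (auto simp: chain_map_def)
    ultimately show ?thesis
      by (simp add: \<eta>_def KL.pullback_coboundary[OF \<phi>(1)])
  qed
  interpret ZK: comm_group ?ZK by (rule KL.HK.comm_group_cocycles)
  interpret ZL: comm_group ?ZL by (rule KL.HL.comm_group_cocycles)
  interpret BK: normal ?BK ?ZK by (rule KL.HK.coboundaries_normal)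
  interpret BL: normal ?BL ?ZL by (rule KL.HL.coboundaries_normal)
  have "?ZK Mod ?BK \<cong> ?ZL Mod ?BL"
  proof (rule FactGroup_iso_FactGroup[where \<theta> = \<theta>])
    show "\<theta> \<in> hom ?ZK ?ZL"
      unfolding \<theta>_def by (rule LK.pullback_hom[OF \<psi>(1)])
    show "?BK \<subseteq> carrier ?ZK" by (rule BK.subset)
    fix f assume f: "f \<in> carrier ?ZK"
    then obtain h where h: "h \<in> KL.HK.C n" "f = KL.HK.\<delta> n h \<otimes>\<^bsub>?ZK\<^esub> \<eta> (\<theta> f)"
      using KK.pullback_homotopic_id[OF \<psi>\<phi>, of f n] \<phi>(2) \<psi>(2) unfolding \<eta>\<theta> fun_group_def by auto
    show "\<theta> f \<in> ?BL \<longleftrightarrow> f \<in> ?BK"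
    proof
      assume "\<theta> f \<in> ?BL"
      then have "\<eta> (\<theta> f) \<in> ?BK" by (rule \<eta>_bd)
      then show "f \<in> ?BK"
        using h by (metis BK.m_closed imageI)
    qed (rule \<theta>_bd)
  next
    fix f assume f: "f \<in> carrier ?ZL"
    then obtain h where h: "h \<in> KL.HL.C n" "f = KL.HL.\<delta> n h \<otimes>\<^bsub>?ZL\<^esub> \<theta> (\<eta> f)"
      using LL.pullback_homotopic_id[OF \<phi>\<psi>, of f n] \<phi>(2) \<psi>(2) unfolding \<theta>\<eta> fun_group_def by auto
    moreover have "\<eta> f \<in> carrier ?ZK"
      using f KL.pullback_cocycle[OF \<phi>(1)] by (simp add: \<eta>_def fun_group_def)
    ultimately show "\<exists>x\<in>carrier ?ZK. \<exists>m\<in>?BL. f = m \<otimes>\<^bsub>?ZL\<^esub> \<theta> x" by blast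
  qed (unfold_locales)
  then show ?thesis by (simp add: complex_cohomology_def)
qed


section \<open>The bar resolution\<close>

text \<open>The recursion is the boundary of a cone with apex \<open>g\<close>: the base minus the
  cone over the boundary of the base. This makes exactness immediate;
  \<open>bar_boundary_faces\<close> recovers the alternating sum over faces.\<close>

fun bar_boundary :: "'g list \<Rightarrow> 'g list \<Rightarrow>\<^sub>0 int" where
  "bar_boundary [] = 0"
| "bar_boundary (g # gs) = frag_of gs - frag_map ((#) g) (bar_boundary gs)"

text \<open>Prefixing a fixed entry is a contracting homotopy of the augmented bar complex. This is
  its exactness, and by the recursion also the source of the vanishing of the double
  boundary.\<close>

lemma bar_boundary_cone:
  "frag_extend bar_boundary (frag_map ((#) g) c) = c - frag_map ((#) g) (frag_extend bar_boundary c)"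
  by (induction c rule: frag_induct) (simp_all add: frag_extend_diff)

lemma bar_boundary_boundary: "frag_extend bar_boundary (bar_boundary gs) = 0"
  by (induction gs) (simp_all add: frag_extend_diff bar_boundary_cone)

lemma keys_bar_boundary:
  "gs \<in> tuples G (Suc n) \<Longrightarrow> Poly_Mapping.keys (bar_boundary gs) \<subseteq> tuples G n"
proof (induction gs arbitrary: n)
  case (Cons g gs)
  then have gs: "g \<in> carrier G" "gs \<in> tuples G n" by (auto simp: tuples_def)
  have "Poly_Mapping.keys (frag_map ((#) g) (bar_boundary gs)) \<subseteq> tuples G n"
  proof (cases n)
    case (Suc m)
    then have "Poly_Mapping.keys (bar_boundary gs) \<subseteq> tuples G m" using Cons.IH gs by simp
    then show ?thesis using gs Suc
      by (intro keys_frag_extend_subset) (auto simp: tuples_def)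
  qed (use gs in \<open>simp add: tuples_def\<close>)
  then show ?case using gs(2) by (simp add: keys_diff_subset)
qed (simp add: tuples_def)

lemma bar_boundary_map: "bar_boundary (map h gs) = frag_map (map h) (bar_boundary gs)"
  by (induction gs) (simp_all add: frag_extend_diff frag_extend_frag_extend)

lemma bar_boundary_faces:
  "bar_boundary gs = (\<Sum>i<length gs. frag_cmul ((- 1) ^ i) (frag_of (take i gs @ drop (Suc i) gs)))"
proof (induction gs)
  case (Cons g gs)
  have "frag_map ((#) g) (bar_boundary gs)
      = (\<Sum>i<length gs. frag_cmul ((- 1) ^ i) (frag_of (g # take i gs @ drop (Suc i) gs)))"
    by (simp add: Cons.IH frag_extend_sum frag_extend_cmul)
  then show ?case
    by (simp add: sum.lessThan_Suc_shift sum_negf[symmetric] del: sum.lessThan_Suc)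
qed simp

lemma free_resolution_bar:
  fixes G (structure)
  assumes "group G"
  shows "free_resolution G (tuples G) (\<lambda>g. map ((\<otimes>) g)) (\<lambda>n. bar_boundary) [] hd"
proof -
  interpret group G by fact
  show ?thesis
  proof
    show "tuples G 0 = {[]}" by (auto simp: tuples_def)
    fix c :: "'a list \<Rightarrow>\<^sub>0 int" and n
    assume c: "Poly_Mapping.keys c \<subseteq> tuples G n" "frag_extend bar_boundary c = 0"
    have "Poly_Mapping.keys (frag_map ((#) \<one>) c) \<subseteq> tuples G (Suc n)"
      using c(1) by (intro keys_frag_extend_subset) (auto simp: tuples_def)
    moreover have "frag_extend bar_boundary (frag_map ((#) \<one>) c) = c"
      using c(2) by (simp add: bar_boundary_cone)
    ultimately show "\<exists>c'. Poly_Mapping.keys c' \<subseteq> tuples G (Suc n) \<and> frag_extend bar_boundary c' = c"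
      by blast
  next
    fix gs :: "'a list" and n assume "gs \<in> tuples G (Suc n)"
    then show "hd gs \<in> carrier G" "g \<in> carrier G \<Longrightarrow> hd (map ((\<otimes>) g) gs) = g \<otimes> hd gs" for g
      by (cases gs; force simp: tuples_def)+
  next
    show "gs \<in> tuples G (Suc n) \<Longrightarrow> Poly_Mapping.keys (bar_boundary gs) \<subseteq> tuples G n" for gs :: "'a list" and n
      by (rule keys_bar_boundary)
  qed (auto simp: bar_boundary_boundary bar_boundary_map tuples_def m_assoc image_subset_iff subset_iff
     intro!: map_idI)
qed

lemma finprod_additive:
  fixes A :: "'a::comm_ring_1 monoid"
  assumes A: "comm_monoid A" "monoid.mult A = (+)" "one A = 0" and f: "f \<in> I \<rightarrow> carrier A" and I: "finite I"
  shows "finprod A f I = sum f I"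
proof -
  interpret comm_monoid A by fact
  show ?thesis using I f
    by (induction I rule: finite_induct) (simp_all add: A)
qed

text \<open>An equality and not only an isomorphism: both sides are the same quotient of the same
  functions on tuples, once the alternating product in \<open>A\<close> is rewritten as the sum
  computed by \<open>feval\<close>.\<close>

lemma group_cohomology_eq_complex_cohomology:
  fixes G (structure) and A :: "'a::comm_ring_1 monoid"
  assumes "group G" "comm_group A" and A: "monoid.mult A = (+)" "one A = 0"
    and M: "coefficient_module G (carrier A) act"
  shows "group_cohomology G A act (Suc n)
    = complex_cohomology G (tuples G) (\<lambda>g. map ((\<otimes>) g)) (\<lambda>n. bar_boundary) (carrier A) act n"
proof -
  interpret A: comm_group A by fact
  interpret resolution_cohomology G "tuples G" "\<lambda>g. map ((\<otimes>) g)" "\<lambda>n. bar_boundary" "[]" hd "carrier A" act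
    using free_resolution_bar[OF assms(1)] M by (rule resolution_cohomology.intro)
  have inv: "inv\<^bsub>A\<^esub> a = - a" if "a \<in> carrier A" for a
    using that M.minus_closed by (intro A.inv_equality) (auto simp: A)
  have cochains: "carrier (cochain_group G A act m) = C m" for m
    by (auto simp: cochain_group_def equivariant_cochains_def)
  have bd: "coboundary_map G A m f = \<delta> m f" if f: "f \<in> C m" for f m
  proof -
    have "finprod A (\<lambda>i. let a = f (take i gs @ drop (Suc i) gs) in if even i then a else inv\<^bsub>A\<^esub> a) {..m + 1}
        = feval f (bar_boundary gs)" if gs: "gs \<in> tuples G (Suc (Suc m))" for gs
    proof -
      have f_closed: "f (take i gs @ drop (Suc i) gs) \<in> carrier A" if "i \<le> m + 1" for i
      proof -
        have "take i gs @ drop (Suc i) gs \<in> tuples G (Suc m)"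
          using gs that by (auto simp: tuples_def dest!: in_set_takeD in_set_dropD)
        then show ?thesis using f by (auto simp: equivariant_cochains_def dest: PiE_mem)
      qed
      have "finprod A (\<lambda>i. let a = f (take i gs @ drop (Suc i) gs) in if even i then a else inv\<^bsub>A\<^esub> a) {..m + 1}
         = (\<Sum>i\<le>m+1. let a = f (take i gs @ drop (Suc i) gs) in if even i then a else inv\<^bsub>A\<^esub> a)"
        using f_closed by (intro finprod_additive A.comm_monoid_axioms A) (auto simp: Let_def)
      also have "\<dots> = (\<Sum>i\<le>m+1. feval f (frag_cmul ((- 1) ^ i) (frag_of (take i gs @ drop (Suc i) gs))))"
        using f_closed by (intro sum.cong) (auto simp: Let_def inv feval_minus)
      also have "\<dots> = (\<Sum>i<length gs. feval f (frag_cmul ((- 1) ^ i) (frag_of (take i gs @ drop (Suc i) gs))))"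
        using gs by (intro sum.cong) (auto simp: tuples_def)
      finally show ?thesis by (simp add: bar_boundary_faces feval_sum)
    qed
    then show ?thesis by (auto simp: coboundary_map_def cochain_bd_def fun_eq_iff)
  qed
  have one: "\<one>\<^bsub>cochain_group G A act m\<^esub> = (\<lambda>x\<in>tuples G (Suc m). 0)" for m
    by (simp add: cochain_group_def product_group_def A)
  have "cocycles G A act (Suc n) = Z (Suc n)"
    unfolding cocycles_def kernel_def cochains equivariant_cocycles_def one
    by (auto simp: bd cochain_bd_def fun_eq_iff)
  moreover have "coboundaries G A act (Suc n) = \<delta> n ` C n"
    by (auto simp: cochains bd)
  ultimately show ?thesis
    by (simp add: group_cohomology_def complex_cohomology_def cochain_group_def product_group_def fun_group_def A)
qed

section \<open>The periodic resolution of a cyclic group\<close>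

text \<open>A set on which a cyclic group of order \<open>m\<close> acts freely through the powers
  of \<open>\<rho>\<close>. On chains, the periodic resolution alternates \<rho> - 1 with the norm;
  \<open>norm_kernel\<close> and \<open>invariant_norm\<close> place the kernel of each in the image
  of the other.\<close>

locale cyclic_permutation =
  fixes S :: "'x set" and \<rho> :: "'x \<Rightarrow> 'x" and m :: nat
  assumes m_pos: "0 < m"
    and closed: "x \<in> S \<Longrightarrow> \<rho> x \<in> S"
    and order: "x \<in> S \<Longrightarrow> (\<rho> ^^ m) x = x"
    and free: "x \<in> S \<Longrightarrow> 0 < k \<Longrightarrow> k < m \<Longrightarrow> (\<rho> ^^ k) x \<noteq> x"
begin

lemma funpow_closed: "x \<in> S \<Longrightarrow> (\<rho> ^^ k) x \<in> S"
  by (induction k) (auto simp: closed)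

lemma funpow_complement: "x \<in> S \<Longrightarrow> k \<le> m \<Longrightarrow> (\<rho> ^^ k) ((\<rho> ^^ (m - k)) x) = x"
  using funpow_add[of k "m - k" \<rho>] order by (metis comp_apply le_add_diff_inverse)

lemma funpow_complement': "x \<in> S \<Longrightarrow> k \<le> m \<Longrightarrow> (\<rho> ^^ (m - k)) ((\<rho> ^^ k) x) = x"
  using funpow_complement[of x "m - k"] by simp

definition orbit :: "'x \<Rightarrow> 'x set" where
  "orbit x = (\<lambda>k. (\<rho> ^^ k) x) ` {..<m}"

lemma orbit_step:
  assumes "x \<in> S"
  shows "orbit (\<rho> x) = orbit x"
proof -
  have "insert ((\<rho> ^^ m) x) (orbit (\<rho> x)) = insert x (orbit (\<rho> x))"
    using assms order by simp
  have "x \<in> orbit (\<rho> x)"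
  proof -
    have "x = (\<rho> ^^ (m - 1)) (\<rho> x)"
      using assms m_pos order by (metis Suc_diff_1 comp_apply funpow_Suc_right)
    then show ?thesis using m_pos by (auto simp: orbit_def)
  qed
  moreover have "x \<in> orbit x"
    using m_pos by (auto simp: orbit_def intro: image_eqI[of _ _ 0])
  moreover have "insert x (orbit (\<rho> x)) = (\<lambda>k. (\<rho> ^^ k) x) ` {..<Suc m}"
    by (simp add: lessThan_Suc_eq_insert_0 orbit_def image_image funpow_swap1)
  moreover have "\<dots> = insert ((\<rho> ^^ m) x) (orbit x)"
    by (simp add: lessThan_Suc orbit_def)
  ultimately show ?thesis using order[OF assms] by (metis insert_absorb)
qed

definition rep :: "'x \<Rightarrow> 'x" where
  "rep x = (SOME y. y \<in> orbit x)"

lemma rep_in_orbit: "rep x \<in> orbit x"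
proof -
  have "\<exists>y. y \<in> orbit x"
    using m_pos by (auto simp: orbit_def)
  then show ?thesis
    unfolding rep_def by (rule someI_ex)
qed

lemma rep_funpow: "x \<in> S \<Longrightarrow> rep ((\<rho> ^^ k) x) = rep x"
  by (induction k) (simp_all add: rep_def orbit_step funpow_closed)

definition norm_chain :: "('x \<Rightarrow>\<^sub>0 int) \<Rightarrow> 'x \<Rightarrow>\<^sub>0 int" where
  "norm_chain c = (\<Sum>k<m. frag_map (\<rho> ^^ k) c)"

lemma frag_map_keys: "Poly_Mapping.keys c \<subseteq> S \<Longrightarrow> Poly_Mapping.keys (frag_map (\<rho> ^^ k) c) \<subseteq> S"
  by (intro keys_frag_extend_subset) (auto simp: funpow_closed)

text \<open>Modulo the image of \<rho> - 1 every point equals the representative of its orbit, so it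
  suffices that the push-forward of \<open>c\<close> to representatives vanishes. The push-forward
  of the norm is \<open>m\<close> times that chain, and chains have no torsion.\<close>

lemma norm_kernel:
  assumes c: "Poly_Mapping.keys c \<subseteq> S" and N: "norm_chain c = 0"
  shows "\<exists>c'. Poly_Mapping.keys c' \<subseteq> S \<and> frag_map \<rho> c' - c' = c"
proof -
  have "frag_map rep (norm_chain c) = (\<Sum>k<m. frag_map rep c)"
    unfolding norm_chain_def using c
    by (auto simp: frag_extend_sum frag_extend_frag_extend rep_funpow intro!: sum.cong frag_extend_eq)
  also have "\<dots> = frag_cmul (int m) (frag_map rep c)"
  proof -
    have "(\<Sum>k<j. a) = frag_cmul (int j) a" for j and a :: "'x \<Rightarrow>\<^sub>0 int"
      by (induction j) (simp_all add: frag_cmul_distrib)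
    then show ?thesis .
  qed
  finally have 0: "frag_map rep c = 0"
    using N m_pos by simp
  have "\<exists>w. Poly_Mapping.keys w \<subseteq> S \<and> frag_map \<rho> w - w = frag_of x - frag_of (rep x)" if x: "x \<in> S" for x
  proof -
    obtain k where k: "rep x = (\<rho> ^^ k) x"
      using rep_in_orbit[of x] by (auto simp: orbit_def)
    \<comment> \<open>A telescoping sum along the orbit from \<open>x\<close> to its
      representative.\<close>
    let ?w = "\<lambda>k. - (\<Sum>j<k. frag_of ((\<rho> ^^ j) x))"
    have "Poly_Mapping.keys (?w k) \<subseteq> S" for k
      using x funpow_closed by (auto dest!: keys_sum[THEN subsetD])
    moreover have "frag_map \<rho> (?w k) - ?w k = frag_of x - frag_of ((\<rho> ^^ k) x)" for k
    proof -
      have "frag_map \<rho> (?w k) - ?w k = - (\<Sum>j<k. frag_of ((\<rho> ^^ Suc j) x) - frag_of ((\<rho> ^^ j) x))"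
        by (simp add: frag_extend_minus frag_extend_sum sum_subtractf)
      also have "\<dots> = frag_of x - frag_of ((\<rho> ^^ k) x)"
        by (subst sum_lessThan_telescope) simp
      finally show ?thesis .
    qed
    ultimately show ?thesis using k by metis
  qed
  then obtain w where w: "\<And>x. x \<in> S \<Longrightarrow> Poly_Mapping.keys (w x) \<subseteq> S"
    "\<And>x. x \<in> S \<Longrightarrow> frag_map \<rho> (w x) - w x = frag_of x - frag_of (rep x)"
    by metis
  have "frag_map \<rho> (frag_extend w c) - frag_extend w c = frag_extend (\<lambda>x. frag_of x - frag_of (rep x)) c"
    unfolding frag_extend_frag_extend frag_extend_fun_diff[symmetric]
    using c w(2) by (intro frag_extend_eq) auto
  also have "\<dots> = c"
    by (simp add: frag_extend_fun_diff 0)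
  finally show ?thesis
    using c w(1) by (intro exI[of _ "frag_extend w c"] conjI keys_frag_extend_subset) auto
qed

text \<open>An invariant chain has constant coefficients on each orbit, so it is the norm of its
  restriction to the chosen representatives; \<open>e\<close> performs this restriction.\<close>

lemma invariant_norm:
  assumes c: "Poly_Mapping.keys c \<subseteq> S" and inv: "frag_map \<rho> c = c"
  shows "\<exists>c'. Poly_Mapping.keys c' \<subseteq> S \<and> norm_chain c' = c"
proof -
  define e where "e x = (if rep x = x then frag_of x else 0)" for x
  have funpow_inv: "frag_map (\<rho> ^^ k) c = c" for k
  proof (induction k)
    case (Suc k)
    have "frag_map (\<rho> ^^ Suc k) c = frag_map \<rho> (frag_map (\<rho> ^^ k) c)"
      by (simp add: frag_extend_frag_extend)
    then show ?case using Suc inv by simp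
  qed simp
  have e: "(\<Sum>k<m. frag_map (\<rho> ^^ k) (e ((\<rho> ^^ (m - k)) x))) = frag_of x" if x: "x \<in> S" for x
  proof -
    obtain l where l: "l < m" "rep x = (\<rho> ^^ l) x"
      using rep_in_orbit[of x] by (auto simp: orbit_def)
    \<comment> \<open>The unique index below \<open>m\<close> whose complementary power takes
      \<open>x\<close> to its representative; if \<open>l\<close> is 0 the complement is
      \<open>m\<close> itself.\<close>
    define k0 where "k0 = (if l = 0 then 0 else m - l)"
    have k0: "k0 < m" "(\<rho> ^^ (m - k0)) x = rep x"
      using l x m_pos order by (auto simp: k0_def)
    have uniq: "k = k0" if k: "k < m" "(\<rho> ^^ (m - k)) x = rep x" for k
    proof -
      have "(\<rho> ^^ k) (rep x) = x" "(\<rho> ^^ k0) (rep x) = x"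
        using funpow_complement[OF x, of k] funpow_complement[OF x, of k0] k k0 by auto
      moreover have "rep x \<in> S" using l x funpow_closed by auto
      moreover have "i = j" if "(\<rho> ^^ i) y = x" "(\<rho> ^^ j) y = x" "i \<le> j" "j < m" "y \<in> S" for i j y
      proof (rule ccontr)
        assume "i \<noteq> j"
        moreover have "(\<rho> ^^ (j - i)) x = x"
          using that by (metis comp_apply funpow_add le_add_diff_inverse2)
        ultimately show False using free[OF x, of "j - i"] that by auto
      qed
      ultimately show ?thesis using k(1) k0(1) by (metis nle_le)
    qed
    have "frag_map (\<rho> ^^ k) (e ((\<rho> ^^ (m - k)) x)) = (if k = k0 then frag_of x else 0)" if "k < m" for k
    proof (cases "(\<rho> ^^ (m - k)) x = rep x")
      case True
      have "rep (rep x) = rep x"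
        using rep_funpow[OF x, of "m - k"] True by simp
      moreover have "(\<rho> ^^ k) (rep x) = x"
        using funpow_complement[OF x, of k] that True by simp
      ultimately show ?thesis
        using uniq[OF that True] True by (simp add: e_def)
    next
      case False
      then have "k \<noteq> k0" using k0(2) by blast
      moreover have "e ((\<rho> ^^ (m - k)) x) = 0"
        using False rep_funpow[OF x, of "m - k"] by (simp add: e_def)
      ultimately show ?thesis by simp
    qed
    then have "(\<Sum>k<m. frag_map (\<rho> ^^ k) (e ((\<rho> ^^ (m - k)) x))) = (\<Sum>k<m. if k = k0 then frag_of x else 0)"
      by (intro sum.cong) auto
    then show ?thesis using k0 by simp
  qed
  \<comment> \<open>By invariance, \<open>c\<close> may be replaced in the summand for
    \<open>k\<close> by its shift by \<open>m - k\<close>. The sum can then be evaluated one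
    generator at a time.\<close>
  have "norm_chain (frag_extend e c) = (\<Sum>k<m. frag_map (\<rho> ^^ k) (frag_extend e (frag_map (\<rho> ^^ (m - k)) c)))"
    by (simp add: norm_chain_def funpow_inv)
  also have "\<dots> = frag_extend (\<lambda>x. \<Sum>k<m. frag_map (\<rho> ^^ k) (e ((\<rho> ^^ (m - k)) x))) c"
    by (induction c rule: frag_induct) (simp_all add: frag_extend_diff sum_subtractf)
  also have "\<dots> = frag_extend frag_of c"
    using c e by (intro frag_extend_eq) auto
  finally show ?thesis
    using c by (intro exI[of _ "frag_extend e c"] conjI keys_frag_extend_subset) (auto simp: e_def)
qed

end

section \<open>The modular group acting on the topograph\<close>

text \<open>The square of \<open>matS\<close> and the cube of \<open>matT\<close> are both -1, so
  the two generators have orders 4 and 6 and their cyclic groups share {1, -1}.\<close>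

definition matS :: "int^2^2" where "matS = vector [vector [0, -1], vector [1, 0]]"
definition matT :: "int^2^2" where "matT = vector [vector [0, 1], vector [-1, 1]]"

text \<open>Right multiplications commute with the left action of the group, so they can serve as
  boundary maps of left modules.\<close>

definition rightS :: "int^2^2 \<Rightarrow> int^2^2" where "rightS g = g ** matS"
definition rightT :: "int^2^2 \<Rightarrow> int^2^2" where "rightT g = g ** matT"

lemma rightS_entries [simp]:
  "rightS g $ i $ 1 = g $ i $ 2" "rightS g $ i $ 2 = - g $ i $ 1"
  by (simp_all add: rightS_def matS_def matrix_matrix_mult_def sum_2)

lemma rightT_entries [simp]:
  "rightT g $ i $ 1 = - g $ i $ 2" "rightT g $ i $ 2 = g $ i $ 1 + g $ i $ 2"
  by (simp_all add: rightT_def matT_def matrix_matrix_mult_def sum_2)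

lemma carrier_SL2Z: "carrier SL2Z = {g. det g = 1}"
  by (simp add: SL2Z_def)

lemma mem_SL2Z: "g \<in> carrier SL2Z \<longleftrightarrow> g $ 1 $ 1 * g $ 2 $ 2 - g $ 1 $ 2 * g $ 2 $ 1 = 1"
  by (simp add: carrier_SL2Z det_2)

lemma right_closed [simp]:
  "g \<in> carrier SL2Z \<Longrightarrow> rightS g \<in> carrier SL2Z"
  "g \<in> carrier SL2Z \<Longrightarrow> rightT g \<in> carrier SL2Z"
  "g \<in> carrier SL2Z \<Longrightarrow> - g \<in> carrier SL2Z"
  by (simp_all add: mem_SL2Z algebra_simps)

lemma right_relations [simp]:
  "rightS (rightS g) = - g" "rightT (rightT (rightT g)) = - g"
  "rightS (- g) = - rightS g" "rightT (- g) = - rightT g"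
  by (simp_all add: vec_eq_iff forall_2)

lemma inj_right: "inj rightS" "inj rightT"
  by (auto simp: inj_def vec_eq_iff forall_2)

lemma minus_neq_SL2Z: "g \<in> carrier SL2Z \<Longrightarrow> - g \<noteq> (g :: int^2^2)"
  by (auto simp: mem_SL2Z vec_eq_iff forall_2)

text \<open>
  The columns of a matrix, up to signs and order, are a basis of the plane lattice.  The edges of
  Conway's topograph are these bases, and \<open>edge_height\<close> and \<open>edge_slope\<close> are the sum of the squared
  lengths and the inner product of the two vectors.
\<close>

definition edge_height :: "int^2^2 \<Rightarrow> int" where
  "edge_height g = (g $ 1 $ 1)\<^sup>2 + (g $ 2 $ 1)\<^sup>2 + (g $ 1 $ 2)\<^sup>2 + (g $ 2 $ 2)\<^sup>2"

definition edge_slope :: "int^2^2 \<Rightarrow> int" where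
  "edge_slope g = g $ 1 $ 1 * g $ 1 $ 2 + g $ 2 $ 1 * g $ 2 $ 2"

lemma edge_rightS: "edge_height (rightS g) = edge_height g" "edge_slope (rightS g) = - edge_slope g"
  and edge_minus: "edge_height (- g) = edge_height g" "edge_slope (- g) = edge_slope g"
  by (simp_all add: edge_height_def edge_slope_def algebra_simps)

lemma column_pos:
  assumes "g \<in> carrier SL2Z"
  shows "0 < (g $ 1 $ 1)\<^sup>2 + (g $ 2 $ 1)\<^sup>2" "0 < (g $ 1 $ 2)\<^sup>2 + (g $ 2 $ 2)\<^sup>2"
  using assms by (auto simp: mem_SL2Z sum_power2_gt_zero_iff)

lemma edge_height_rightT:
  "edge_height (rightT g) = edge_height g + ((g $ 1 $ 2)\<^sup>2 + (g $ 2 $ 2)\<^sup>2) + 2 * edge_slope g"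
  "edge_height (rightT (rightT g)) = edge_height g + ((g $ 1 $ 1)\<^sup>2 + (g $ 2 $ 1)\<^sup>2) + 2 * edge_slope g"
  by (simp_all add: edge_height_def edge_slope_def power2_eq_square algebra_simps)

lemma edge_slope_rightT:
  "edge_slope (rightT g) = - edge_slope g - ((g $ 1 $ 2)\<^sup>2 + (g $ 2 $ 2)\<^sup>2)"
  "edge_slope (rightT (rightT g)) = - edge_slope g - ((g $ 1 $ 1)\<^sup>2 + (g $ 2 $ 1)\<^sup>2)"
  by (simp_all add: edge_slope_def power2_eq_square algebra_simps)

text \<open>Up to sign, \<open>g\<close>, \<open>rightT g\<close> and
  \<open>rightT (rightT g)\<close> are the three edges at one vertex; an edge with nonnegative inner
  product is strictly lowest there. Connectedness and acyclicity both rest on this.\<close>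

lemma edge_height_increases:
  assumes "g \<in> carrier SL2Z" "0 \<le> edge_slope g"
  shows "edge_height g < edge_height (rightT g)" "edge_height g < edge_height (rightT (rightT g))"
  using column_pos[OF assms(1)] assms(2) edge_height_rightT[of g] by linarith+

text \<open>Lagrange's identity for two vectors in the plane, with determinant 1.\<close>

lemma columns_gram:
  assumes "g \<in> carrier SL2Z"
  shows "((g $ 1 $ 1)\<^sup>2 + (g $ 2 $ 1)\<^sup>2) * ((g $ 1 $ 2)\<^sup>2 + (g $ 2 $ 2)\<^sup>2) = 1 + (edge_slope g)\<^sup>2"
proof -
  have "((g $ 1 $ 1)\<^sup>2 + (g $ 2 $ 1)\<^sup>2) * ((g $ 1 $ 2)\<^sup>2 + (g $ 2 $ 2)\<^sup>2)
      = (g $ 1 $ 1 * g $ 2 $ 2 - g $ 1 $ 2 * g $ 2 $ 1)\<^sup>2 + (edge_slope g)\<^sup>2"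
    by (simp add: edge_slope_def power2_eq_square algebra_simps)
  then show ?thesis using assms by (simp add: mem_SL2Z)
qed

text \<open>If all three inner products at the vertex were negative, both squared lengths would be
  at least \<open>?p + 1\<close>. Their product would then exceed the value 1 plus the square of
  \<open>?p\<close> that Lagrange's identity prescribes.\<close>

lemma edge_slope_nonneg_exists:
  assumes g: "g \<in> carrier SL2Z" and "edge_slope g < 0"
  shows "0 \<le> edge_slope (rightT g) \<or> 0 \<le> edge_slope (rightT (rightT g))"
proof (rule ccontr)
  let ?a = "(g $ 1 $ 1)\<^sup>2 + (g $ 2 $ 1)\<^sup>2" and ?c = "(g $ 1 $ 2)\<^sup>2 + (g $ 2 $ 2)\<^sup>2" and ?p = "- edge_slope g"
  assume "\<not> ?thesis"
  then have "?p + 1 \<le> ?a" "?p + 1 \<le> ?c" using edge_slope_rightT[of g] by linarith+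
  then have "(?p + 1) * (?p + 1) \<le> ?a * ?c" using assms(2) by (intro mult_mono) auto
  also have "\<dots> = 1 + ?p\<^sup>2" using columns_gram[OF g] by simp
  finally show False using assms(2) by (simp add: power2_eq_square algebra_simps)
qed

text \<open>Orthogonal columns have squared lengths with product 1, so both are unit vectors, and
  determinant 1 leaves the four rotations by multiples of a right angle.\<close>

lemma edge_slope_zero:
  assumes g: "g \<in> carrier SL2Z" and "edge_slope g = 0"
  shows "g \<in> {mat 1, rightS (mat 1), - mat 1, - rightS (mat 1)}"
proof -
  let ?a = "(g $ 1 $ 1)\<^sup>2 + (g $ 2 $ 1)\<^sup>2" and ?c = "(g $ 1 $ 2)\<^sup>2 + (g $ 2 $ 2)\<^sup>2"
  have "?a * ?c = 1" using columns_gram[OF g] assms(2) by simp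
  then have *: "?a = 1" "?c = 1"
    using column_pos[OF g] zmult_eq_1_iff[of ?a ?c] by auto
  have slope: "g $ 1 $ 1 * g $ 1 $ 2 + g $ 2 $ 1 * g $ 2 $ 2 = 0"
    using assms(2) by (simp add: edge_slope_def)
  have det: "g $ 1 $ 1 * g $ 2 $ 2 - g $ 1 $ 2 * g $ 2 $ 1 = 1"
    using g by (simp add: mem_SL2Z)
  \<comment> \<open>Multiplying by the squared length 1 of the first column writes each entry of the
    second column through the inner product 0 and the determinant 1.\<close>
  have "g $ 1 $ 2 = g $ 1 $ 2 * ?a" using * by simp
  also have "\<dots> = g $ 1 $ 1 * (g $ 1 $ 1 * g $ 1 $ 2 + g $ 2 $ 1 * g $ 2 $ 2)
      - g $ 2 $ 1 * (g $ 1 $ 1 * g $ 2 $ 2 - g $ 1 $ 2 * g $ 2 $ 1)"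
    by (simp add: power2_eq_square algebra_simps)
  finally have 12: "g $ 1 $ 2 = - g $ 2 $ 1" unfolding slope det by simp
  have "g $ 2 $ 2 = g $ 2 $ 2 * ?a" using * by simp
  also have "\<dots> = g $ 2 $ 1 * (g $ 1 $ 1 * g $ 1 $ 2 + g $ 2 $ 1 * g $ 2 $ 2)
      + g $ 1 $ 1 * (g $ 1 $ 1 * g $ 2 $ 2 - g $ 1 $ 2 * g $ 2 $ 1)"
    by (simp add: power2_eq_square algebra_simps)
  finally have 22: "g $ 2 $ 2 = g $ 1 $ 1" unfolding slope det by simp
  have "\<bar>g $ 1 $ 1\<bar> \<le> 1" "\<bar>g $ 2 $ 1\<bar> \<le> 1"
    unfolding abs_square_le_1[symmetric]
    using *(1) zero_le_power2[of "g $ 1 $ 1"] zero_le_power2[of "g $ 2 $ 1"] by linarith+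
  then have "g $ 1 $ 1 \<in> {-1, 0, 1}" "g $ 2 $ 1 \<in> {-1, 0, 1}" by auto
  then show ?thesis
    using *(1) by (auto simp: vec_eq_iff forall_2 mat_def 12 22)
qed

text \<open>Connectedness of the tree, equivalently generation by \<open>matS\<close> and
  \<open>matT\<close>. The height descends: a step by S makes the inner product negative, and an
  edge with negative inner product has a lower neighbour at its vertex. The descent ends at inner
  product zero.\<close>

lemma SL2Z_induct [consumes 1, case_names one S T]:
  assumes "g \<in> carrier SL2Z" and one: "P (mat 1)"
    and S: "\<And>g. g \<in> carrier SL2Z \<Longrightarrow> P g \<Longrightarrow> P (rightS g)"
    and T: "\<And>g. g \<in> carrier SL2Z \<Longrightarrow> P g \<Longrightarrow> P (rightT g)"
  shows "P g"
  using assms(1)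
proof (induction "nat (edge_height g)" arbitrary: g rule: less_induct)
  case less
  have neg: "P (- h) \<longleftrightarrow> P h" if "h \<in> carrier SL2Z" for h
    using S[of h] S[of "rightS h"] S[of "- h"] S[of "- rightS h"] that by auto
  \<comment> \<open>One of the other two edges at the vertex, \<open>k\<close>, has nonnegative
    inner product and so is lower; one or two T steps lead from \<open>k\<close> to
    \<open>- h\<close>.\<close>
  have *: "P h" if h: "h \<in> carrier SL2Z" "edge_height h = edge_height g" "edge_slope h < 0" for h
  proof -
    have "\<exists>k\<in>{rightT h, rightT (rightT h)}. 0 \<le> edge_slope k"
      using edge_slope_nonneg_exists[OF h(1,3)] by auto
    then obtain k where k: "k = rightT h \<or> k = rightT (rightT h)" "0 \<le> edge_slope k" by blast
    have k': "k \<in> carrier SL2Z" using k h by auto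
    have "edge_height k < edge_height h"
      using edge_height_increases[OF k' k(2)] k(1) edge_minus(1)[of h] by auto
    moreover have "0 \<le> edge_height k" by (simp add: edge_height_def)
    ultimately have "P k" using less.hyps[of k] k' h by auto
    then have "P (- h)"
      using k(1) T[of k] T[of "rightT k"] k' by auto
    then show ?thesis using neg h by blast
  qed
  consider "edge_slope g < 0" | "edge_slope g = 0" | "0 < edge_slope g" by linarith
  then show ?case
  proof cases
    case 1
    then show ?thesis using *[of g] less.prems by simp
  next
    case 2
    have "mat 1 \<in> carrier SL2Z" by (simp add: carrier_SL2Z)
    then show ?thesis
      using edge_slope_zero[OF less.prems 2] one S neg by auto
  next
    case 3
    then have "P (rightS g)" using *[of "rightS g"] less.prems by (simp add: edge_rightS)
    then show ?thesis using S[of "rightS g"] less.prems neg by auto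
  qed
qed

text \<open>
  The topograph is a tree: of the edges in the support, one of maximal height would be the only
  one at one of its two ends.
\<close>

lemma topograph_acyclic:
  fixes f :: "int^2^2 \<Rightarrow> int"
  assumes fin: "finite {g \<in> carrier SL2Z. f g \<noteq> 0}"
    and S: "\<And>g. f (rightS g) = - f g"
    and T: "\<And>g. f g + f (rightT g) + f (rightT (rightT g)) = 0"
    and g: "g \<in> carrier SL2Z"
  shows "f g = 0"
proof (rule ccontr)
  assume "f g \<noteq> 0"
  let ?X = "{g \<in> carrier SL2Z. f g \<noteq> 0}"
  define M where "M = Max (edge_height ` ?X)"
  have "M \<in> edge_height ` ?X"
    unfolding M_def using fin g \<open>f g \<noteq> 0\<close> by (intro Max_in) auto
  then obtain h where h: "h \<in> ?X" "edge_height h = M" by auto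
  define k where "k = (if 0 \<le> edge_slope h then h else rightS h)"
  have k: "k \<in> ?X" "edge_height k = M" "0 \<le> edge_slope k"
    using h S by (auto simp: k_def edge_rightS)
  have le: "edge_height x \<le> M" if "x \<in> ?X" for x
    unfolding M_def using fin that by (intro Max_ge) auto
  have "f (rightT k) = 0" "f (rightT (rightT k)) = 0"
    using le[of "rightT k"] le[of "rightT (rightT k)"] edge_height_increases[of k] k by force+
  then show False using T[of k] k by auto
qed

lemma rightS_order: "(rightS ^^ 4) g = g" "(rightT ^^ 6) g = g"
  by (simp_all add: eval_nat_numeral)

interpretation permS: cyclic_permutation "carrier SL2Z" rightS 4
proof
  fix g :: "int^2^2" and k :: nat
  assume g: "g \<in> carrier SL2Z" and k: "0 < k" "k < 4"
  have "rightS g \<noteq> g" "rightS (rightS (rightS g)) \<noteq> g"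
    using g minus_neq_SL2Z[OF g] by (metis right_relations(1,3) minus_minus)+
  moreover have "k \<in> {1, 2, 3}" using k by auto
  ultimately show "(rightS ^^ k) g \<noteq> g"
    using minus_neq_SL2Z[OF g] by (auto simp: eval_nat_numeral)
qed (simp_all add: rightS_order)

interpretation permT: cyclic_permutation "carrier SL2Z" rightT 6
proof
  fix g :: "int^2^2" and k :: nat
  assume g: "g \<in> carrier SL2Z" and k: "0 < k" "k < 6"
  \<comment> \<open>The characteristic equation of \<open>matT\<close>. It excludes fixed points of
    the powers of order 3, among whose powers -1 does not occur.\<close>
  have sq: "rightT (rightT g) = rightT g - g"
    by (simp add: vec_eq_iff forall_2)
  have 1: "rightT g \<noteq> g"
    using minus_neq_SL2Z[OF g] by (metis right_relations(2))
  have 2: "rightT (rightT g) \<noteq> g"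
  proof
    assume "rightT (rightT g) = g"
    then have "rightT g = - g" by (metis right_relations(2))
    then show False using sq right_relations(4)[of g] minus_neq_SL2Z[OF g]
      by (simp add: vec_eq_iff forall_2)
  qed
  have "rightT (rightT (- g)) \<noteq> g" "rightT (- g) \<noteq> g"
    using 1 2 by (metis right_relations(2,4) minus_minus)+
  moreover have "k \<in> {1, 2, 3, 4, 5}" using k by auto
  ultimately show "(rightT ^^ k) g \<noteq> g"
    using 1 2 minus_neq_SL2Z[OF g] by (auto simp: eval_nat_numeral)
qed (simp_all add: rightS_order)

interpretation permN: cyclic_permutation "carrier SL2Z" uminus 2
proof
  fix g :: "int^2^2" and k :: nat
  assume g: "g \<in> carrier SL2Z" and k: "0 < k" "k < 2"
  then have "k = 1" by simp
  then show "(uminus ^^ k) g \<noteq> g" using minus_neq_SL2Z[OF g] by simp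
qed (simp_all add: eval_nat_numeral)

lemma norm_chains:
  "permS.norm_chain c = c + frag_map rightS c + frag_map uminus c + frag_map (\<lambda>g. - rightS g) c"
  "permT.norm_chain c = c + frag_map rightT c + frag_map (\<lambda>g. rightT (rightT g)) c
     + frag_map uminus c + frag_map (\<lambda>g. - rightT g) c + frag_map (\<lambda>g. - rightT (rightT g)) c"
  "permN.norm_chain c = c + frag_map uminus c"
  unfolding permS.norm_chain_def permT.norm_chain_def permN.norm_chain_def
  by (simp_all add: eval_nat_numeral)

section \<open>A free resolution of the modular group from its action on the tree\<close>

text \<open>
  The cells over the quotient of the topograph by the group: \<open>CA\<close> belongs to the vertices with
  stabilizer of order 4, \<open>CB\<close> to those with stabilizer of order 6 and \<open>CC\<close> to the edges, whose
  stabilizer has order 2.  Over each of them lies the periodic resolution of its stabilizer.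
\<close>

datatype cell = CPoint | CA "int^2^2" | CB "int^2^2" | CC "int^2^2"

fun cells :: "nat \<Rightarrow> cell set" where
  "cells 0 = {CPoint}"
| "cells (Suc 0) = CA ` carrier SL2Z \<union> CB ` carrier SL2Z"
| "cells (Suc (Suc n)) = CA ` carrier SL2Z \<union> CB ` carrier SL2Z \<union> CC ` carrier SL2Z"

fun cell_act :: "int^2^2 \<Rightarrow> cell \<Rightarrow> cell" where
  "cell_act h CPoint = CPoint"
| "cell_act h (CA g) = CA (h ** g)"
| "cell_act h (CB g) = CB (h ** g)"
| "cell_act h (CC g) = CC (h ** g)"

fun cell_base :: "cell \<Rightarrow> int^2^2" where
  "cell_base CPoint = mat 1"
| "cell_base (CA g) = g"
| "cell_base (CB g) = g"
| "cell_base (CC g) = g"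

text \<open>The mapping cone of a chain map from the edge resolution to the two vertex resolutions.
  Since -1 is the square of \<open>matS\<close> and the cube of \<open>matT\<close>, that map is the
  identity in even dimensions, and 1 + S and 1 + T + T^2 in odd ones; the two targets enter with
  opposite signs. A cell \<open>CC g\<close> has its dimension raised by one, so that the lowest
  ones bound differences of vertices. The extra case \<open>n = 0\<close> is the bottom of the edge
  resolution.\<close>

fun cell_bd :: "nat \<Rightarrow> cell \<Rightarrow> cell \<Rightarrow>\<^sub>0 int" where
  "cell_bd 0 x = 0"
| "cell_bd (Suc n) CPoint = 0"
| "cell_bd (Suc 0) (CA g) = frag_of CPoint"
| "cell_bd (Suc 0) (CB g) = frag_of CPoint"
| "cell_bd (Suc 0) (CC g) = 0"
| "cell_bd (Suc (Suc n)) (CA g) =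
     (if even n then frag_of (CA (rightS g)) - frag_of (CA g)
      else frag_of (CA g) + frag_of (CA (rightS g)) + frag_of (CA (- g)) + frag_of (CA (- rightS g)))"
| "cell_bd (Suc (Suc n)) (CB g) =
     (if even n then frag_of (CB (rightT g)) - frag_of (CB g)
      else frag_of (CB g) + frag_of (CB (rightT g)) + frag_of (CB (rightT (rightT g)))
        + frag_of (CB (- g)) + frag_of (CB (- rightT g)) + frag_of (CB (- rightT (rightT g))))"
| "cell_bd (Suc (Suc n)) (CC g) =
     (if even n then frag_of (CA g) - frag_of (CB g)
        - (if n = 0 then 0 else frag_of (CC (- g)) + frag_of (CC g))
      else frag_of (CA g) + frag_of (CA (rightS g))
        - (frag_of (CB g) + frag_of (CB (rightT g)) + frag_of (CB (rightT (rightT g))))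
        - (frag_of (CC (- g)) - frag_of (CC g)))"

lemmas frag_linear = frag_extend_frag_extend frag_extend_diff frag_extend_add frag_extend_minus
  frag_extend_fun_diff frag_extend_fun_add

lemma cell_bd_bd: "x \<in> cells (Suc n) \<Longrightarrow> frag_extend (cell_bd n) (cell_bd (Suc n) x) = 0"
proof (induction n x rule: cell_bd.induct)
  case (1 x)
  then show ?case by (auto intro: frag_extend_eq_0)
qed (auto simp: frag_extend_diff frag_extend_add elim: evenE)

lemma mult_right: "h ** rightS g = rightS (h ** g)" "h ** rightT g = rightT (h ** g)" "h ** (- g) = - (h ** g)"
  for h :: "int^2^2"
  by (simp_all add: rightS_def rightT_def matrix_mul_assoc)
    (simp add: vec_eq_iff forall_2 matrix_matrix_mult_def sum_2)

lemma cell_bd_act: "cell_bd n (cell_act h x) = frag_map (cell_act h) (cell_bd n x)"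
  by (induction n x rule: cell_bd.induct)
    (simp_all add: frag_extend_diff frag_extend_add mult_right)

lemma cell_bd_keys: "x \<in> cells (Suc n) \<Longrightarrow> Poly_Mapping.keys (cell_bd (Suc n) x) \<subseteq> cells n"
proof (cases n)
  case 0
  then show "x \<in> cells (Suc n) \<Longrightarrow> Poly_Mapping.keys (cell_bd (Suc n) x) \<subseteq> cells n" by auto
next
  case (Suc m)
  assume x: "x \<in> cells (Suc n)"
  then obtain g where g: "g \<in> carrier SL2Z" "x = CA g \<or> x = CB g \<or> x = CC g"
    unfolding Suc by auto
  then show ?thesis
    unfolding Suc by (cases m) (elim disjE; simp add: keys_diff_subset keys_add_subset)+
qed

definition partA :: "(cell \<Rightarrow>\<^sub>0 int) \<Rightarrow> int^2^2 \<Rightarrow>\<^sub>0 int" where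
  "partA = frag_extend (\<lambda>x. case x of CA g \<Rightarrow> frag_of g | _ \<Rightarrow> 0)"
definition partB :: "(cell \<Rightarrow>\<^sub>0 int) \<Rightarrow> int^2^2 \<Rightarrow>\<^sub>0 int" where
  "partB = frag_extend (\<lambda>x. case x of CB g \<Rightarrow> frag_of g | _ \<Rightarrow> 0)"
definition partC :: "(cell \<Rightarrow>\<^sub>0 int) \<Rightarrow> int^2^2 \<Rightarrow>\<^sub>0 int" where
  "partC = frag_extend (\<lambda>x. case x of CC g \<Rightarrow> frag_of g | _ \<Rightarrow> 0)"

lemmas part_defs = partA_def partB_def partC_def

definition cell_sum where
  "cell_sum \<alpha> \<beta> \<gamma> = frag_map CA \<alpha> + frag_map CB \<beta> + frag_map CC \<gamma>"

lemma part_cell_sum [simp]: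
  "partA (cell_sum \<alpha> \<beta> \<gamma>) = \<alpha>" "partB (cell_sum \<alpha> \<beta> \<gamma>) = \<beta>" "partC (cell_sum \<alpha> \<beta> \<gamma>) = \<gamma>"
  by (simp_all add: part_defs cell_sum_def frag_linear frag_extend_eq_0)

lemma cell_sum_eq_0: "cell_sum \<alpha> \<beta> \<gamma> = 0 \<longleftrightarrow> \<alpha> = 0 \<and> \<beta> = 0 \<and> \<gamma> = 0"
proof
  assume "cell_sum \<alpha> \<beta> \<gamma> = 0"
  then show "\<alpha> = 0 \<and> \<beta> = 0 \<and> \<gamma> = 0"
    using part_cell_sum[of \<alpha> \<beta> \<gamma>] by (simp add: part_defs)
qed (simp add: cell_sum_def)

lemma cell_sum_parts:
  assumes "Poly_Mapping.keys c \<subseteq> cells (Suc (Suc n))"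
  shows "cell_sum (partA c) (partB c) (partC c) = c"
  using assms
proof (induction rule: frag_induction)
  case (diff a b)
  have "cell_sum (partA (a - b)) (partB (a - b)) (partC (a - b))
      = cell_sum (partA a) (partB a) (partC a) - cell_sum (partA b) (partB b) (partC b)"
    by (simp add: cell_sum_def part_defs frag_extend_diff)
  then show ?case using diff by simp
qed (auto simp: part_defs cell_sum_def)

lemma keys_parts:
  assumes "Poly_Mapping.keys c \<subseteq> cells (Suc (Suc n))"
  shows "Poly_Mapping.keys (partA c) \<subseteq> carrier SL2Z" "Poly_Mapping.keys (partB c) \<subseteq> carrier SL2Z"
    "Poly_Mapping.keys (partC c) \<subseteq> carrier SL2Z"
  unfolding part_defs using assms by (force intro!: keys_frag_extend_subset split: cell.splits)+

lemma keys_cell_sum: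
  assumes "Poly_Mapping.keys \<alpha> \<subseteq> carrier SL2Z" "Poly_Mapping.keys \<beta> \<subseteq> carrier SL2Z"
    "Poly_Mapping.keys \<gamma> \<subseteq> carrier SL2Z"
  shows "Poly_Mapping.keys (cell_sum \<alpha> \<beta> \<gamma>) \<subseteq> cells (Suc (Suc n))"
  unfolding cell_sum_def using assms
  by (intro keys_add_subset keys_frag_extend_subset) auto

lemma cell_bd_sum:
  "frag_extend (cell_bd (Suc (Suc n))) (cell_sum \<alpha> \<beta> \<gamma>) =
     (if even n then cell_sum (frag_map rightS \<alpha> - \<alpha> + \<gamma>) (frag_map rightT \<beta> - \<beta> - \<gamma>)
         (if n = 0 then 0 else - (frag_map uminus \<gamma> + \<gamma>))
      else cell_sum (permS.norm_chain \<alpha> + (\<gamma> + frag_map rightS \<gamma>))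
         (permT.norm_chain \<beta> - (\<gamma> + frag_map rightT \<gamma> + frag_map (\<lambda>g. rightT (rightT g)) \<gamma>))
         (- (frag_map uminus \<gamma> - \<gamma>)))"
  by (auto simp: cell_sum_def frag_linear norm_chains frag_extend_eq_0)

lemma lookup_frag_map_inj: "inj \<rho> \<Longrightarrow> Poly_Mapping.lookup (frag_map \<rho> c) (\<rho> x) = Poly_Mapping.lookup c x"
  by (induction c rule: frag_induct) (simp_all add: frag_extend_diff lookup_minus inj_eq)

text \<open>The boundary of a one-dimensional cell \<open>CC g\<close> has no component of that
  kind, so the tree must supply what the periodic resolution supplies in higher dimensions. Made
  invariant under -1, the chain \<gamma> becomes a finite chain of oriented edges, negated by
  reversal (S) and summing to zero around each vertex (T). Such a cycle on a tree is 0.\<close>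

lemma topograph_chain_acyclic:
  assumes keys: "Poly_Mapping.keys \<gamma> \<subseteq> carrier SL2Z"
    and \<alpha>: "frag_map rightS \<alpha> - \<alpha> + \<gamma> = 0" and \<beta>: "frag_map rightT \<beta> - \<beta> - \<gamma> = 0"
  shows "frag_map uminus \<gamma> + \<gamma> = 0"
proof -
  define \<delta> where "\<delta> = frag_map uminus \<gamma> + \<gamma>"
  have \<gamma>: "\<gamma> = \<alpha> - frag_map rightS \<alpha>" "\<gamma> = frag_map rightT \<beta> - \<beta>"
    using \<alpha> \<beta> by (simp_all add: algebra_simps)
  have S: "frag_map rightS \<delta> = - \<delta>"
    unfolding \<delta>_def \<gamma>(1) by (simp add: frag_linear)
  have T: "\<delta> + frag_map rightT \<delta> + frag_map rightT (frag_map rightT \<delta>) = 0"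
    unfolding \<delta>_def \<gamma>(2) by (simp add: frag_linear)
  have keys\<delta>: "Poly_Mapping.keys \<delta> \<subseteq> carrier SL2Z"
    unfolding \<delta>_def using keys by (intro keys_add_subset keys_frag_extend_subset) auto
  have "Poly_Mapping.lookup \<delta> g = 0" if g: "g \<in> carrier SL2Z" for g
  proof (rule topograph_acyclic[OF _ _ _ g])
    show "finite {g \<in> carrier SL2Z. Poly_Mapping.lookup \<delta> g \<noteq> 0}"
      by (rule finite_subset[OF _ finite_keys[of \<delta>]]) (auto simp: in_keys_iff)
    fix g
    have "Poly_Mapping.lookup (frag_map rightS \<delta>) (rightS g) = Poly_Mapping.lookup \<delta> g"
      by (rule lookup_frag_map_inj[OF inj_right(1)])
    then show "Poly_Mapping.lookup \<delta> (rightS g) = - Poly_Mapping.lookup \<delta> g"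
      by (simp add: S)
    have "Poly_Mapping.lookup (\<delta> + frag_map rightT \<delta> + frag_map rightT (frag_map rightT \<delta>)) (rightT (rightT g)) = 0"
      by (simp only: T lookup_zero)
    then show "Poly_Mapping.lookup \<delta> g + Poly_Mapping.lookup \<delta> (rightT g) + Poly_Mapping.lookup \<delta> (rightT (rightT g)) = 0"
      by (simp add: lookup_add lookup_frag_map_inj[OF inj_right(2)] del: right_relations)
  qed
  then show ?thesis
    unfolding \<delta>_def[symmetric] using keys\<delta>
    by (intro poly_mapping_eqI) (metis in_keys_iff lookup_zero subsetD)
qed

text \<open>A cell \<open>CC g\<close> joins \<open>CA g\<close> to \<open>CB g\<close>, and the
  one-dimensional cells \<open>CA g\<close> and \<open>CB g\<close> join a vertex cell to its S or T
  translate. \<open>SL2Z_induct\<close> concatenates these steps to a path from the base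
  vertex.\<close>

lemma cell_connected:
  assumes "x \<in> cells (Suc 0)"
  shows "\<exists>w. Poly_Mapping.keys w \<subseteq> cells (Suc (Suc 0)) \<and>
    frag_extend (cell_bd (Suc (Suc 0))) w = frag_of x - frag_of (CA (mat 1))"
proof -
  define P where "P x \<longleftrightarrow> (\<exists>w. Poly_Mapping.keys w \<subseteq> cells (Suc (Suc 0)) \<and>
    frag_extend (cell_bd (Suc (Suc 0))) w = frag_of x - frag_of (CA (mat 1)))" for x
  have step: "P y" if x: "P x" and w: "Poly_Mapping.keys w \<subseteq> cells (Suc (Suc 0))"
    "frag_extend (cell_bd (Suc (Suc 0))) w = frag_of y - frag_of x" for x y w
  proof -
    obtain v where v: "Poly_Mapping.keys v \<subseteq> cells (Suc (Suc 0))"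
       "frag_extend (cell_bd (Suc (Suc 0))) v = frag_of x - frag_of (CA (mat 1))"
      using x by (auto simp: P_def)
    then have "frag_extend (cell_bd (Suc (Suc 0))) (v + w) = frag_of y - frag_of (CA (mat 1))"
      using w(2) by (simp add: frag_extend_add)
    then show ?thesis unfolding P_def using keys_add_subset[OF v(1) w(1)] by blast
  qed
  have A: "P (CA g)" and B: "P (CB g)" if "g \<in> carrier SL2Z" for g
  proof -
    have AB: "P (CB g)" if "P (CA g)" "g \<in> carrier SL2Z" for g
      using that by (rule_tac step[of "CA g" "- frag_of (CC g)"]) (auto simp: frag_extend_minus)
    have BA: "P (CA g)" if "P (CB g)" "g \<in> carrier SL2Z" for g
      using that by (rule_tac step[of "CB g" "frag_of (CC g)"]) auto
    show A: "P (CA g)" using that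
    proof (induction rule: SL2Z_induct)
      case one
      show ?case unfolding P_def by (intro exI[of _ 0]) simp
    next
      case (S g)
      then show ?case by (rule_tac step[of "CA g" "frag_of (CA g)"]) auto
    next
      case (T g)
      then have "P (CB g)" by (intro AB)
      then have "P (CB (rightT g))"
        using T by (rule_tac step[of "CB g" "frag_of (CB g)"]) auto
      then show ?case using T by (intro BA) auto
    qed
    then show "P (CB g)" using that by (rule AB)
  qed
  then show ?thesis using assms unfolding P_def by auto
qed

text \<open>The long exact sequence of the mapping cone, by hand: the edge part of a cycle is a
  boundary in the edge resolution, and adding the boundary of \<open>cell_sum 0 0 \<gamma>'\<close>
  removes it. What remains is a pair of cycles of the vertex resolutions, which are exact by
  \<open>norm_kernel\<close> and \<open>invariant_norm\<close>. The augmentation and the vertices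
  are treated separately.\<close>

lemma cell_exact:
  assumes c: "Poly_Mapping.keys c \<subseteq> cells n" and bd: "frag_extend (cell_bd n) c = 0"
  shows "\<exists>c'. Poly_Mapping.keys c' \<subseteq> cells (Suc n) \<and> frag_extend (cell_bd (Suc n)) c' = c"
proof (cases n rule: cells.cases)
  case 1
  have "frag_extend (cell_bd (Suc 0)) (frag_map (\<lambda>x. CA (mat 1)) c) = frag_extend frag_of c"
    unfolding frag_extend_frag_extend using c 1 by (intro frag_extend_eq) auto
  moreover have "Poly_Mapping.keys (frag_map (\<lambda>x. CA (mat 1)) c) \<subseteq> cells (Suc 0)"
    by (intro keys_frag_extend_subset) (auto simp: carrier_SL2Z)
  ultimately show ?thesis using 1 by auto
next
  case 2
  obtain w where w: "\<And>x. x \<in> cells (Suc 0) \<Longrightarrow> Poly_Mapping.keys (w x) \<subseteq> cells (Suc (Suc 0))"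
    "\<And>x. x \<in> cells (Suc 0) \<Longrightarrow> frag_extend (cell_bd (Suc (Suc 0))) (w x) = frag_of x - frag_of (CA (mat 1))"
    using cell_connected by metis
  \<comment> \<open>The coefficients of \<open>c\<close> sum to zero, so \<open>c\<close> is
    recovered from the differences between its cells and the base vertex.\<close>
  have "frag_map (\<lambda>x. CA (mat 1)) (frag_extend (cell_bd 1) c) = frag_map (\<lambda>x. CA (mat 1)) c"
    unfolding frag_extend_frag_extend using c 2 by (intro frag_extend_eq) auto
  then have 0: "frag_map (\<lambda>x. CA (mat 1)) c = 0" using bd 2 by simp
  have "frag_extend (cell_bd (Suc (Suc 0))) (frag_extend w c) = frag_extend (\<lambda>x. frag_of x - frag_of (CA (mat 1))) c"
    unfolding frag_extend_frag_extend using c w 2 by (intro frag_extend_eq) (auto simp del: cells.simps)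
  also have "\<dots> = c" by (simp add: frag_extend_fun_diff 0)
  finally have "frag_extend (cell_bd (Suc (Suc 0))) (frag_extend w c) = c" .
  moreover have "Poly_Mapping.keys (frag_extend w c) \<subseteq> cells (Suc (Suc 0))"
    using c w 2 by (intro keys_frag_extend_subset) (auto simp del: cells.simps)
  ultimately show ?thesis unfolding 2 by blast
next
  case (3 m)
  define \<alpha> \<beta> \<gamma> where "\<alpha> = partA c" and "\<beta> = partB c" and "\<gamma> = partC c"
  have c_eq: "c = cell_sum \<alpha> \<beta> \<gamma>"
    using c 3 by (simp add: \<alpha>_def \<beta>_def \<gamma>_def cell_sum_parts del: cells.simps)
  have keys: "Poly_Mapping.keys \<alpha> \<subseteq> carrier SL2Z" "Poly_Mapping.keys \<beta> \<subseteq> carrier SL2Z"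
    "Poly_Mapping.keys \<gamma> \<subseteq> carrier SL2Z"
    using keys_parts[of c m] c 3 by (simp_all add: \<alpha>_def \<beta>_def \<gamma>_def del: cells.simps)
  have bd0: "frag_extend (cell_bd (Suc (Suc m))) (cell_sum \<alpha> \<beta> \<gamma>) = 0"
    using bd c_eq 3 by simp
  have "\<exists>\<gamma>'. Poly_Mapping.keys \<gamma>' \<subseteq> carrier SL2Z \<and>
     \<gamma> = (if even m then frag_map uminus \<gamma>' - \<gamma>' else frag_map uminus \<gamma>' + \<gamma>')"
  proof (cases "even m")
    case True
    have "frag_map uminus \<gamma> + \<gamma> = 0"
    proof (cases "m = 0")
      case True
      \<comment> \<open>In dimension 1 the acyclicity of the tree replaces the condition on the edge
        part.\<close>
      then show ?thesis
        using bd0 keys(3) by (intro topograph_chain_acyclic) (auto simp: cell_bd_sum cell_sum_eq_0)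
    next
      case False
      have "- (frag_map uminus \<gamma> + \<gamma>) = 0"
        using bd0 True False by (simp only: cell_bd_sum cell_sum_eq_0 if_True if_False)
      then show ?thesis by (simp only: neg_equal_0_iff_equal)
    qed
    then have "permN.norm_chain \<gamma> = 0"
      by (simp add: norm_chains add.commute)
    then show ?thesis using permN.norm_kernel[OF keys(3)] True by auto
  next
    case False
    then have "frag_map uminus \<gamma> = \<gamma>"
      using bd0 by (simp add: cell_bd_sum cell_sum_eq_0)
    then show ?thesis using permN.invariant_norm[OF keys(3)] False
      by (auto simp: norm_chains add.commute)
  qed
  then obtain \<gamma>' where \<gamma>': "Poly_Mapping.keys \<gamma>' \<subseteq> carrier SL2Z"
    "\<gamma> = (if even m then frag_map uminus \<gamma>' - \<gamma>' else frag_map uminus \<gamma>' + \<gamma>')" by blast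
  define c1 where "c1 = c + frag_extend (cell_bd (Suc n)) (cell_sum 0 0 \<gamma>')"
  have c\<gamma>: "Poly_Mapping.keys (cell_sum 0 0 \<gamma>') \<subseteq> cells (Suc n)"
    unfolding 3 using \<gamma>'(1) by (intro keys_cell_sum) auto
  have "Poly_Mapping.keys c1 \<subseteq> cells (Suc (Suc m))"
    unfolding c1_def 3 using c c\<gamma> cell_bd_keys[of _ n] unfolding 3
    by (intro keys_add_subset keys_frag_extend_subset) blast+
  moreover have "partC c1 = 0"
  proof -
    have add: "partC (a + b) = partC a + partC b" for a b
      by (simp add: partC_def frag_extend_add)
    show ?thesis
      unfolding c1_def c_eq 3 cell_bd_sum add using \<gamma>'(2) by simp
  qed
  ultimately have c1: "c1 = cell_sum (partA c1) (partB c1) 0"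
    and keys1: "Poly_Mapping.keys (partA c1) \<subseteq> carrier SL2Z" "Poly_Mapping.keys (partB c1) \<subseteq> carrier SL2Z"
    using cell_sum_parts[of c1 m] keys_parts[of c1 m] by (simp_all del: cells.simps)
  have "frag_extend (cell_bd n) (frag_extend (cell_bd (Suc n)) (cell_sum 0 0 \<gamma>')) = 0"
    unfolding frag_extend_frag_extend using c\<gamma> cell_bd_bd
    by (auto intro!: frag_extend_eq_0[where f = "\<lambda>x. frag_extend (cell_bd n) (cell_bd (Suc n) x)"]
        simp del: cells.simps cell_bd.simps)
  then have "frag_extend (cell_bd n) c1 = 0"
    using bd by (simp add: c1_def frag_extend_add)
  then have bd1: "frag_extend (cell_bd (Suc (Suc m))) (cell_sum (partA c1) (partB c1) 0) = 0"
    using 3 c1 by simp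
  have "\<exists>\<alpha>' \<beta>'. Poly_Mapping.keys \<alpha>' \<subseteq> carrier SL2Z \<and> Poly_Mapping.keys \<beta>' \<subseteq> carrier SL2Z \<and>
     frag_extend (cell_bd (Suc (Suc (Suc m)))) (cell_sum \<alpha>' \<beta>' 0) = c1"
  proof (cases "even m")
    case True
    then have "frag_map rightS (partA c1) = partA c1" "frag_map rightT (partB c1) = partB c1"
      using bd1 by (simp_all add: cell_bd_sum cell_sum_eq_0)
    then obtain \<alpha>' \<beta>' where "Poly_Mapping.keys \<alpha>' \<subseteq> carrier SL2Z" "permS.norm_chain \<alpha>' = partA c1"
      "Poly_Mapping.keys \<beta>' \<subseteq> carrier SL2Z" "permT.norm_chain \<beta>' = partB c1"
      using permS.invariant_norm[OF keys1(1)] permT.invariant_norm[OF keys1(2)] by blast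
    then show ?thesis
      using True c1 by (intro exI[of _ \<alpha>'] exI[of _ \<beta>']) (simp add: cell_bd_sum)
  next
    case False
    then have "permS.norm_chain (partA c1) = 0" "permT.norm_chain (partB c1) = 0"
      using bd1 by (simp_all add: cell_bd_sum cell_sum_eq_0)
    then obtain \<alpha>' \<beta>' where "Poly_Mapping.keys \<alpha>' \<subseteq> carrier SL2Z" "frag_map rightS \<alpha>' - \<alpha>' = partA c1"
      "Poly_Mapping.keys \<beta>' \<subseteq> carrier SL2Z" "frag_map rightT \<beta>' - \<beta>' = partB c1"
      using permS.norm_kernel[OF keys1(1)] permT.norm_kernel[OF keys1(2)] by blast
    then show ?thesis
      using False c1 by (intro exI[of _ \<alpha>'] exI[of _ \<beta>']) (simp add: cell_bd_sum)
  qed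
  then obtain \<alpha>' \<beta>' where *: "Poly_Mapping.keys \<alpha>' \<subseteq> carrier SL2Z" "Poly_Mapping.keys \<beta>' \<subseteq> carrier SL2Z"
     "frag_extend (cell_bd (Suc n)) (cell_sum \<alpha>' \<beta>' 0) = c1" using 3 by blast
  have "Poly_Mapping.keys (cell_sum \<alpha>' \<beta>' 0) \<subseteq> cells (Suc n)"
    unfolding 3 using * by (intro keys_cell_sum) auto
  then show ?thesis
    using * c\<gamma> by (intro exI[of _ "cell_sum \<alpha>' \<beta>' 0 - cell_sum 0 0 \<gamma>'"])
      (simp add: frag_extend_diff c1_def keys_diff_subset)
qed

lemma SL2Z_simps [simp]: "monoid.mult SL2Z = (**)" "one SL2Z = mat 1"
  by (simp_all add: SL2Z_def)

lemma free_resolution_cells: "free_resolution SL2Z cells cell_act cell_bd CPoint cell_base"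
proof (rule free_resolution.intro[OF group_SL2Z], unfold_locales)
  interpret group SL2Z by (rule group_SL2Z)
  show "cell_act g x \<in> cells n" if "g \<in> carrier SL2Z" "x \<in> cells n" for g x n
    using that m_closed by (cases n rule: cells.cases) auto
  show "cell_act \<one>\<^bsub>SL2Z\<^esub> x = x" for x by (cases x) auto
  show "cell_act (g \<otimes>\<^bsub>SL2Z\<^esub> h) x = cell_act g (cell_act h x)" for g h x
    by (cases x) (auto simp: matrix_mul_assoc)
  show "cell_base x \<in> carrier SL2Z" if "x \<in> cells (Suc n)" for x n
    using that by (cases n) auto
  show "cell_base (cell_act g x) = g \<otimes>\<^bsub>SL2Z\<^esub> cell_base x" if "x \<in> cells (Suc n)" for g x n
    using that by (cases n) auto
  show "Poly_Mapping.keys (cell_bd (Suc n) x) \<subseteq> cells n" if "x \<in> cells (Suc n)" for x n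
    using that by (rule cell_bd_keys)
  show "frag_extend (cell_bd n) (cell_bd (Suc n) x) = 0" if "x \<in> cells (Suc n)" for x n
    using that by (rule cell_bd_bd)
  show "\<exists>c'. Poly_Mapping.keys c' \<subseteq> cells (Suc n) \<and> frag_extend (cell_bd (Suc n)) c' = c"
    if "Poly_Mapping.keys c \<subseteq> cells n" "frag_extend (cell_bd n) c = 0" for c n
    using that by (rule cell_exact)
qed (auto simp: cell_bd_act)

section \<open>Cohomology in degree at least 2 as classes of triples\<close>

definition add_group :: "'a::ab_group_add set \<Rightarrow> 'a monoid" where
  "add_group S = \<lparr>carrier = S, monoid.mult = (+), one = 0\<rparr>"

lemma add_group_simps [simp]:
  "carrier (add_group S) = S" "monoid.mult (add_group S) = (+)" "one (add_group S) = 0"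
  by (simp_all add: add_group_def)

definition add_subgroup :: "'a::ab_group_add set \<Rightarrow> bool" where
  "add_subgroup S \<longleftrightarrow> 0 \<in> S \<and> (\<forall>a\<in>S. \<forall>b\<in>S. a - b \<in> S)"

lemma add_subgroupD:
  assumes "add_subgroup S"
  shows "0 \<in> S" "a \<in> S \<Longrightarrow> b \<in> S \<Longrightarrow> a - b \<in> S" "a \<in> S \<Longrightarrow> - a \<in> S" "a \<in> S \<Longrightarrow> b \<in> S \<Longrightarrow> a + b \<in> S"
proof -
  show 0: "0 \<in> S" and diff: "\<And>a b. a \<in> S \<Longrightarrow> b \<in> S \<Longrightarrow> a - b \<in> S"
    using assms by (auto simp: add_subgroup_def)
  show minus: "a \<in> S \<Longrightarrow> - a \<in> S" for a using diff[OF 0, of a] by simp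
  show "a \<in> S \<Longrightarrow> b \<in> S \<Longrightarrow> a + b \<in> S" using diff[of a "- b"] minus by simp
qed

lemma comm_group_add_group:
  assumes "add_subgroup S"
  shows "comm_group (add_group S)"
  using add_subgroupD[OF assms]
  by (intro comm_groupI) (auto simp: algebra_simps intro!: bexI[of _ "- x" for x])

lemma inv_add_group:
  assumes "add_subgroup S" "a \<in> S"
  shows "inv\<^bsub>add_group S\<^esub> a = - a"
proof -
  interpret comm_group "add_group S" using assms(1) by (rule comm_group_add_group)
  show ?thesis using assms add_subgroupD[OF assms(1)] by (intro inv_equality) auto
qed

lemma normal_add_group:
  assumes "add_subgroup S" "add_subgroup T" "T \<subseteq> S"
  shows "T \<lhd> add_group S"
proof -
  interpret comm_group "add_group S" using assms(1) by (rule comm_group_add_group)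
  have "subgroup T (add_group S)"
    using assms add_subgroupD[OF assms(2)]
    by (intro subgroupI) (auto simp: inv_add_group subset_iff)
  then show ?thesis by (rule subgroup_imp_normal)
qed

text \<open>The triple lists the values on the base cells of kinds \<open>CA\<close>,
  \<open>CB\<close>, \<open>CC\<close>, and \<open>ev\<close> tells whether the cohomological degree
  is even. The third entry is a cochain on {1, -1} of one degree less, which makes the restrictions
  of the classes of \<open>a\<close> and \<open>b\<close> agree.\<close>

definition stabilizer_cocycles ::
  "bool \<Rightarrow> 'a::ab_group_add set \<Rightarrow> ('a \<Rightarrow> 'a) \<Rightarrow> ('a \<Rightarrow> 'a) \<Rightarrow> ('a \<times> 'a \<times> 'a) set" where
  "stabilizer_cocycles ev A s t = {(a, b, c). a \<in> A \<and> b \<in> A \<and> c \<in> A \<and>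
     (if ev then s a = a \<and> t b = b \<and> a - b = s (s c) + c
      else a + s a + s (s a) + s (s (s a)) = 0 \<and>
        b + t b + t (t b) + t (t (t b)) + t (t (t (t b))) + t (t (t (t (t b)))) = 0 \<and>
        a + s a - (b + t b + t (t b)) = s (s c) - c)}"

text \<open>Here \<open>ev\<close> is the parity of the degree in which the coboundary
  lands.\<close>

definition stabilizer_bd ::
  "bool \<Rightarrow> ('a::ab_group_add \<Rightarrow> 'a) \<Rightarrow> ('a \<Rightarrow> 'a) \<Rightarrow> 'a \<times> 'a \<times> 'a \<Rightarrow> 'a \<times> 'a \<times> 'a" where
  "stabilizer_bd ev s t = (\<lambda>(a, b, c).
     if ev then (a + s a + s (s a) + s (s (s a)),
       b + t b + t (t b) + t (t (t b)) + t (t (t (t b))) + t (t (t (t (t b)))),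
       a + s a - (b + t b + t (t b)) - (s (s c) - c))
     else (s a - a, t b - b, a - b - (s (s c) + c)))"

definition stabilizer_coboundaries where
  "stabilizer_coboundaries ev A s t = stabilizer_bd ev s t ` (A \<times> A \<times> A)"

definition stabilizer_cohomology where
  "stabilizer_cohomology ev A s t =
     add_group (stabilizer_cocycles ev A s t) Mod stabilizer_coboundaries ev A s t"

lemma SL2Z_elements [simp]:
  "mat 1 \<in> carrier SL2Z" "matS \<in> carrier SL2Z" "matT \<in> carrier SL2Z"
  by (simp_all add: carrier_SL2Z) (simp_all add: matS_def matT_def det_2)

locale SL2Z_module = coefficient_module SL2Z A \<rho> for A :: "'a::ring_1 set" and \<rho>
begin

sublocale resolution_cohomology SL2Z cells cell_act cell_bd CPoint cell_base A \<rho>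
  using free_resolution_cells coefficient_module_axioms by (rule resolution_cohomology.intro)

abbreviation "s \<equiv> \<rho> matS"
abbreviation "t \<equiv> \<rho> matT"

lemma right_mat_one:
  "rightS (mat 1) = matS" "rightT (mat 1) = matT" "- mat 1 = matS ** matS"
  "- mat 1 = matT ** (matT ** matT)" "rightT matT = matT ** matT" "- matS = matS ** (matS ** matS)"
  "- matT = matT ** (matT ** (matT ** matT))"
  "- (matT ** matT) = matT ** (matT ** (matT ** (matT ** matT)))"
  using right_relations(1)[of "mat 1"] right_relations(2)[of "mat 1"] right_relations(1)[of matS]
    right_relations(2)[of matT] right_relations(2)[of "rightT matT"]
  by (simp_all add: rightS_def rightT_def matrix_mul_assoc mult_right(3))

lemma action_products:
  assumes "a \<in> A"
  shows "\<rho> (matS ** matS) a = s (s a)" "\<rho> (matS ** (matS ** matS)) a = s (s (s a))"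
    "\<rho> (matT ** matT) a = t (t a)" "\<rho> (matT ** (matT ** matT)) a = t (t (t a))"
    "\<rho> (matT ** (matT ** (matT ** matT))) a = t (t (t (t a)))"
    "\<rho> (matT ** (matT ** (matT ** (matT ** matT)))) a = t (t (t (t (t a))))"
proof -
  interpret group SL2Z by (rule group_SL2Z)
  have "g ** h \<in> carrier SL2Z" if "g \<in> carrier SL2Z" "h \<in> carrier SL2Z" for g h
    using m_closed[OF that] by simp
  then show "\<rho> (matS ** matS) a = s (s a)" "\<rho> (matS ** (matS ** matS)) a = s (s (s a))"
    "\<rho> (matT ** matT) a = t (t a)" "\<rho> (matT ** (matT ** matT)) a = t (t (t a))"
    "\<rho> (matT ** (matT ** (matT ** matT))) a = t (t (t (t a)))"
    "\<rho> (matT ** (matT ** (matT ** (matT ** matT)))) a = t (t (t (t (t a))))"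
    using assms action_mult by (simp_all add: action_closed)
qed

definition cell_values :: "(cell \<Rightarrow> 'a) \<Rightarrow> 'a \<times> 'a \<times> 'a" where
  "cell_values f = (f (CA (mat 1)), f (CB (mat 1)), f (CC (mat 1)))"

definition cell_extend :: "nat \<Rightarrow> 'a \<times> 'a \<times> 'a \<Rightarrow> cell \<Rightarrow> 'a" where
  "cell_extend n = (\<lambda>(a, b, c). \<lambda>x\<in>cells n. case x of CPoint \<Rightarrow> 0 | CA g \<Rightarrow> \<rho> g a | CB g \<Rightarrow> \<rho> g b | CC g \<Rightarrow> \<rho> g c)"

lemma cochain_cells:
  assumes "f \<in> C (Suc n)" "g \<in> carrier SL2Z"
  shows "f (CA g) = \<rho> g (f (CA (mat 1)))" "f (CB g) = \<rho> g (f (CB (mat 1)))" "f (CC g) = \<rho> g (f (CC (mat 1)))"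
proof -
  have "f (cell_act g x) = \<rho> g (f x)" if "x \<in> cells (Suc (Suc n))" for x
    using assms that by (simp add: equivariant_cochains_def del: cells.simps)
  from this[of "CA (mat 1)"] this[of "CB (mat 1)"] this[of "CC (mat 1)"]
  show "f (CA g) = \<rho> g (f (CA (mat 1)))" "f (CB g) = \<rho> g (f (CB (mat 1)))" "f (CC g) = \<rho> g (f (CC (mat 1)))"
    by auto
qed

lemma cell_values_closed:
  assumes "f \<in> C (Suc n)"
  shows "cell_values f \<in> A \<times> A \<times> A"
proof -
  have "f x \<in> A" if "x \<in> cells (Suc (Suc n))" for x
    using assms that by (auto simp: equivariant_cochains_def dest: PiE_mem simp del: cells.simps)
  then show ?thesis by (auto simp: cell_values_def)
qed

lemma cell_values_inject:
  assumes "f \<in> C (Suc n)" "g \<in> C (Suc n)" "cell_values f = cell_values g"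
  shows "f = g"
proof
  fix x
  show "f x = g x"
  proof (cases "x \<in> cells (Suc (Suc n))")
    case True
    then obtain g where g: "g \<in> carrier SL2Z" and x: "x = CA g \<or> x = CB g \<or> x = CC g" by auto
    show ?thesis
      using cochain_cells[OF assms(1) g] cochain_cells[OF assms(2) g] assms(3) x
      by (auto simp: cell_values_def)
  next
    case False
    then show ?thesis
      using assms(1,2) by (auto simp: equivariant_cochains_def PiE_def extensional_def simp del: cells.simps)
  qed
qed

lemma cell_extend_cochain:
  assumes "v \<in> A \<times> A \<times> A"
  shows "cell_extend (Suc (Suc n)) v \<in> C (Suc n)" "cell_values (cell_extend (Suc (Suc n)) v) = v"
proof -
  interpret group SL2Z by (rule group_SL2Z)
  have closed: "g ** h \<in> carrier SL2Z" if "g \<in> carrier SL2Z" "h \<in> carrier SL2Z" for g h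
    using m_closed[OF that] by simp
  show "cell_values (cell_extend (Suc (Suc n)) v) = v"
    using assms action_one by (auto simp: cell_values_def cell_extend_def)
  obtain a b c where v: "v = (a, b, c)" "a \<in> A" "b \<in> A" "c \<in> A" using assms by auto
  have act: "\<rho> (g ** h) x = \<rho> g (\<rho> h x)" if "g \<in> carrier SL2Z" "h \<in> carrier SL2Z" "x \<in> A" for g h x
    using action_mult[OF that] by simp
  have mem: "(case x of CPoint \<Rightarrow> 0 | CA g \<Rightarrow> \<rho> g a | CB g \<Rightarrow> \<rho> g b | CC g \<Rightarrow> \<rho> g c) \<in> A" if "x \<in> cells (Suc (Suc n))" for x
    using that v action_closed by auto
  have "cell_extend (Suc (Suc n)) v (cell_act g x) = \<rho> g (cell_extend (Suc (Suc n)) v x)"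
    if g: "g \<in> carrier SL2Z" and x: "x \<in> cells (Suc (Suc n))" for g x
  proof -
    obtain h where "h \<in> carrier SL2Z" "x = CA h \<or> x = CB h \<or> x = CC h" using x by auto
    then show ?thesis using g v by (auto simp: cell_extend_def act closed)
  qed
  then show "cell_extend (Suc (Suc n)) v \<in> C (Suc n)"
    using mem v(1) by (simp add: equivariant_cochains_def cell_extend_def del: cells.simps)
qed

lemma action_right:
  assumes "a \<in> A"
  shows "\<rho> (rightS (mat 1)) a = s a" "\<rho> (- mat 1) a = s (s a)" "\<rho> (- rightS (mat 1)) a = s (s (s a))"
    "\<rho> (rightT (mat 1)) a = t a" "\<rho> (rightT (rightT (mat 1))) a = t (t a)" "\<rho> (- mat 1) a = t (t (t a))"
    "\<rho> (- rightT (mat 1)) a = t (t (t (t a)))" "\<rho> (- rightT (rightT (mat 1))) a = t (t (t (t (t a))))"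
  unfolding right_mat_one(1,2,5,6,7,8) using action_products[OF assms]
  by (simp_all only: right_mat_one(3,4)[symmetric])

lemma cell_values_coboundary:
  assumes f: "f \<in> C (Suc n)"
  shows "cell_values (\<delta> (Suc n) f) = stabilizer_bd (even n) s t (cell_values f)"
proof -
  have A: "f (CA (mat 1)) \<in> A" "f (CB (mat 1)) \<in> A" "f (CC (mat 1)) \<in> A"
    using cell_values_closed[OF f] by (auto simp: cell_values_def)
  have 1: "mat 1 \<in> carrier SL2Z" by simp
  note a = action_right[OF A(1)] and b = action_right[OF A(2)] and c = action_right[OF A(3)]
  have "f (CA (rightS (mat 1))) = s (f (CA (mat 1)))" "f (CA (- mat 1)) = s (s (f (CA (mat 1))))"
    "f (CA (- rightS (mat 1))) = s (s (s (f (CA (mat 1)))))"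
    using cochain_cells(1)[OF f right_closed(1)[OF 1]] cochain_cells(1)[OF f right_closed(3)[OF 1]]
      cochain_cells(1)[OF f right_closed(3)[OF right_closed(1)[OF 1]]] a(1-3) by simp_all
  moreover have "f (CB (rightT (mat 1))) = t (f (CB (mat 1)))" "f (CB (rightT (rightT (mat 1)))) = t (t (f (CB (mat 1))))"
    "f (CB (- mat 1)) = t (t (t (f (CB (mat 1)))))" "f (CB (- rightT (mat 1))) = t (t (t (t (f (CB (mat 1))))))"
    "f (CB (- rightT (rightT (mat 1)))) = t (t (t (t (t (f (CB (mat 1)))))))"
    using cochain_cells(2)[OF f right_closed(2)[OF 1]] cochain_cells(2)[OF f right_closed(2)[OF right_closed(2)[OF 1]]]
      cochain_cells(2)[OF f right_closed(3)[OF 1]] cochain_cells(2)[OF f right_closed(3)[OF right_closed(2)[OF 1]]]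
      cochain_cells(2)[OF f right_closed(3)[OF right_closed(2)[OF right_closed(2)[OF 1]]]] b(4-8)
    by simp_all
  moreover have "f (CC (- mat 1)) = s (s (f (CC (mat 1))))"
    using cochain_cells(3)[OF f right_closed(3)[OF 1]] c(2) by simp
  ultimately show ?thesis
    by (simp add: cell_values_def cochain_bd_def stabilizer_bd_def feval_add feval_diff)
qed

lemma cell_values_cocycle:
  assumes f: "f \<in> C (Suc n)"
  shows "f \<in> Z (Suc n) \<longleftrightarrow> cell_values f \<in> stabilizer_cocycles (odd n) A s t"
proof -
  have "f \<in> Z (Suc n) \<longleftrightarrow> \<delta> (Suc n) f = (\<lambda>x\<in>cells (Suc (Suc (Suc n))). 0)"
    using f by (auto simp: equivariant_cocycles_def cochain_bd_def fun_eq_iff simp del: cells.simps)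
  also have "\<dots> \<longleftrightarrow> cell_values (\<delta> (Suc n) f) = 0"
  proof
    assume "cell_values (\<delta> (Suc n) f) = 0"
    moreover have "cell_values (\<lambda>x\<in>cells (Suc (Suc (Suc n))). 0) = 0"
      by (simp add: cell_values_def zero_prod_def)
    moreover have "\<delta> (Suc n) f \<in> C (Suc (Suc n))"
      using cochain_bd_closed[OF f] by (simp add: equivariant_cocycles_def)
    ultimately show "\<delta> (Suc n) f = (\<lambda>x\<in>cells (Suc (Suc (Suc n))). 0)"
      using cochains_closed(1)[of "Suc (Suc n)"] by (intro cell_values_inject) auto
  qed (simp add: cell_values_def zero_prod_def)
  also have "\<dots> \<longleftrightarrow> cell_values f \<in> stabilizer_cocycles (odd n) A s t"
    using cell_values_closed[OF f] unfolding cell_values_coboundary[OF f]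
    by (auto simp: stabilizer_bd_def stabilizer_cocycles_def zero_prod_def algebra_simps)
  finally show ?thesis .
qed

declare cells.simps [simp del]

text \<open>From dimension 1 on there is one free orbit of cells of each kind, so a cochain amounts
  to three arbitrary values. From dimension 2 on the boundary depends only on the parity of the
  dimension. Hence the index \<open>Suc n\<close>, which stands for cohomological degree
  \<open>n + 2\<close>.\<close>

theorem complex_cohomology_cells:
  "complex_cohomology SL2Z cells cell_act cell_bd A \<rho> (Suc n) \<cong> stabilizer_cohomology (even n) A s t"
  and stabilizer_subgroups: "add_subgroup (stabilizer_cocycles (even n) A s t)"
    "add_subgroup (stabilizer_coboundaries (even n) A s t)"
    "stabilizer_coboundaries (even n) A s t \<subseteq> stabilizer_cocycles (even n) A s t"
proof -
  let ?ZC = "fun_group (cells (Suc (Suc (Suc n)))) (Z (Suc (Suc n)))"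
    and ?BC = "\<delta> (Suc n) ` C (Suc n)"
    and ?Z = "stabilizer_cocycles (even n) A s t" and ?B = "stabilizer_coboundaries (even n) A s t"
  interpret ZC: comm_group ?ZC by (rule comm_group_cocycles)
  interpret BC: normal ?BC ?ZC by (rule coboundaries_normal)
  have mem: "cell_values f \<in> ?Z" if "f \<in> Z (Suc (Suc n))" for f
    using that cell_values_cocycle[of f "Suc n"] by (auto simp: equivariant_cocycles_def)
  have bd: "cell_values f \<in> ?B \<longleftrightarrow> f \<in> ?BC" if "f \<in> Z (Suc (Suc n))" for f
  proof
    assume "f \<in> ?BC"
    then obtain h where "h \<in> C (Suc n)" "f = \<delta> (Suc n) h" by blast
    then show "cell_values f \<in> ?B"
      using cell_values_closed[of h n] cell_values_coboundary[of h n] by (auto simp: stabilizer_coboundaries_def)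
  next
    assume "cell_values f \<in> ?B"
    then obtain v where v: "v \<in> A \<times> A \<times> A" "cell_values f = stabilizer_bd (even n) s t v"
      by (auto simp: stabilizer_coboundaries_def)
    have "cell_values f = cell_values (\<delta> (Suc n) (cell_extend (Suc (Suc n)) v))"
      using cell_values_coboundary[OF cell_extend_cochain(1)] cell_extend_cochain(2) v by simp
    moreover have "\<delta> (Suc n) (cell_extend (Suc (Suc n)) v) \<in> C (Suc (Suc n))"
      using cochain_bd_closed[OF cell_extend_cochain(1)[OF v(1)]] by (simp add: equivariant_cocycles_def)
    ultimately have "f = \<delta> (Suc n) (cell_extend (Suc (Suc n)) v)"
      using that by (intro cell_values_inject) (auto simp: equivariant_cocycles_def)
    then show "f \<in> ?BC" using cell_extend_cochain(1)[OF v(1)] by blast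
  qed
  have surj: "\<exists>f\<in>Z (Suc (Suc n)). cell_values f = v" if v: "v \<in> ?Z" for v
  proof -
    have A: "v \<in> A \<times> A \<times> A" using v by (auto simp: stabilizer_cocycles_def)
    then have "cell_extend (Suc (Suc (Suc n))) v \<in> Z (Suc (Suc n))"
      using cell_values_cocycle[OF cell_extend_cochain(1)[OF A], of "Suc n"] cell_extend_cochain(2)[OF A] v by simp
    then show ?thesis using cell_extend_cochain(2)[OF A] by blast
  qed
  have add: "cell_values (f \<otimes>\<^bsub>?ZC\<^esub> g) = cell_values f + cell_values g" for f g
    by (simp add: cell_values_def fun_group_def cells.simps)
  have one: "cell_values \<one>\<^bsub>?ZC\<^esub> = 0"
    by (simp add: cell_values_def fun_group_def zero_prod_def cells.simps)
  have carrier: "carrier ?ZC = Z (Suc (Suc n))" by (simp add: fun_group_def)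
  have image: "cell_values ` Z (Suc (Suc n)) = ?Z" using mem surj by blast
  have subgroup_image: "add_subgroup (cell_values ` H)" if H: "subgroup H ?ZC" for H
    unfolding add_subgroup_def
  proof (intro conjI ballI)
    interpret H: subgroup H ?ZC by fact
    show "0 \<in> cell_values ` H" using H.one_closed one by (metis imageI)
    fix a b assume "a \<in> cell_values ` H" "b \<in> cell_values ` H"
    then obtain f g where fg: "f \<in> H" "g \<in> H" "a = cell_values f" "b = cell_values g" by blast
    have "cell_values (inv\<^bsub>?ZC\<^esub> g) + cell_values g = 0"
      using fg H.mem_carrier by (simp only: add[symmetric] ZC.l_inv one)
    then have "cell_values (f \<otimes>\<^bsub>?ZC\<^esub> inv\<^bsub>?ZC\<^esub> g) = a - b"
      using fg by (simp add: add eq_neg_iff_add_eq_0[symmetric] )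
    then show "a - b \<in> cell_values ` H"
      using fg H.m_closed H.m_inv_closed by (metis imageI)
  qed
  have Z: "add_subgroup ?Z"
    using subgroup_image[OF ZC.subgroup_self] image carrier by simp
  have BC_image: "cell_values ` ?BC = ?B"
  proof
    show "cell_values ` ?BC \<subseteq> ?B" using bd BC.subset carrier by auto
    show "?B \<subseteq> cell_values ` ?BC"
    proof
      fix w assume "w \<in> ?B"
      then obtain v where v: "v \<in> A \<times> A \<times> A" "w = stabilizer_bd (even n) s t v"
        by (auto simp: stabilizer_coboundaries_def)
      then have "w = cell_values (\<delta> (Suc n) (cell_extend (Suc (Suc n)) v))"
        using cell_values_coboundary[OF cell_extend_cochain(1)] cell_extend_cochain(2) by simp
      then show "w \<in> cell_values ` ?BC" using cell_extend_cochain(1)[OF v(1)] by blast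
    qed
  qed
  have B: "add_subgroup ?B"
    using subgroup_image[OF BC.subgroup_axioms] BC_image by simp
  have BZ: "?B \<subseteq> ?Z"
    unfolding image[symmetric] BC_image[symmetric] using BC.subset carrier by (intro image_mono) simp
  have "?ZC Mod ?BC \<cong> add_group ?Z Mod ?B"
  proof (rule FactGroup_iso_FactGroup[where \<theta> = "cell_values"])
    show "group (add_group ?Z)" using comm_group_add_group[OF Z] by (rule comm_group.axioms(2))
    show "?B \<lhd> add_group ?Z" using Z B BZ by (rule normal_add_group)
    show "cell_values \<in> hom ?ZC (add_group ?Z)" using mem add carrier by (auto simp: hom_def)
    show "?BC \<subseteq> carrier ?ZC" by (rule BC.subset)
    show "cell_values f \<in> ?B \<longleftrightarrow> f \<in> ?BC" if "f \<in> carrier ?ZC" for f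
      using bd that carrier by simp
    show "\<exists>x\<in>carrier ?ZC. \<exists>n\<in>?B. y = n \<otimes>\<^bsub>add_group ?Z\<^esub> cell_values x" if "y \<in> carrier (add_group ?Z)" for y
      using surj[of y] that carrier add_subgroupD(1)[OF B] by force
  qed (rule ZC.is_group)
  then show "complex_cohomology SL2Z cells cell_act cell_bd A \<rho> (Suc n) \<cong> stabilizer_cohomology (even n) A s t"
    by (simp add: complex_cohomology_def stabilizer_cohomology_def)
  show "add_subgroup ?Z" "add_subgroup ?B" "?B \<subseteq> ?Z" by fact+
qed

lemma comm_group_complex_cohomology:
  "comm_group (complex_cohomology SL2Z cells cell_act cell_bd A \<rho> n)"
proof -
  interpret Z: comm_group "fun_group (cells (Suc (Suc n))) (Z (Suc n))" by (rule comm_group_cocycles)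
  show ?thesis
    unfolding complex_cohomology_def
    using coboundaries_normal by (intro Z.abelian_FactGroup normal_imp_subgroup)
qed

end

lemma hom_pow_nat:
  assumes "group G" "group H" "h \<in> hom G H" "x \<in> carrier G"
  shows "h (x [^]\<^bsub>G\<^esub> (k::nat)) = h x [^]\<^bsub>H\<^esub> k"
proof -
  interpret G: group G by fact
  interpret H: group H by fact
  show ?thesis
    using assms(3,4) hom_one[OF assms(3,1,2)] by (induction k) (auto simp: hom_mult)
qed

lemma iso_pow_eq_one:
  assumes "group G" "group H" "G \<cong> H" and k: "\<And>y. y \<in> carrier H \<Longrightarrow> y [^]\<^bsub>H\<^esub> (k::nat) = \<one>\<^bsub>H\<^esub>"
    and x: "x \<in> carrier G"
  shows "x [^]\<^bsub>G\<^esub> k = \<one>\<^bsub>G\<^esub>"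
proof -
  interpret G: group G by fact
  interpret H: group H by fact
  obtain h where h: "h \<in> hom G H" "bij_betw h (carrier G) (carrier H)"
    using assms(3) by (auto simp: is_iso_def iso_def)
  have "h x \<in> carrier H" using h x by (auto simp: bij_betw_def)
  then have "h (x [^]\<^bsub>G\<^esub> k) = h \<one>\<^bsub>G\<^esub>"
    using hom_pow_nat[OF assms(1,2) h(1) x] k hom_one[OF h(1) assms(1,2)] by simp
  then show ?thesis
    using h(2) x by (auto simp: bij_betw_def dest: inj_onD)
qed

subsection \<open>Vector spaces over the prime fields\<close>

lemma int_pow_mod_exponent:
  assumes "group T" "u \<in> carrier T" "u [^]\<^bsub>T\<^esub> (p::nat) = \<one>\<^bsub>T\<^esub>"
  shows "u [^]\<^bsub>T\<^esub> (k mod int p) = u [^]\<^bsub>T\<^esub> (k::int)"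
proof -
  interpret group T by fact
  have "u [^]\<^bsub>T\<^esub> k = u [^]\<^bsub>T\<^esub> (int p * (k div int p) + k mod int p)" by simp
  also have "\<dots> = (u [^]\<^bsub>T\<^esub> int p) [^]\<^bsub>T\<^esub> (k div int p) \<otimes>\<^bsub>T\<^esub> u [^]\<^bsub>T\<^esub> (k mod int p)"
    using assms(2) by (simp only: int_pow_mult int_pow_pow)
  also have "u [^]\<^bsub>T\<^esub> int p = \<one>\<^bsub>T\<^esub>" using assms(3) by (simp add: int_pow_int)
  finally show ?thesis using assms(2) by simp
qed

text \<open>A finite vector space over the field of \<open>p\<close> elements is in bijection with
  the functions from a basis to that field, so its cardinality determines its dimension.\<close>

lemma elementary_abelian_dim:
  fixes T :: "('t, 'm) monoid_scheme"
  assumes T: "comm_group T" and p: "Factorial_Ring.prime p"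
    and exp: "\<And>u. u \<in> carrier T \<Longrightarrow> u [^]\<^bsub>T\<^esub> p = \<one>\<^bsub>T\<^esub>" and card: "card (carrier T) = p ^ r"
    and V: "carrier V = carrier T" "ring.zero V = \<one>\<^bsub>T\<^esub>" "ring.add V = monoid.mult T"
      "smult V = (\<lambda>k u. u [^]\<^bsub>T\<^esub> (k::int))"
  shows "vectorspace.fin_dim (residue_ring (int p)) V \<and> vectorspace.dim (residue_ring (int p)) V = r"
proof -
  interpret T: comm_group T by fact
  interpret R: residues_prime p "residue_ring (int p)"
    using p by unfold_locales simp
  have fin: "finite (carrier T)"
    using card p by (metis card.infinite not_prime_0 power_not_zero)
  have "module (residue_ring (int p)) V"
  proof (rule moduleI)
    show "cring (residue_ring (int p))" ..
    show "abelian_group V"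
    proof (rule abelian_groupI)
      fix x assume "x \<in> carrier V"
      then show "\<exists>y\<in>carrier V. y \<oplus>\<^bsub>V\<^esub> x = \<zero>\<^bsub>V\<^esub>"
        by (auto simp: V intro: bexI[of _ "inv\<^bsub>T\<^esub> x"])
    qed (auto simp: V T.m_ac)
  next
    fix a b x y
    assume "a \<in> carrier (residue_ring (int p))" "b \<in> carrier (residue_ring (int p))" "x \<in> carrier V" "y \<in> carrier V"
    then show "(a \<oplus>\<^bsub>residue_ring (int p)\<^esub> b) \<odot>\<^bsub>V\<^esub> x = (a \<odot>\<^bsub>V\<^esub> x) \<oplus>\<^bsub>V\<^esub> (b \<odot>\<^bsub>V\<^esub> x)"
      "(a \<otimes>\<^bsub>residue_ring (int p)\<^esub> b) \<odot>\<^bsub>V\<^esub> x = a \<odot>\<^bsub>V\<^esub> (b \<odot>\<^bsub>V\<^esub> x)"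
      "a \<odot>\<^bsub>V\<^esub> (x \<oplus>\<^bsub>V\<^esub> y) = (a \<odot>\<^bsub>V\<^esub> x) \<oplus>\<^bsub>V\<^esub> (a \<odot>\<^bsub>V\<^esub> y)"
      by (simp_all add: V residue_ring_def int_pow_mod_exponent[OF T.is_group _ exp] T.int_pow_mult
          T.int_pow_pow T.int_pow_distrib mult.commute)
  qed (auto simp: V residue_ring_def)
  then interpret V: vectorspace "residue_ring (int p)" V
    by (intro vectorspace.intro R.field_axioms)
  have "V.gen_set (carrier V)"
    using V.in_own_span[of "carrier V"] V.span_is_subset2[of "carrier V"] by auto
  then have fd: "V.fin_dim"
    unfolding V.fin_dim_def using fin by (intro exI[of _ "carrier V"]) (auto simp: V)
  then obtain B where B: "finite B" "V.basis B" using V.finite_basis_exists by blast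
  then have BV: "B \<subseteq> carrier V" by (simp add: V.basis_def)
  have crit: "\<forall>v. v \<in> carrier V \<longrightarrow> (\<exists>!a. a \<in> B \<rightarrow>\<^sub>E carrier (residue_ring (int p)) \<and> V.lincomb a B = v)"
    using V.basis_criterion[OF B(1) BV] B(2) by blast
  have "bij_betw (\<lambda>a. V.lincomb a B) (B \<rightarrow>\<^sub>E carrier (residue_ring (int p))) (carrier V)"
    unfolding bij_betw_def
  proof
    have closed: "V.lincomb a B \<in> carrier V" if "a \<in> B \<rightarrow>\<^sub>E carrier (residue_ring (int p))" for a
      using that B BV by (intro V.lincomb_closed) auto
    then show "(\<lambda>a. V.lincomb a B) ` (B \<rightarrow>\<^sub>E carrier (residue_ring (int p))) = carrier V"
      using crit by (auto simp: image_iff)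
    show "inj_on (\<lambda>a. V.lincomb a B) (B \<rightarrow>\<^sub>E carrier (residue_ring (int p)))"
      using crit closed by (intro inj_onI) metis
  qed
  then have "card (carrier V) = card (B \<rightarrow>\<^sub>E carrier (residue_ring (int p)))"
    by (simp add: bij_betw_same_card)
  also have "\<dots> = p ^ card B"
    using B(1) by (simp add: card_PiE residue_ring_def)
  finally have "p ^ card B = p ^ r" using card by (simp add: V)
  then have "card B = r"
    using p prime_gt_1_nat by (simp add: power_inject_exp)
  then show ?thesis using fd V.dim_basis[OF B] by simp
qed

subsection \<open>Tensor products with a cyclic group\<close>

definition nat_powers :: "('a, 'm) monoid_scheme \<Rightarrow> nat \<Rightarrow> 'a set" where
  "nat_powers A p = (\<lambda>a. a [^]\<^bsub>A\<^esub> p) ` carrier A"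

lemma (in comm_group) subgroup_nat_powers: "subgroup (nat_powers G p) G"
proof (rule subgroupI)
  show "nat_powers G p \<subseteq> carrier G" "nat_powers G p \<noteq> {}" by (auto simp: nat_powers_def)
  show "inv a \<in> nat_powers G p" if "a \<in> nat_powers G p" for a
    using that by (auto simp: nat_powers_def nat_pow_inv[symmetric])
  show "a \<otimes> b \<in> nat_powers G p" if "a \<in> nat_powers G p" "b \<in> nat_powers G p" for a b
    using that by (auto simp: nat_powers_def nat_pow_distrib[symmetric])
qed

text \<open>The tensor of a and k goes to the coset of the k-th power of a. Every element of the
  tensor product has the form a tensor 1, and if a is a p-th power of b, then a tensor 1 equals b
  tensor 0 and vanishes.\<close>

lemma tensor_cyclic_iso:
  assumes A: "comm_group A" and p: "1 < p"
  shows "tensor_group A (integer_mod_group p) \<cong> A Mod nat_powers A p"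
    and "comm_group (tensor_group A (integer_mod_group p))"
proof -
  interpret A: comm_group A by fact
  let ?Z = "integer_mod_group p" and ?P = "nat_powers A p"
  let ?S = "carrier A \<times> carrier ?Z"
  define F where "F = free_Abelian_group ?S"
  define R where "R = generate F (tensor_relations A ?Z)"
  interpret F: comm_group F unfolding F_def by (rule abelian_free_Abelian_group)
  interpret P: normal ?P A using A.subgroup_nat_powers by (rule A.subgroup_imp_normal)
  have AP: "comm_group (A Mod ?P)" using A.subgroup_nat_powers by (rule A.abelian_FactGroup)
  interpret AP: comm_group "A Mod ?P" by (rule AP)
  have carrier_Z: "carrier ?Z = {0..<int p}" using p by (simp add: carrier_integer_mod_group)
  have F_simps: "\<And>x. x \<in> carrier F \<longleftrightarrow> Poly_Mapping.keys x \<subseteq> ?S" "monoid.mult F = (+)" "one F = 0"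
    "\<And>x. Poly_Mapping.keys x \<subseteq> ?S \<Longrightarrow> inv\<^bsub>F\<^esub> x = - x"
    by (simp_all add: F_def fun_eq_iff)
  have rel: "tensor_relations A ?Z \<subseteq> carrier F"
  proof -
    have *: "frag_of s - frag_of s' - frag_of s'' \<in> carrier F" if "s \<in> ?S" "s' \<in> ?S" "s'' \<in> ?S" for s s' s''
      unfolding F_simps using that by (intro keys_diff_subset) auto
    show ?thesis
      unfolding tensor_relations_def by (auto simp: carrier_Z intro!: *)
  qed
  have R: "subgroup R F" unfolding R_def using rel by (rule F.generate_is_subgroup)
  interpret R: subgroup R F by (rule R)
  show "comm_group (tensor_group A ?Z)"
    using F.abelian_FactGroup[OF R] by (simp add: tensor_group_def Let_def F_def R_def)
  have R_add: "x + y \<in> R" if "x \<in> R" "y \<in> R" for x y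
    using R.m_closed[OF that] by (simp add: F_simps)
  have R_minus: "- x \<in> R" if "x \<in> R" for x
    using R.m_inv_closed[OF that] R.mem_carrier[OF that] by (simp add: F_simps)
  have R_diff: "x - y \<in> R" if "x \<in> R" "y \<in> R" for x y
    using R_add[OF that(1) R_minus[OF that(2)]] by simp
  have R_zero: "0 \<in> R" using R.one_closed by (simp add: F_simps)
  have rel1: "frag_of (a \<otimes>\<^bsub>A\<^esub> a', b) - frag_of (a, b) - frag_of (a', b) \<in> R"
    if "a \<in> carrier A" "a' \<in> carrier A" "b \<in> carrier ?Z" for a a' b
    unfolding R_def using that by (intro generate.incl) (auto simp: tensor_relations_def)
  have rel2: "frag_of (a, (b + b') mod int p) - frag_of (a, b) - frag_of (a, b') \<in> R"
    if "a \<in> carrier A" "b \<in> carrier ?Z" "b' \<in> carrier ?Z" for a b b'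
  proof -
    have "frag_of (a, b \<otimes>\<^bsub>?Z\<^esub> b') - frag_of (a, b) - frag_of (a, b') \<in> R"
      unfolding R_def using that by (intro generate.incl UnI2 CollectI exI conjI refl) (auto simp: tensor_relations_def)
    then show ?thesis by simp
  qed
  have 01: "0 \<in> carrier ?Z" "1 \<in> carrier ?Z" using p by (auto simp: carrier_Z)
  have one: "frag_of (\<one>\<^bsub>A\<^esub>, b) \<in> R" if "b \<in> carrier ?Z" for b
    using R_minus[OF rel1[of "\<one>\<^bsub>A\<^esub>" "\<one>\<^bsub>A\<^esub>" b]] that by simp
  have zero: "frag_of (a, 0) \<in> R" if "a \<in> carrier A" for a
    using R_minus[OF rel2[of a 0 0]] that 01 by simp
  have scalar: "frag_of (a, int k) - frag_of (a [^]\<^bsub>A\<^esub> k, 1) \<in> R" if "a \<in> carrier A" "k < p" for a k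
    using that(2)
  proof (induction k)
    case 0
    then show ?case using R_diff[OF zero[OF that(1)] one[OF 01(2)]] by simp
  next
    case (Suc k)
    have "frag_of (a, (int k + 1) mod int p) - frag_of (a, int k) - frag_of (a, 1) \<in> R"
      using Suc.prems that(1) 01 by (intro rel2) (auto simp: carrier_Z)
    moreover have "(int k + 1) mod int p = int (Suc k)" using Suc.prems by simp
    ultimately have 1: "frag_of (a, int (Suc k)) - frag_of (a, int k) - frag_of (a, 1) \<in> R" by simp
    have 2: "frag_of (a [^]\<^bsub>A\<^esub> Suc k, 1) - frag_of (a [^]\<^bsub>A\<^esub> k, 1) - frag_of (a, 1) \<in> R"
      using rel1[of "a [^]\<^bsub>A\<^esub> k" a 1] that(1) 01 by simp
    have "frag_of (a, int k) - frag_of (a [^]\<^bsub>A\<^esub> k, 1) \<in> R" using Suc by simp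
    from R_add[OF R_diff[OF 1 2] this] show ?case by (simp add: algebra_simps)
  qed
  have reduce: "\<exists>a\<in>carrier A. c - frag_of (a, 1) \<in> R" if "c \<in> carrier F" for c
  proof -
    have "Poly_Mapping.keys c \<subseteq> ?S" using that by (simp add: F_simps)
    then show ?thesis
    proof (induction rule: frag_induction)
      case zero
      then show ?case using R_minus[OF one[OF 01(2)]] by (intro bexI[of _ "\<one>\<^bsub>A\<^esub>"]) auto
    next
      case (one x)
      obtain a b where x: "x = (a, b)" "a \<in> carrier A" "0 \<le> b" "b < int p"
        using one by (auto simp: carrier_Z)
      then show ?case
        using scalar[of a "nat b"] by (intro bexI[of _ "a [^]\<^bsub>A\<^esub> nat b"]) auto
    next
      case (diff c d)
      then obtain a b where a: "a \<in> carrier A" "c - frag_of (a, 1) \<in> R"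
        and b: "b \<in> carrier A" "d - frag_of (b, 1) \<in> R" by blast
      have "frag_of (a, 1) - frag_of (a \<otimes>\<^bsub>A\<^esub> inv\<^bsub>A\<^esub> b, 1) - frag_of (b, 1) \<in> R"
        using rel1[of "a \<otimes>\<^bsub>A\<^esub> inv\<^bsub>A\<^esub> b" b 1] a b 01 by (simp add: A.m_assoc)
      from R_add[OF R_diff[OF a(2) b(2)] this]
      have "c - d - frag_of (a \<otimes>\<^bsub>A\<^esub> inv\<^bsub>A\<^esub> b, 1) \<in> R" by (simp add: algebra_simps)
      then show ?case using a b by blast
    qed
  qed
  have coset_pow: "?P #>\<^bsub>A\<^esub> a [^]\<^bsub>A\<^esub> (k mod int p) = ?P #>\<^bsub>A\<^esub> a [^]\<^bsub>A\<^esub> (k :: int)" if a: "a \<in> carrier A" for a k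
  proof -
    have "a [^]\<^bsub>A\<^esub> k = a [^]\<^bsub>A\<^esub> ((k div int p) * int p + k mod int p)" by simp
    also have "\<dots> = (a [^]\<^bsub>A\<^esub> (k div int p)) [^]\<^bsub>A\<^esub> p \<otimes>\<^bsub>A\<^esub> a [^]\<^bsub>A\<^esub> (k mod int p)"
      using a by (simp only: A.int_pow_mult A.int_pow_pow[symmetric] int_pow_int)
    finally have "a [^]\<^bsub>A\<^esub> k = (a [^]\<^bsub>A\<^esub> (k div int p)) [^]\<^bsub>A\<^esub> p \<otimes>\<^bsub>A\<^esub> a [^]\<^bsub>A\<^esub> (k mod int p)" .
    moreover have "(a [^]\<^bsub>A\<^esub> (k div int p)) [^]\<^bsub>A\<^esub> p \<in> ?P" using a by (auto simp: nat_powers_def)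
    ultimately show ?thesis using a
      by (metis A.coset_join2 A.coset_mult_assoc A.int_pow_closed A.subgroup_nat_powers P.mem_carrier P.subset)
  qed
  define f where "f = (\<lambda>(a, k). ?P #>\<^bsub>A\<^esub> a [^]\<^bsub>A\<^esub> (k::int))"
  have "f ` ?S \<subseteq> carrier (A Mod ?P)" by (auto simp: f_def carrier_FactGroup)
  then obtain h where h: "h \<in> hom F (A Mod ?P)" "\<And>x. x \<in> ?S \<Longrightarrow> h (frag_of x) = f x"
    using AP.free_Abelian_group_universal unfolding F_def by metis
  interpret h: group_hom F "A Mod ?P" h
    using h(1) by (simp add: group_hom_def group_hom_axioms_def F.is_group AP.is_group)
  have h_frag: "frag_of s \<in> carrier F" if "s \<in> ?S" for s
    using that by (simp add: F_simps)
  have h_add: "h (x + y) = h x \<otimes>\<^bsub>A Mod ?P\<^esub> h y" if "x \<in> carrier F" "y \<in> carrier F" for x y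
    using h.hom_mult[OF that] by (simp only: F_simps)
  have ker: "subgroup (kernel F (A Mod ?P) h) F" by (rule h.subgroup_kernel)
  have kernel_rel: "frag_of s - frag_of s' - frag_of s'' \<in> kernel F (A Mod ?P) h"
    if s: "s \<in> ?S" "s' \<in> ?S" "s'' \<in> ?S" and eq: "f s = f s' \<otimes>\<^bsub>A Mod ?P\<^esub> f s''" for s s' s''
  proof -
    let ?d = "frag_of s - frag_of s' - frag_of s''"
    have d: "?d \<in> carrier F"
      unfolding F_simps using s by (intro keys_diff_subset) auto
    have "frag_of s = ?d + (frag_of s' + frag_of s'')" by simp
    then have "f s = h ?d \<otimes>\<^bsub>A Mod ?P\<^esub> (f s' \<otimes>\<^bsub>A Mod ?P\<^esub> f s'')"
      using h_add[OF d F.m_closed[OF h_frag[OF s(2)] h_frag[OF s(3)]]] h_add[OF h_frag[OF s(2)] h_frag[OF s(3)]] h(2) s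
      by (simp add: F_simps)
    moreover have "f s \<in> carrier (A Mod ?P)" using s by (auto simp: f_def carrier_FactGroup)
    ultimately have "h ?d = \<one>\<^bsub>A Mod ?P\<^esub>"
      using eq h.hom_closed[OF d] by (metis AP.l_cancel_one' AP.r_cancel_one')
    then show ?thesis using d by (simp add: kernel_def)
  qed
  have "tensor_relations A ?Z \<subseteq> kernel F (A Mod ?P) h"
    unfolding tensor_relations_def
  proof (intro Un_least subsetI; elim CollectE exE conjE; hypsubst)
    fix a a' b assume ab: "a \<in> carrier A" "a' \<in> carrier A" "b \<in> carrier ?Z"
    show "frag_of (a \<otimes>\<^bsub>A\<^esub> a', b) - frag_of (a, b) - frag_of (a', b) \<in> kernel F (A Mod ?P) h"
      using ab by (intro kernel_rel) (auto simp: f_def A.int_pow_distrib P.rcos_sum)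
  next
    fix a b b' assume ab: "a \<in> carrier A" "b \<in> carrier ?Z" "b' \<in> carrier ?Z"
    show "frag_of (a, b \<otimes>\<^bsub>?Z\<^esub> b') - frag_of (a, b) - frag_of (a, b') \<in> kernel F (A Mod ?P) h"
      using ab p by (intro kernel_rel) (auto simp: f_def coset_pow A.int_pow_mult P.rcos_sum carrier_Z)
  qed
  then have R_kernel: "R \<subseteq> kernel F (A Mod ?P) h"
    unfolding R_def using ker by (rule F.generate_subgroup_incl)
  have "kernel F (A Mod ?P) h \<subseteq> R"
  proof
    fix c assume c: "c \<in> kernel F (A Mod ?P) h"
    then have cF: "c \<in> carrier F" by (simp add: kernel_def)
    then obtain a where a: "a \<in> carrier A" "c - frag_of (a, 1) \<in> R" using reduce by blast
    have "h c = h (c - frag_of (a, 1)) \<otimes>\<^bsub>A Mod ?P\<^esub> h (frag_of (a, 1))"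
      using h_add[of "c - frag_of (a, 1)" "frag_of (a, 1)"] a R.mem_carrier 01 h_frag[of "(a, 1)"] by simp
    also have "h (c - frag_of (a, 1)) = \<one>\<^bsub>A Mod ?P\<^esub>"
      using R_kernel a(2) by (auto simp: kernel_def)
    also have "h (frag_of (a, 1)) = ?P #>\<^bsub>A\<^esub> a" using h(2)[of "(a, 1)"] a 01 by (simp add: f_def)
    finally have "?P #>\<^bsub>A\<^esub> a = ?P"
      using c a AP.l_one[of "?P #>\<^bsub>A\<^esub> a"] by (auto simp: kernel_def carrier_FactGroup)
    then obtain b where b: "b \<in> carrier A" "a = b [^]\<^bsub>A\<^esub> p"
      using A.coset_join1[of ?P a] a A.subgroup_nat_powers P.subset by (auto simp: nat_powers_def)
    \<comment> \<open>Adding 1 to \<open>p - 1\<close> gives 0 in the cyclic group; this relation is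
      what kills p-th powers.\<close>
    have "frag_of (b, (int (p - 1) + 1) mod int p) - frag_of (b, int (p - 1)) - frag_of (b, 1) \<in> R"
      using b p 01 by (intro rel2) (auto simp: carrier_Z)
    moreover have "(int (p - 1) + 1) mod int p = 0" using p by (simp add: of_nat_diff)
    ultimately have 1: "frag_of (b, 0) - frag_of (b, int (p - 1)) - frag_of (b, 1) \<in> R" by simp
    have 2: "frag_of (b, int (p - 1)) - frag_of (b [^]\<^bsub>A\<^esub> (p - 1), 1) \<in> R"
      using b p by (intro scalar) auto
    have "frag_of (b [^]\<^bsub>A\<^esub> Suc (p - 1), 1) - frag_of (b [^]\<^bsub>A\<^esub> (p - 1), 1) - frag_of (b, 1) \<in> R"
      using rel1[of "b [^]\<^bsub>A\<^esub> (p - 1)" b 1] b 01 by simp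
    then have 3: "frag_of (a, 1) - frag_of (b [^]\<^bsub>A\<^esub> (p - 1), 1) - frag_of (b, 1) \<in> R"
      using b p by simp
    have "frag_of (a, 1) \<in> R"
      using R_add[OF R_diff[OF 3 R_add[OF 1 2]] zero[OF b(1)]] by (simp add: algebra_simps)
    from R_add[OF a(2) this] show "c \<in> R" by simp
  qed
  then have "kernel F (A Mod ?P) h = R" using R_kernel by blast
  moreover have "h ` carrier F = carrier (A Mod ?P)"
  proof
    show "carrier (A Mod ?P) \<subseteq> h ` carrier F"
    proof
      fix U assume "U \<in> carrier (A Mod ?P)"
      then obtain a where a: "a \<in> carrier A" "U = ?P #>\<^bsub>A\<^esub> a" by (auto simp: carrier_FactGroup)
      then have "U = h (frag_of (a, 1))" using h(2)[of "(a, 1)"] 01 by (simp add: f_def)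
      then show "U \<in> h ` carrier F" using a 01 h_frag[of "(a, 1)"] by blast
    qed
  qed auto
  ultimately have "F Mod R \<cong> A Mod ?P" using h.FactGroup_iso by simp
  then show "tensor_group A ?Z \<cong> A Mod ?P"
    by (simp add: tensor_group_def Let_def F_def R_def)
qed

text \<open>Coefficients of the Poincare series become logarithms of cardinalities of quotients
  A/pA.\<close>

lemma tensor_Fp_dim:
  assumes A: "comm_group A" and p: "Factorial_Ring.prime p" and card: "card (carrier (A Mod nat_powers A p)) = p ^ r"
  shows "vectorspace.fin_dim (residue_ring (int p)) (tensor_Fp A p) \<and>
    vectorspace.dim (residue_ring (int p)) (tensor_Fp A p) = r"
proof -
  interpret A: comm_group A by fact
  let ?T = "tensor_group A (integer_mod_group p)"
  have p1: "1 < p" using p by (rule prime_gt_1_nat)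
  interpret T: comm_group ?T using A p1 by (rule tensor_cyclic_iso(2))
  interpret P: normal "nat_powers A p" A using A.subgroup_nat_powers by (rule A.subgroup_imp_normal)
  interpret AP: group "A Mod nat_powers A p" by (rule P.factorgroup_is_group)
  note iso = tensor_cyclic_iso(1)[OF A p1]
  have "U [^]\<^bsub>A Mod nat_powers A p\<^esub> p = \<one>\<^bsub>A Mod nat_powers A p\<^esub>" if U: "U \<in> carrier (A Mod nat_powers A p)" for U
  proof -
    obtain a where a: "a \<in> carrier A" "U = nat_powers A p #>\<^bsub>A\<^esub> a" using U by (auto simp: carrier_FactGroup)
    have "nat_powers A p #>\<^bsub>A\<^esub> (a [^]\<^bsub>A\<^esub> p) = U [^]\<^bsub>A Mod nat_powers A p\<^esub> p"
      using hom_pow_nat[OF A.is_group AP.is_group P.r_coset_hom_Mod a(1)] a(2) by simp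
    moreover have "nat_powers A p #>\<^bsub>A\<^esub> (a [^]\<^bsub>A\<^esub> p) = nat_powers A p"
      using a by (intro A.coset_join2 A.subgroup_nat_powers) (auto simp: nat_powers_def)
    ultimately show ?thesis by simp
  qed
  then have exp: "u [^]\<^bsub>?T\<^esub> p = \<one>\<^bsub>?T\<^esub>" if "u \<in> carrier ?T" for u
    using iso_pow_eq_one[OF T.is_group AP.is_group iso] that by blast
  have "card (carrier ?T) = p ^ r" using iso_same_card[OF iso] card by simp
  from elementary_abelian_dim[OF T.comm_group_axioms p exp this, of "tensor_Fp A p"]
  show ?thesis by (simp add: tensor_Fp_def Let_def)
qed

subsection \<open>Quotients of additive groups of triples\<close>

definition scale3 :: "nat \<Rightarrow> 'a::comm_ring_1 \<times> 'a \<times> 'a \<Rightarrow> 'a \<times> 'a \<times> 'a" where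
  "scale3 k = (\<lambda>(a, b, c). (of_nat k * a, of_nat k * b, of_nat k * c))"

lemma pow_add_group: "z [^]\<^bsub>add_group S\<^esub> (k::nat) = scale3 k z"
  by (induction k) (auto simp: scale3_def zero_prod_def algebra_simps split: prod.splits)

lemma quotient_exponent:
  fixes Z :: "('a::comm_ring_1 \<times> 'a \<times> 'a) set"
  assumes Z: "add_subgroup Z" "add_subgroup B" "B \<subseteq> Z" and H: "group H" "H \<cong> add_group Z Mod B"
    and k: "\<And>z. z \<in> Z \<Longrightarrow> scale3 k z \<in> B" and x: "x \<in> carrier H"
  shows "x [^]\<^bsub>H\<^esub> k = \<one>\<^bsub>H\<^esub>"
proof -
  interpret B: normal B "add_group Z" using Z by (rule normal_add_group)
  have Q: "group (add_group Z Mod B)" by (rule B.factorgroup_is_group)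
  show ?thesis
  proof (rule iso_pow_eq_one[OF H(1) Q H(2) _ x])
    fix y assume "y \<in> carrier (add_group Z Mod B)"
    then obtain z where z: "z \<in> Z" "y = B #>\<^bsub>add_group Z\<^esub> z" by (auto simp: carrier_FactGroup)
    have "B #>\<^bsub>add_group Z\<^esub> (scale3 k z) = y [^]\<^bsub>add_group Z Mod B\<^esub> k"
      using hom_pow_nat[OF B.is_group Q B.r_coset_hom_Mod, of z k] z by (simp add: pow_add_group)
    moreover have "B #>\<^bsub>add_group Z\<^esub> (scale3 k z) = B"
      using k[OF z(1)] Z(3) by (intro B.coset_join2 B.subgroup_axioms) auto
    ultimately show "y [^]\<^bsub>add_group Z Mod B\<^esub> k = \<one>\<^bsub>add_group Z Mod B\<^esub>" by simp
  qed
qed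

text \<open>
  A presentation of an abelian group as a quotient of a group of triples, in a form that is
  independent of the quotient construction.
\<close>

lemma quotient_presentation:
  fixes Z :: "('a::comm_ring_1 \<times> 'a \<times> 'a) set"
  assumes Z: "add_subgroup Z" "add_subgroup B" "B \<subseteq> Z" and H: "comm_group H" "H \<cong> add_group Z Mod B"
  obtains \<pi> where "\<pi> \<in> hom (add_group Z) H" "\<pi> ` Z = carrier H" "\<And>z. z \<in> Z \<Longrightarrow> \<pi> z = \<one>\<^bsub>H\<^esub> \<longleftrightarrow> z \<in> B"
proof -
  interpret B: normal B "add_group Z" using Z by (rule normal_add_group)
  interpret H: comm_group H by fact
  have Q: "group (add_group Z Mod B)" by (rule B.factorgroup_is_group)
  have "add_group Z Mod B \<cong> H" using H.iso_sym H(2) by blast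
  then obtain h where h: "h \<in> hom (add_group Z Mod B) H" "bij_betw h (carrier (add_group Z Mod B)) (carrier H)"
    by (auto simp: is_iso_def iso_def)
  define \<pi> where "\<pi> z = h (B #>\<^bsub>add_group Z\<^esub> z)" for z
  have "\<pi> \<in> hom (add_group Z) H"
    using hom_compose[OF B.r_coset_hom_Mod h(1)] by (simp add: \<pi>_def[abs_def] o_def)
  moreover have "\<pi> ` Z = carrier H"
    using h(2) by (auto simp: \<pi>_def bij_betw_def carrier_FactGroup image_image)
  moreover have "\<pi> z = \<one>\<^bsub>H\<^esub> \<longleftrightarrow> z \<in> B" if z: "z \<in> Z" for z
  proof -
    have mem: "B #>\<^bsub>add_group Z\<^esub> z \<in> carrier (add_group Z Mod B)" "B \<in> carrier (add_group Z Mod B)"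
      using z group.is_monoid[OF Q, THEN monoid.one_closed] by (auto simp: carrier_FactGroup)
    have "h B = \<one>\<^bsub>H\<^esub>" using hom_one[OF h(1) Q H.is_group] by simp
    then have "\<pi> z = \<one>\<^bsub>H\<^esub> \<longleftrightarrow> B #>\<^bsub>add_group Z\<^esub> z = B"
      using inj_on_eq_iff[OF bij_betw_imp_inj_on[OF h(2)] mem] by (simp add: \<pi>_def)
    also have "\<dots> \<longleftrightarrow> z \<in> B"
      using z B.coset_join1[OF _ _ B.subgroup_axioms, of z] B.coset_join2[OF _ B.subgroup_axioms, of z]
      by (metis add_group_simps(1))
    finally show ?thesis .
  qed
  ultimately show ?thesis using that by blast
qed

text \<open>H/pH is the quotient of Z by B + pZ. An additive surjection \<open>f\<close> from
  \<open>Z\<close> to \<open>Q\<close> under which this subgroup is the preimage of \<open>Y\<close>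
  identifies it with Q/Y. The rank computations below consist in finding such an \<open>f\<close>
  with values in forms modulo 2 or residues modulo 3.\<close>

lemma quotient_card_mod_p:
  fixes Z :: "('a::comm_ring_1 \<times> 'a \<times> 'a) set" and f :: "'a \<times> 'a \<times> 'a \<Rightarrow> 'q::ab_group_add"
  assumes Z: "add_subgroup Z" "add_subgroup B" "B \<subseteq> Z" and H: "comm_group H" "H \<cong> add_group Z Mod B"
    and f: "\<And>z w. z \<in> Z \<Longrightarrow> w \<in> Z \<Longrightarrow> f (z + w) = f z + f w" "f ` Z = Q"
    and Y: "add_subgroup Q" "add_subgroup Y" "Y \<subseteq> Q"
    and kernel: "\<And>z. z \<in> Z \<Longrightarrow> f z \<in> Y \<longleftrightarrow> (\<exists>w\<in>Z. z - scale3 p w \<in> B)"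
    and card: "card Q = card Y * p ^ r" "finite Q"
  shows "card (carrier (H Mod nat_powers H p)) = p ^ r"
proof -
  interpret H: comm_group H by fact
  interpret Zg: comm_group "add_group Z" using Z(1) by (rule comm_group_add_group)
  interpret Q: comm_group "add_group Q" using Y(1) by (rule comm_group_add_group)
  interpret YQ: normal Y "add_group Q" using Y by (rule normal_add_group)
  interpret P: normal "nat_powers H p" H using H.subgroup_nat_powers by (rule H.subgroup_imp_normal)
  obtain \<pi> where \<pi>: "\<pi> \<in> hom (add_group Z) H" "\<pi> ` Z = carrier H" "\<And>z. z \<in> Z \<Longrightarrow> \<pi> z = \<one>\<^bsub>H\<^esub> \<longleftrightarrow> z \<in> B"
    using quotient_presentation[OF Z H] by blast
  define N where "N = {z \<in> Z. f z \<in> Y}"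
  have diff: "z - w \<in> Z" if "z \<in> Z" "w \<in> Z" for z w using add_subgroupD(2)[OF Z(1) that] .
  have \<pi>_eq: "\<pi> z = \<pi> w \<longleftrightarrow> z - w \<in> B" if zw: "z \<in> Z" "w \<in> Z" for z w
  proof -
    have "\<pi> z = \<pi> (z - w) \<otimes>\<^bsub>H\<^esub> \<pi> w"
      using hom_mult[OF \<pi>(1), of "z - w" w] diff[OF zw] zw by simp
    moreover have "\<pi> w \<in> carrier H" "\<pi> (z - w) \<in> carrier H"
      unfolding \<pi>(2)[symmetric] using zw diff by (simp_all add: imageI del: split_paired_All)
    ultimately show ?thesis using \<pi>(3)[OF diff[OF zw]] by (metis H.l_one H.r_cancel_one)
  qed
  have scale: "scale3 p w \<in> Z" "\<pi> (scale3 p w) = \<pi> w [^]\<^bsub>H\<^esub> p" if "w \<in> Z" for w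
    using Zg.nat_pow_closed[of w p] hom_pow_nat[OF Zg.is_group H.is_group \<pi>(1), of w p] that
    by (simp_all add: pow_add_group)
  have "add_group Z Mod N \<cong> H Mod nat_powers H p"
  proof (rule FactGroup_iso_FactGroup[OF Zg.is_group H.is_group P.normal_axioms \<pi>(1)])
    show "N \<subseteq> carrier (add_group Z)" by (auto simp: N_def)
    fix z assume "z \<in> carrier (add_group Z)"
    then have z: "z \<in> Z" by simp
    have "\<pi> z \<in> nat_powers H p \<longleftrightarrow> (\<exists>w\<in>Z. \<pi> z = \<pi> w [^]\<^bsub>H\<^esub> p)"
      unfolding nat_powers_def \<pi>(2)[symmetric] by auto
    also have "\<dots> \<longleftrightarrow> (\<exists>w\<in>Z. z - scale3 p w \<in> B)"
      using \<pi>_eq[OF z scale(1)] scale(2) by metis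
    finally show "\<pi> z \<in> nat_powers H p \<longleftrightarrow> z \<in> N"
      using kernel[OF z] z by (simp add: N_def)
  next
    fix y assume "y \<in> carrier H"
    then obtain z where "z \<in> Z" "y = \<pi> z" using \<pi>(2) by blast
    then show "\<exists>x\<in>carrier (add_group Z). \<exists>n\<in>nat_powers H p. y = n \<otimes>\<^bsub>H\<^esub> \<pi> x"
      using \<open>y \<in> carrier H\<close> P.one_closed by (intro bexI[of _ z] bexI[of _ "\<one>\<^bsub>H\<^esub>"]) auto
  qed
  then have "card (carrier (H Mod nat_powers H p)) = card (carrier (add_group Z Mod N))"
    by (rule iso_same_card[symmetric])
  also have "add_group Z Mod N \<cong> add_group Q Mod Y"
  proof (rule FactGroup_iso_FactGroup[OF Zg.is_group Q.is_group YQ.normal_axioms])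
    show "f \<in> hom (add_group Z) (add_group Q)" using f by (auto simp: hom_def)
    show "\<exists>x\<in>carrier (add_group Z). \<exists>n\<in>Y. y = n \<otimes>\<^bsub>add_group Q\<^esub> f x" if y: "y \<in> carrier (add_group Q)" for y
    proof -
      obtain z where "z \<in> Z" "y = f z" using y f(2) by auto
      then show ?thesis
        using add_subgroupD(1)[OF Y(2)] by (intro bexI[of _ z] bexI[of _ 0]) auto
    qed
  qed (auto simp: N_def)
  then have "card (carrier (add_group Z Mod N)) = card (carrier (add_group Q Mod Y))"
    by (rule iso_same_card)
  also have "card (carrier (add_group Q Mod Y)) * card Y = card Q"
    using Q.lagrange[OF YQ.subgroup_axioms] by (simp add: FactGroup_def order_def)
  then have "card (carrier (add_group Q Mod Y)) = p ^ r"
    using card Y add_subgroupD(1)[OF Y(2)]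
    by (metis card_gt_0_iff empty_iff finite_subset mult.commute nat_mult_eq_cancel1)
  finally show ?thesis .
qed

subsection \<open>Abelian groups of exponent 4\<close>

text \<open>Take the largest \<open>N\<close> such that a cyclic group of order 4, generated by
  \<open>x\<close>, times N - 1 groups of order 2 embeds into the 2-primary part. An element outside
  the image, divided by \<open>x\<close> if its square is \<open>u\<close>, has trivial square and
  would provide one more summand; so the embedding is onto.\<close>

lemma cyclic_summand_count_4:
  assumes A: "comm_group A"
    and fin: "finite {a \<in> carrier A. a [^]\<^bsub>A\<^esub> (4::nat) = \<one>\<^bsub>A\<^esub>}"
    and exp: "\<And>a k. a \<in> carrier A \<Longrightarrow> a [^]\<^bsub>A\<^esub> (2 ^ k :: nat) = \<one>\<^bsub>A\<^esub> \<Longrightarrow> a [^]\<^bsub>A\<^esub> (4::nat) = \<one>\<^bsub>A\<^esub>"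
    and sq: "\<And>a. a \<in> carrier A \<Longrightarrow> a [^]\<^bsub>A\<^esub> (4::nat) = \<one>\<^bsub>A\<^esub> \<Longrightarrow> a [^]\<^bsub>A\<^esub> (2::nat) \<in> {\<one>\<^bsub>A\<^esub>, u}"
    and u: "u \<noteq> \<one>\<^bsub>A\<^esub>" "u [^]\<^bsub>A\<^esub> (2::nat) = \<one>\<^bsub>A\<^esub>"
    and x: "x \<in> carrier A" "x [^]\<^bsub>A\<^esub> (2::nat) = u"
  shows "cyclic_summand_count A 2 2 1"
proof -
  interpret A: comm_group A by fact
  define S where "S = {a \<in> carrier A. a [^]\<^bsub>A\<^esub> (4::nat) = \<one>\<^bsub>A\<^esub>}"
  have S: "a \<in> S \<longleftrightarrow> a \<in> carrier A \<and> a [^]\<^bsub>A\<^esub> (4::nat) = \<one>\<^bsub>A\<^esub>" for a by (simp add: S_def)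
  have pow4: "a [^]\<^bsub>A\<^esub> (4::nat) = (a [^]\<^bsub>A\<^esub> (2::nat)) [^]\<^bsub>A\<^esub> (2::nat)" if "a \<in> carrier A" for a
    using that by (simp add: A.nat_pow_pow)
  have xS: "x \<in> S" using x u pow4 by (simp add: S)
  \<comment> \<open>Index 0 is reserved for the summand of order 4, whose generator will be
    \<open>x\<close>; all other summands have order 2.\<close>
  define e :: "nat \<Rightarrow> nat" where "e i = (if i = 0 then 2 else 1)" for i
  define PG where "PG N = product_group {..<N} (\<lambda>i. integer_mod_group (2 ^ e i))" for N :: nat
  define good where "good N y \<longleftrightarrow> y 0 = x \<and> (\<forall>i. y i \<in> carrier A \<and> y i [^]\<^bsub>A\<^esub> (2 ^ e i :: nat) = \<one>\<^bsub>A\<^esub>)" for N :: nat and y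
  define F where "F N y c = finprod A (\<lambda>i. y i [^]\<^bsub>A\<^esub> (c i :: int)) {..<N}" for N :: nat and y c
  have group_PG: "group (PG N)" for N by (simp add: PG_def)
  have F_closed: "F N y c \<in> carrier A" if "good N y" for N y c
    using that unfolding F_def good_def by (intro A.finprod_closed) auto
  have F_Suc: "F (Suc N) y c = y N [^]\<^bsub>A\<^esub> c N \<otimes>\<^bsub>A\<^esub> F N y c" if "good N y" for N y c
    using that unfolding F_def lessThan_Suc good_def by (subst A.finprod_insert) auto
  have F_hom: "F N y \<in> hom (PG N) A" if y: "good N y" for N y
  proof (rule homI)
    fix c d assume "c \<in> carrier (PG N)" "d \<in> carrier (PG N)"
    have "F N y (c \<otimes>\<^bsub>PG N\<^esub> d) = finprod A (\<lambda>i. y i [^]\<^bsub>A\<^esub> c i \<otimes>\<^bsub>A\<^esub> y i [^]\<^bsub>A\<^esub> d i) {..<N}"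
      unfolding F_def
    proof (rule A.finprod_cong')
      fix i assume i: "i \<in> {..<N}"
      have "y i [^]\<^bsub>A\<^esub> ((c i + d i) mod int (2 ^ e i)) = y i [^]\<^bsub>A\<^esub> (c i + d i)"
        using y by (intro int_pow_mod_exponent A.is_group) (auto simp: good_def)
      then show "y i [^]\<^bsub>A\<^esub> (c \<otimes>\<^bsub>PG N\<^esub> d) i = y i [^]\<^bsub>A\<^esub> c i \<otimes>\<^bsub>A\<^esub> y i [^]\<^bsub>A\<^esub> d i"
        using i y by (simp add: PG_def A.int_pow_mult good_def)
    qed (use y in \<open>auto simp: good_def\<close>)
    also have "\<dots> = F N y c \<otimes>\<^bsub>A\<^esub> F N y d"
      using y unfolding F_def good_def by (intro A.finprod_multf) auto
    finally show "F N y (c \<otimes>\<^bsub>PG N\<^esub> d) = F N y c \<otimes>\<^bsub>A\<^esub> F N y d" .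
  qed (use F_closed y in blast)
  have good_S: "y i \<in> S" if "good N y" for N y i
  proof -
    have yi: "y i \<in> carrier A" "y i [^]\<^bsub>A\<^esub> (2 ^ e i :: nat) = \<one>\<^bsub>A\<^esub>" using that by (auto simp: good_def)
    show ?thesis
    proof (cases "i = 0")
      case False
      then show ?thesis using yi pow4 by (simp add: S e_def)
    qed (use that xS in \<open>simp add: good_def\<close>)
  qed
  have S_group: "a \<otimes>\<^bsub>A\<^esub> b \<in> S" "inv\<^bsub>A\<^esub> a \<in> S" "\<one>\<^bsub>A\<^esub> \<in> S" if "a \<in> S" "b \<in> S" for a b
    using that by (auto simp: S A.nat_pow_distrib A.nat_pow_inv)
  have S_pow: "a [^]\<^bsub>A\<^esub> (k::int) \<in> S" if a: "a \<in> S" for a k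
  proof -
    have "(a [^]\<^bsub>A\<^esub> k) [^]\<^bsub>A\<^esub> int 4 = (a [^]\<^bsub>A\<^esub> int 4) [^]\<^bsub>A\<^esub> k"
      using a by (simp only: S A.int_pow_pow mult.commute)
    then show ?thesis using a by (simp only: int_pow_int S A.int_pow_closed A.int_pow_one)
  qed
  have F_S: "F N y c \<in> S" if "good N y" for N y c
  proof (induction N)
    case 0
    then show ?case using S_group[OF xS xS] by (simp add: F_def)
  next
    case (Suc N)
    have "good N y" using that by (simp add: good_def)
    then show ?case using Suc F_Suc S_group S_pow good_S by auto
  qed
  have finS: "finite S" using fin by (simp add: S_def)
  define inj where "inj N \<longleftrightarrow> (\<exists>y. good N y \<and> inj_on (F N y) (carrier (PG N)))" for N
  have card_PG: "N \<le> card (carrier (PG N))" for N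
  proof -
    have "N \<le> 2 ^ N" by (simp add: less_imp_le)
    also have "(2::nat) ^ N = (\<Prod>i<N. 2)" by simp
    also have "\<dots> \<le> (\<Prod>i<N. 2 ^ e i)" by (intro prod_mono) (auto simp: e_def)
    also have "\<dots> = card (carrier (PG N))"
      by (simp add: PG_def card_PiE carrier_integer_mod_group nat_power_eq)
    finally show ?thesis .
  qed
  \<comment> \<open>Finiteness of the 4-torsion bounds the number of summands, so a largest family
    exists.\<close>
  have bound: "N \<le> card S" if injN: "inj N" for N
  proof -
    obtain y where y: "good N y" "inj_on (F N y) (carrier (PG N))" using injN by (auto simp: inj_def)
    have "card (carrier (PG N)) = card (F N y ` carrier (PG N))" using y(2) by (simp add: card_image)
    also have "\<dots> \<le> card S" using F_S[OF y(1)] finS by (intro card_mono) auto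
    finally show ?thesis using card_PG[of N] by simp
  qed
  have inj1: "inj 1"
  proof -
    define y where "y i = (if i = 0 then x else \<one>\<^bsub>A\<^esub>)" for i :: nat
    have y: "good 1 y" using xS x by (auto simp: good_def y_def e_def S)
    interpret h: group_hom "PG 1" A "F 1 y"
      using F_hom[OF y] by (simp add: group_hom_def group_hom_axioms_def group_PG A.is_group)
    have F1: "F 1 y c = x [^]\<^bsub>A\<^esub> c 0" for c
      using F_Suc[of 0 y c] y x by (simp add: F_def y_def good_def)
    have "c = \<one>\<^bsub>PG 1\<^esub>" if c: "c \<in> carrier (PG 1)" "F 1 y c = \<one>\<^bsub>A\<^esub>" for c
    proof -
      have c0: "c 0 \<in> {0..<4}" and ext: "c \<in> extensional {0}"
        using c(1) by (auto simp: PG_def carrier_integer_mod_group e_def PiE_def lessThan_Suc)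
      have pow: "x [^]\<^bsub>A\<^esub> nat (c 0) = \<one>\<^bsub>A\<^esub>" using c F1 c0 by (simp add: int_pow_int[symmetric])
      have ne: "A.ord x dvd nat (c 0)" "\<not> A.ord x dvd 2" "A.ord x dvd 4"
        using pow x u xS by (auto simp: A.pow_eq_id[symmetric] S)
      have "A.ord x \<in> {1, 2, 4}" using ne(3) dvd_imp_le[OF ne(3)]
        by (auto simp: le_Suc_eq numeral_eq_Suc dvd_def) presburger
      then have "4 dvd nat (c 0)" using ne by auto
      then have "c 0 = 0" using c0 by (auto dest: dvd_imp_le)
      then show ?thesis using ext by (auto simp: PG_def fun_eq_iff extensional_def)
    qed
    then have "kernel (PG 1) A (F 1 y) = {\<one>\<^bsub>PG 1\<^esub>}"
      unfolding kernel_def using h.hom_one h.G.one_closed by blast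
    then show ?thesis using y h.inj_iff_trivial_ker by (auto simp: inj_def)
  qed
  define N where "N = Max {N. inj N}"
  have fin_inj: "finite {N. inj N}" by (rule finite_subset[of _ "{..card S}"]) (use bound in auto)
  have N: "inj N" "\<not> inj (Suc N)" "1 \<le> N"
  proof -
    show "inj N" unfolding N_def using Max_in[OF fin_inj] inj1 by auto
    show "\<not> inj (Suc N)" using Max_ge[OF fin_inj, of "Suc N"] by (auto simp: N_def)
    show "1 \<le> N" unfolding N_def using fin_inj inj1 by (intro Max_ge) auto
  qed
  obtain y where y: "good N y" "inj_on (F N y) (carrier (PG N))" using N(1) by (auto simp: inj_def)
  interpret h: group_hom "PG N" A "F N y"
    using F_hom[OF y(1)] by (simp add: group_hom_def group_hom_axioms_def group_PG A.is_group)
  let ?I = "F N y ` carrier (PG N)"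
  have I: "subgroup ?I A" by (rule h.img_is_subgroup)
  interpret I: subgroup ?I A by (rule I)
  have xI: "x \<in> ?I"
  proof -
    define c where "c = (\<lambda>i\<in>{..<N}. if i = 0 then 1 else 0 :: int)"
    have c: "c \<in> carrier (PG N)" by (auto simp: c_def PG_def carrier_integer_mod_group e_def)
    have "F N y c = finprod A (\<lambda>i. if i = 0 then x else \<one>\<^bsub>A\<^esub>) {..<N}"
      unfolding F_def using y(1) x by (intro A.finprod_cong') (auto simp: c_def good_def)
    also have "\<dots> = x" using N(3) x A.finprod_singleton[of 0 "{..<N}" "\<lambda>i. x"] by (simp add: eq_commute)
    finally show ?thesis using c by (metis imageI)
  qed
  have "S \<subseteq> ?I"
  proof (rule ccontr)
    assume "\<not> S \<subseteq> ?I"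
    then obtain z where z: "z \<in> S" "z \<notin> ?I" by blast
    \<comment> \<open>Since \<open>x\<close> lies in the image, dividing by it keeps the element
      outside, and it removes a square equal to \<open>u\<close>.\<close>
    define w where "w = (if z [^]\<^bsub>A\<^esub> (2::nat) = \<one>\<^bsub>A\<^esub> then z else z \<otimes>\<^bsub>A\<^esub> inv\<^bsub>A\<^esub> x)"
    have zA: "z \<in> carrier A" using z by (simp add: S)
    have w: "w \<in> carrier A" "w [^]\<^bsub>A\<^esub> (2::nat) = \<one>\<^bsub>A\<^esub>" "w \<notin> ?I"
    proof -
      show "w \<in> carrier A" using zA x by (simp add: w_def)
      show "w [^]\<^bsub>A\<^esub> (2::nat) = \<one>\<^bsub>A\<^esub>"
        using sq[of z] z x zA by (auto simp: w_def S A.nat_pow_distrib A.nat_pow_inv)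
      have "z \<in> ?I" if "z \<otimes>\<^bsub>A\<^esub> inv\<^bsub>A\<^esub> x \<in> ?I"
        using I.m_closed[OF that xI] zA x by (simp add: A.m_assoc)
      then show "w \<notin> ?I" using z by (auto simp: w_def)
    qed
    define y' where "y' = y(N := w)"
    have y': "good (Suc N) y'" using y(1) w N(3) by (auto simp: good_def y'_def e_def)
    interpret h': group_hom "PG (Suc N)" A "F (Suc N) y'"
      using F_hom[OF y'] by (simp add: group_hom_def group_hom_axioms_def group_PG A.is_group)
    have "c = \<one>\<^bsub>PG (Suc N)\<^esub>" if c: "c \<in> carrier (PG (Suc N))" "F (Suc N) y' c = \<one>\<^bsub>A\<^esub>" for c
    proof -
      let ?c = "restrict c {..<N}"
      have c': "?c \<in> carrier (PG N)" using c(1) by (auto simp: PG_def PiE_iff)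
      have "F N y' c = F N y ?c"
        unfolding F_def using y(1) by (intro A.finprod_cong') (auto simp: y'_def good_def)
      then have eq: "w [^]\<^bsub>A\<^esub> c N \<otimes>\<^bsub>A\<^esub> F N y ?c = \<one>\<^bsub>A\<^esub>"
        using F_Suc[of N y' c] y' c(2) by (simp add: y'_def good_def)
      have "c N \<in> carrier (integer_mod_group (2 ^ e N))" using c(1) by (auto simp: PG_def PiE_iff)
      then have "c N \<in> {0..<2}" using N(3) by (simp add: carrier_integer_mod_group e_def)
      then consider "c N = 0" | "c N = 1" by fastforce
      then show ?thesis
      proof cases
        case 1
        then have "F N y ?c = \<one>\<^bsub>A\<^esub>" using eq F_closed[OF y(1)] by simp
        then have "?c = \<one>\<^bsub>PG N\<^esub>"
          using y(2) c' h.hom_one h.G.one_closed by (metis inj_onD)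
        then have "c i = 0" if "i < N" for i
          using that by (auto simp: PG_def fun_eq_iff split: if_splits)
        then show ?thesis using 1 c(1)
          by (auto simp: PG_def fun_eq_iff PiE_def extensional_def less_Suc_eq)
      next
        case 2
        then have "w = inv\<^bsub>A\<^esub> (F N y ?c)"
          using eq F_closed[OF y(1)] w(1) by (simp add: A.inv_equality[symmetric])
        then show ?thesis using w(3) c' I.m_inv_closed by blast
      qed
    qed
    then have "kernel (PG (Suc N)) A (F (Suc N) y') = {\<one>\<^bsub>PG (Suc N)\<^esub>}"
      unfolding kernel_def using h'.hom_one h'.G.one_closed by blast
    then have "inj (Suc N)" using y' h'.inj_iff_trivial_ker by (auto simp: inj_def)
    then show False using N(2) by simp
  qed
  then have image: "?I = S" using F_S[OF y(1)] by auto
  have PC: "carrier (primary_component A 2) = S"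
  proof
    show "carrier (primary_component A 2) \<subseteq> S" using exp by (auto simp: primary_component_def S)
    show "S \<subseteq> carrier (primary_component A 2)"
      by (auto simp: primary_component_def S intro!: exI[of _ 2])
  qed
  have "F N y \<in> iso (PG N) (primary_component A 2)"
    using F_hom[OF y(1)] y(2) image PC
    by (auto simp: iso_def hom_def bij_betw_def primary_component_def)
  then have "PG N \<cong> primary_component A 2" by (auto simp: is_iso_def)
  then have "primary_component A 2 \<cong> PG N" by (rule group.iso_sym[OF group_PG])
  moreover have "{i. i < N \<and> e i = 2} = {0}" using N(3) by (auto simp: e_def)
  ultimately show ?thesis
    unfolding cyclic_summand_count_def PG_def
    by (intro exI[of _ N] exI[of _ e]) (auto simp: e_def)
qed

section \<open>Binary forms over a commutative ring\<close>

text \<open>Coefficients are kept general because the forms are needed over the integers and over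
  the field of two elements; over the integers these are \<open>var_x\<close>, \<open>var_y\<close>
  and \<open>substitute\<close> again.\<close>

definition PX :: "'a::comm_ring_1 poly poly" where "PX = [:[:0, 1:]:]"
definition PY :: "'a::comm_ring_1 poly poly" where "PY = [:0, 1:]"
definition PK :: "'a::comm_ring_1 \<Rightarrow> 'a poly poly" where "PK c = [:[:c:]:]"

definition ev :: "'a::comm_ring_1 \<Rightarrow> 'a \<Rightarrow> 'a poly poly \<Rightarrow> 'a" where
  "ev a b f = poly (poly f [:b:]) a"

definition subst :: "'a::comm_ring_1 poly poly \<Rightarrow> 'a poly poly \<Rightarrow> 'a poly poly \<Rightarrow> 'a poly poly" where
  "subst u v f = poly (map_poly (\<lambda>q. poly (map_poly PK q) u) f) v"

lemma PK_simps: "PK 0 = 0" "PK 1 = 1" "PK (a + b) = PK a + PK b" "PK (a * b) = PK a * PK b"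
  "PK (- a) = - PK a" "PK (a - b) = PK a - PK b"
  by (simp_all add: PK_def one_pCons)

lemma PK_of_nat: "PK (of_nat k) = of_nat k"
  by (induction k) (simp_all add: PK_simps)

lemma PK_of_int: "PK (of_int k) = of_int k"
  by (cases k rule: int_cases) (simp_all only: of_int_of_nat_eq of_int_minus PK_of_nat PK_simps)

lemma ev_simps [simp]: "ev a b PX = a" "ev a b PY = b" "ev a b (PK c) = c" "ev a b 0 = 0" "ev a b 1 = 1"
  "ev a b (f + g) = ev a b f + ev a b g" "ev a b (f * g) = ev a b f * ev a b g"
  "ev a b (f - g) = ev a b f - ev a b g" "ev a b (- f) = - ev a b f" "ev a b (f ^ k) = ev a b f ^ k"
  by (simp_all add: ev_def PX_def PY_def PK_def)

lemma inner_pCons: "poly (map_poly PK (pCons c q)) u = PK c + u * poly (map_poly PK q) u"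
  by (cases "c = 0 \<and> q = 0") (auto simp: map_poly_pCons PK_simps)

lemma inner_add: "poly (map_poly PK (p + q)) u = poly (map_poly PK p) u + poly (map_poly PK q) u"
  by (induction p q rule: poly_induct2) (simp_all add: inner_pCons PK_simps algebra_simps)

lemma inner_smult: "poly (map_poly PK (Polynomial.smult c q)) u = PK c * poly (map_poly PK q) u"
  by (induction q) (simp_all add: inner_pCons PK_simps algebra_simps)

lemma inner_mult: "poly (map_poly PK (p * q)) u = poly (map_poly PK p) u * poly (map_poly PK q) u"
  by (induction p) (simp_all add: inner_pCons inner_add inner_smult PK_simps algebra_simps)

lemma subst_pCons: "subst u v (pCons q f) = poly (map_poly PK q) u + v * subst u v f"
  by (cases "q = 0 \<and> f = 0") (auto simp: subst_def map_poly_pCons)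

lemma subst_0 [simp]: "subst u v 0 = 0"
  by (simp add: subst_def)

lemma subst_add [simp]: "subst u v (f + h) = subst u v f + subst u v h"
  by (induction f h rule: poly_induct2) (simp_all add: subst_pCons inner_add algebra_simps)

lemma subst_smult: "subst u v (Polynomial.smult q f) = poly (map_poly PK q) u * subst u v f"
  by (induction f) (simp_all add: subst_pCons inner_mult algebra_simps)

lemma subst_mult [simp]: "subst u v (f * h) = subst u v f * subst u v h"
  by (induction f) (simp_all add: subst_pCons subst_smult algebra_simps)

lemma subst_PK [simp]: "subst u v (PK c) = PK c"
  by (simp add: subst_pCons inner_pCons PK_def)

lemma subst_1 [simp]: "subst u v 1 = 1"
  using subst_PK[of u v 1] by (simp add: PK_simps)

lemma subst_vars [simp]: "subst u v PX = u" "subst u v PY = v"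
  by (simp_all add: PX_def PY_def subst_pCons inner_pCons PK_simps)

lemma subst_minus [simp]: "subst u v (- f) = - subst u v f"
  using subst_add[of u v f "- f"] by (simp add: eq_neg_iff_add_eq_0 add.commute)

lemma subst_diff [simp]: "subst u v (f - h) = subst u v f - subst u v h"
  using subst_add[of u v f "- h"] by simp

lemma subst_power [simp]: "subst u v (f ^ k) = subst u v f ^ k"
  by (induction k) simp_all

text \<open>Identities between composites of substitutions, evaluations and reductions can thus be
  checked on constants and the two variables.\<close>

lemma bipoly_hom_unique:
  fixes \<phi> \<psi> :: "'a::comm_ring_1 poly poly \<Rightarrow> 'b::comm_ring_1"
  assumes add: "\<And>f h. \<phi> (f + h) = \<phi> f + \<phi> h" "\<And>f h. \<psi> (f + h) = \<psi> f + \<psi> h"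
    and mult: "\<And>f h. \<phi> (f * h) = \<phi> f * \<phi> h" "\<And>f h. \<psi> (f * h) = \<psi> f * \<psi> h"
    and const: "\<And>c. \<phi> (PK c) = \<psi> (PK c)"
    and vars: "\<phi> PX = \<psi> PX" "\<phi> PY = \<psi> PY"
  shows "\<phi> f = \<psi> f"
proof -
  have zero: "\<phi> 0 = \<psi> 0" using const[of 0] by (simp add: PK_simps)
  have inner: "\<phi> [:q:] = \<psi> [:q:]" for q
  proof (induction q)
    case (pCons c q)
    have "[:pCons c q:] = PK c + PX * [:q:]"
      by (simp add: PX_def PK_def)
    then show ?case by (simp only: add mult const vars pCons.IH)
  qed (use zero in simp)
  show ?thesis
  proof (induction f)
    case (pCons q f)
    have "pCons q f = [:q:] + PY * f"
      by (simp add: PY_def)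
    then show ?case by (simp only: add mult vars inner pCons.IH)
  qed (rule zero)
qed

lemma subst_subst: "subst u v (subst u' v' f) = subst (subst u v u') (subst u v v') f"
  by (rule bipoly_hom_unique) simp_all

lemma subst_id: "subst PX PY f = f"
  by (rule bipoly_hom_unique) simp_all

lemma ev_subst: "ev a b (subst u v f) = ev (ev a b u) (ev a b v) f"
  by (rule bipoly_hom_unique) simp_all

subsection \<open>Homogeneous polynomials\<close>

text \<open>Degrees are integers, so that dividing by a linear form always lowers the degree by 1.\<close>

definition homog :: "int \<Rightarrow> 'a::comm_ring_1 poly poly \<Rightarrow> bool" where
  "homog d f \<longleftrightarrow> (\<forall>i j. poly.coeff (poly.coeff f j) i \<noteq> 0 \<longrightarrow> int i + int j = d)"

lemma homog_0 [simp]: "homog d 0"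
  by (simp add: homog_def)

lemma homog_add: "homog d f \<Longrightarrow> homog d h \<Longrightarrow> homog d (f + h)"
  unfolding homog_def by (metis add.right_neutral add_0 coeff_add)

lemma homog_minus: "homog d f \<Longrightarrow> homog d (- f)"
  by (simp add: homog_def)

lemma homog_diff: "homog d f \<Longrightarrow> homog d h \<Longrightarrow> homog d (f - h)"
  using homog_add[of d f "- h"] homog_minus[of d h] by simp

lemma homog_sum: "(\<And>i. i \<in> I \<Longrightarrow> homog d (f i)) \<Longrightarrow> homog d (sum f I)"
  by (induction I rule: infinite_finite_induct) (auto intro: homog_add)

lemma homog_neg: "d < 0 \<Longrightarrow> homog d f \<Longrightarrow> f = 0"
  unfolding homog_def by (intro poly_eqI) (metis add_nonneg_nonneg coeff_0 not_less of_nat_0_le_iff)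

lemma monom2_eq: "Polynomial.monom (Polynomial.monom c i) j = PK c * PX ^ i * PY ^ j"
proof -
  have X: "PX ^ i = [:Polynomial.monom 1 i:]"
    by (induction i) (simp_all add: PX_def one_pCons monom_Suc)
  have Y: "PY ^ j = (Polynomial.monom 1 j :: 'a poly poly)"
    by (induction j) (simp_all add: PY_def one_pCons Polynomial.monom_0 monom_Suc smult_monom)
  show ?thesis by (simp add: X Y PK_def smult_monom)
qed

lemma homog_expand:
  assumes "homog d f"
  shows "f = (\<Sum>j\<le>nat d. PK (poly.coeff (poly.coeff f j) (nat d - j)) * PX ^ (nat d - j) * PY ^ j)"
proof (cases "d < 0")
  case True
  then have "f = 0" using assms by (rule homog_neg)
  then show ?thesis by (simp add: PK_simps)
next
  case False
  show ?thesis
  proof (intro poly_eqI)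
    fix j i
    have "poly.coeff (poly.coeff (\<Sum>j\<le>nat d. PK (poly.coeff (poly.coeff f j) (nat d - j)) * PX ^ (nat d - j) * PY ^ j) j) i
      = (if j \<le> nat d \<and> i = nat d - j then poly.coeff (poly.coeff f j) i else 0)"
      by (auto simp: monom2_eq[symmetric] coeff_sum if_distrib[of "\<lambda>p. poly.coeff p _"] coeff_monom sum.delta'
        cong: if_cong)
    also have "\<dots> = poly.coeff (poly.coeff f j) i"
    proof (cases "poly.coeff (poly.coeff f j) i = 0")
      case False
      then have "int i + int j = d" using assms by (simp add: homog_def)
      then show ?thesis by auto
    qed auto
    finally show "poly.coeff (poly.coeff f j) i =
      poly.coeff (poly.coeff (\<Sum>j\<le>nat d. PK (poly.coeff (poly.coeff f j) (nat d - j)) * PX ^ (nat d - j) * PY ^ j) j) i" ..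
  qed
qed

lemma homog_monom: "homog (int i + int j) (PK c * PX ^ i * PY ^ j)"
  by (auto simp: homog_def monom2_eq[symmetric] coeff_monom split: if_splits)

lemma homog_vars: "homog 1 PX" "homog 1 PY" "homog 0 (PK c)" "homog 0 1"
  using homog_monom[of 1 0 1] homog_monom[of 0 1 1] homog_monom[of 0 0 c] homog_monom[of 0 0 1]
  by (simp_all add: PK_simps)

lemma homog_mult:
  assumes "homog d f" "homog e h"
  shows "homog (d + e) (f * h)"
proof (cases "d < 0 \<or> e < 0")
  case True
  then show ?thesis using assms homog_neg by fastforce
next
  case False
  have eq: "f * h = (\<Sum>j\<le>nat d. \<Sum>k\<le>nat e. PK (poly.coeff (poly.coeff f j) (nat d - j) * poly.coeff (poly.coeff h k) (nat e - k))
      * PX ^ (nat d - j + (nat e - k)) * PY ^ (j + k))"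
    by (subst homog_expand[OF assms(1)], subst homog_expand[OF assms(2)])
      (simp only: sum_product PK_simps power_add mult_ac)
  show ?thesis
    unfolding eq
  proof (intro homog_sum)
    fix j k assume jk: "j \<in> {..nat d}" "k \<in> {..nat e}"
    have "int (nat d - j + (nat e - k)) + int (j + k) = d + e"
      using jk False by auto
    then show "homog (d + e) (PK (poly.coeff (poly.coeff f j) (nat d - j) * poly.coeff (poly.coeff h k) (nat e - k))
      * PX ^ (nat d - j + (nat e - k)) * PY ^ (j + k))"
      using homog_monom by metis
  qed
qed

lemma homog_PK_mult: "homog d f \<Longrightarrow> homog d (PK c * f)"
  using homog_mult[OF homog_vars(3)] by fastforce

lemma homog_power: "homog d f \<Longrightarrow> homog (int k * d) (f ^ k)"
  by (induction k) (use homog_mult in \<open>fastforce simp: homog_vars algebra_simps\<close>)+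

lemma homog_subst:
  assumes "homog d f" "homog 1 u" "homog 1 v"
  shows "homog d (subst u v f)"
proof (cases "d < 0")
  case True
  then show ?thesis using assms homog_neg by fastforce
next
  case False
  have "subst u v f = (\<Sum>j\<le>nat d. PK (poly.coeff (poly.coeff f j) (nat d - j)) * u ^ (nat d - j) * v ^ j)"
  proof -
    have sum: "subst u v (sum g I) = (\<Sum>i\<in>I. subst u v (g i))" for g :: "nat \<Rightarrow> 'a poly poly" and I
      by (induction I rule: infinite_finite_induct) simp_all
    show ?thesis
      by (subst homog_expand[OF assms(1)]) (simp add: sum)
  qed
  moreover have "homog d (PK c * u ^ (nat d - j) * v ^ j)" if "j \<le> nat d" for c j
  proof -
    have "homog (0 + int (nat d - j) * 1 + int j * 1) (PK c * u ^ (nat d - j) * v ^ j)"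
      using assms by (intro homog_mult homog_power homog_vars)
    moreover have "0 + int (nat d - j) * 1 + int j * 1 = d" using that False by auto
    ultimately show ?thesis by simp
  qed
  ultimately show ?thesis by (auto intro!: homog_sum)
qed

text \<open>The substitution is the action of -1; its sign separates the even and odd polynomial
  degrees in all that follows.\<close>

lemma subst_neg:
  assumes "homog d f"
  shows "subst (- PX) (- PY) f = (if even d then f else - f)"
proof (cases "d < 0")
  case True
  then show ?thesis using assms homog_neg by fastforce
next
  case False
  have sum: "subst u v (sum g I) = (\<Sum>i\<in>I. subst u v (g i))" for u v :: "'a poly poly" and g :: "nat \<Rightarrow> 'a poly poly" and I
    by (induction I rule: infinite_finite_induct) simp_all
  have "subst (- PX) (- PY) f = (\<Sum>j\<le>nat d. PK (poly.coeff (poly.coeff f j) (nat d - j)) * (- PX) ^ (nat d - j) * (- PY) ^ j)"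
    by (subst homog_expand[OF assms(1)]) (simp add: sum)
  also have "\<dots> = (\<Sum>j\<le>nat d. (- 1) ^ nat d * (PK (poly.coeff (poly.coeff f j) (nat d - j)) * PX ^ (nat d - j) * PY ^ j))"
  proof (intro sum.cong refl)
    fix j assume "j \<in> {..nat d}"
    then have "(- 1) ^ nat d = ((- 1) ^ (nat d - j) * (- 1) ^ j :: 'a poly poly)"
      by (simp flip: power_add)
    moreover have "(- PX) ^ (nat d - j) = (- 1) ^ (nat d - j) * (PX :: 'a poly poly) ^ (nat d - j)"
      "(- PY) ^ j = (- 1) ^ j * (PY :: 'a poly poly) ^ j"
      by (rule power_minus)+
    ultimately show "PK (poly.coeff (poly.coeff f j) (nat d - j)) * (- PX) ^ (nat d - j) * (- PY) ^ j
      = (- 1) ^ nat d * (PK (poly.coeff (poly.coeff f j) (nat d - j)) * PX ^ (nat d - j) * PY ^ j)"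
      by (simp only: mult_ac)
  qed
  also have "\<dots> = (- 1) ^ nat d * f"
    by (simp only: sum_distrib_left[symmetric] homog_expand[OF assms(1), symmetric])
  also have "\<dots> = (if even d then f else - f)"
    using False by (auto simp: even_nat_iff)
  finally show ?thesis .
qed

lemma ev_neg: "homog d f \<Longrightarrow> ev (- a) (- b) f = (if even d then ev a b f else - ev a b f)"
  using ev_subst[of a b "- PX" "- PY" f] subst_neg[of d f] by (auto split: if_splits)

section \<open>The substitutions of order 4 and 3 and division by linear forms\<close>

text \<open>The first is the action of \<open>matS\<close>. The second is that of
  \<open>matT\<close> times -1: it has order 3 in every degree, and differs from the action of
  \<open>matT\<close> by the sign (-1)^d.\<close>

definition actS :: "'a::comm_ring_1 poly poly \<Rightarrow> 'a poly poly" where "actS = subst PY (- PX)"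
definition actR :: "'a::comm_ring_1 poly poly \<Rightarrow> 'a poly poly" where "actR = subst PY (- PX - PY)"

lemma act_simps [simp]:
  "actS 0 = 0" "actS (f + h) = actS f + actS h" "actS (f - h) = actS f - actS h" "actS (- f) = - actS f"
  "actS (f * h) = actS f * actS h" "actS (f ^ k) = actS f ^ k" "actS PX = PY" "actS PY = - PX" "actS (PK c) = PK c" "actS 1 = 1"
  "actR 0 = 0" "actR (f + h) = actR f + actR h" "actR (f - h) = actR f - actR h" "actR (- f) = - actR f"
  "actR (f * h) = actR f * actR h" "actR (f ^ k) = actR f ^ k" "actR PX = PY" "actR PY = - PX - PY" "actR (PK c) = PK c" "actR 1 = 1"
  by (simp_all add: actS_def actR_def)

lemma actS_actS: "homog d f \<Longrightarrow> actS (actS f) = (if even d then f else - f)"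
  by (simp add: actS_def subst_subst subst_neg)

lemma actR_order: "actR (actR (actR f)) = f"
  by (simp add: actR_def subst_subst subst_id)

lemma homog_act: "homog d f \<Longrightarrow> homog d (actS f)" "homog d f \<Longrightarrow> homog d (actR f)"
  unfolding actS_def actR_def by (auto intro!: homog_subst homog_vars homog_minus homog_diff)

lemma ev_actS: "ev a b (actS f) = ev b (- a) f" and ev_actR: "ev a b (actR f) = ev b (- a - b) f"
  by (simp_all add: actS_def actR_def ev_subst)

text \<open>The value at (1, 0) is the coefficient of the pure power of x, the only monomial not
  divisible by y. The other two linear forms are obtained by transport along \<open>actS\<close> and
  \<open>actR\<close>.\<close>

lemma homog_divide_PY:
  assumes f: "homog d f" and 0: "ev 1 0 f = 0"
  shows "\<exists>h. homog (d - 1) h \<and> f = PY * h"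
proof (cases f)
  case (pCons q h)
  have q: "poly.coeff q i = 0" if "int i \<noteq> d" for i
    using f that unfolding homog_def pCons by (metis add.right_neutral coeff_pCons_0 of_nat_0)
  have h: "homog (d - 1) h"
    unfolding homog_def
  proof (intro allI impI)
    fix i j assume "poly.coeff (poly.coeff h j) i \<noteq> 0"
    then have "int i + int (Suc j) = d"
      using f unfolding homog_def pCons by (metis coeff_pCons_Suc)
    then show "int i + int j = d - 1" by simp
  qed
  have "q = Polynomial.monom (poly.coeff q (nat d)) (nat d)"
    using q by (intro poly_eqI) (auto simp: coeff_monom)
  then have "poly q 1 = poly.coeff q (nat d)"
    by (metis mult.right_neutral poly_monom power_one)
  moreover have "poly q 1 = 0"
    using 0 by (simp add: ev_def pCons)
  ultimately have "q = 0"
    using q by (intro poly_eqI) (metis coeff_0 nat_int)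
  then have "f = PY * h" by (simp add: pCons PY_def)
  then show ?thesis using h by blast
qed

lemma homog_divide_PX:
  assumes f: "homog d f" and 0: "ev 0 1 f = 0"
  shows "\<exists>h. homog (d - 1) h \<and> f = PX * h"
proof -
  have "ev 1 0 (actS f) = 0"
    using ev_neg[OF f, of 0 1] 0 by (simp add: ev_actS)
  then obtain h where h: "homog (d - 1) h" "actS f = PY * h"
    using homog_divide_PY[OF homog_act(1)[OF f]] by blast
  then have "actS (actS f) = - PX * actS h" by simp
  then have "f = PX * (if even d then - actS h else actS h)"
    using actS_actS[OF f] by (auto simp: minus_equation_iff[of f] split: if_splits)
  moreover have "homog (d - 1) (if even d then - actS h else actS h)"
    using h by (auto intro: homog_act homog_minus)
  ultimately show ?thesis by blast
qed

lemma homog_divide_PXY: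
  assumes f: "homog d f" and 0: "ev 1 (- 1) f = 0"
  shows "\<exists>h. homog (d - 1) h \<and> f = (PX + PY) * h"
proof -
  have "ev 1 0 (actR (actR f)) = 0"
    using ev_neg[OF f, of 1 "- 1"] 0 by (simp add: ev_actR)
  then obtain h where h: "homog (d - 1) h" "actR (actR f) = PY * h"
    using homog_divide_PY[OF homog_act(2)[OF homog_act(2)[OF f]]] by blast
  then have "f = (- PX - PY) * actR h"
    using actR_order[of f] by simp
  also have "\<dots> = (PX + PY) * (- actR h)" by (simp add: algebra_simps)
  finally have "f = (PX + PY) * (- actR h)" .
  then show ?thesis using h by (metis homog_act(2) homog_minus)
qed

text \<open>The product of the three linear forms that are nonzero modulo 2.\<close>

definition PD :: "'a::comm_ring_1 poly poly" where "PD = PX * PY * (PX + PY)"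

lemma homog_PD: "homog 3 PD"
proof -
  have "homog (1 + 1 + 1) (PX * PY * (PX + PY))"
    by (intro homog_mult homog_add homog_vars)
  then show ?thesis by (simp add: PD_def)
qed

lemma actR_PD [simp]: "actR PD = PD"
  by (simp add: PD_def algebra_simps)

lemma homog_divide_PXPY:
  assumes f: "homog d f" and 0: "ev 1 0 f = 0" "ev 0 1 f = 0"
  shows "\<exists>h. homog (d - 2) h \<and> f = PX * PY * h"
proof -
  obtain g where g: "homog (d - 1) g" "f = PY * g" using homog_divide_PY[OF f 0(1)] by blast
  have "ev 0 1 g = 0" using 0(2) g by simp
  then obtain h where h: "homog (d - 1 - 1) h" "g = PX * h" using homog_divide_PX[OF g(1)] by blast
  then show ?thesis using g by (intro exI[of _ h]) (simp add: mult_ac)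
qed

lemma homog_divide_PD:
  assumes f: "homog d f" and 0: "ev 1 0 f = 0" "ev 0 1 f = 0" "ev 1 (- 1) f = 0"
  shows "\<exists>h. homog (d - 3) h \<and> f = PD * h"
proof -
  obtain g where g: "homog (d - 2) g" "f = PX * PY * g" using homog_divide_PXPY[OF f 0(1,2)] by blast
  have "ev 1 (- 1) g = 0" using 0(3) g by simp
  then obtain h where h: "homog (d - 2 - 1) h" "g = (PX + PY) * h" using homog_divide_PXY[OF g(1)] by blast
  then show ?thesis using g by (intro exI[of _ h]) (simp add: PD_def mult_ac)
qed

lemma PX_nz [simp]: "PX \<noteq> (0 :: 'a::idom poly poly)" and PY_nz [simp]: "PY \<noteq> (0 :: 'a::idom poly poly)"
  by (simp_all add: PX_def PY_def)

lemma PD_nz [simp]: "PD \<noteq> (0 :: 'a::idom poly poly)"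
proof -
  have "(PX + PY :: 'a poly poly) \<noteq> 0" by (simp add: PX_def PY_def)
  then show ?thesis by (simp add: PD_def)
qed

lemma homog_degree_0:
  assumes "homog 0 f"
  shows "f = PK (ev 1 0 f)"
proof -
  have "f = PK (poly.coeff (poly.coeff f 0) 0)" using homog_expand[OF assms] by simp
  then show ?thesis by (metis ev_simps(3))
qed

lemma homog_degree_1:
  assumes "homog 1 f"
  shows "f = PK (ev 1 0 f) * PX + PK (ev 0 1 f) * PY"
proof -
  obtain a b where "f = PK a * PX + PK b * PY"
    using homog_expand[OF assms] by (auto simp: numeral_eq_Suc)
  then show ?thesis by simp
qed

lemma PK_numeral: "PK (numeral k) = numeral k"
  using PK_of_nat[of "numeral k"] by simp

lemma ev_numeral [simp]: "ev a b (numeral k) = numeral k"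
  by (metis PK_numeral ev_simps(3))

text \<open>
  Away from the monomial in the middle, \<open>actS\<close> permutes the monomials of even degree freely up to
  sign.
\<close>

lemma actS_eigenvector:
  fixes a :: "int poly poly"
  assumes "homog d a" "even d" "e = 1 \<or> e = - 1" "actS a = PK e * a"
  shows "\<exists>\<alpha> k. homog d \<alpha> \<and> a = \<alpha> + PK e * actS \<alpha> + PK k * (PX * PY) ^ (nat d div 2) \<and>
    (k = 0 \<or> 0 \<le> d \<and> e = (- 1) ^ (nat d div 2))"
  using assms
proof (induction "nat (d + 2)" arbitrary: d a e rule: less_induct)
  case less
  consider "d < 0" | "d = 0" | "0 < d" by linarith
  then show ?case
  proof cases
    case 1
    then have "a = 0" using less.prems(1) by (rule homog_neg)
    then show ?thesis by (intro exI[of _ 0]) (simp add: PK_simps)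
  next
    case 2
    then have a: "a = PK (ev 1 0 a)" using less.prems(1) homog_degree_0 by blast
    from less.prems(4) have "ev 1 0 a = e * ev 1 0 a"
      by (subst (asm) (1 2) a) (metis act_simps(9) ev_simps(3,7))
    then have "ev 1 0 a = 0 \<or> e = 1" by simp
    then show ?thesis using a 2 by (intro exI[of _ 0] exI[of _ "ev 1 0 a"]) auto
  next
    case 3
    let ?c = "ev 1 0 a"
    \<comment> \<open>This summand corrects the value at (1, 0), and by symmetry the one at (0, 1),
      so the difference is divisible by xy. As xy changes sign under \<open>actS\<close>, the
      quotient has eigenvalue \<open>- e\<close> in degree \<open>d - 2\<close>.\<close>
    let ?\<alpha> = "PK ?c * PX ^ nat d"
    have hX: "homog d (PX ^ nat d :: int poly poly)"
      using homog_power[OF homog_vars(1), of "nat d"] 3 by simp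
    then have h\<alpha>: "homog d ?\<alpha>" by (rule homog_PK_mult)
    define b where "b = a - (?\<alpha> + PK e * actS ?\<alpha>)"
    have hb: "homog d b"
      unfolding b_def by (intro homog_diff[OF less.prems(1) homog_add[OF h\<alpha> homog_PK_mult[OF homog_act(1)[OF h\<alpha>]]]])
    have ee: "PK e * PK e = 1" using less.prems(3) by (auto simp: PK_simps)
    have Sb: "actS b = PK e * b"
    proof -
      have "actS (PK e * actS ?\<alpha>) = PK e * ?\<alpha>"
        using actS_actS[OF h\<alpha>] less.prems(2) by (simp del: act_simps(6,7))
      then have "actS b = PK e * a - (actS ?\<alpha> + PK e * ?\<alpha>)"
        unfolding b_def using less.prems(4) by (simp only: act_simps(2,3))
      also have "\<dots> = PK e * a - (PK e * (PK e * actS ?\<alpha>) + PK e * ?\<alpha>)"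
        by (simp add: ee mult.assoc[symmetric])
      finally show ?thesis by (simp add: b_def algebra_simps)
    qed
    have 10: "ev 1 0 b = 0" using 3 by (simp add: b_def)
    have "ev 1 0 (actS b) = ev 0 1 b"
      using ev_neg[OF hb, of 0 1] less.prems(2) by (simp add: ev_actS)
    then have 01: "ev 0 1 b = 0" using 10 by (simp add: Sb)
    obtain h where h: "homog (d - 2) h" "b = PX * PY * h" using homog_divide_PXPY[OF hb 10 01] by blast
    have "PX * PY * actS h = PX * PY * (PK (- e) * h)"
      using Sb by (simp add: h(2) PK_simps algebra_simps minus_equation_iff)
    then have Sh: "actS h = PK (- e) * h" by simp
    have "\<exists>\<beta> k. homog (d - 2) \<beta> \<and> h = \<beta> + PK (- e) * actS \<beta> + PK k * (PX * PY) ^ (nat (d - 2) div 2) \<and>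
      (k = 0 \<or> 0 \<le> d - 2 \<and> - e = (- 1) ^ (nat (d - 2) div 2))"
      using 3 h(1) Sh less.prems(2,3) by (intro less.hyps) auto
    then obtain \<beta> k where \<beta>: "homog (d - 2) \<beta>" "h = \<beta> + PK (- e) * actS \<beta> + PK k * (PX * PY) ^ (nat (d - 2) div 2)"
      "k = 0 \<or> 0 \<le> d - 2 \<and> - e = (- 1) ^ (nat (d - 2) div 2)" by blast
    have d: "nat d div 2 = Suc (nat (d - 2) div 2)" 
    proof -
      have "2 \<le> d" using 3 less.prems(2) by presburger
      then have "nat d = Suc (Suc (nat (d - 2)))" by simp
      then show ?thesis by simp
    qed
    have h\<beta>: "homog d (PX * PY * \<beta>)"
      using homog_mult[OF homog_mult[OF homog_vars(1,2)] \<beta>(1)] by simp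
    have "a = b + (?\<alpha> + PK e * actS ?\<alpha>)" by (simp add: b_def)
    also have "b = PX * PY * \<beta> + PK e * actS (PX * PY * \<beta>) + PK k * (PX * PY) ^ (nat d div 2)"
      by (simp add: h(2) \<beta>(2) d PK_simps algebra_simps)
    finally have "a = (PX * PY * \<beta> + ?\<alpha>) + PK e * actS (PX * PY * \<beta> + ?\<alpha>) + PK k * (PX * PY) ^ (nat d div 2)"
      by (simp only: act_simps(2) distrib_left add_ac)
    moreover have "k = 0 \<or> 0 \<le> d \<and> e = (- 1) ^ (nat d div 2)"
      using \<beta>(3) 3 by (auto simp: d)
    ultimately show ?thesis using homog_add[OF h\<beta> h\<alpha>] by blast
  qed
qed

lemma ev_cong_dvd:
  fixes f :: "int poly poly"
  assumes "m dvd a - a'" "m dvd b - b'"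
  shows "m dvd ev a b f - ev a' b' f"
proof -
  have inner: "m dvd poly q a - poly q a'" for q
  proof (induction q)
    case (pCons c q)
    have "poly (pCons c q) a - poly (pCons c q) a' = a * (poly q a - poly q a') + (a - a') * poly q a'"
      by (simp add: algebra_simps)
    then show ?case using pCons assms(1) by (metis dvd_add dvd_mult dvd_mult2)
  qed simp
  show ?thesis
  proof (induction f)
    case (pCons q f)
    have "ev a b (pCons q f) - ev a' b' (pCons q f)
        = (poly q a - poly q a') + (b * (ev a b f - ev a' b' f) + (b - b') * ev a' b' f)"
      by (simp add: ev_def algebra_simps)
    then show ?case using pCons assms(2) inner by (metis dvd_add dvd_mult dvd_mult2)
  qed simp
qed

text \<open>The substitution moves the point (1, 1) to (1, -2), which is the same point modulo
  3.\<close>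

lemma ev_actR_mod_3: "(3::int) dvd ev 1 1 (actR f) - ev 1 1 f"
  unfolding ev_actR by (rule ev_cong_dvd) simp_all

section \<open>Tate cohomology of the group of order 3 with coefficients in forms\<close>

definition normR :: "'a::comm_ring_1 poly poly \<Rightarrow> 'a poly poly" where
  "normR f = f + actR f + actR (actR f)"

lemma normR_simps [simp]: "normR 0 = 0" "normR (f + h) = normR f + normR h" "normR (f - h) = normR f - normR h"
  "normR (- f) = - normR f" "actR (normR f) = normR f" "normR (PD * f) = PD * normR f" "normR (PK c * f) = PK c * normR f"
  "normR (actR f) = normR f"
  by (simp_all add: normR_def actR_order algebra_simps)

lemma homog_normR: "homog d f \<Longrightarrow> homog d (normR f)"
  unfolding normR_def by (intro homog_add homog_act)

lemma ev_normR_mod_3: "(3::int) dvd ev 1 1 (normR f)"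
proof -
  have "ev 1 1 (normR f) = 3 * ev 1 1 f + 2 * (ev 1 1 (actR f) - ev 1 1 f)
      + (ev 1 1 (actR (actR f)) - ev 1 1 (actR f))"
    by (simp add: normR_def)
  then show ?thesis using ev_actR_mod_3[of f] ev_actR_mod_3[of "actR f"]
    by (metis dvd_add dvd_mult dvd_triv_left)
qed

lemma normR_invariant: "actR f = f \<Longrightarrow> normR f = PK 3 * f"
  by (simp add: normR_def PK_numeral algebra_simps)

text \<open>Takes the value 1 at one of the three zeros of \<open>PD\<close> and vanishes at the other two.\<close>

lemma delta_form:
  assumes "2 \<le> d"
  obtains \<delta> :: "'a::comm_ring_1 poly poly" where "homog d \<delta>" "ev 0 1 \<delta> = 1" "ev 1 (- 1) \<delta> = 0" "ev (- 1) 0 \<delta> = 0"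
proof
  let ?\<delta> = "(PX + PY) * PY ^ nat (d - 1) :: 'a poly poly"
  have "homog (1 + int (nat (d - 1)) * 1) ?\<delta>"
    by (intro homog_mult homog_add homog_power homog_vars)
  then show "homog d ?\<delta>" using assms by simp
  show "ev 0 1 ?\<delta> = 1" "ev 1 (- 1) ?\<delta> = 0" "ev (- 1) 0 ?\<delta> = 0" using assms by (simp_all add: power_0_left)
qed

lemma homog_divide_PD':
  assumes f: "homog d f" and 0: "ev 0 1 f = 0" "ev 1 (- 1) f = 0" "ev (- 1) 0 f = 0"
  shows "\<exists>h. homog (d - 3) h \<and> f = PD * h"
  using homog_divide_PD[OF f] ev_neg[OF f, of 1 0] 0 by (auto split: if_splits)

lemma ev_PD: "ev 1 1 PD = 2"
  by (simp add: PD_def)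

text \<open>\<open>actR\<close> permutes the three zeros of \<open>PD\<close> cyclically, so
  subtracting the norm of a form supported at one of them makes an invariant form vanish at all
  three. The rest is \<open>PD\<close> times an invariant form of degree d - 3. As \<open>PD\<close>
  takes the value 2 at (1, 1), a unit modulo 3, the condition is inherited by the quotient.\<close>

lemma actR_invariant_norm:
  fixes b :: "int poly poly"
  assumes "homog d b" "actR b = b" "3 dvd ev 1 1 b \<or> \<not> 3 dvd d"
  shows "\<exists>\<beta>. homog d \<beta> \<and> b = normR \<beta>"
  using assms
proof (induction "nat (d + 3)" arbitrary: d b rule: less_induct)
  case less
  consider "d < 0" | "d = 0" | "d = 1" | "2 \<le> d" by linarith
  then show ?case
  proof cases
    case 1
    then have "b = 0" using less.prems(1) by (rule homog_neg)
    then show ?thesis by (intro exI[of _ 0]) simp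
  next
    case 2
    then have b: "b = PK (ev 1 0 b)" using less.prems(1) homog_degree_0 by blast
    then have "ev 1 1 b = ev 1 0 b" by (metis ev_simps(3))
    then obtain c where "ev 1 0 b = 3 * c" using less.prems(3) 2 by (auto elim: dvdE)
    then have "b = normR (PK c)" using b by (simp add: normR_def PK_simps(3)[symmetric])
    then show ?thesis using 2 homog_vars(3) by blast
  next
    case 3
    then have b: "b = PK (ev 1 0 b) * PX + PK (ev 0 1 b) * PY" using less.prems(1) homog_degree_1 by blast
    have "ev 1 0 (actR b) = - ev 0 1 b" "ev 0 1 (actR b) = ev 1 0 b - ev 0 1 b"
      by (subst b; simp)+
    then have "ev 1 0 b = 0" "ev 0 1 b = 0" using less.prems(2) by auto
    then have "b = 0" using b by (simp add: PK_simps)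
    then show ?thesis by (intro exI[of _ 0]) simp
  next
    case 4
    obtain \<delta> :: "int poly poly" where \<delta>: "homog d \<delta>" "ev 0 1 \<delta> = 1" "ev 1 (- 1) \<delta> = 0" "ev (- 1) 0 \<delta> = 0"
      using delta_form[OF 4] by blast
    \<comment> \<open>The norm of \<gamma> takes the common value of \<open>b\<close> at each of the
      three points.\<close>
    define \<gamma> where "\<gamma> = PK (ev 0 1 b) * \<delta>"
    define b' where "b' = b - normR \<gamma>"
    have h\<gamma>: "homog d \<gamma>" unfolding \<gamma>_def using \<delta>(1) by (rule homog_PK_mult)
    have hb': "homog d b'" unfolding b'_def using less.prems(1) h\<gamma> by (intro homog_diff homog_normR)
    have Rb': "actR b' = b'" by (simp add: b'_def less.prems(2))
    have v: "ev 0 1 b' = 0"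
      by (simp add: b'_def normR_def \<gamma>_def ev_actR \<delta>)
    have "ev 0 1 (actR b') = ev 1 (- 1) b'" "ev 0 1 (actR (actR b')) = ev (- 1) 0 b'"
      by (simp_all add: ev_actR)
    then obtain h where h: "homog (d - 3) h" "b' = PD * h"
      using homog_divide_PD'[OF hb' v] v Rb' by auto
    have Rh: "actR h = h" using Rb' by (simp add: h(2))
    have "3 dvd ev 1 1 h \<or> \<not> 3 dvd d - 3"
    proof (cases "3 dvd d")
      case True
      then have "3 dvd ev 1 1 b" using less.prems(3) by blast
      then have "3 dvd ev 1 1 b'" using ev_normR_mod_3[of \<gamma>] by (simp add: b'_def)
      then have "3 dvd 2 * ev 1 1 h" by (simp add: h(2) ev_PD)
      then show ?thesis by presburger
    next
      case False
      then show ?thesis by presburger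
    qed
    then obtain \<beta> where "homog (d - 3) \<beta>" "h = normR \<beta>"
      using less.hyps[of "d - 3" h] 4 h(1) Rh by auto
    moreover then have "homog d (PD * \<beta>)" using homog_mult[OF homog_PD] by fastforce
    ultimately have "b = normR (PD * \<beta> + \<gamma>)" "homog d (PD * \<beta> + \<gamma>)"
      using h(2) h\<gamma> by (auto simp: b'_def algebra_simps intro: homog_add)
    then show ?thesis by blast
  qed
qed

text \<open>The same induction with \<beta> mapped to \<open>actR \<beta> - \<beta>\<close> in place
  of the norm. Degrees congruent to 1 modulo 3 end at linear forms, where the value at (1, 1) modulo
  3 is the one obstruction.\<close>

lemma normR_kernel:
  fixes b :: "int poly poly"
  assumes "homog d b" "normR b = 0" "3 dvd ev 1 1 b \<or> d mod 3 \<noteq> 1"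
  shows "\<exists>\<beta>. homog d \<beta> \<and> b = actR \<beta> - \<beta>"
  using assms
proof (induction "nat (d + 3)" arbitrary: d b rule: less_induct)
  case less
  consider "d < 0" | "d = 0" | "d = 1" | "2 \<le> d" by linarith
  then show ?case
  proof cases
    case 1
    then have "b = 0" using less.prems(1) by (rule homog_neg)
    then show ?thesis by (intro exI[of _ 0]) simp
  next
    case 2
    then have b: "b = PK (ev 1 0 b)" using less.prems(1) homog_degree_0 by blast
    have "ev 1 0 (normR b) = 3 * ev 1 0 b" by (subst b) (simp add: normR_def)
    then have "b = 0" using less.prems(2) b by (simp add: PK_simps)
    then show ?thesis by (intro exI[of _ 0]) simp
  next
    case 3
    then have b: "b = PK (ev 1 0 b) * PX + PK (ev 0 1 b) * PY" using less.prems(1) homog_degree_1 by blast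
    have "ev 1 1 b = ev 1 0 b + ev 0 1 b" by (subst b) simp
    then obtain e where e: "ev 1 0 b + ev 0 1 b = 3 * e" using less.prems(3) 3 by (auto elim: dvdE)
    \<comment> \<open>The linear system for the coefficients of \<beta> has determinant 3; it is
      solvable because the coefficients of \<open>b\<close> add up to \<open>3 * e\<close>.\<close>
    let ?\<beta> = "PK (e - ev 1 0 b) * PX + PK (- e) * PY"
    have "actR ?\<beta> - ?\<beta> = PK (ev 1 0 b) * PX + PK (3 * e - ev 1 0 b) * PY"
    proof -
      have "3 * e = e + e + e" by simp
      then show ?thesis by (simp only: act_simps PK_simps) (simp add: algebra_simps)
    qed
    also have "\<dots> = b" using b e by (metis add_diff_cancel_left')
    finally have "b = actR ?\<beta> - ?\<beta>" by simp
    moreover have "homog d ?\<beta>" using 3 by (auto intro!: homog_add homog_PK_mult homog_vars)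
    ultimately show ?thesis by blast
  next
    case 4
    obtain \<delta> :: "int poly poly" where \<delta>: "homog d \<delta>" "ev 0 1 \<delta> = 1" "ev 1 (- 1) \<delta> = 0" "ev (- 1) 0 \<delta> = 0"
      using delta_form[OF 4] by blast
    \<comment> \<open>Along the cycle of points, \<gamma> has the partial sums of the values of
      \<open>b\<close> as values, so that \<open>actR \<gamma> - \<gamma>\<close> matches
      \<open>b\<close> at all three; the last match holds because the values of \<open>b\<close> sum
      to zero.\<close>
    define \<gamma> where "\<gamma> = PK (ev 0 1 b) * actR (actR \<delta>) + PK (ev 0 1 b + ev 1 (- 1) b) * actR \<delta>"
    define b' where "b' = b - (actR \<gamma> - \<gamma>)"
    have h\<gamma>: "homog d \<gamma>" unfolding \<gamma>_def using \<delta>(1) by (intro homog_add homog_PK_mult homog_act)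
    have hb': "homog d b'" unfolding b'_def using less.prems(1) h\<gamma> by (intro homog_diff homog_act)
    have Nb': "normR b' = 0" by (simp add: b'_def less.prems(2))
    have "ev 0 1 (normR b) = ev 0 1 b + ev 1 (- 1) b + ev (- 1) 0 b"
      by (simp add: normR_def ev_actR)
    then have sum: "ev (- 1) 0 b = - ev 0 1 b - ev 1 (- 1) b" using less.prems(2) by simp
    obtain h where h: "homog (d - 3) h" "b' = PD * h"
      using homog_divide_PD'[OF hb'] by (auto simp: b'_def \<gamma>_def ev_actR \<delta> sum)
    have Nh: "normR h = 0" using Nb' by (simp add: h(2))
    have "3 dvd ev 1 1 h \<or> (d - 3) mod 3 \<noteq> 1"
    proof (cases "d mod 3 = 1")
      case True
      then have "3 dvd ev 1 1 b" using less.prems(3) by blast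
      then have "3 dvd ev 1 1 b'" using ev_actR_mod_3[of \<gamma>] by (simp add: b'_def)
      then have "3 dvd 2 * ev 1 1 h" by (simp add: h(2) ev_PD)
      then show ?thesis by presburger
    next
      case False
      then show ?thesis by presburger
    qed
    then obtain \<beta> where \<beta>: "homog (d - 3) \<beta>" "h = actR \<beta> - \<beta>"
      using less.hyps[of "d - 3" h] 4 h(1) Nh by auto
    have "homog d (PD * \<beta>)" using homog_mult[OF homog_PD \<beta>(1)] by simp
    then have "homog d (PD * \<beta> + \<gamma>)" using h\<gamma> by (rule homog_add)
    moreover have "b = actR (PD * \<beta> + \<gamma>) - (PD * \<beta> + \<gamma>)"
      using h(2) \<beta>(2) by (simp add: b'_def algebra_simps)
    ultimately show ?thesis by blast
  qed
qed

subsection \<open>Counting\<close>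

lemma card_additive:
  fixes \<phi> :: "'a::ab_group_add \<Rightarrow> 'b::ab_group_add"
  assumes A: "add_subgroup A" and add: "\<And>a b. a \<in> A \<Longrightarrow> b \<in> A \<Longrightarrow> \<phi> (a + b) = \<phi> a + \<phi> b"
    and fin: "finite (\<phi> ` A)" "finite {a \<in> A. \<phi> a = 0}"
  shows "finite A" "card A = card (\<phi> ` A) * card {a \<in> A. \<phi> a = 0}"
proof -
  note A_closed = add_subgroupD[OF A]
  have fiber: "{b \<in> A. \<phi> b = \<phi> a} = (+) a ` {a \<in> A. \<phi> a = 0}" if a: "a \<in> A" for a
  proof (intro equalityI subsetI)
    fix b assume b: "b \<in> {b \<in> A. \<phi> b = \<phi> a}"
    have "\<phi> b = \<phi> a + \<phi> (b - a)"
      using add[OF a A_closed(2)[of b a]] a b by simp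
    then have "b - a \<in> {a \<in> A. \<phi> a = 0}" using a b A_closed(2) by simp
    moreover have "b = a + (b - a)" by simp
    ultimately show "b \<in> (+) a ` {a \<in> A. \<phi> a = 0}" by blast
  qed (use a add A_closed(4) in auto)
  have A_eq: "A = (\<Union>y\<in>\<phi> ` A. {b \<in> A. \<phi> b = y})" by auto
  have "finite (\<Union>y\<in>\<phi> ` A. {b \<in> A. \<phi> b = y})"
  proof (rule finite_UN_I[OF fin(1)])
    fix y assume "y \<in> \<phi> ` A"
    then obtain a where "a \<in> A" "y = \<phi> a" by blast
    then show "finite {b \<in> A. \<phi> b = y}" using fin(2) by (simp add: fiber)
  qed
  then show finA: "finite A" using A_eq by simp
  have "card A = (\<Sum>y\<in>\<phi> ` A. card {b \<in> A. \<phi> b = y})"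
    using sum.image_gen[OF finA, of "\<lambda>_. 1::nat" \<phi>] by simp
  also have "\<dots> = (\<Sum>y\<in>\<phi> ` A. card {a \<in> A. \<phi> a = 0})"
  proof (intro sum.cong refl)
    fix y assume "y \<in> \<phi> ` A"
    then obtain a where "a \<in> A" "y = \<phi> a" by blast
    then show "card {b \<in> A. \<phi> b = y} = card {a \<in> A. \<phi> a = 0}"
      by (simp add: fiber card_image)
  qed
  finally show "card A = card (\<phi> ` A) * card {a \<in> A. \<phi> a = 0}" by simp
qed

lemma card_sum_Int:
  fixes P Q :: "'a::ab_group_add set"
  assumes P: "add_subgroup P" "finite P" and Q: "add_subgroup Q" "finite Q"
  shows "card P * card Q = card ((\<lambda>(p, q). p + q) ` (P \<times> Q)) * card (P \<inter> Q)"
proof -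
  let ?\<phi> = "\<lambda>(p, q). p + q :: 'a"
  have "add_subgroup (P \<times> Q)"
    using add_subgroupD[OF P(1)] add_subgroupD[OF Q(1)] by (auto simp: add_subgroup_def zero_prod_def)
  then have "card (P \<times> Q) = card (?\<phi> ` (P \<times> Q)) * card {a \<in> P \<times> Q. ?\<phi> a = 0}"
    using P(2) Q(2) by (intro card_additive(2)) auto
  also have "{a \<in> P \<times> Q. ?\<phi> a = 0} = (\<lambda>p. (p, - p)) ` (P \<inter> Q)"
  proof (intro equalityI subsetI)
    fix a assume "a \<in> {a \<in> P \<times> Q. ?\<phi> a = 0}"
    then obtain p q where pq: "a = (p, q)" "p \<in> P" "q \<in> Q" "p + q = 0" by auto
    then have "q = - p" by (simp add: add_eq_0_iff)
    moreover then have "p \<in> Q" using add_subgroupD(3)[OF Q(1) pq(3)] by simp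
    ultimately show "a \<in> (\<lambda>p. (p, - p)) ` (P \<inter> Q)" using pq by blast
  next
    fix a assume "a \<in> (\<lambda>p. (p, - p)) ` (P \<inter> Q)"
    then show "a \<in> {a \<in> P \<times> Q. ?\<phi> a = 0}" using add_subgroupD(3)[OF Q(1)] by auto
  qed
  also have "card \<dots> = card (P \<inter> Q)"
    by (rule card_image) (auto simp: inj_on_def)
  finally show ?thesis by (simp add: card_cartesian_product)
qed

subsection \<open>Polynomials modulo 2\<close>

type_synonym bpoly = "bit poly poly"

lemma bpoly_double [simp]: "(f :: bpoly) + f = 0"
proof -
  have "f + f = PK (1 + 1) * f" by (simp only: PK_simps distrib_right mult_1_left)
  then show ?thesis by (simp add: PK_simps)
qed

lemma bpoly_uminus [simp]: "- (f :: bpoly) = f"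
  using bpoly_double[of f] by (simp only: neg_eq_iff_add_eq_0)

lemma bpoly_diff [simp]: "(f :: bpoly) - g = f + g"
  using bpoly_uminus[of g] by (simp only: diff_conv_add_uminus)

lemma bit_add_self: "(b :: bit) + b = 0"
  by (cases b) simp_all

lemma bit_uminus: "- (b :: bit) = b"
  by (cases b) simp_all

lemma bit_cases01: "(b :: bit) = 0 \<or> b = 1"
  by (cases b) auto

lemma homog_subgroup: "add_subgroup {f. homog d f}"
  by (simp add: add_subgroup_def homog_diff)

definition forms :: "int \<Rightarrow> bpoly set" where "forms d = {f. homog d f}"
definition formsS :: "int \<Rightarrow> bpoly set" where "formsS d = {f \<in> forms d. actS f = f}"
definition formsR :: "int \<Rightarrow> bpoly set" where "formsR d = {f \<in> forms d. actR f = f}"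
text \<open>Modulo 2 the two substitutions generate GL_2(F_2), so these are the forms invariant
  under that whole group.\<close>

definition formsI :: "int \<Rightarrow> bpoly set" where "formsI d = formsS d \<inter> formsR d"

lemma forms_subgroups:
  "add_subgroup (forms d)" "add_subgroup (formsS d)" "add_subgroup (formsR d)" "add_subgroup (formsI d)"
  unfolding forms_def formsS_def formsR_def formsI_def
  by (auto simp: add_subgroup_def homog_add)

lemma forms_neg: "d < 0 \<Longrightarrow> forms d = {0}"
  using homog_neg by (auto simp: forms_def)

lemma formsSRI_neg: "d < 0 \<Longrightarrow> formsS d = {0}" "d < 0 \<Longrightarrow> formsR d = {0}" "d < 0 \<Longrightarrow> formsI d = {0}"
  by (auto simp: formsS_def formsR_def formsI_def forms_neg)

text \<open>One step of each dimension count: \<phi> is evaluation at a rational point, and the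
  forms vanishing there are the multiples of a fixed form \<open>p\<close>, with cofactors in a
  lower degree.\<close>

lemma card_functional:
  fixes \<phi> :: "bpoly \<Rightarrow> bit"
  assumes A: "add_subgroup A" and add: "\<And>a b. \<phi> (a + b) = \<phi> a + \<phi> b"
    and ker: "{a \<in> A. \<phi> a = 0} = (*) p ` B" and p: "p \<noteq> 0" and B: "finite B"
  shows "finite A" "card A = (if \<exists>a\<in>A. \<phi> a = 1 then 2 else 1) * card B"
proof -
  have fin: "finite (\<phi> ` A)" "finite {a \<in> A. \<phi> a = 0}"
    using B unfolding ker by (auto intro: finite_subset[of _ "{0, 1}"] bit_cases01)
  note card = card_additive[OF A add fin]
  show "finite A" by (rule card(1))
  have "\<phi> 0 = 0" using add[of 0 0] by simp
  then have 0: "0 \<in> \<phi> ` A" using add_subgroupD(1)[OF A] by (metis imageI)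
  have "card (\<phi> ` A) = (if \<exists>a\<in>A. \<phi> a = 1 then 2 else 1)"
  proof (cases "\<exists>a\<in>A. \<phi> a = 1")
    case True
    then have "\<phi> ` A = {0, 1}" using 0 bit_cases01 by force
    then show ?thesis using True by simp
  next
    case False
    then have "\<phi> ` A = {0}" using 0 bit_cases01 by force
    then show ?thesis using False by simp
  qed
  moreover have "card ((*) p ` B) = card B" using p by (intro card_image) (auto simp: inj_on_def)
  ultimately show "card A = (if \<exists>a\<in>A. \<phi> a = 1 then 2 else 1) * card B"
    using card(2) ker by simp
qed

lemma homog_power_PX: "homog (int n) (PX ^ n)" and homog_power_PY: "homog (int n) (PY ^ n)"
  using homog_power[OF homog_vars(1), of n] homog_power[OF homog_vars(2), of n] by simp_all

lemma card_forms: "finite (forms (int n)) \<and> card (forms (int n)) = 2 ^ (n + 1)"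
proof (induction n)
  case 0
  have ker: "{f \<in> forms (int 0). ev 1 0 f = 0} = (*) PY ` {0}"
    using homog_divide_PY[of 0] homog_neg[of "-1"] by (fastforce simp: forms_def)
  have "\<exists>f\<in>forms (int 0). ev 1 0 f = 1" by (intro bexI[of _ 1]) (simp_all add: forms_def homog_vars)
  then show ?case using card_functional[OF forms_subgroups(1) ev_simps(6) ker] by simp
next
  case (Suc n)
  have ker: "{f \<in> forms (int (Suc n)). ev 1 0 f = 0} = (*) PY ` forms (int n)"
  proof (intro equalityI subsetI)
    fix f assume "f \<in> {f \<in> forms (int (Suc n)). ev 1 0 f = 0}"
    then show "f \<in> (*) PY ` forms (int n)"
      using homog_divide_PY[of "int (Suc n)" f] by (auto simp: forms_def)
  next
    fix f assume "f \<in> (*) PY ` forms (int n)"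
    then show "f \<in> {f \<in> forms (int (Suc n)). ev 1 0 f = 0}"
      using homog_mult[OF homog_vars(2), of "int n"] by (auto simp: forms_def)
  qed
  have "\<exists>f\<in>forms (int (Suc n)). ev 1 0 f = 1"
    using homog_power_PX by (intro bexI[of _ "PX ^ Suc n"]) (simp_all only: forms_def mem_Collect_eq ev_simps power_one)
  then show ?case using card_functional[OF forms_subgroups(1) ev_simps(6) ker] Suc by simp
qed

lemma kernel_formsS:
  "{f \<in> formsS d. ev 1 0 f = 0} = (*) (PX * PY) ` formsS (d - 2)"
proof (intro equalityI subsetI)
  fix f assume f: "f \<in> {f \<in> formsS d. ev 1 0 f = 0}"
  then have f': "homog d f" "actS f = f" "ev 1 0 f = 0" by (auto simp: formsS_def forms_def)
  have "ev 0 1 (actS f) = ev 1 0 f" by (simp add: ev_actS)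
  then obtain h where h: "homog (d - 2) h" "f = PX * PY * h"
    using homog_divide_PXPY[OF f'(1)] f' by auto
  have "PX * PY * actS h = PX * PY * h" using f'(2) by (simp add: h(2) mult_ac)
  then have "actS h = h" by simp
  then show "f \<in> (*) (PX * PY) ` formsS (d - 2)" using h by (auto simp: formsS_def forms_def)
next
  fix f assume "f \<in> (*) (PX * PY) ` formsS (d - 2)"
  then show "f \<in> {f \<in> formsS d. ev 1 0 f = 0}"
    using homog_mult[OF homog_mult[OF homog_vars(1,2)], of "d - 2"]
    by (auto simp: formsS_def forms_def mult_ac)
qed

text \<open>\<open>actR\<close> permutes the three points of the projective line over F_2, so an
  invariant form that vanishes at one of them vanishes at all and is divisible by \<open>PD\<close>,
  which is invariant itself.\<close>

lemma kernel_formsR: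
  "{f \<in> formsR d. ev 1 0 f = 0} = (*) PD ` formsR (d - 3)"
  "{f \<in> formsI d. ev 1 0 f = 0} = (*) PD ` formsI (d - 3)"
proof -
  have div: "\<exists>h\<in>forms (d - 3). f = PD * h" if "homog d f" "actR f = f" "ev 1 0 f = 0" for f :: bpoly
  proof -
    have "ev 1 0 (actR f) = ev 0 (- 1) f" "ev 0 1 (actR f) = ev 1 (- 1) f" by (simp_all add: ev_actR)
    then have "ev 0 1 f = 0" "ev 1 (- 1) f = 0" using that by (simp_all add: bit_uminus)
    then show ?thesis using homog_divide_PD[OF that(1,3)] by (auto simp: forms_def)
  qed
  have R: "actR h = h \<longleftrightarrow> actR (PD * h) = PD * h" and S: "actS h = h \<longleftrightarrow> actS (PD * h) = PD * h" for h :: bpoly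
  proof -
    show "actR h = h \<longleftrightarrow> actR (PD * h) = PD * h" by simp
    have "actS PD = (PD :: bpoly)" by (simp add: PD_def algebra_simps)
    then show "actS h = h \<longleftrightarrow> actS (PD * h) = PD * h" by simp
  qed
  have ev: "ev 1 0 (PD * h) = 0" for h :: bpoly by (simp add: PD_def)
  have hom: "homog d (PD * h)" if "homog (d - 3) h" for h :: bpoly
    using homog_mult[OF homog_PD that] by simp
  show "{f \<in> formsR d. ev 1 0 f = 0} = (*) PD ` formsR (d - 3)"
  proof (intro equalityI subsetI)
    fix f assume "f \<in> {f \<in> formsR d. ev 1 0 f = 0}"
    then have f: "homog d f" "actR f = f" "ev 1 0 f = 0" by (auto simp: formsR_def forms_def)
    then obtain h where "h \<in> forms (d - 3)" "f = PD * h" using div by blast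
    then show "f \<in> (*) PD ` formsR (d - 3)" using R f(2) by (auto simp: formsR_def)
  next
    fix f assume "f \<in> (*) PD ` formsR (d - 3)"
    then show "f \<in> {f \<in> formsR d. ev 1 0 f = 0}" using R ev hom by (auto simp: formsR_def forms_def)
  qed
  show "{f \<in> formsI d. ev 1 0 f = 0} = (*) PD ` formsI (d - 3)"
  proof (intro equalityI subsetI)
    fix f assume "f \<in> {f \<in> formsI d. ev 1 0 f = 0}"
    then have f: "homog d f" "actR f = f" "actS f = f" "ev 1 0 f = 0" by (auto simp: formsI_def formsS_def formsR_def forms_def)
    then obtain h where "h \<in> forms (d - 3)" "f = PD * h" using div by blast
    then show "f \<in> (*) PD ` formsI (d - 3)" using R S f(2,3) by (auto simp: formsI_def formsS_def formsR_def)
  next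
    fix f assume "f \<in> (*) PD ` formsI (d - 3)"
    then obtain h where h: "homog (d - 3) h" "actR h = h" "actS h = h" "f = PD * h"
      by (auto simp: formsI_def formsS_def formsR_def forms_def)
    have "actR f = f" "actS f = f" unfolding h(4) using R[of h] S[of h] h(2,3) by blast+
    moreover have "homog d f" "ev 1 0 f = 0" unfolding h(4) using hom[OF h(1)] ev by blast+
    ultimately show "f \<in> {f \<in> formsI d. ev 1 0 f = 0}"
      by (simp add: formsI_def formsS_def formsR_def forms_def)
  qed
qed

lemma card_formsS: "finite (formsS (int n)) \<and> card (formsS (int n)) = 2 ^ (n div 2 + 1)"
proof (induction n rule: less_induct)
  case (less n)
  define f where "f = (if n = 0 then 1 else PX ^ n + PY ^ n :: bpoly)"
  have "homog (int n) (PX ^ n + PY ^ n :: bpoly)"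
    by (intro homog_add homog_power_PX homog_power_PY)
  then have "f \<in> formsS (int n)" "ev 1 0 f = 1"
    by (auto simp: f_def formsS_def forms_def homog_vars homog_add power_0_left add.commute)
  then have ex: "\<exists>f\<in>formsS (int n). ev 1 0 f = 1" by blast
  have IH: "finite (formsS (int n - 2)) \<and> card (formsS (int n - 2)) = 2 ^ (n div 2)"
  proof (cases "n < 2")
    case True
    then show ?thesis by (auto simp: formsSRI_neg)
  next
    case False
    then obtain k where "n = k + 2" by (metis add.commute le_add_diff_inverse not_less)
    then show ?thesis using less[of k] by simp
  qed
  show ?case
    using card_functional[OF forms_subgroups(2) ev_simps(6) kernel_formsS[of "int n"]] IH ex by simp
qed

text \<open>\<open>dickson2\<close> and \<open>PD\<close> are the Dickson invariants, which generate
  the invariants of GL_2(F_2). \<open>cubic3\<close> is a further invariant of the subgroup of order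
  3.\<close>

definition dickson2 :: bpoly where "dickson2 = PX ^ 2 + PX * PY + PY ^ 2"
definition cubic3 :: bpoly where "cubic3 = PX ^ 3 + PX ^ 2 * PY + PY ^ 3"

lemma homog_dickson: "homog 2 dickson2" "homog 3 cubic3"
proof -
  have "homog (1 + 1) (PX * PY :: bpoly)" by (intro homog_mult homog_vars)
  moreover have "homog (int 2) (PX ^ 2 :: bpoly)" "homog (int 2) (PY ^ 2 :: bpoly)"
    "homog (int 3) (PX ^ 3 :: bpoly)" "homog (int 3) (PY ^ 3 :: bpoly)"
    by (rule homog_power_PX homog_power_PY)+
  moreover have "homog (int 2 + 1) (PX ^ 2 * PY :: bpoly)"
    by (intro homog_mult homog_vars homog_power_PX)
  ultimately show "homog 2 dickson2" "homog 3 cubic3"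
    unfolding dickson2_def cubic3_def by (auto intro!: homog_add)
qed

lemma dickson_invariant: "actS dickson2 = dickson2" "actR dickson2 = dickson2" "actR cubic3 = cubic3"
  "ev 1 0 dickson2 = 1" "ev 1 1 dickson2 = 1" "ev 1 0 cubic3 = 1"
proof -
  show "actS dickson2 = dickson2" by (simp add: dickson2_def algebra_simps)
  have "(PX + PY) ^ 2 = PX ^ 2 + PY ^ 2 + (PX * PY + PX * PY :: bpoly)"
    by (simp add: power2_eq_square algebra_simps del: bpoly_double)
  then have sq: "(PX + PY) ^ 2 = PX ^ 2 + (PY ^ 2 :: bpoly)" by simp
  have "PY ^ 2 + PY * (PX + PY) + (PX ^ 2 + PY ^ 2) = PX ^ 2 + PX * PY + PY ^ 2 + (PY ^ 2 + PY ^ 2 :: bpoly)"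
    by (simp add: power2_eq_square algebra_simps del: bpoly_double)
  then show "actR dickson2 = dickson2" by (simp add: dickson2_def sq)
  have "(PX + PY) ^ 3 = (PX + PY) * (PX + PY) ^ 2" for PX PY :: bpoly by (simp add: power2_eq_square power3_eq_cube)
  then have cube: "(PX + PY) ^ 3 = (PX + PY) * (PX ^ 2 + (PY ^ 2 :: bpoly))" using sq by metis
  have "PY ^ 3 + PY ^ 2 * (PX + PY) + (PX + PY) * (PX ^ 2 + (PY ^ 2 :: bpoly))
    = PX ^ 3 + PX ^ 2 * PY + PY ^ 3 + (PX * PY ^ 2 + PX * PY ^ 2) + (PY ^ 3 + PY ^ 3)"
    by (simp add: power2_eq_square power3_eq_cube algebra_simps del: bpoly_double)
  then show "actR cubic3 = cubic3" by (simp add: cubic3_def cube)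
  show "ev 1 0 dickson2 = 1" "ev 1 1 dickson2 = 1" "ev 1 0 cubic3 = 1"
    by (simp_all add: dickson2_def cubic3_def bit_add_self)
qed

lemma even_invariant:
  assumes "even n"
  shows "dickson2 ^ (n div 2) \<in> formsI (int n)" "ev 1 0 (dickson2 ^ (n div 2)) = 1" "ev 1 1 (dickson2 ^ (n div 2)) = 1"
proof -
  have "homog (int (n div 2) * 2) (dickson2 ^ (n div 2))" by (rule homog_power[OF homog_dickson(1)])
  moreover have "int (n div 2) * 2 = int n" using assms by auto
  ultimately show "dickson2 ^ (n div 2) \<in> formsI (int n)"
    by (simp add: formsI_def formsS_def formsR_def forms_def dickson_invariant)
qed (simp_all add: dickson_invariant)

text \<open>The number of monomials u^i v^j with i + j = n and i congruent to j modulo 3, where u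
  and v are eigenvectors of \<open>actR\<close> over the field of four elements; so it is the
  dimension of the invariants.\<close>

definition tau :: "nat \<Rightarrow> nat" where "tau n = (n + 3) div 3 - (if n mod 3 = 1 then 1 else 0)"
text \<open>The number of monomials of degree n in two generators of degrees 2 and 3, the degrees of
  the Dickson invariants.\<close>

definition inv_dim :: "nat \<Rightarrow> nat" where "inv_dim n = (if even n then n div 6 + 1 else (n + 3) div 6)"

lemma ev_formsR:
  assumes "f \<in> formsR d"
  shows "ev 0 1 f = ev 1 0 f" "ev 1 1 f = ev 1 0 f"
proof -
  have "ev 1 0 (actR f) = ev 0 (- 1) f" "ev 0 1 (actR f) = ev 1 (- 1) f" by (simp_all add: ev_actR)
  then show "ev 0 1 f = ev 1 0 f" "ev 1 1 f = ev 1 0 f" using assms by (simp_all add: bit_uminus formsR_def)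
qed

text \<open>An invariant form has equal values at the three nonzero vectors, while for a linear form
  the value at (1, 1) is the sum of the other two.\<close>

lemma formsR_1: "f \<in> formsR 1 \<Longrightarrow> ev 1 0 f = 0"
proof -
  assume f: "f \<in> formsR 1"
  then have "f = PK (ev 1 0 f) * PX + PK (ev 0 1 f) * PY"
    by (intro homog_degree_1) (simp add: formsR_def forms_def)
  then have "ev 1 1 f = ev 1 1 (PK (ev 1 0 f) * PX + PK (ev 0 1 f) * PY)" by (rule arg_cong)
  then have "ev 1 1 f = ev 1 0 f + ev 0 1 f" by simp
  then show ?thesis using ev_formsR[OF f] by (simp add: bit_add_self)
qed

text \<open>Division by \<open>PD\<close> lowers the degree by 3, and each degree except 1 has an
  invariant that does not vanish at (1, 0): a power of \<open>dickson2\<close>, multiplied by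
  \<open>cubic3\<close> if the degree is odd.\<close>

lemma card_formsR: "finite (formsR (int n)) \<and> card (formsR (int n)) = 2 ^ tau n"
proof (induction n rule: less_induct)
  case (less n)
  have ex: "(\<exists>f\<in>formsR (int n). ev 1 0 f = 1) \<longleftrightarrow> n \<noteq> 1"
  proof
    assume "\<exists>f\<in>formsR (int n). ev 1 0 f = 1"
    then show "n \<noteq> 1" using formsR_1 by auto
  next
    assume n: "n \<noteq> 1"
    show "\<exists>f\<in>formsR (int n). ev 1 0 f = 1"
    proof (cases "even n")
      case True
      then show ?thesis using even_invariant[OF True] unfolding formsI_def by blast
    next
      case False
      then have "even (n - 3)" "n = 3 + (n - 3)" using n by presburger+
      note inv = even_invariant[OF this(1)]
      have "homog (3 + int (n - 3)) (cubic3 * dickson2 ^ ((n - 3) div 2))"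
        using inv(1) by (intro homog_mult homog_dickson) (simp add: formsI_def formsS_def forms_def)
      moreover have "3 + int (n - 3) = int n" using \<open>n = 3 + (n - 3)\<close> by linarith
      ultimately have "cubic3 * dickson2 ^ ((n - 3) div 2) \<in> formsR (int n)"
        by (simp add: formsR_def forms_def dickson_invariant)
      moreover have "ev 1 0 (cubic3 * dickson2 ^ ((n - 3) div 2)) = 1"
        by (simp add: dickson_invariant)
      ultimately show ?thesis by blast
    qed
  qed
  have IH: "finite (formsR (int n - 3)) \<and> card (formsR (int n - 3)) = 2 ^ (if n < 3 then 0 else tau (n - 3))"
  proof (cases "n < 3")
    case True
    then show ?thesis by (auto simp: formsSRI_neg)
  next
    case False
    then have "int (n - 3) = int n - 3" by simp
    then show ?thesis using less[of "n - 3"] False by simp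
  qed
  have "(if n \<noteq> 1 then 2 else 1) * 2 ^ (if n < 3 then 0 else tau (n - 3)) = (2 ^ tau n :: nat)"
  proof (cases "n < 3")
    case True
    then have "n = 0 \<or> n = 1 \<or> n = 2" by auto
    then show ?thesis by (auto simp: tau_def)
  next
    case False
    then obtain k where k: "n = k + 3" by (metis add.commute le_add_diff_inverse not_less)
    have "(6 + k) div 3 = k div 3 + 2" by simp
    then have "tau n = Suc (tau (n - 3))" by (simp add: tau_def k)
    then show ?thesis using False by simp
  qed
  then show ?case
    using card_functional[OF forms_subgroups(3) ev_simps(6) kernel_formsR(1)[of "int n"]] IH ex by simp
qed

definition imageS :: "int \<Rightarrow> bpoly set" where "imageS d = (\<lambda>f. f + actS f) ` forms d"

lemma imageS_subgroup: "add_subgroup (imageS d)"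
  unfolding add_subgroup_def
proof (intro conjI ballI)
  show "0 \<in> imageS d" unfolding imageS_def using add_subgroupD(1)[OF forms_subgroups(1)] by force
  fix a b assume "a \<in> imageS d" "b \<in> imageS d"
  then obtain f g where fg: "f \<in> forms d" "g \<in> forms d" "a = f + actS f" "b = g + actS g" by (auto simp: imageS_def)
  then have "a - b = (f + g) + actS (f + g)" by (simp add: algebra_simps)
  then show "a - b \<in> imageS d" using fg add_subgroupD(4)[OF forms_subgroups(1)] unfolding imageS_def by blast
qed

lemma card_imageS: "card (imageS (int n)) = 2 ^ (n - n div 2)"
proof -
  have "card (forms (int n)) = card (imageS (int n)) * card {f \<in> forms (int n). f + actS f = 0}"
    unfolding imageS_def using card_forms[of n]
    by (intro card_additive(2) forms_subgroups) (auto simp: algebra_simps)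
  also have "{f \<in> forms (int n). f + actS f = 0} = formsS (int n)"
    by (auto simp: formsS_def add_eq_0_iff)
  finally have eq: "2 ^ (n + 1) = card (imageS (int n)) * 2 ^ (n div 2 + 1)"
    using card_forms[of n] card_formsS[of n] by simp
  have "n + 1 = (n - n div 2) + (n div 2 + 1)" by simp
  then have "(2::nat) ^ (n + 1) = 2 ^ (n - n div 2) * 2 ^ (n div 2 + 1)" by (metis power_add)
  then show ?thesis using eq by (metis mult_right_cancel power_not_zero zero_neq_numeral)
qed

lemma imageS_subset: "imageS d \<subseteq> {f \<in> formsS d. ev 1 1 f = 0}"
proof
  fix f assume "f \<in> imageS d"
  then obtain g where g: "homog d g" "f = g + actS g" by (auto simp: imageS_def forms_def)
  have "ev 1 1 (actS g) = ev 1 (- 1) g" by (simp add: ev_actS)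
  then have "ev 1 1 f = 0" using g by (simp add: bit_uminus bit_add_self)
  moreover have "actS (actS g) = g" using actS_actS[OF g(1)] by (simp split: if_splits)
  then have "actS f = f" using g by (simp add: add.commute)
  ultimately show "f \<in> {f \<in> formsS d. ev 1 1 f = 0}"
    using g homog_add[OF g(1) homog_act(1)[OF g(1)]] by (simp add: formsS_def forms_def)
qed

text \<open>By counting: without a middle monomial the norms of the involution already exhaust its
  invariants.\<close>

lemma imageS_odd: "odd n \<Longrightarrow> imageS (int n) = formsS (int n)"
proof (rule card_subset_eq)
  assume "odd n"
  then have "n - n div 2 = n div 2 + 1" by presburger
  then show "card (imageS (int n)) = card (formsS (int n))"
    using card_imageS[of n] card_formsS[of n] by simp
qed (use card_formsS imageS_subset in auto)

lemma card_eval11: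
  assumes "add_subgroup A" "finite A" "f \<in> A" "ev 1 1 f = (1::bit)"
  shows "card A = 2 * card {f \<in> A. ev 1 1 f = 0}"
proof -
  have "ev 1 1 ` A = {0, 1 :: bit}"
    using assms add_subgroupD(1)[OF assms(1)] bit_cases01 by (force simp: image_iff)
  moreover have "card A = card (ev 1 1 ` A) * card {f \<in> A. ev 1 1 f = 0}"
    using assms by (intro card_additive(2)) auto
  ultimately show ?thesis by simp
qed

lemma middle_formsS:
  assumes "even n"
  shows "(PX * PY) ^ (n div 2) \<in> formsS (int n)"
proof -
  have "homog (int (n div 2) * (1 + 1)) ((PX * PY) ^ (n div 2) :: bpoly)"
    by (intro homog_power homog_mult homog_vars)
  moreover have "int (n div 2) * (1 + 1) = int n" using assms by auto
  ultimately show ?thesis by (simp add: formsS_def forms_def mult.commute)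
qed

text \<open>The middle monomial is an invariant with value 1 at (1, 1), so the invariants vanishing
  there form half of all invariants, and this is the number of norms.\<close>

lemma imageS_even:
  assumes "even n"
  shows "imageS (int n) = {f \<in> formsS (int n). ev 1 1 f = 0}"
proof (rule card_subset_eq)
  have "card (formsS (int n)) = 2 * card {f \<in> formsS (int n). ev 1 1 f = 0}"
    using card_formsS middle_formsS[OF assms] by (intro card_eval11[OF forms_subgroups(2)]) auto
  moreover have "n - n div 2 = n div 2" using assms by presburger
  ultimately show "card (imageS (int n)) = card {f \<in> formsS (int n). ev 1 1 f = 0}"
    using card_imageS[of n] card_formsS[of n] by simp
qed (use card_formsS imageS_subset in auto)

lemma card_formsI: "finite (formsI (int n)) \<and> card (formsI (int n)) = 2 ^ inv_dim n"
proof (induction n rule: less_induct)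
  case (less n)
  have ex: "(\<exists>f\<in>formsI (int n). ev 1 0 f = 1) \<longleftrightarrow> even n"
  proof
    assume "\<exists>f\<in>formsI (int n). ev 1 0 f = 1"
    then obtain f where f: "f \<in> formsI (int n)" "ev 1 0 f = 1" by blast
    then have 1: "ev 1 1 f = 1" using ev_formsR(2)[of f] by (auto simp: formsI_def)
    show "even n"
    proof (rule ccontr)
      assume "odd n"
      \<comment> \<open>In odd degree an invariant of \<open>actS\<close> is a norm and vanishes at
        (1, 1), whereas invariance under \<open>actR\<close> makes the values at (1, 1) and (1, 0)
        equal.\<close>
      then have "f \<in> imageS (int n)" using imageS_odd f(1) by (simp add: formsI_def)
      then have "ev 1 1 f = 0" using imageS_subset by blast
      then show False using 1 by simp
    qed
  qed (use even_invariant in blast)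
  have IH: "finite (formsI (int n - 3)) \<and> card (formsI (int n - 3)) = 2 ^ (if n < 3 then 0 else inv_dim (n - 3))"
  proof (cases "n < 3")
    case True
    then show ?thesis by (auto simp: formsSRI_neg)
  next
    case False
    then have "int (n - 3) = int n - 3" by simp
    then show ?thesis using less[of "n - 3"] False by simp
  qed
  have "(if even n then 2 else 1) * 2 ^ (if n < 3 then 0 else inv_dim (n - 3)) = (2 ^ inv_dim n :: nat)"
  proof (cases "n < 3")
    case True
    then have "n = 0 \<or> n = 1 \<or> n = 2" by auto
    then show ?thesis by (auto simp: inv_dim_def)
  next
    case False
    then obtain k where k: "n = k + 3" by (metis add.commute le_add_diff_inverse not_less)
    have "(k + 6) div 6 = k div 6 + 1" by simp
    then have "inv_dim n = inv_dim (n - 3) + (if even n then 1 else 0)"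
      by (simp add: inv_dim_def k)
    then show ?thesis using False by simp
  qed
  then show ?case
    using card_functional[OF forms_subgroups(4) ev_simps(6) kernel_formsR(2)[of "int n"]] IH ex by simp
qed

subsection \<open>Reduction modulo 2\<close>

definition red :: "int poly poly \<Rightarrow> bpoly" where "red = map_poly (map_poly of_int)"

lemma coeff_red: "poly.coeff (poly.coeff (red f) j) i = of_int (poly.coeff (poly.coeff f j) i)"
  by (simp add: red_def coeff_map_poly)

lemma red_add [simp]: "red (f + g) = red f + red g"
  by (intro poly_eqI) (simp add: coeff_red)

lemma red_mult [simp]: "red (f * g) = red f * red g"
  by (intro poly_eqI) (simp add: coeff_red coeff_mult coeff_sum)

lemma red_0 [simp]: "red 0 = 0"
  by (simp add: red_def)

lemma red_minus [simp]: "red (- f) = red f"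
  using red_add[of f "- f"] by (simp add: add_eq_0_iff)

lemma red_diff [simp]: "red (f - g) = red f + red g"
  using red_add[of f "- g"] by simp

lemma red_PK [simp]: "red (PK c) = PK (of_int c)"
  by (cases "c = 0") (simp_all add: red_def PK_def map_poly_pCons)

lemma red_PX [simp]: "red PX = PX" and red_PY [simp]: "red PY = PY"
  by (simp_all add: red_def PX_def PY_def map_poly_pCons)

lemma red_1 [simp]: "red 1 = 1"
  using red_PK[of 1] by (simp add: PK_simps)

lemma red_power [simp]: "red (f ^ k) = red f ^ k"
  by (induction k) simp_all

lemma red_act [simp]: "red (actS f) = actS (red f)" "red (actR f) = actR (red f)"
  by (rule bipoly_hom_unique[where \<phi> = "\<lambda>f. red (actS f)" and \<psi> = "\<lambda>f. actS (red f)"]; simp)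
    (rule bipoly_hom_unique[where \<phi> = "\<lambda>f. red (actR f)" and \<psi> = "\<lambda>f. actR (red f)"]; simp)

lemma ev_red: "ev (of_int a) (of_int b) (red f) = of_int (ev a b f)"
  by (rule bipoly_hom_unique[where \<phi> = "\<lambda>f. ev (of_int a) (of_int b) (red f)" and \<psi> = "\<lambda>f. of_int (ev a b f)"])
    simp_all

lemma homog_red: "homog d f \<Longrightarrow> homog d (red f)"
  unfolding homog_def coeff_red by (metis of_int_0)

lemma red_sum [simp]: "red (sum f I) = (\<Sum>i\<in>I. red (f i))"
  by (induction I rule: infinite_finite_induct) simp_all

lemma red_surj: "homog d g \<Longrightarrow> \<exists>f. homog d f \<and> red f = g"
proof -
  assume g: "homog d g"
  show ?thesis
  proof (cases "d < 0")
    case True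
    then show ?thesis using g homog_neg by (intro exI[of _ 0]) auto
  next
    case False
    define lift :: "bit \<Rightarrow> int" where "lift b = (if b = 1 then 1 else 0)" for b
    have lift: "of_int (lift b) = b" for b using bit_cases01[of b] by (auto simp: lift_def)
    let ?f = "\<Sum>j\<le>nat d. PK (lift (poly.coeff (poly.coeff g j) (nat d - j))) * PX ^ (nat d - j) * PY ^ j"
    have "homog d (PK c * PX ^ (nat d - j) * PY ^ j)" if "j \<le> nat d" for c :: int and j
      using homog_monom[of "nat d - j" j c] that False by simp
    then have "homog d ?f" by (intro homog_sum) auto
    moreover have "red ?f = g"
      by (subst (2) homog_expand[OF g]) (simp add: lift)
    ultimately show ?thesis by blast
  qed
qed

lemma of_int_bit_eq_0: "(of_int k :: bit) = 0 \<longleftrightarrow> even k"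
proof
  show "even k" if "(of_int k :: bit) = 0"
  proof (rule ccontr)
    assume "odd k"
    then obtain m where "k = 2 * m + 1" by (auto elim: oddE)
    then have "(of_int k :: bit) = of_int m + of_int m + 1" by simp
    then show False using that by (simp add: bit_add_self)
  qed
  show "(of_int k :: bit) = 0" if even: "even k"
  proof -
    obtain m where "k = 2 * m" using even by blast
    then have "(of_int k :: bit) = of_int m + of_int m" by simp
    then show ?thesis by (simp add: bit_add_self)
  qed
qed

lemma red_eq_0:
  assumes f: "homog d f" and 0: "red f = 0"
  shows "\<exists>h. homog d h \<and> f = 2 * h"
proof (cases "d < 0")
  case True
  then show ?thesis using f homog_neg by (intro exI[of _ 0]) auto
next
  case False
  have even: "even (poly.coeff (poly.coeff f j) i)" for i j
    using coeff_red[of f j i] by (simp add: 0 of_int_bit_eq_0)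
  let ?h = "\<Sum>j\<le>nat d. PK (poly.coeff (poly.coeff f j) (nat d - j) div 2) * PX ^ (nat d - j) * PY ^ j :: int poly poly"
  have "homog d (PK c * PX ^ (nat d - j) * PY ^ j)" if "j \<le> nat d" for c :: int and j
    using homog_monom[of "nat d - j" j c] that False by simp
  then have "homog d ?h" by (intro homog_sum) auto
  moreover have "f = 2 * ?h"
  proof -
    have "PK c = 2 * PK (c div 2)" if "even c" for c :: int
      using that PK_simps(4)[of 2 "c div 2"] by (simp add: PK_numeral)
    then have "PK c * PX ^ i * PY ^ j = 2 * (PK (c div 2) * PX ^ i * PY ^ j)" if "even c" for c :: int and i j
      using that by (metis mult.assoc)
    then have "(\<Sum>j\<le>nat d. PK (poly.coeff (poly.coeff f j) (nat d - j)) * PX ^ (nat d - j) * PY ^ j) = 2 * ?h"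
      using even by (simp only: sum_distrib_left)
    then show ?thesis using homog_expand[OF f] by simp
  qed
  ultimately show ?thesis by blast
qed

lemma red_two [simp]: "red (2 * h) = 0"
  unfolding mult_2 by (simp only: red_add bpoly_double)

section \<open>Cocycles and coboundaries with values in forms\<close>

definition actT :: "int poly poly \<Rightarrow> int poly poly" where "actT = subst (- PY) (PX + PY)"

lemma actT_actR: "homog d f \<Longrightarrow> actT f = (if even d then actR f else - actR f)"
proof -
  assume f: "homog d f"
  have "actT f = actR (subst (- PX) (- PY) f)"
    by (simp add: actT_def actR_def subst_subst add.commute)
  then show ?thesis using subst_neg[OF f] by simp
qed

lemma homog_actT: "homog d f \<Longrightarrow> homog d (actT f)"
  by (auto simp: actT_actR homog_act homog_minus)

text \<open>From here on \<open>p\<close> holds in even cohomological degrees, and \<open>d\<close>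
  is the degree of the forms in two variables of degree one.\<close>

abbreviation "cocyc p d \<equiv> stabilizer_cocycles p {f :: int poly poly. homog d f} actS actT"
abbreviation "cobs p d \<equiv> stabilizer_coboundaries p {f :: int poly poly. homog d f} actS actT"

lemma add_self: "a + a = 2 * (a :: int poly poly)" "a + 2 * a = 3 * a" "2 * a + a = 3 * a"
  by (simp_all add: mult_2[symmetric] distrib_right[symmetric])

lemma triple_add_self: "a + a + a = 3 * (a :: int poly poly)"
  by (simp add: add_self)

text \<open>
  In even degree \<open>actS\<close> has order 2 and \<open>actT\<close> agrees with \<open>actR\<close>, which has order 3.
\<close>

lemma cocyc_even:
  assumes "even d"
  shows "(a, b, c) \<in> cocyc True d \<longleftrightarrow>
      homog d a \<and> homog d b \<and> homog d c \<and> actS a = a \<and> actR b = b \<and> a - b = 2 * c"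
    and "(a, b, c) \<in> cocyc False d \<longleftrightarrow>
      homog d a \<and> homog d b \<and> homog d c \<and> actS a = - a \<and> normR b = 0"
proof -
  have T: "actT f = actR f" "homog d (actR f)" "actS (actS f) = f" if "homog d f" for f
    using that assms by (simp_all add: actT_actR homog_act actS_actS)
  show "(a, b, c) \<in> cocyc True d \<longleftrightarrow>
      homog d a \<and> homog d b \<and> homog d c \<and> actS a = a \<and> actR b = b \<and> a - b = 2 * c"
    by (auto simp: stabilizer_cocycles_def T add_self)
  have S2: "a + actS a + actS (actS a) + actS (actS (actS a)) = 2 * (a + actS a)" if "homog d a"
    using that T by (simp add: homog_act algebra_simps)
  have T2: "normR b + actT (actT (actT b)) + actT (actT (actT (actT b))) + actT (actT (actT (actT (actT b)))) = 2 * normR b"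
    if "homog d b"
    using that by (simp add: T normR_def actR_order algebra_simps)
  have N: "b + actT b + actT (actT b) = normR b" if "homog d b"
    using that by (simp add: T normR_def)
  have T3: "actT (actT (actT b)) + actT (actT (actT (actT b))) + actT (actT (actT (actT (actT b)))) = 0"
    if "normR b = 0" "homog d b"
    using T2[OF that(2)] that(1) by simp
  have eq: "actS a = - a \<longleftrightarrow> a + actS a = 0"
    by (simp add: eq_neg_iff_add_eq_0 add.commute)
  show "(a, b, c) \<in> cocyc False d \<longleftrightarrow>
      homog d a \<and> homog d b \<and> homog d c \<and> actS a = - a \<and> normR b = 0"
    unfolding eq by (auto simp: stabilizer_cocycles_def S2 T2 T3 N T(3))
qed

lemma cobs_even:
  assumes "even d"
  shows "cobs True d = {(2 * (\<alpha> + actS \<alpha>), 2 * normR \<beta>, \<alpha> + actS \<alpha> - normR \<beta>) | \<alpha> \<beta>. homog d \<alpha> \<and> homog d \<beta>}"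
    and "cobs False d = {(actS \<alpha> - \<alpha>, actR \<beta> - \<beta>, \<alpha> - \<beta> - 2 * \<gamma>) | \<alpha> \<beta> \<gamma>. homog d \<alpha> \<and> homog d \<beta> \<and> homog d \<gamma>}"
proof -
  have T: "actT f = actR f" "homog d (actR f)" "actS (actS f) = f" if "homog d f" for f
    using that assms by (simp_all add: actT_actR homog_act actS_actS)
  have bd1: "stabilizer_bd True actS actT (\<alpha>, \<beta>, \<gamma>) = (2 * (\<alpha> + actS \<alpha>), 2 * normR \<beta>, \<alpha> + actS \<alpha> - normR \<beta>)"
    if "homog d \<alpha>" "homog d \<beta>" "homog d \<gamma>" for \<alpha> \<beta> \<gamma>
    using that T by (simp add: stabilizer_bd_def homog_act normR_def actR_order algebra_simps)
  have bd2: "stabilizer_bd False actS actT (\<alpha>, \<beta>, \<gamma>) = (actS \<alpha> - \<alpha>, actR \<beta> - \<beta>, \<alpha> - \<beta> - 2 * \<gamma>)"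
    if "homog d \<alpha>" "homog d \<beta>" "homog d \<gamma>" for \<alpha> \<beta> \<gamma>
    using that T by (simp add: stabilizer_bd_def add_self)
  show "cobs True d = {(2 * (\<alpha> + actS \<alpha>), 2 * normR \<beta>, \<alpha> + actS \<alpha> - normR \<beta>) | \<alpha> \<beta>. homog d \<alpha> \<and> homog d \<beta>}"
  proof (intro equalityI subsetI)
    fix z :: "int poly poly \<times> int poly poly \<times> int poly poly"
    assume "z \<in> cobs True d"
    then obtain \<alpha> \<beta> \<gamma> where "homog d \<alpha>" "homog d \<beta>" "homog d \<gamma>" "z = stabilizer_bd True actS actT (\<alpha>, \<beta>, \<gamma>)"
      by (auto simp: stabilizer_coboundaries_def)
    then show "z \<in> {(2 * (\<alpha> + actS \<alpha>), 2 * normR \<beta>, \<alpha> + actS \<alpha> - normR \<beta>) | \<alpha> \<beta>. homog d \<alpha> \<and> homog d \<beta>}"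
      using bd1 by blast
  next
    fix z :: "int poly poly \<times> int poly poly \<times> int poly poly"
    assume "z \<in> {(2 * (\<alpha> + actS \<alpha>), 2 * normR \<beta>, \<alpha> + actS \<alpha> - normR \<beta>) | \<alpha> \<beta>. homog d \<alpha> \<and> homog d \<beta>}"
    then obtain \<alpha> \<beta> where "homog d \<alpha>" "homog d \<beta>" "z = stabilizer_bd True actS actT (\<alpha>, \<beta>, 0)"
      using bd1[of _ _ 0] by force
    then show "z \<in> cobs True d" unfolding stabilizer_coboundaries_def by force
  qed
  show "cobs False d = {(actS \<alpha> - \<alpha>, actR \<beta> - \<beta>, \<alpha> - \<beta> - 2 * \<gamma>) | \<alpha> \<beta> \<gamma>. homog d \<alpha> \<and> homog d \<beta> \<and> homog d \<gamma>}"
  proof (intro equalityI subsetI)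
    fix z :: "int poly poly \<times> int poly poly \<times> int poly poly"
    assume "z \<in> cobs False d"
    then obtain \<alpha> \<beta> \<gamma> where "homog d \<alpha>" "homog d \<beta>" "homog d \<gamma>" "z = stabilizer_bd False actS actT (\<alpha>, \<beta>, \<gamma>)"
      by (auto simp: stabilizer_coboundaries_def)
    then show "z \<in> {(actS \<alpha> - \<alpha>, actR \<beta> - \<beta>, \<alpha> - \<beta> - 2 * \<gamma>) | \<alpha> \<beta> \<gamma>. homog d \<alpha> \<and> homog d \<beta> \<and> homog d \<gamma>}"
      using bd2 by blast
  next
    fix z :: "int poly poly \<times> int poly poly \<times> int poly poly"
    assume "z \<in> {(actS \<alpha> - \<alpha>, actR \<beta> - \<beta>, \<alpha> - \<beta> - 2 * \<gamma>) | \<alpha> \<beta> \<gamma>. homog d \<alpha> \<and> homog d \<beta> \<and> homog d \<gamma>}"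
    then obtain \<alpha> \<beta> \<gamma> where "homog d \<alpha>" "homog d \<beta>" "homog d \<gamma>" "z = stabilizer_bd False actS actT (\<alpha>, \<beta>, \<gamma>)"
      using bd2 by force
    then show "z \<in> cobs False d" unfolding stabilizer_coboundaries_def by force
  qed
qed

text \<open>In odd degree \<open>actS\<close> squares to \<open>- 1\<close> and \<open>actT\<close> cubes to \<open>- 1\<close>.\<close>

definition altR :: "int poly poly \<Rightarrow> int poly poly" where "altR f = f - actR f + actR (actR f)"

lemma double_cancel [simp]: "2 * a = 2 * b \<longleftrightarrow> a = (b :: int poly poly)"
  by simp

text \<open>A power of each generator acts as -1. So invariants are equal to their negatives and
  vanish, the full norms are zero, and in odd cohomological degree the gluing relation alone
  survives.\<close>

lemma cocyc_odd:
  assumes "odd d"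
  shows "(a, b, c) \<in> cocyc True d \<longleftrightarrow> a = 0 \<and> b = 0 \<and> homog d c"
    and "(a, b, c) \<in> cocyc False d \<longleftrightarrow>
      homog d a \<and> homog d b \<and> homog d c \<and> a + actS a - altR b = - (2 * c)"
proof -
  have T: "actT f = - actR f" "homog d (actR f)" "homog d (- actR f)" "actS (actS f) = - f" if "homog d f" for f
    using that assms by (simp_all add: actT_actR homog_act homog_minus actS_actS)
  have T': "actT (- f) = actR f" if "homog d f" for f
    using T(1)[OF homog_minus[OF that]] by simp
  have a0: "a = 0" if "homog d a" "actS a = a"
    using T(4)[OF that(1)] that(2) by (simp add: eq_neg_iff_add_eq_0 add_self)
  have b0: "b = 0" if "homog d b" "actT b = b"
  proof -
    have "b = - actR b" using that T(1) by simp
    then have "actR b = - b" by (simp add: minus_equation_iff)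
    then have "actR (actR (actR b)) = - b" by simp
    then have "b = - b" using actR_order by metis
    then show ?thesis by (simp add: eq_neg_iff_add_eq_0 add_self)
  qed
  show "(a, b, c) \<in> cocyc True d \<longleftrightarrow> a = 0 \<and> b = 0 \<and> homog d c"
    using a0 b0 by (auto simp: stabilizer_cocycles_def T actT_def)
  have S2: "a + actS a + actS (actS a) + actS (actS (actS a)) = 0" if "homog d a"
    using that T by simp
  have T2: "altR b + actT (actT (actT b)) + actT (actT (actT (actT b))) + actT (actT (actT (actT (actT b)))) = 0"
    if "homog d b"
    using that T T' by (simp add: actR_order altR_def)
  have N: "b + actT b + actT (actT b) = altR b" if "homog d b"
    using that T T' by (simp add: altR_def)
  have c2: "- c - c = - (2 * c)" by simp
  show "(a, b, c) \<in> cocyc False d \<longleftrightarrow>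
      homog d a \<and> homog d b \<and> homog d c \<and> a + actS a - altR b = - (2 * c)"
    by (auto simp: stabilizer_cocycles_def S2 T2 N T(4) c2)
qed

lemma cobs_odd:
  assumes "odd d"
  shows "cobs True d = {(0, 0, \<alpha> + actS \<alpha> - altR \<beta> + 2 * \<gamma>) | \<alpha> \<beta> \<gamma>. homog d \<alpha> \<and> homog d \<beta> \<and> homog d \<gamma>}"
    and "cobs False d = {(actS \<alpha> - \<alpha>, - actR \<beta> - \<beta>, \<alpha> - \<beta>) | \<alpha> \<beta>. homog d \<alpha> \<and> homog d \<beta>}"
proof -
  have T: "actT f = - actR f" "homog d (actR f)" "homog d (- actR f)" "actS (actS f) = - f" if "homog d f" for f
    using that assms by (simp_all add: actT_actR homog_act homog_minus actS_actS)
  have T': "actT (- f) = actR f" if "homog d f" for f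
    using T(1)[OF homog_minus[OF that]] by simp
  have bd1: "stabilizer_bd True actS actT (\<alpha>, \<beta>, \<gamma>) = (0, 0, \<alpha> + actS \<alpha> - altR \<beta> + 2 * \<gamma>)"
    if "homog d \<alpha>" "homog d \<beta>" "homog d \<gamma>" for \<alpha> \<beta> \<gamma>
    using that T T' by (simp add: stabilizer_bd_def actR_order altR_def)
  have bd2: "stabilizer_bd False actS actT (\<alpha>, \<beta>, \<gamma>) = (actS \<alpha> - \<alpha>, - actR \<beta> - \<beta>, \<alpha> - \<beta>)"
    if "homog d \<alpha>" "homog d \<beta>" "homog d \<gamma>" for \<alpha> \<beta> \<gamma>
    using that T by (simp add: stabilizer_bd_def)
  show "cobs True d = {(0, 0, \<alpha> + actS \<alpha> - altR \<beta> + 2 * \<gamma>) | \<alpha> \<beta> \<gamma>. homog d \<alpha> \<and> homog d \<beta> \<and> homog d \<gamma>}"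
  proof (intro equalityI subsetI)
    fix z :: "int poly poly \<times> int poly poly \<times> int poly poly"
    assume "z \<in> cobs True d"
    then obtain \<alpha> \<beta> \<gamma> where "homog d \<alpha>" "homog d \<beta>" "homog d \<gamma>" "z = stabilizer_bd True actS actT (\<alpha>, \<beta>, \<gamma>)"
      by (auto simp: stabilizer_coboundaries_def)
    then show "z \<in> {(0, 0, \<alpha> + actS \<alpha> - altR \<beta> + 2 * \<gamma>) | \<alpha> \<beta> \<gamma>. homog d \<alpha> \<and> homog d \<beta> \<and> homog d \<gamma>}"
      using bd1 by blast
  next
    fix z :: "int poly poly \<times> int poly poly \<times> int poly poly"
    assume "z \<in> {(0, 0, \<alpha> + actS \<alpha> - altR \<beta> + 2 * \<gamma>) | \<alpha> \<beta> \<gamma>. homog d \<alpha> \<and> homog d \<beta> \<and> homog d \<gamma>}"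
    then obtain \<alpha> \<beta> \<gamma> where "homog d \<alpha>" "homog d \<beta>" "homog d \<gamma>" "z = stabilizer_bd True actS actT (\<alpha>, \<beta>, \<gamma>)"
      using bd1 by force
    then show "z \<in> cobs True d" unfolding stabilizer_coboundaries_def by force
  qed
  show "cobs False d = {(actS \<alpha> - \<alpha>, - actR \<beta> - \<beta>, \<alpha> - \<beta>) | \<alpha> \<beta>. homog d \<alpha> \<and> homog d \<beta>}"
  proof (intro equalityI subsetI)
    fix z :: "int poly poly \<times> int poly poly \<times> int poly poly"
    assume "z \<in> cobs False d"
    then obtain \<alpha> \<beta> \<gamma> where "homog d \<alpha>" "homog d \<beta>" "homog d \<gamma>" "z = stabilizer_bd False actS actT (\<alpha>, \<beta>, \<gamma>)"
      by (auto simp: stabilizer_coboundaries_def)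
    then show "z \<in> {(actS \<alpha> - \<alpha>, - actR \<beta> - \<beta>, \<alpha> - \<beta>) | \<alpha> \<beta>. homog d \<alpha> \<and> homog d \<beta>}"
      using bd2 by blast
  next
    fix z :: "int poly poly \<times> int poly poly \<times> int poly poly"
    assume "z \<in> {(actS \<alpha> - \<alpha>, - actR \<beta> - \<beta>, \<alpha> - \<beta>) | \<alpha> \<beta>. homog d \<alpha> \<and> homog d \<beta>}"
    then obtain \<alpha> \<beta> where "homog d \<alpha>" "homog d \<beta>" "z = stabilizer_bd False actS actT (\<alpha>, \<beta>, 0)"
      using bd2[of _ _ 0] by force
    then show "z \<in> cobs False d" unfolding stabilizer_coboundaries_def by force
  qed
qed

lemma red_normR: "red (normR f) = normR (red f)" and red_altR: "red (altR f) = normR (red f)"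
  by (simp_all add: normR_def altR_def)

lemma normR_bit: "f \<in> formsR d \<Longrightarrow> normR f = f" and normR_forms: "f \<in> forms d \<Longrightarrow> normR f \<in> formsR d"
  by (simp add: normR_def formsR_def, simp add: formsR_def forms_def homog_normR)

text \<open>Lifting invariants modulo 2 to eigenvectors of \<open>actS\<close> and invariants of \<open>actR\<close>.\<close>

definition middle :: "int \<Rightarrow> int poly poly" where "middle d = (PX * PY) ^ (nat d div 2)"

lemma middle_props:
  assumes "even d" "0 \<le> d"
  shows "homog d (middle d)" "actS (middle d) = PK ((- 1) ^ (nat d div 2)) * middle d" "ev 1 1 (red (middle d)) = 1"
    "actS (red (middle d)) = red (middle d)"
proof -
  have "homog (int (nat d div 2) * (1 + 1)) ((PX * PY) ^ (nat d div 2) :: int poly poly)"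
    by (intro homog_power homog_mult homog_vars)
  moreover have "int (nat d div 2) * (1 + 1) = d" using assms by auto
  ultimately show "homog d (middle d)" by (simp add: middle_def)
  have S: "actS (PX * PY) = - (PX * PY :: int poly poly)" by simp
  have K: "PK ((- 1) ^ k) = (- 1 :: int poly poly) ^ k" for k
    by (induction k) (simp_all add: PK_simps)
  show "actS (middle d) = PK ((- 1) ^ (nat d div 2)) * middle d"
    unfolding middle_def by (simp only: act_simps(6) S K power_minus[of "PX * PY"])
qed (simp_all add: middle_def mult.commute)

text \<open>A norm g + S g modulo 2 lifts to \<open>\<alpha> + PK e * actS \<alpha>\<close> for
  either sign \<open>e\<close>. Modulo norms the middle monomial is the only other invariant, and
  its integral version is an eigenvector for the sign (-1)^(d/2) alone.\<close>

lemma lift_eigenvector: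
  assumes d: "even d" "0 \<le> d" and e: "e = 1 \<or> e = - 1" and v: "v \<in> formsS d"
    and cond: "e = (- 1) ^ (nat d div 2) \<or> ev 1 1 v = 0"
  shows "\<exists>a. homog d a \<and> actS a = PK e * a \<and> red a = v"
proof -
  define n where "n = nat d"
  have n: "d = int n" "even n" using d by (auto simp: n_def even_nat_iff)
  have lift: "\<exists>a. homog d a \<and> actS a = PK e * a \<and> red a = u" if "u \<in> formsS d" "ev 1 1 u = 0" for u
  proof -
    have "u \<in> imageS d" using that imageS_even[OF n(2)] n(1) by simp
    then obtain g where g: "homog d g" "u = g + actS g" by (auto simp: imageS_def forms_def)
    then obtain \<alpha> where \<alpha>: "homog d \<alpha>" "red \<alpha> = g" using red_surj by blast
    have "homog d (\<alpha> + PK e * actS \<alpha>)" using \<alpha> homog_add[OF \<alpha>(1) homog_PK_mult[OF homog_act(1)[OF \<alpha>(1)]]] by simp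
    moreover have "PK e * PK e = 1" using e by (auto simp: PK_simps)
    then have "actS (\<alpha> + PK e * actS \<alpha>) = PK e * (\<alpha> + PK e * actS \<alpha>)"
      using actS_actS[OF \<alpha>(1)] d by (simp add: distrib_left mult.assoc[symmetric] add.commute)
    moreover have "red (\<alpha> + PK e * actS \<alpha>) = u" using \<alpha> g e by (auto simp: PK_simps)
    ultimately show ?thesis by blast
  qed
  show ?thesis
  proof (cases "ev 1 1 v = 0")
    case False
    then have "ev 1 1 v = 1" using bit_cases01 by blast
    note mid = middle_props[OF d]
    have "red (middle d) \<in> formsS d" using mid homog_red by (auto simp: formsS_def forms_def)
    then have "v + red (middle d) \<in> formsS d" using v add_subgroupD(4)[OF forms_subgroups(2)] by blast
    moreover have "ev 1 1 (v + red (middle d)) = 0" using \<open>ev 1 1 v = 1\<close> mid(3) by (simp add: bit_add_self)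
    ultimately obtain a where a: "homog d a" "actS a = PK e * a" "red a = v + red (middle d)" using lift by blast
    have "actS (a + middle d) = PK e * (a + middle d)"
      using a mid(2) cond False by (simp add: distrib_left)
    moreover have "red (a + middle d) = v"
      using a(3) by (simp add: add.assoc)
    ultimately show ?thesis using homog_add[OF a(1) mid(1)] by blast
  qed (use lift v in blast)
qed

lemma red_eigenvector:
  assumes d: "even d" and e: "e = 1 \<or> e = - 1" and a: "homog d a" "actS a = PK e * a"
  shows "red a \<in> formsS d" "e \<noteq> (- 1) ^ (nat d div 2) \<or> d < 0 \<Longrightarrow> red a \<in> imageS d"
proof -
  have "actS (red a) = red (actS a)" by simp
  also have "\<dots> = red a" unfolding a(2) using e by (auto simp: PK_simps)
  finally have "actS (red a) = red a" .
  then show "red a \<in> formsS d" using homog_red[OF a(1)] by (simp add: formsS_def forms_def)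
  assume ne: "e \<noteq> (- 1) ^ (nat d div 2) \<or> d < 0"
  obtain \<alpha> k where \<alpha>: "homog d \<alpha>" "a = \<alpha> + PK e * actS \<alpha> + PK k * (PX * PY) ^ (nat d div 2)"
    "k = 0 \<or> 0 \<le> d \<and> e = (- 1) ^ (nat d div 2)"
    using actS_eigenvector[OF a(1) d e a(2)] by blast
  then have "red a = red \<alpha> + actS (red \<alpha>)" using ne e by (auto simp: PK_simps)
  then show "red a \<in> imageS d" using homog_red[OF \<alpha>(1)] by (auto simp: imageS_def forms_def)
qed

text \<open>Modulo 2 the norm of the group of order 3 is the identity on invariants, so the norm of
  any integral lift is an invariant lift.\<close>

lemma lift_invariant:
  assumes "v \<in> formsR d"
  shows "\<exists>b. homog d b \<and> red (normR b) = v"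
proof -
  obtain b where "homog d b" "red b = v" using assms red_surj by (auto simp: formsR_def forms_def)
  then show ?thesis using normR_bit[OF assms] by (auto simp: red_normR)
qed

lemma red_eq:
  assumes "homog d f" "homog d g" "red f = red g"
  shows "\<exists>h. homog d h \<and> f - g = 2 * h"
  using red_eq_0[OF homog_diff[OF assms(1,2)]] assms(3) by simp

section \<open>Presentation of the cohomology groups by triples of forms\<close>

lemma var_eq: "var_x = PX" "var_y = PY"
  by (simp_all add: var_x_def var_y_def PX_def PY_def)

lemma of_int_eq_PK: "(of_int :: int \<Rightarrow> int poly poly) = PK"
  using PK_of_int[where 'a = int] by (simp add: fun_eq_iff)

lemma substitute_eq_subst: "substitute = subst"
  by (simp add: fun_eq_iff substitute_def subst_def of_int_eq_PK)

lemma poly_act_eq_subst: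
  "poly_act g = subst (PK (g $ 1 $ 1) * PX + PK (g $ 2 $ 1) * PY) (PK (g $ 1 $ 2) * PX + PK (g $ 2 $ 2) * PY)"
  by (simp add: poly_act_def substitute_eq_subst var_eq of_int_eq_PK)

lemma poly_act_matS: "poly_act matS = actS" and poly_act_matT: "poly_act matT = actT"
  by (simp_all add: poly_act_eq_subst matS_def matT_def actS_def actT_def PK_simps)

lemma SL2Z_module_forms: "SL2Z_module {f. homog d f} poly_act"
proof -
  interpret group SL2Z by (rule group_SL2Z)
  have "homog d (poly_act g f)" if "homog d f" for g f
    unfolding poly_act_eq_subst using that by (intro homog_subst homog_add homog_PK_mult homog_vars)
  then show ?thesis
    by unfold_locales (simp_all add: homog_diff poly_act_add poly_act_mat_1 poly_act_matrix_mult)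
qed

lemma cocyc_subgroups:
  "add_subgroup (cocyc p d)" "add_subgroup (cobs p d)" "cobs p d \<subseteq> cocyc p d"
proof -
  interpret SL2Z_module "{f. homog d f}" poly_act by (rule SL2Z_module_forms)
  note sub = stabilizer_subgroups[of 0] stabilizer_subgroups[of 1]
  show "add_subgroup (cocyc p d)" "add_subgroup (cobs p d)" "cobs p d \<subseteq> cocyc p d"
    using sub by (cases p; simp add: poly_act_matS poly_act_matT)+
qed

lemmas cocyc_closed = add_subgroupD[OF cocyc_subgroups(1)]
lemmas cobs_closed = add_subgroupD[OF cocyc_subgroups(2)]

text \<open>All exponents and ranks are derived from this presentation alone, which separates the
  arithmetic of forms from cochains and resolutions.\<close>

locale cohomology_presentation =
  fixes H :: "('h, 'm) monoid_scheme" and p :: bool and d :: int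
  assumes H: "comm_group H" and iso: "H \<cong> add_group (cocyc p d) Mod cobs p d"
begin

lemmas card_mod_p = quotient_card_mod_p[OF cocyc_subgroups H iso]
lemmas exponent = quotient_exponent[OF cocyc_subgroups comm_group.axioms(2)[OF H] iso]
lemmas presentation = quotient_presentation[OF cocyc_subgroups H iso]

lemma card_mod_p_trivial:
  assumes "\<And>z. z \<in> cocyc p d \<Longrightarrow> \<exists>w\<in>cocyc p d. z - scale3 q w \<in> cobs p d"
  shows "card (carrier (H Mod nat_powers H q)) = q ^ 0"
proof (rule card_mod_p[where f = "\<lambda>_. 0 :: int" and Q = "{0}" and Y = "{0}"])
  show "(\<lambda>_. 0 :: int) ` cocyc p d = {0}"
    using cocyc_closed(1) by blast
qed (use assms in \<open>auto simp: add_subgroup_def\<close>)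

lemma negative_degree:
  assumes "d < 0"
  shows "card (carrier (H Mod nat_powers H q)) = q ^ 0"
    and "x \<in> carrier H \<Longrightarrow> x [^]\<^bsub>H\<^esub> (1::nat) = \<one>\<^bsub>H\<^esub>"
proof -
  have 0: "z = 0" if z: "z \<in> cocyc p d" for z
  proof -
    obtain a b c where "z = (a, b, c)" "homog d a" "homog d b" "homog d c"
      using z by (auto simp: stabilizer_cocycles_def)
    then show ?thesis using homog_neg[OF assms] by (auto simp: zero_prod_def)
  qed
  show "card (carrier (H Mod nat_powers H q)) = q ^ 0"
  proof (rule card_mod_p_trivial)
    fix z assume "z \<in> cocyc p d"
    then have "z = 0" by (rule 0)
    then show "\<exists>w\<in>cocyc p d. z - scale3 q w \<in> cobs p d"
      using cocyc_closed(1) cobs_closed(1) by (intro bexI[of _ 0]) (auto simp: scale3_def zero_prod_def)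
  qed
  show "x [^]\<^bsub>H\<^esub> (1::nat) = \<one>\<^bsub>H\<^esub>" if "x \<in> carrier H"
  proof (rule exponent[OF _ that])
    fix z assume "z \<in> cocyc p d"
    then have "z = 0" by (rule 0)
    then show "scale3 1 z \<in> cobs p d"
      using cobs_closed(1) by (auto simp: scale3_def zero_prod_def)
  qed
qed

end

lemma scale3_numeral: "scale3 (numeral k) (a, b, c) = (numeral k * a, numeral k * b, numeral k * (c :: int poly poly))"
  by (simp add: scale3_def)

lemma red_2 [simp]: "red 2 = 0"
  using red_two[of 1] by simp

lemma tau_le: "tau n \<le> n div 2 + 1"
proof -
  have "tau n \<le> (n + 3) div 3" by (simp add: tau_def)
  also have "\<dots> \<le> n div 2 + 1" by linarith
  finally show ?thesis .
qed

lemma add_subgroup_sums: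
  assumes P: "add_subgroup P" and Q: "add_subgroup Q"
  shows "add_subgroup ((\<lambda>(p, q). p + q) ` (P \<times> Q))"
  unfolding add_subgroup_def
proof (intro conjI ballI)
  have "(0, 0) \<in> P \<times> Q" using add_subgroupD(1)[OF P] add_subgroupD(1)[OF Q] by blast
  then show "0 \<in> (\<lambda>(p, q). p + q) ` (P \<times> Q)" by (rule rev_image_eqI) simp
  fix a b assume "a \<in> (\<lambda>(p, q). p + q) ` (P \<times> Q)" "b \<in> (\<lambda>(p, q). p + q) ` (P \<times> Q)"
  then obtain x y x' y' where *: "x \<in> P" "y \<in> Q" "x' \<in> P" "y' \<in> Q" "a = x + y" "b = x' + y'"
    by auto
  then have "(x - x', y - y') \<in> P \<times> Q" using add_subgroupD(2)[OF P] add_subgroupD(2)[OF Q] by blast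
  then show "a - b \<in> (\<lambda>(p, q). p + q) ` (P \<times> Q)" by (rule rev_image_eqI) (simp add: *)
qed

subsection \<open>Odd polynomial degree\<close>

lemma cobs_odd_double:
  assumes d: "odd d" and z: "z \<in> cocyc p d"
  shows "scale3 2 z \<in> cobs p d"
proof (cases p)
  case True
  then obtain c where c: "z = (0, 0, c)" "homog d c"
    using z d by (cases z) (auto simp: cocyc_odd)
  have "scale3 2 z = (0, 0, 0 + actS 0 - altR 0 + 2 * c)"
    by (simp add: c scale3_numeral altR_def)
  then have "scale3 2 z \<in> cobs True d"
    unfolding cobs_odd(1)[OF d] using c(2) homog_0 by blast
  then show ?thesis using True by simp
next
  case False
  then obtain a b c where z': "z = (a, b, c)" "homog d a" "homog d b" "homog d c" "a + actS a - altR b = - (2 * c)"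
    using z d by (cases z) (auto simp: cocyc_odd)
  \<comment> \<open>The gluing relation says that the difference of these two forms is
    \<open>2 * c\<close>; the identities for \<open>actS\<close> and \<open>actR\<close> in odd
    degree give the other two entries.\<close>
  let ?\<alpha> = "- (a + actS a)" and ?\<beta> = "- altR b"
  have "actS (actS a) = - a" using actS_actS[OF z'(2)] d by simp
  then have 1: "actS ?\<alpha> - ?\<alpha> = 2 * a" by (simp add: algebra_simps)
  have 2: "- actR ?\<beta> - ?\<beta> = 2 * b" by (simp add: altR_def actR_order)
  have 3: "?\<alpha> - ?\<beta> = 2 * c" using z'(5) by (simp add: algebra_simps eq_neg_iff_add_eq_0 add_eq_0_iff)
  have "homog d ?\<alpha>" "homog d ?\<beta>"
    unfolding altR_def using z' by (intro homog_minus homog_add homog_diff homog_act; simp)+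
  moreover have "scale3 2 z = (actS ?\<alpha> - ?\<alpha>, - actR ?\<beta> - ?\<beta>, ?\<alpha> - ?\<beta>)"
    unfolding 1 2 3 by (simp add: z' scale3_numeral)
  ultimately have "scale3 2 z \<in> cobs False d"
    unfolding cobs_odd(2)[OF d] by blast
  then show ?thesis using False by simp
qed

context cohomology_presentation
begin

lemma odd_degree_exponent: "odd d \<Longrightarrow> x \<in> carrier H \<Longrightarrow> x [^]\<^bsub>H\<^esub> (2::nat) = \<one>\<^bsub>H\<^esub>"
  using cobs_odd_double by (intro exponent) auto

lemma odd_degree_rank_3:
  assumes "odd d"
  shows "card (carrier (H Mod nat_powers H 3)) = 3 ^ 0"
proof (rule card_mod_p_trivial)
  fix z assume z: "z \<in> cocyc p d"
  obtain a b c where abc: "z = (a, b, c)" by (cases z)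
  have "z - scale3 3 z = - scale3 2 z" by (simp add: abc scale3_numeral)
  then have "z - scale3 3 z \<in> cobs p d" using cobs_closed(3)[OF cobs_odd_double[OF assms z]] by simp
  then show "\<exists>w\<in>cocyc p d. z - scale3 3 w \<in> cobs p d" using z by blast
qed

text \<open>The group is the space of forms modulo 2 divided by the norms of S plus the invariants
  of R. The sum is counted through the intersection, which is \<open>formsI\<close> because in odd
  degree the norms of S are all of its invariants.\<close>

lemma odd_degree_rank_2_even:
  assumes p: "p" and n: "odd n" "d = int n"
  shows "card (carrier (H Mod nat_powers H 2)) = 2 ^ (n div 2 + 1 + inv_dim n - tau n)"
proof -
  have d: "odd d" using n by simp
  let ?Y = "(\<lambda>(p, q). p + q) ` (imageS d \<times> formsR d)"
  have Z: "(a, b, c) \<in> cocyc p d \<longleftrightarrow> a = 0 \<and> b = 0 \<and> homog d c" for a b c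
    using p cocyc_odd(1)[OF d] by simp
  show ?thesis
  proof (rule card_mod_p[where f = "\<lambda>(a, b, c). red c" and Q = "forms d" and Y = ?Y])
    show "(case z + w of (a, b, c) \<Rightarrow> red c) = (case z of (a, b, c) \<Rightarrow> red c) + (case w of (a, b, c) \<Rightarrow> red c)" for z w
      by (cases z; cases w) simp
    show "(\<lambda>(a, b, c). red c) ` cocyc p d = forms d"
    proof (intro equalityI subsetI)
      fix v assume "v \<in> forms d"
      then obtain c where "homog d c" "red c = v" using red_surj by (auto simp: forms_def)
      then show "v \<in> (\<lambda>(a, b, c). red c) ` cocyc p d"
        using Z[of 0 0 c] by force
    qed (use Z homog_red in \<open>force simp: forms_def\<close>)
    show "add_subgroup (forms d)" by (rule forms_subgroups)
    show "add_subgroup ?Y"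
      using imageS_subgroup forms_subgroups(3) by (rule add_subgroup_sums)
    show "?Y \<subseteq> forms d"
    proof
      fix v assume "v \<in> ?Y"
      then obtain x y where "x \<in> imageS d" "y \<in> formsR d" "v = x + y" by auto
      then show "v \<in> forms d" using imageS_subset homog_add by (fastforce simp: formsS_def formsR_def forms_def)
    qed
    show "finite (forms d)" using card_forms n by simp
    show "card (forms d) = card ?Y * 2 ^ (n div 2 + 1 + inv_dim n - tau n)"
    proof -
      have fin: "finite (imageS d)" "finite (formsR d)" using card_forms[of n] card_formsR[of n] n by (auto simp: imageS_def)
      have "imageS d \<inter> formsR d = formsI d" using imageS_odd[OF n(1)] n by (simp add: formsI_def)
      then have "2 ^ (n - n div 2) * 2 ^ tau n = card ?Y * 2 ^ inv_dim n"
        using card_sum_Int[OF imageS_subgroup fin(1) forms_subgroups(3) fin(2)]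
          card_imageS[of n] card_formsR[of n] card_formsI[of n] n by simp
      then have "card ?Y * 2 ^ (n div 2 + 1 + inv_dim n - tau n) * 2 ^ inv_dim n
         = 2 ^ (n - n div 2) * 2 ^ tau n * 2 ^ (n div 2 + 1 + inv_dim n - tau n)" by simp
      also have "\<dots> = 2 ^ (n - n div 2 + tau n + (n div 2 + 1 + inv_dim n - tau n))" by (simp only: power_add)
      also have "n - n div 2 + tau n + (n div 2 + 1 + inv_dim n - tau n) = (n + 1) + inv_dim n"
        using tau_le[of n] by linarith
      also have "2 ^ ((n + 1) + inv_dim n) = card (forms d) * 2 ^ inv_dim n"
        using card_forms[of n] n by (simp add: power_add)
      finally show ?thesis by simp
    qed
    fix z assume z: "z \<in> cocyc p d"
    then obtain c where c: "z = (0, 0, c)" "homog d c" using Z by (cases z) auto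
    show "(case z of (a, b, c) \<Rightarrow> red c) \<in> ?Y \<longleftrightarrow> (\<exists>w\<in>cocyc p d. z - scale3 2 w \<in> cobs p d)"
    proof
      assume "(case z of (a, b, c) \<Rightarrow> red c) \<in> ?Y"
      then obtain x y where xy: "x \<in> imageS d" "y \<in> formsR d" "red c = x + y" using c by auto
      obtain u where u: "homog d u" "x = u + actS u" using xy(1) by (auto simp: imageS_def forms_def)
      obtain \<alpha> \<beta> where \<alpha>: "homog d \<alpha>" "red \<alpha> = u" and \<beta>: "homog d \<beta>" "red \<beta> = y"
        using red_surj u(1) xy(2) by (metis (no_types, lifting) formsR_def forms_def mem_Collect_eq)
      have h: "homog d (\<alpha> + actS \<alpha> - altR \<beta>)"
        unfolding altR_def using \<alpha> \<beta> by (intro homog_diff homog_add homog_act)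
      have "red c = red (\<alpha> + actS \<alpha> - altR \<beta>)"
        using xy u \<alpha> \<beta> normR_bit[OF xy(2)] by (simp add: red_altR)
      then obtain \<gamma> where \<gamma>: "homog d \<gamma>" "c - (\<alpha> + actS \<alpha> - altR \<beta>) = 2 * \<gamma>" using red_eq[OF c(2) h] by blast
      then have "c = \<alpha> + actS \<alpha> - altR \<beta> + 2 * \<gamma>" by (simp add: algebra_simps)
      then have "z \<in> cobs True d" unfolding cobs_odd(1)[OF d] using c \<alpha> \<beta> \<gamma> by blast
      then have "z - scale3 2 0 \<in> cobs p d" using p by (simp add: scale3_def zero_prod_def c)
      then show "\<exists>w\<in>cocyc p d. z - scale3 2 w \<in> cobs p d" using cocyc_closed(1) by blast
    next
      assume "\<exists>w\<in>cocyc p d. z - scale3 2 w \<in> cobs p d"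
      then obtain w where w: "w \<in> cocyc p d" "z - scale3 2 w \<in> cobs True d" using p by auto
      obtain e where e: "w = (0, 0, e)" using w Z by (cases w) auto
      obtain \<alpha> \<beta> \<gamma> where *: "homog d \<alpha>" "homog d \<beta>" "c - 2 * e = \<alpha> + actS \<alpha> - altR \<beta> + 2 * \<gamma>"
        using w(2) unfolding cobs_odd(1)[OF d] by (auto simp: c e scale3_numeral)
      have "red c = red (c - 2 * e)" by simp
      also have "\<dots> = (red \<alpha> + actS (red \<alpha>)) + normR (red \<beta>)" unfolding *(3) by (simp add: red_altR)
      finally have "red c = (red \<alpha> + actS (red \<alpha>)) + normR (red \<beta>)" .
      moreover have "red \<alpha> + actS (red \<alpha>) \<in> imageS d" "normR (red \<beta>) \<in> formsR d"
        using * homog_red normR_forms by (auto simp: imageS_def forms_def)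
      ultimately show "(case z of (a, b, c) \<Rightarrow> red c) \<in> ?Y" using c by force
    qed
  qed
qed

text \<open>By the gluing relation a + S a agrees modulo 2 with an invariant of R, so its reduction
  is invariant under both substitutions, and all such invariants occur. If the reduction is zero,
  half of a + S a and half of \<open>altR b\<close> form a cochain with the given
  coboundary.\<close>

lemma odd_degree_rank_2_odd:
  assumes p: "\<not> p" and n: "odd n" "d = int n"
  shows "card (carrier (H Mod nat_powers H 2)) = 2 ^ inv_dim n"
proof -
  have d: "odd d" using n by simp
  have Z: "(a, b, c) \<in> cocyc p d \<longleftrightarrow> homog d a \<and> homog d b \<and> homog d c \<and> a + actS a - altR b = - (2 * c)" for a b c
    using p cocyc_odd(2)[OF d] by simp
  have SS: "actS (actS f) = - f" if "homog d f" for f :: "int poly poly" using actS_actS[OF that] d by simp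
  show ?thesis
  proof (rule card_mod_p[where f = "\<lambda>(a, b, c). red (a + actS a)" and Q = "formsI d" and Y = "{0}"])
    show "(case z + w of (a, b, c) \<Rightarrow> red (a + actS a)) = (case z of (a, b, c) \<Rightarrow> red (a + actS a)) + (case w of (a, b, c) \<Rightarrow> red (a + actS a))" for z w
      by (cases z; cases w) (simp add: add_ac)
    show "(\<lambda>(a, b, c). red (a + actS a)) ` cocyc p d = formsI d"
    proof (intro equalityI subsetI)
      fix v assume "v \<in> (\<lambda>(a, b, c). red (a + actS a)) ` cocyc p d"
      then obtain a b c where z: "homog d a" "homog d b" "a + actS a - altR b = - (2 * c)" "v = red (a + actS a)"
        using Z by auto
      have "red (a + actS a) = red (a + actS a - altR b) + red (altR b)" by (simp add: add.assoc)
      also have "\<dots> = normR (red b)" unfolding z(3) by (simp add: red_altR)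
      finally have "v \<in> formsR d" using z homog_red normR_forms by (auto simp: forms_def)
      moreover have "v \<in> imageS d" using z homog_red by (auto simp: imageS_def forms_def)
      ultimately show "v \<in> formsI d" using imageS_subset by (auto simp: formsI_def)
    next
      fix v assume v: "v \<in> formsI d"
      then have "v \<in> imageS d" using imageS_odd[OF n(1)] n by (simp add: formsI_def)
      then obtain u where u: "homog d u" "v = u + actS u" by (auto simp: imageS_def forms_def)
      obtain a where a: "homog d a" "red a = u" using u red_surj by blast
      obtain b where b: "homog d b" "red (normR b) = v" using v lift_invariant by (auto simp: formsI_def)
      have "red (a + actS a) = red (altR b)" using a b u by (simp add: red_altR red_normR)
      moreover have "homog d (a + actS a)" "homog d (altR b)"
        unfolding altR_def using a b by (intro homog_diff homog_add homog_act; simp)+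
      ultimately obtain c where "homog d c" "a + actS a - altR b = 2 * c" using red_eq by blast
      then have "(a, b, - c) \<in> cocyc p d" using Z a b homog_minus by simp
      moreover have "red (a + actS a) = v" using a u by simp
      ultimately show "v \<in> (\<lambda>(a, b, c). red (a + actS a)) ` cocyc p d" by force
    qed
    show "add_subgroup (formsI d)" by (rule forms_subgroups)
    show "{0} \<subseteq> formsI d" using add_subgroupD(1)[OF forms_subgroups(4)] by simp
    show "card (formsI d) = card {0::bpoly} * 2 ^ inv_dim n" "finite (formsI d)" using card_formsI[of n] n by simp_all
    fix z assume z: "z \<in> cocyc p d"
    then obtain a b c where abc: "z = (a, b, c)" "homog d a" "homog d b" "homog d c" "a + actS a - altR b = - (2 * c)"
      using Z by (cases z) auto
    show "(case z of (a, b, c) \<Rightarrow> red (a + actS a)) \<in> {0} \<longleftrightarrow> (\<exists>w\<in>cocyc p d. z - scale3 2 w \<in> cobs p d)"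
    proof
      assume "(case z of (a, b, c) \<Rightarrow> red (a + actS a)) \<in> {0}"
      then have "red (a + actS a) = 0" using abc by simp
      then obtain m where m: "homog d m" "a + actS a = 2 * m"
        using red_eq_0[OF homog_add[OF abc(2) homog_act(1)[OF abc(2)]]] by blast
      \<comment> \<open>Applying 1 - S to a + S a gives 2 a, because \<open>actS\<close> squares to
        -1.\<close>
      have "2 * (m - actS m) = 2 * m - actS (2 * m)"
        by (simp flip: PK_numeral) (simp add: algebra_simps)
      also have "\<dots> = 2 * a" unfolding m(2)[symmetric] using SS[OF abc(2)] by simp
      finally have 1: "a = actS (- m) - (- m)" by simp
      let ?m' = "m + c"
      have alt: "altR b = 2 * ?m'" using abc(5) m(2) by (simp add: algebra_simps)
      have "2 * (- actR (- ?m') - (- ?m')) = actR (2 * ?m') + 2 * ?m'"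
        by (simp flip: PK_numeral) (simp add: algebra_simps)
      also have "\<dots> = 2 * b" unfolding alt[symmetric] by (simp add: altR_def actR_order)
      finally have 2: "b = - actR (- ?m') - (- ?m')" by simp
      have "z = (actS (- m) - (- m), - actR (- ?m') - (- ?m'), - m - (- ?m'))"
        using abc(1) 1 2 by simp
      moreover note homog_minus[OF m(1)] homog_minus[OF homog_add[OF m(1) abc(4)]]
      ultimately have "z \<in> cobs False d" unfolding cobs_odd(2)[OF d] by blast
      then have "z - scale3 2 0 \<in> cobs p d" using p by (simp add: scale3_def zero_prod_def abc(1))
      then show "\<exists>w\<in>cocyc p d. z - scale3 2 w \<in> cobs p d" using cocyc_closed(1) by blast
    next
      assume "\<exists>w\<in>cocyc p d. z - scale3 2 w \<in> cobs p d"
      then obtain w where w: "w \<in> cocyc p d" "z - scale3 2 w \<in> cobs False d" using p by auto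
      obtain w1 w2 w3 where w': "w = (w1, w2, w3)" by (cases w)
      obtain \<alpha> where \<alpha>: "homog d \<alpha>" "a - 2 * w1 = actS \<alpha> - \<alpha>"
        using w(2) unfolding cobs_odd(2)[OF d] by (auto simp: abc(1) w' scale3_numeral)
      have "red a = red (a - 2 * w1)" by simp
      also have "\<dots> = actS (red \<alpha>) + red \<alpha>" unfolding \<alpha>(2) by simp
      finally have "red a = actS (red \<alpha>) + red \<alpha>" .
      moreover have "actS (actS (red \<alpha>)) = red \<alpha>" using actS_actS[OF homog_red[OF \<alpha>(1)]] by (simp split: if_splits)
      ultimately have "red (a + actS a) = (red \<alpha> + red \<alpha>) + (actS (red \<alpha>) + actS (red \<alpha>))" by (simp only: red_add red_act act_simps add_ac)
      then show "(case z of (a, b, c) \<Rightarrow> red (a + actS a)) \<in> {0}" using abc(1) by simp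
    qed
  qed (auto simp: add_subgroup_def)
qed

end

subsection \<open>Even polynomial degree\<close>

lemma int_numeral_simps [simp]:
  "actS (numeral k) = (numeral k :: int poly poly)" "actR (numeral k) = (numeral k :: int poly poly)"
  "normR (numeral k * f) = numeral k * normR (f :: int poly poly)"
  by (simp_all flip: PK_numeral)

lemma homog_numeral_mult: "homog d f \<Longrightarrow> homog d (numeral k * f :: int poly poly)"
  unfolding PK_numeral[symmetric] by (rule homog_PK_mult)

lemmas homog_intros = homog_add homog_diff homog_minus homog_act homog_PK_mult homog_numeral_mult homog_normR homog_0

text \<open>For \<open>True\<close> the third entry is forced: forms have no torsion and a cocycle
  satisfies a - b = 2 * c.\<close>

lemma cobs_evenI:
  assumes "even d" "homog d \<alpha>" "homog d \<beta>"
  shows "(a, b, c) \<in> cocyc True d \<Longrightarrow> a = 2 * (\<alpha> + actS \<alpha>) \<Longrightarrow> b = 2 * normR \<beta> \<Longrightarrow> (a, b, c) \<in> cobs True d"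
    and "homog d \<gamma> \<Longrightarrow> a = actS \<alpha> - \<alpha> \<Longrightarrow> b = actR \<beta> - \<beta> \<Longrightarrow> c = \<alpha> - \<beta> - 2 * \<gamma> \<Longrightarrow> (a, b, c) \<in> cobs False d"
proof -
  assume z: "(a, b, c) \<in> cocyc True d" and ab: "a = 2 * (\<alpha> + actS \<alpha>)" "b = 2 * normR \<beta>"
  have "2 * c = a - b" using z cocyc_even(1)[OF assms(1)] by simp
  also have "\<dots> = 2 * (\<alpha> + actS \<alpha> - normR \<beta>)" by (simp add: ab algebra_simps)
  finally have "c = \<alpha> + actS \<alpha> - normR \<beta>" by simp
  then show "(a, b, c) \<in> cobs True d"
    unfolding cobs_even(1)[OF assms(1)] using ab assms by blast
next
  assume "homog d \<gamma>" "a = actS \<alpha> - \<alpha>" "b = actR \<beta> - \<beta>" "c = \<alpha> - \<beta> - 2 * \<gamma>"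
  then show "(a, b, c) \<in> cobs False d"
    unfolding cobs_even(2)[OF assms(1)] using assms by blast
qed

lemma cobs_evenE:
  assumes "even d" "(a, b, c) \<in> cobs p d"
  obtains (True) \<alpha> \<beta> where "p" "homog d \<alpha>" "homog d \<beta>" "a = 2 * (\<alpha> + actS \<alpha>)" "b = 2 * normR \<beta>" "c = \<alpha> + actS \<alpha> - normR \<beta>"
  | (False) \<alpha> \<beta> \<gamma> where "\<not> p" "homog d \<alpha>" "homog d \<beta>" "homog d \<gamma>" "a = actS \<alpha> - \<alpha>" "b = actR \<beta> - \<beta>" "c = \<alpha> - \<beta> - 2 * \<gamma>"
proof (cases p)
  case True
  then have "(a, b, c) \<in> cobs True d" using assms(2) by simp
  then show ?thesis unfolding cobs_even(1)[OF assms(1)] using that(1) True by blast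
next
  case False
  then have "(a, b, c) \<in> cobs False d" using assms(2) by simp
  then show ?thesis unfolding cobs_even(2)[OF assms(1)] using that(2) False by blast
qed

lemma actS_invariant:
  fixes a :: "int poly poly"
  assumes d: "even d" and a: "homog d a" "actS a = a"
  obtains \<alpha> k where "homog d \<alpha>" "a = \<alpha> + actS \<alpha> + PK k * middle d" "k = 0 \<or> 0 \<le> d \<and> even (nat d div 2)"
proof -
  have "actS a = PK 1 * a" using a by (simp add: PK_simps)
  then obtain \<alpha> k where "homog d \<alpha>" "a = \<alpha> + PK 1 * actS \<alpha> + PK k * (PX * PY) ^ (nat d div 2)"
    "k = 0 \<or> 0 \<le> d \<and> (1::int) = (- 1) ^ (nat d div 2)"
    using actS_eigenvector[OF a(1) d, of 1] by blast
  then show ?thesis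
    by (intro that[of \<alpha> k]) (auto simp: PK_simps middle_def minus_one_power_iff split: if_splits)
qed

lemma actS_antiinvariant:
  fixes a :: "int poly poly"
  assumes d: "even d" and a: "homog d a" "actS a = - a"
  obtains \<alpha> k where "homog d \<alpha>" "a = \<alpha> - actS \<alpha> + PK k * middle d" "k = 0 \<or> 0 \<le> d \<and> odd (nat d div 2)"
proof -
  have "actS a = PK (- 1) * a" using a by (simp add: PK_simps)
  then obtain \<alpha> k where "homog d \<alpha>" "a = \<alpha> + PK (- 1) * actS \<alpha> + PK k * (PX * PY) ^ (nat d div 2)"
    "k = 0 \<or> 0 \<le> d \<and> (- 1::int) = (- 1) ^ (nat d div 2)"
    using actS_eigenvector[OF a(1) d, of "- 1"] by blast
  then show ?thesis
    by (intro that[of \<alpha> k]) (auto simp: PK_simps middle_def minus_one_power_iff split: if_splits)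
qed

lemma actS_middle:
  assumes "even d" "0 \<le> d"
  shows "actS (middle d) = (if even (nat d div 2) then middle d else - middle d)"
  using middle_props(2)[OF assms] by (simp add: PK_simps minus_one_power_iff)

text \<open>The middle monomial is invariant exactly if half of the degree is even. This cocycle
  represents the class that will be the double of a class of order 4.\<close>

lemma middle_cocycle:
  assumes "even d" "0 \<le> d" "even (nat d div 2)"
  shows "(2 * middle d, 0, middle d) \<in> cocyc True d"
  using assms middle_props(1)[OF assms(1,2)] actS_middle[OF assms(1,2)]
  by (simp add: cocyc_even homog_numeral_mult)

lemma scale_cocycle: "(a, b, c) \<in> cocyc p d \<Longrightarrow> (PK k * a, PK k * b, PK k * c) \<in> cocyc p d"
proof (induction k rule: int_induct[where k = 0])
  case base
  then show ?case using cocyc_closed(1)[of p d] by (simp add: PK_simps zero_prod_def)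
next
  case (step1 i)
  then show ?case using cocyc_closed(4)[OF step1(2) step1(3)] step1 by (simp add: PK_simps algebra_simps)
next
  case (step2 i)
  then show ?case using cocyc_closed(2)[OF step2(2) step2(3)] step2 by (simp add: PK_simps algebra_simps)
qed

text \<open>
  A power of the Dickson invariant of degree 2 lifts to a class of order 4: its double is the class
  of the cocycle \<open>(2 * middle d, 0, middle d)\<close>.
\<close>

lemma generator_cocycle:
  assumes d: "even d" "0 \<le> d" "even (nat d div 2)"
  obtains \<alpha> \<beta> c where "homog d \<alpha>" "homog d \<beta>" "(\<alpha> + actS \<alpha> + middle d, normR \<beta>, c) \<in> cocyc True d"
proof -
  define n where "n = nat d"
  have n: "d = int n" "even n" using d by (auto simp: n_def even_nat_iff)
  let ?v = "dickson2 ^ (n div 2)"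
  note v = even_invariant[OF n(2)]
  have v': "?v \<in> formsS d" "?v \<in> formsR d" using v(1) n by (auto simp: formsI_def)
  obtain a where a: "homog d a" "actS a = PK 1 * a" "red a = ?v"
    using lift_eigenvector[OF d(1,2) _ v'(1), of 1] d(3) by (auto simp: minus_one_power_iff)
  obtain \<beta> where \<beta>: "homog d \<beta>" "red (normR \<beta>) = ?v" using lift_invariant[OF v'(2)] by blast
  obtain c where c: "homog d c" "a - normR \<beta> = 2 * c"
    using red_eq[OF a(1) homog_normR[OF \<beta>(1)]] a \<beta> by auto
  have Sa: "actS a = a" using a(2) by (simp add: PK_simps)
  obtain \<alpha> k where \<alpha>: "homog d \<alpha>" "a = \<alpha> + actS \<alpha> + PK k * middle d"
    using actS_invariant[OF d(1) a(1) Sa] by blast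
  have z: "(a, normR \<beta>, c) \<in> cocyc True d"
    using a \<beta> c d by (simp add: cocyc_even homog_normR PK_simps)
  \<comment> \<open>Norms vanish at (1, 1) modulo 2, while the Dickson power and the middle monomial
    have the value 1 there.\<close>
  have "odd k"
  proof -
    have "red \<alpha> + actS (red \<alpha>) \<in> imageS d" using homog_red[OF \<alpha>(1)] by (auto simp: imageS_def forms_def)
    then have "ev 1 1 (red \<alpha> + actS (red \<alpha>)) = 0" using imageS_subset by blast
    then have "ev 1 1 (red a) = of_int k"
      using middle_props(3)[OF d(1,2)] by (simp add: \<alpha>(2))
    then show ?thesis using v(3) a(3) of_int_bit_eq_0[of k] by auto
  qed
  then obtain l where l: "k = 2 * l + 1" by (auto elim: oddE)
  \<comment> \<open>Subtracting \<open>l\<close> times the cocycle of the middle monomial reduces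
    its odd coefficient to 1.\<close>
  have "(a, normR \<beta>, c) - (PK l * (2 * middle d), PK l * 0, PK l * middle d) \<in> cocyc True d"
    using cocyc_closed(2)[OF z scale_cocycle[OF middle_cocycle[OF d]]] .
  moreover have "a - PK l * (2 * middle d) = \<alpha> + actS \<alpha> + middle d"
    by (simp add: \<alpha>(2) l PK_simps PK_numeral algebra_simps)
  ultimately have "(\<alpha> + actS \<alpha> + middle d, normR \<beta>, c - PK l * middle d) \<in> cocyc True d" by simp
  then show ?thesis using that \<alpha>(1) \<beta>(1) by blast
qed

text \<open>Invariants of S modulo norms are multiples of the middle monomial, which by
  \<open>generator_cocycle\<close> is the first entry of a cocycle up to a norm. So every invariant
  extends to a cocycle after correction by a norm.\<close>

lemma actS_invariant_cocycle:
  assumes d: "even d" and a: "homog d a" "actS a = a"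
  obtains \<alpha> a' b' c' where "homog d \<alpha>" "(a', b', c') \<in> cocyc True d" "a = \<alpha> + actS \<alpha> + a'"
proof -
  obtain \<alpha> k where \<alpha>: "homog d \<alpha>" "a = \<alpha> + actS \<alpha> + PK k * middle d" "k = 0 \<or> 0 \<le> d \<and> even (nat d div 2)"
    using actS_invariant[OF d a] by blast
  show ?thesis
  proof (cases "k = 0")
    case True
    then show ?thesis
      using that[OF \<alpha>(1), of 0 0 0] \<alpha>(2) cocyc_closed(1)[of True d] by (simp add: PK_simps zero_prod_def)
  next
    case False
    then have d': "0 \<le> d" "even (nat d div 2)" using \<alpha>(3) by auto
    obtain \<alpha>' \<beta> c where g: "homog d \<alpha>'" "homog d \<beta>" "(\<alpha>' + actS \<alpha>' + middle d, normR \<beta>, c) \<in> cocyc True d"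
      using generator_cocycle[OF d d'] by blast
    have "homog d (\<alpha> - PK k * \<alpha>')" using \<alpha> g by (intro homog_intros)
    moreover have "a = (\<alpha> - PK k * \<alpha>') + actS (\<alpha> - PK k * \<alpha>') + PK k * (\<alpha>' + actS \<alpha>' + middle d)"
      by (simp add: \<alpha>(2) algebra_simps)
    ultimately show ?thesis using that scale_cocycle[OF g(3)] by blast
  qed
qed

text \<open>The factor 3 turns \<open>b\<close> into a norm, or into a difference along
  \<open>actR\<close>. For \<open>a\<close>, a factor 4 always suffices. In even cohomological
  degree a factor 2 suffices when the middle monomial is not S-invariant, as \<open>a\<close> then
  is a norm. In odd cohomological degree 2 suffices for \<open>a\<close> and 3 for \<open>b\<close>
  separately, but a middle monomial in \<open>a\<close> leaves a parity defect in the gluing, which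
  is repaired by invariant forms.\<close>

lemma even_degree_multiples:
  assumes d: "even d"
  shows "z \<in> cocyc p d \<Longrightarrow> scale3 12 z \<in> cobs p d"
    and "\<not> p \<or> odd (nat d div 2) \<Longrightarrow> z \<in> cocyc p d \<Longrightarrow> scale3 6 z \<in> cobs p d"
proof -
  obtain a b c where abc: "z = (a, b, c)" by (cases z)
  have *: "scale3 6 z \<in> cobs p d" if p: "\<not> p \<or> odd (nat d div 2)" and z: "z \<in> cocyc p d"
  proof (cases p)
    case True
    then have "z \<in> cocyc True d" using z by simp
    then have Z: "homog d a" "homog d b" "homog d c" "actS a = a" "actR b = b" "a - b = 2 * c"
      using d by (simp_all add: abc cocyc_even)
    obtain \<alpha> k where "homog d \<alpha>" "a = \<alpha> + actS \<alpha> + PK k * middle d" "k = 0 \<or> 0 \<le> d \<and> even (nat d div 2)"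
      using actS_invariant[OF d Z(1,4)] by blast
    then have \<alpha>: "homog d \<alpha>" "a = \<alpha> + actS \<alpha>" using p True by (auto simp: PK_simps)
    have "(6 * a, 6 * b, 6 * c) \<in> cobs True d"
    proof (rule cobs_evenI(1)[OF d homog_numeral_mult[OF \<alpha>(1), of "num.Bit1 num.One"] Z(2)])
      have "6 * a - 6 * b = 6 * (2 * c)" unfolding Z(6)[symmetric] by (simp add: algebra_simps)
      then show "(6 * a, 6 * b, 6 * c) \<in> cocyc True d"
        using Z d by (simp add: cocyc_even homog_numeral_mult)
      show "6 * a = 2 * (3 * \<alpha> + actS (3 * \<alpha>))" by (simp add: \<alpha>(2) algebra_simps)
      show "6 * b = 2 * normR b" using normR_invariant[OF Z(5)] by (simp add: PK_numeral)
    qed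
    then show ?thesis using True by (simp add: abc scale3_numeral)
  next
    case False
    then have "z \<in> cocyc False d" using z by simp
    then have Z: "homog d a" "homog d b" "homog d c" "actS a = - a" "normR b = 0"
      using d by (simp_all add: abc cocyc_even)
    obtain \<alpha> k where \<alpha>: "homog d \<alpha>" "a = \<alpha> - actS \<alpha> + PK k * middle d" "k = 0 \<or> 0 \<le> d \<and> odd (nat d div 2)"
      using actS_antiinvariant[OF d Z(1,4)] by blast
    have b: "actR (actR b) = - b - actR b"
      using Z(5) by (simp add: normR_def algebra_simps add_eq_0_iff2)
    \<comment> \<open>The repair: an S-invariant \<omega> and an R-invariant \<tau> whose difference
      is the middle monomial modulo 2. \<tau> lifts a Dickson power, and \<omega> lifts the sum of
      that power and the middle monomial, which vanishes at (1, 1) and so is a norm modulo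
      2.\<close>
    have "\<exists>\<omega> \<tau> \<theta>. homog d \<omega> \<and> homog d \<tau> \<and> homog d \<theta> \<and> actS (PK k * \<omega>) = PK k * \<omega> \<and> actR \<tau> = \<tau> \<and>
      actS (PK k * middle d) = - (PK k * middle d) \<and> homog d (PK k * middle d) \<and>
      PK k * (\<omega> - \<tau> - middle d) = 2 * \<theta>"
    proof (cases "k = 0")
      case True
      then show ?thesis by (intro exI[of _ 0]) (simp add: PK_simps)
    next
      case False
      then have d': "0 \<le> d" "odd (nat d div 2)" using \<alpha>(3) by auto
      define n where "n = nat d"
      have n: "d = int n" "even n" using d d' by (auto simp: n_def even_nat_iff)
      let ?v = "dickson2 ^ (n div 2)"
      note v = even_invariant[OF n(2)]
      note mid = middle_props[OF d d'(1)]
      have v': "?v \<in> formsS d" "?v \<in> formsR d" using v(1) n by (auto simp: formsI_def)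
      obtain \<beta> where \<beta>: "homog d \<beta>" "red (normR \<beta>) = ?v" using lift_invariant[OF v'(2)] by blast
      have "red (middle d) \<in> formsS d" using mid homog_red by (simp add: formsS_def forms_def)
      then have "?v + red (middle d) \<in> formsS d" using v'(1) add_subgroupD(4)[OF forms_subgroups(2)] by blast
      moreover have "ev 1 1 (?v + red (middle d)) = 0" using v(3) mid(3) by (simp add: bit_add_self)
      ultimately obtain \<omega> where \<omega>: "homog d \<omega>" "actS \<omega> = PK 1 * \<omega>" "red \<omega> = ?v + red (middle d)"
        using lift_eigenvector[OF d d'(1), of 1] by blast
      have "homog d (\<omega> - normR \<beta> - middle d)" using \<omega> \<beta> mid by (intro homog_intros)
      moreover have "red (\<omega> - normR \<beta> - middle d) = (?v + ?v) + (red (middle d) + red (middle d))"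
        by (simp only: red_diff \<omega>(3) \<beta>(2) add_ac)
      ultimately obtain \<theta> where \<theta>: "homog d \<theta>" "\<omega> - normR \<beta> - middle d = 2 * \<theta>"
        using red_eq_0 by (metis bpoly_double)
      have "PK k * (\<omega> - normR \<beta> - middle d) = 2 * (PK k * \<theta>)" unfolding \<theta>(2) by (rule mult.left_commute)
      then show ?thesis
        using \<omega> \<beta> \<theta> mid(1) actS_middle[OF d d'(1)] d'(2)
        by (intro exI[of _ \<omega>] exI[of _ "normR \<beta>"] exI[of _ "PK k * \<theta>"])
          (simp add: homog_normR homog_PK_mult PK_simps)
    qed
    then obtain \<omega> \<tau> \<theta> where w: "homog d \<omega>" "homog d \<tau>" "homog d \<theta>" "actS (PK k * \<omega>) = PK k * \<omega>" "actR \<tau> = \<tau>"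
      "actS (PK k * middle d) = - (PK k * middle d)" "homog d (PK k * middle d)" "PK k * (\<omega> - \<tau> - middle d) = 2 * \<theta>"
      by blast
    \<comment> \<open>The multiples of \<omega> and \<tau> are invariant and do not affect the first
      two entries of the coboundary; they make the remaining discrepancy in the third entry
      even.\<close>
    let ?\<alpha> = "PK k * \<omega> - 6 * \<alpha> - 3 * (PK k * middle d)" and ?\<beta> = "PK k * \<tau> - 2 * (2 * b + actR b)"
    let ?\<gamma> = "\<theta> - 3 * \<alpha> - PK k * middle d + (2 * b + actR b) - 3 * c"
    have "actS (actS \<alpha>) = \<alpha>" using actS_actS[OF \<alpha>(1)] d by simp
    then have 1: "6 * a = actS ?\<alpha> - ?\<alpha>" using w(4,6) by (simp only: act_simps(3) w(4)) (simp add: \<alpha>(2) algebra_simps)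
    have 2: "6 * b = actR ?\<beta> - ?\<beta>" by (simp add: w(5) b algebra_simps)
    have 3: "6 * c = ?\<alpha> - ?\<beta> - 2 * ?\<gamma>"
      using w(8) by (simp add: algebra_simps)
    have "(6 * a, 6 * b, 6 * c) \<in> cobs False d"
      by (rule cobs_evenI(2)[OF d _ _ _ 1 2 3])
        (intro homog_intros w(1,2,3,7) \<alpha>(1) Z(1-3))+
    then show ?thesis using False by (simp add: abc scale3_numeral)
  qed
  then show "\<not> p \<or> odd (nat d div 2) \<Longrightarrow> z \<in> cocyc p d \<Longrightarrow> scale3 6 z \<in> cobs p d" .
  show "scale3 12 z \<in> cobs p d" if z: "z \<in> cocyc p d"
  proof (cases p)
    case True
    then have "z \<in> cocyc True d" using z by simp
    then have Z: "homog d a" "homog d b" "homog d c" "actS a = a" "actR b = b" "a - b = 2 * c"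
      using d by (simp_all add: abc cocyc_even)
    have "(12 * a, 12 * b, 12 * c) \<in> cobs True d"
    proof (rule cobs_evenI(1)[OF d homog_numeral_mult[OF Z(1), of "num.Bit1 num.One"] homog_numeral_mult[OF Z(2), of "num.Bit0 num.One"]])
      have "12 * a - 12 * b = 12 * (2 * c)" unfolding Z(6)[symmetric] by (simp add: algebra_simps)
      then show "(12 * a, 12 * b, 12 * c) \<in> cocyc True d"
        using Z d by (simp add: cocyc_even homog_numeral_mult)
      show "12 * a = 2 * (3 * a + actS (3 * a))" by (simp add: Z(4))
      show "12 * b = 2 * normR (2 * b)" using normR_invariant[OF Z(5)] by (simp add: PK_numeral)
    qed
    then show ?thesis using True by (simp add: abc scale3_numeral)
  next
    case False
    then have "scale3 6 z + scale3 6 z \<in> cobs p d" using * z cobs_closed(4) by blast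
    then show ?thesis by (simp add: abc scale3_numeral flip: distrib_right)
  qed
qed

context cohomology_presentation
begin

lemma even_degree_exponent:
  assumes "even d" "x \<in> carrier H"
  shows "x [^]\<^bsub>H\<^esub> (12::nat) = \<one>\<^bsub>H\<^esub>"
    and "\<not> p \<or> odd (nat d div 2) \<Longrightarrow> x [^]\<^bsub>H\<^esub> (6::nat) = \<one>\<^bsub>H\<^esub>"
  using even_degree_multiples[OF assms(1)] by (auto intro!: exponent[OF _ assms(2)])

text \<open>Since a - b is even, the common reduction of a and b is invariant under GL_2(F_2). Every
  such invariant lifts, except that those nonzero at (1, 1) need an S-invariant middle monomial. If
  the reduction is zero, \<open>a\<close> and \<open>b\<close> can be halved, and
  \<open>actS_invariant_cocycle\<close> turns the half of \<open>a\<close> into a cocycle modulo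
  norms.\<close>

lemma even_degree_rank_2_even:
  assumes p: "p" and n: "even n" "d = int n"
  shows "card (carrier (H Mod nat_powers H 2)) = 2 ^ (if even (n div 2) then inv_dim n else inv_dim n - 1)"
proof -
  have d: "even d" "0 \<le> d" using n by auto
  have nd: "nat d = n" using n by simp
  have Z: "(a, b, c) \<in> cocyc p d \<longleftrightarrow>
      homog d a \<and> homog d b \<and> homog d c \<and> actS a = a \<and> actR b = b \<and> a - b = 2 * c" for a b c
    using p cocyc_even(1)[OF d(1)] by simp
  let ?Q = "if even (n div 2) then formsI d else {v \<in> formsI d. ev 1 1 v = 0}"
  have red_ab: "red a = red b" if "a - b = 2 * c" for a b c
  proof -
    have "a = b + 2 * c" using that by (simp add: algebra_simps)
    then show ?thesis by simp
  qed
  show ?thesis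
  proof (rule card_mod_p[where f = "\<lambda>(a, b, c). red a" and Q = ?Q and Y = "{0}"])
    show "(case z + w of (a, b, c) \<Rightarrow> red a) = (case z of (a, b, c) \<Rightarrow> red a) + (case w of (a, b, c) \<Rightarrow> red a)" for z w
      by (cases z; cases w) simp
    show "(\<lambda>(a, b, c). red a) ` cocyc p d = ?Q"
    proof (intro equalityI subsetI)
      fix v assume "v \<in> (\<lambda>(a, b, c). red a) ` cocyc p d"
      then obtain a b c where z: "homog d a" "homog d b" "actS a = a" "actR b = b" "a - b = 2 * c" "v = red a"
        using Z by auto
      have S: "actS a = PK 1 * a" using z(3) by (simp add: PK_simps)
      have eig: "red a \<in> formsS d" "(1::int) \<noteq> (- 1) ^ (nat d div 2) \<or> d < 0 \<Longrightarrow> red a \<in> imageS d"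
        using red_eigenvector[OF d(1) _ z(1) S] by blast+
      have "actR (red a) = red a" using red_ab[OF z(5)] z(4) by (metis red_act(2))
      then have I: "red a \<in> formsI d" using eig(1) by (simp add: formsI_def formsS_def formsR_def)
      moreover have "ev 1 1 (red a) = 0" if "odd (n div 2)"
      proof -
        have "red a \<in> imageS d" using that nd by (intro eig(2)) (simp add: minus_one_power_iff)
        then show ?thesis using imageS_subset by blast
      qed
      ultimately show "v \<in> ?Q" using z(6) by simp
    next
      fix v assume v: "v \<in> ?Q"
      then have v': "v \<in> formsS d" "v \<in> formsR d" by (auto simp: formsI_def split: if_splits)
      have "(1::int) = (- 1) ^ (nat d div 2) \<or> ev 1 1 v = 0"
        using v nd by (auto simp: minus_one_power_iff split: if_splits)
      then obtain a where a: "homog d a" "actS a = PK 1 * a" "red a = v"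
        using lift_eigenvector[OF d _ v'(1), of 1] by blast
      obtain \<beta> where \<beta>: "homog d \<beta>" "red (normR \<beta>) = v" using lift_invariant[OF v'(2)] by blast
      obtain c where c: "homog d c" "a - normR \<beta> = 2 * c"
        using red_eq[OF a(1) homog_normR[OF \<beta>(1)]] a \<beta> by auto
      have "(a, normR \<beta>, c) \<in> cocyc p d" using a \<beta> c by (simp add: Z homog_normR PK_simps)
      then show "v \<in> (\<lambda>(a, b, c). red a) ` cocyc p d" using a(3) by force
    qed
    show "add_subgroup ?Q"
      using forms_subgroups(4)[of d] add_subgroupD[OF forms_subgroups(4)[of d]] by (simp add: add_subgroup_def)
    then show "{0} \<subseteq> ?Q" using add_subgroupD(1) by blast
    show "finite ?Q" using card_formsI[of n] n by simp
    have "inv_dim n = Suc (inv_dim n - 1)" using n by (simp add: inv_dim_def)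
    then have "2 ^ inv_dim n = (2 * 2 ^ (inv_dim n - 1) :: nat)" by (metis power_Suc)
    moreover have "card (formsI d) = 2 * card {v \<in> formsI d. ev 1 1 v = 0}"
      using card_formsI[of n] even_invariant[OF n(1)] n by (intro card_eval11[OF forms_subgroups(4)]) auto
    ultimately show "card ?Q = card {0 :: bpoly} * 2 ^ (if even (n div 2) then inv_dim n else inv_dim n - 1)"
      using card_formsI[of n] n by simp
    fix z assume z: "z \<in> cocyc p d"
    then obtain a b c where abc: "z = (a, b, c)" "homog d a" "homog d b" "homog d c" "actS a = a" "actR b = b" "a - b = 2 * c"
      using Z by (cases z) auto
    show "(case z of (a, b, c) \<Rightarrow> red a) \<in> {0} \<longleftrightarrow> (\<exists>w\<in>cocyc p d. z - scale3 2 w \<in> cobs p d)"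
    proof
      assume "(case z of (a, b, c) \<Rightarrow> red a) \<in> {0}"
      then have "red a = 0" "red b = 0" using abc red_ab[OF abc(7)] by auto
      then obtain a2 b2 where a2: "homog d a2" "a = 2 * a2" and b2: "homog d b2" "b = 2 * b2"
        using red_eq_0 abc(2,3) by metis
      have a2S: "actS a2 = a2" and b2R: "actR b2 = b2" using abc(5,6) a2(2) b2(2) by simp_all
      have "2 * (a2 - b2) = 2 * c" using abc(7) unfolding a2(2) b2(2) by (simp add: algebra_simps)
      then have c: "c = a2 - b2" by simp
      obtain \<alpha> a' b' c' where w: "homog d \<alpha>" "(a', b', c') \<in> cocyc True d" "a2 = \<alpha> + actS \<alpha> + a'"
        using actS_invariant_cocycle[OF d(1) a2(1) a2S] by blast
      have w': "homog d a'" "homog d b'" "homog d c'" "actS a' = a'" "actR b' = b'" "a' - b' = 2 * c'"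
        using w(2) by (simp_all add: cocyc_even d)
      \<comment> \<open>The second entry is chosen so that subtracting its double from
        \<open>b\<close> leaves six times \<open>b2 - b'\<close>, which is twice the norm of this
        invariant form.\<close>
      let ?w = "(a', b' - 2 * (b2 - b'), c' + (b2 - b'))"
      have e: "a' = b' + 2 * c'" using w'(6) by (simp add: algebra_simps)
      have wZ: "?w \<in> cocyc p d"
        unfolding Z
      proof (intro conjI)
        show "homog d (b' - 2 * (b2 - b'))" "homog d (c' + (b2 - b'))" by (intro homog_intros w'(2,3) b2(1))+
        show "a' - (b' - 2 * (b2 - b')) = 2 * (c' + (b2 - b'))" by (simp add: e algebra_simps)
      qed (use w' b2R in simp_all)
      have N: "normR (b2 - b') = 3 * (b2 - b')" using normR_invariant[of "b2 - b'"] b2R w'(5) by (simp add: PK_numeral)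
      have h: "homog d (b2 - b')" using b2 w' by (intro homog_intros)
      have eq: "z - scale3 2 ?w = (a - 2 * a', b - 2 * (b' - 2 * (b2 - b')), c - 2 * (c' + (b2 - b')))"
        by (simp add: abc(1) scale3_numeral)
      have "z - scale3 2 ?w = z - (?w + ?w)" by (simp add: scale3_numeral)
      then have mem: "z - scale3 2 ?w \<in> cocyc True d"
        using z wZ p cocyc_closed(2,4) by metis
      have "z - scale3 2 ?w \<in> cobs True d"
        unfolding eq
      proof (rule cobs_evenI(1)[OF d(1) w(1) h])
        show "(a - 2 * a', b - 2 * (b' - 2 * (b2 - b')), c - 2 * (c' + (b2 - b'))) \<in> cocyc True d"
          using mem unfolding eq .
        show "a - 2 * a' = 2 * (\<alpha> + actS \<alpha>)" by (simp add: a2(2) w(3) algebra_simps)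
        show "b - 2 * (b' - 2 * (b2 - b')) = 2 * normR (b2 - b')" unfolding N by (simp add: b2(2) algebra_simps)
      qed
      then have "z - scale3 2 ?w \<in> cobs p d" using p by simp
      then show "\<exists>w\<in>cocyc p d. z - scale3 2 w \<in> cobs p d" using wZ by blast
    next
      assume "\<exists>w\<in>cocyc p d. z - scale3 2 w \<in> cobs p d"
      then obtain w where w: "z - scale3 2 w \<in> cobs p d" by auto
      obtain w1 w2 w3 where w': "w = (w1, w2, w3)" by (cases w)
      have "(a - 2 * w1, b - 2 * w2, c - 2 * w3) \<in> cobs p d" using w by (simp add: abc(1) w' scale3_numeral)
      then obtain \<alpha> where \<alpha>: "a - 2 * w1 = 2 * (\<alpha> + actS \<alpha>)"
        using p by (elim cobs_evenE[OF d(1)]) auto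
      have "red a = red (a - 2 * w1)" by simp
      also have "\<dots> = 0" unfolding \<alpha> by simp
      finally show "(case z of (a, b, c) \<Rightarrow> red a) \<in> {0}" using abc(1) by simp
    qed
  qed (auto simp: add_subgroup_def)
qed

text \<open>The map \<open>?f\<close> is made to cancel \<alpha> on coboundaries: the third entry
  determines \<alpha> up to \<beta> modulo 2, and adding \<open>actR (red b)\<close> completes
  \<beta> to its norm. What survives is (1 + S) applied to an R-invariant. These values are counted
  by \<open>tau\<close> minus \<open>inv_dim\<close>, since the kernel of 1 + S on R-invariants is
  \<open>formsI\<close>.\<close>

lemma even_degree_rank_2_odd:
  assumes p: "\<not> p" and n: "even n" "d = int n"
  shows "card (carrier (H Mod nat_powers H 2)) = 2 ^ (n div 2 + (if even (n div 2) then 0 else 1) + inv_dim n - tau n)"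
    (is "_ = 2 ^ ?r")
proof -
  have d: "even d" "0 \<le> d" using n by auto
  have nd: "nat d = n" using n by simp
  have Z: "(a, b, c) \<in> cocyc p d \<longleftrightarrow>
      homog d a \<and> homog d b \<and> homog d c \<and> actS a = - a \<and> normR b = 0" for a b c
    using p cocyc_even(2)[OF d(1)] by simp
  let ?Q = "if even (n div 2) then imageS d else formsS d"
  let ?D = "\<lambda>v. v + actS v :: bpoly"
  let ?Y = "?D ` formsR d"
  let ?f = "\<lambda>(a, b, c). red a + ?D (red c + actR (red b))"
  have SS: "actS (actS v) = v" if "homog d v" for v :: bpoly using actS_actS[OF that] d by simp
  have im: "imageS d \<subseteq> ?Q" using imageS_subset by auto
  have sQ: "add_subgroup ?Q" using imageS_subgroup forms_subgroups by simp
  have D_add: "?D (u + v) = ?D u + ?D v" for u v by (simp add: add_ac)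
  show ?thesis
  proof (rule card_mod_p[where f = ?f and Q = ?Q and Y = ?Y])
    show "?f (z + w) = ?f z + ?f w" for z w
      by (cases z; cases w) (simp add: add_ac)
    show "?f ` cocyc p d = ?Q"
    proof (intro equalityI subsetI)
      fix v assume "v \<in> ?f ` cocyc p d"
      then obtain a b c where z: "homog d a" "homog d b" "homog d c" "actS a = - a"
          "v = red a + ?D (red c + actR (red b))"
        using Z by auto
      have S: "actS a = PK (- 1) * a" using z(4) by (simp add: PK_simps)
      have eig: "red a \<in> formsS d" "(- 1::int) \<noteq> (- 1) ^ (nat d div 2) \<or> d < 0 \<Longrightarrow> red a \<in> imageS d"
        using red_eigenvector[OF d(1) _ z(1) S] by blast+
      then have "red a \<in> ?Q" using nd by (simp add: minus_one_power_iff)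
      moreover have "homog d (red c + actR (red b))" using z by (intro homog_intros homog_red)
      then have "?D (red c + actR (red b)) \<in> ?Q" using im by (auto simp: imageS_def forms_def)
      ultimately show "v \<in> ?Q" using add_subgroupD(4)[OF sQ] z(5) by blast
    next
      fix v assume v: "v \<in> ?Q"
      then have v': "v \<in> formsS d" using imageS_subset by (auto split: if_splits)
      have "(- 1::int) = (- 1) ^ (nat d div 2) \<or> ev 1 1 v = 0"
        using v nd imageS_subset by (auto simp: minus_one_power_iff split: if_splits)
      then obtain a where a: "homog d a" "actS a = PK (- 1) * a" "red a = v"
        using lift_eigenvector[OF d _ v', of "- 1"] by blast
      have "(a, 0, 0) \<in> cocyc p d" using a by (simp add: Z PK_simps)
      then show "v \<in> ?f ` cocyc p d" using a(3) by force
    qed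
    show "add_subgroup ?Q" by (rule sQ)
    show "add_subgroup ?Y"
      unfolding add_subgroup_def
    proof (intro conjI ballI)
      show "0 \<in> ?Y" using add_subgroupD(1)[OF forms_subgroups(3)] by force
      fix a b assume "a \<in> ?Y" "b \<in> ?Y"
      then obtain u v where uv: "u \<in> formsR d" "v \<in> formsR d" "a = ?D u" "b = ?D v" by auto
      then have "a - b = ?D (u - v)" by (simp add: add_ac)
      then show "a - b \<in> ?Y" using uv add_subgroupD(2)[OF forms_subgroups(3)] by blast
    qed
    show "?Y \<subseteq> ?Q" using im by (auto simp: imageS_def formsR_def)
    show "finite ?Q" using card_formsS[of n] card_forms[of n] n by (simp add: imageS_def)
    have cY: "2 ^ tau n = card ?Y * 2 ^ inv_dim n"
    proof -
      have "{v \<in> formsR d. ?D v = 0} = formsI d"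
        by (auto simp: formsI_def formsS_def formsR_def add_eq_0_iff)
      moreover have "card (formsR d) = card ?Y * card {v \<in> formsR d. ?D v = 0}"
        using card_formsR[of n] n by (intro card_additive(2) forms_subgroups) (simp_all add: add_ac)
      ultimately show ?thesis using card_formsR[of n] card_formsI[of n] n by simp
    qed
    have "tau n \<le> n div 2 + inv_dim n" using tau_le[of n] n by (simp add: inv_dim_def)
    then have r: "tau n + ?r = n div 2 + (if even (n div 2) then 0 else 1) + inv_dim n" by simp
    have "n - n div 2 = n div 2" using n by presburger
    then have cQ: "card ?Q = 2 ^ (n div 2 + (if even (n div 2) then 0 else 1))"
      using card_formsS[of n] card_imageS[of n] n by simp
    have "card ?Y * 2 ^ ?r * 2 ^ inv_dim n = 2 ^ tau n * 2 ^ ?r" unfolding cY by simp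
    also have "\<dots> = card ?Q * 2 ^ inv_dim n" unfolding cQ power_add[symmetric] r ..
    finally show "card ?Q = card ?Y * 2 ^ ?r" by simp
    fix z assume z: "z \<in> cocyc p d"
    then obtain a b c where abc: "z = (a, b, c)" "homog d a" "homog d b" "homog d c" "actS a = - a" "normR b = 0"
      using Z by (cases z) auto
    show "?f z \<in> ?Y \<longleftrightarrow> (\<exists>w\<in>cocyc p d. z - scale3 2 w \<in> cobs p d)"
    proof
      assume "?f z \<in> ?Y"
      then obtain v where v: "v \<in> formsR d" "red a + ?D (red c + actR (red b)) = ?D v" using abc(1) by auto
      obtain \<mu> where "homog d \<mu>" "red (normR \<mu>) = v" using lift_invariant[OF v(1)] by blast
      then obtain m where m: "homog d m" "red m = v" "actR m = m" using homog_normR normR_simps(5) by blast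
      \<comment> \<open>Adding the R-invariant \<open>m\<close> to both forms preserves their
        difference \<open>c\<close> and leaves \<open>actR ?\<beta> - ?\<beta>\<close> unchanged,
        while it adjusts the first entry by (1 + S) \<open>m\<close> modulo 2.\<close>
      let ?\<alpha> = "c - actR b + m" and ?\<beta> = "m - actR b"
      have h: "homog d ?\<alpha>" "homog d ?\<beta>" using abc m by (intro homog_intros; simp)+
      have "red a = ?D (red c + actR (red b)) + (red a + ?D (red c + actR (red b)))"
        by (metis add.assoc add.commute add_0 bpoly_double)
      also have "\<dots> = ?D (red c + actR (red b)) + ?D (red m)" unfolding v(2) m(2) ..
      also have "\<dots> = red (actS ?\<alpha> - ?\<alpha>)" by (simp add: add_ac)
      finally obtain a2 where a2: "homog d a2" "a - (actS ?\<alpha> - ?\<alpha>) = 2 * a2"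
        using red_eq[OF abc(2) homog_diff[OF homog_act(1)[OF h(1)] h(1)]] by blast
      have "2 * actS a2 = actS (2 * a2)" by simp
      also have "\<dots> = actS a - (actS (actS ?\<alpha>) - actS ?\<alpha>)" unfolding a2(2)[symmetric] by (simp only: act_simps(3))
      also have "\<dots> = - (2 * a2)" unfolding a2(2)[symmetric] using actS_actS[OF h(1)] d abc(5) by simp
      finally have "2 * actS a2 = 2 * (- a2)" by simp
      then have a2S: "actS a2 = - a2" by (simp only: double_cancel)
      let ?w = "(a2, - actR b, 0)"
      have wZ: "?w \<in> cocyc p d" using a2 a2S abc by (simp add: Z homog_intros)
      have "actR (actR b) = - b - actR b"
        using abc(6) by (simp add: normR_def algebra_simps add_eq_0_iff2)
      then have 2: "b - 2 * - actR b = actR ?\<beta> - ?\<beta>" by (simp add: m(3))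
      have 1: "a - 2 * a2 = actS ?\<alpha> - ?\<alpha>" using a2(2) by (simp add: algebra_simps)
      have 3: "c - 2 * 0 = ?\<alpha> - ?\<beta> - 2 * 0" by simp
      have "(a - 2 * a2, b - 2 * - actR b, c - 2 * 0) \<in> cobs False d"
        by (rule cobs_evenI(2)[OF d(1) h homog_0 1 2 3])
      then have "z - scale3 2 ?w \<in> cobs p d" using p by (simp add: abc(1) scale3_numeral)
      then show "\<exists>w\<in>cocyc p d. z - scale3 2 w \<in> cobs p d" using wZ by blast
    next
      assume "\<exists>w\<in>cocyc p d. z - scale3 2 w \<in> cobs p d"
      then obtain w where w: "z - scale3 2 w \<in> cobs p d" by auto
      obtain w1 w2 w3 where w': "w = (w1, w2, w3)" by (cases w)
      have "(a - 2 * w1, b - 2 * w2, c - 2 * w3) \<in> cobs p d" using w by (simp add: abc(1) w' scale3_numeral)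
      then obtain \<alpha> \<beta> \<gamma> where *: "homog d \<alpha>" "homog d \<beta>" "a - 2 * w1 = actS \<alpha> - \<alpha>" "b - 2 * w2 = actR \<beta> - \<beta>"
          "c - 2 * w3 = \<alpha> - \<beta> - 2 * \<gamma>"
        using p by (elim cobs_evenE[OF d(1)]) auto
      have ra: "red a = ?D (red \<alpha>)"
      proof -
        have "red a = red (a - 2 * w1)" by simp
        also have "\<dots> = ?D (red \<alpha>)" unfolding *(3) by (simp add: add_ac)
        finally show ?thesis .
      qed
      have rb: "red b = actR (red \<beta>) + red \<beta>"
      proof -
        have "red b = red (b - 2 * w2)" by simp
        also have "\<dots> = actR (red \<beta>) + red \<beta>" unfolding *(4) by simp
        finally show ?thesis .
      qed
      have rc: "red c = red \<alpha> + red \<beta>"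
      proof -
        have "red c = red (c - 2 * w3)" by simp
        also have "\<dots> = red \<alpha> + red \<beta>" unfolding *(5) by simp
        finally show ?thesis .
      qed
      have bc: "red c + actR (red b) = red \<alpha> + normR (red \<beta>)"
        by (simp add: rb rc normR_def add_ac)
      have "?f z = ?D (red \<alpha>) + ?D (red c + actR (red b))" by (simp only: abc(1) prod.case ra)
      also have "\<dots> = ?D (red \<alpha>) + (?D (red \<alpha>) + ?D (normR (red \<beta>)))" unfolding bc D_add ..
      also have "\<dots> = ?D (normR (red \<beta>))" by (metis add.assoc add_0 bpoly_double)
      finally show "?f z \<in> ?Y" using normR_forms[of "red \<beta>" d] homog_red[OF *(2)] by (auto simp: forms_def)
    qed
  qed
qed

end

section \<open>Three-torsion in even polynomial degree\<close>

lemma of_int_3_eq_0: "(of_int k :: 3) = 0 \<longleftrightarrow> 3 dvd k"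
  using of_int_eq_0_iff_char_dvd[where 'a = 3, of k] by simp

lemma mod_3_representative: "\<exists>k. (t :: 3) = of_int k"
  by (cases t) blast

lemma four_power: "(2::int) ^ m * 2 ^ m = 4 ^ m"
  by (simp flip: power_mult_distrib)

lemma four_mod_3: "(4 :: 3) = 1"
  by simp

lemma homog_PD_power:
  assumes "homog e f" "d = e + 3 * int k"
  shows "homog d (PD ^ k * f)"
proof -
  have "homog (int k * 3 + e) (PD ^ k * f)" by (intro homog_mult homog_power homog_PD assms(1))
  then show ?thesis using assms(2) by (simp add: algebra_simps)
qed

lemma actR_PD_power [simp]: "actR (PD ^ k) = PD ^ k"
  by simp

context cohomology_presentation
begin

text \<open>z is 3 (- z) plus 4 z: a cocycle killed by 4 is divisible by 3 up to a
  coboundary.\<close>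

lemma minus_cocycle_witness:
  assumes "z \<in> cocyc p d" "scale3 4 z \<in> cobs p d"
  shows "\<exists>w\<in>cocyc p d. z - scale3 3 w \<in> cobs p d"
proof
  show "- z \<in> cocyc p d" using assms(1) by (rule cocyc_closed(3))
  obtain a b c where "z = (a, b, c)" by (cases z)
  then have "z - scale3 3 (- z) = scale3 4 z" by (simp add: scale3_numeral)
  then show "z - scale3 3 (- z) \<in> cobs p d" using assms(2) by simp
qed

text \<open>Four times a cocycle is a coboundary as soon as \<open>b\<close> is a norm. So only the
  class of \<open>b\<close> modulo norms of the group of order 3 matters, and its value at (1, 1)
  modulo 3 detects it.\<close>

lemma even_degree_rank_3_even:
  assumes p: "p" and n: "even n" "d = int n"
  shows "card (carrier (H Mod nat_powers H 3)) = 3 ^ (if 3 dvd n then 1 else 0)"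
proof -
  have d: "even d" using n by simp
  have Z: "(a, b, c) \<in> cocyc p d \<longleftrightarrow>
      homog d a \<and> homog d b \<and> homog d c \<and> actS a = a \<and> actR b = b \<and> a - b = 2 * c" for a b c
    using p cocyc_even(1)[OF d(1)] by simp
  have quad: "scale3 4 (a, b, c) \<in> cobs p d"
    if z: "(a, b, c) \<in> cocyc p d" and ev: "3 dvd ev 1 1 b \<or> \<not> 3 dvd n" for a b c
  proof -
    have ab: "homog d a" "homog d b" "homog d c" "actS a = a" "actR b = b" "a - b = 2 * c" using z by (simp_all add: Z)
    have "3 dvd ev 1 1 b \<or> \<not> 3 dvd d" using ev n(2) by presburger
    then obtain \<beta> where \<beta>: "homog d \<beta>" "b = normR \<beta>" using actR_invariant_norm[OF ab(2,5)] by blast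
    have "(4 * a, 4 * b, 4 * c) \<in> cobs True d"
    proof (rule cobs_evenI(1)[OF d ab(1) homog_numeral_mult[OF \<beta>(1), of "num.Bit0 num.One"]])
      have "4 * a - 4 * b = 4 * (2 * c)" unfolding ab(6)[symmetric] by (simp add: algebra_simps)
      then show "(4 * a, 4 * b, 4 * c) \<in> cocyc True d"
        using ab d by (simp add: cocyc_even homog_numeral_mult)
    qed (simp_all add: ab(4) \<beta>(2))
    then show ?thesis using p by (simp add: scale3_numeral)
  qed
  show ?thesis
  proof (cases "3 dvd n")
    case False
    have "card (carrier (H Mod nat_powers H 3)) = 3 ^ 0"
    proof (rule card_mod_p_trivial)
      fix z assume z: "z \<in> cocyc p d"
      obtain a b c where "z = (a, b, c)" by (cases z)
      then show "\<exists>w\<in>cocyc p d. z - scale3 3 w \<in> cobs p d"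
        using quad[of a b c] z False by (intro minus_cocycle_witness) auto
    qed
    then show ?thesis using False by simp
  next
    case True
    let ?f = "\<lambda>(a, b, c). of_int (ev 1 1 b) :: 3"
    have "card (carrier (H Mod nat_powers H 3)) = 3 ^ 1"
    proof (rule card_mod_p[where f = ?f and Q = UNIV and Y = "{0}"])
      show "?f (z + w) = ?f z + ?f w" for z w
        by (cases z; cases w) simp
      show "?f ` cocyc p d = UNIV"
      proof (intro equalityI subset_UNIV subsetI)
        fix t :: 3
        obtain j where j: "t = of_int j" using mod_3_representative by blast
        let ?m = "n div 3"
        \<comment> \<open>\<open>PD\<close> has the value 2 at (1, 1). The extra powers of 2 turn
          the value of \<open>2 * ?b\<close> into \<open>j\<close> times a power of 4, hence into
          \<open>j\<close> modulo 3.\<close>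
        let ?b = "PD ^ ?m * PK (j * 2 ^ (?m + 1)) :: int poly poly"
        have hb: "homog d ?b" using True n by (intro homog_PD_power[OF homog_vars(3)]) auto
        have "(0, 2 * ?b, - ?b) \<in> cocyc p d"
          unfolding Z using hb by (simp add: homog_numeral_mult homog_minus)
        moreover have "of_int (ev 1 1 (2 * ?b)) = (t :: 3)"
        proof -
          have "ev 1 1 (2 * ?b) = j * 4 ^ (?m + 1)"
            by (simp add: ev_PD four_power)
          then show ?thesis by (simp only: j of_int_mult of_int_power of_int_numeral four_mod_3 power_one mult_1_right)
        qed
        ultimately show "t \<in> ?f ` cocyc p d" by (intro image_eqI[of _ _ "(0, 2 * ?b, - ?b)"]) simp_all
      qed
      fix z assume z: "z \<in> cocyc p d"
      obtain a b c where abc: "z = (a, b, c)" by (cases z)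
      show "?f z \<in> {0} \<longleftrightarrow> (\<exists>w\<in>cocyc p d. z - scale3 3 w \<in> cobs p d)"
      proof
        assume "?f z \<in> {0}"
        then show "\<exists>w\<in>cocyc p d. z - scale3 3 w \<in> cobs p d"
          using quad[of a b c] z by (intro minus_cocycle_witness) (auto simp: abc of_int_3_eq_0)
      next
        assume "\<exists>w\<in>cocyc p d. z - scale3 3 w \<in> cobs p d"
        then obtain w where w: "z - scale3 3 w \<in> cobs p d" by auto
        obtain w1 w2 w3 where w': "w = (w1, w2, w3)" by (cases w)
        have "(a - 3 * w1, b - 3 * w2, c - 3 * w3) \<in> cobs p d" using w by (simp add: abc w' scale3_numeral)
        then obtain \<beta> where \<beta>: "b - 3 * w2 = 2 * normR \<beta>"
          using p by (elim cobs_evenE[OF d(1)]) auto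
        have "b = 2 * normR \<beta> + 3 * w2" using \<beta> by (simp add: algebra_simps)
        then have "ev 1 1 b = 2 * ev 1 1 (normR \<beta>) + 3 * ev 1 1 w2" by simp
        then have "3 dvd ev 1 1 b" using ev_normR_mod_3[of \<beta>] by simp
        then show "?f z \<in> {0}" by (simp add: abc of_int_3_eq_0)
      qed
    qed (auto simp: add_subgroup_def)
    then show ?thesis using True by simp
  qed
qed

text \<open>As in even cohomological degree, with the kernel of the norm modulo differences along
  \<open>actR\<close>. The class is realised in degrees 1 modulo 3 by a power of \<open>PD\<close>
  times the variable x, which has norm zero.\<close>

lemma even_degree_rank_3_odd:
  assumes p: "\<not> p" and n: "even n" "d = int n"
  shows "card (carrier (H Mod nat_powers H 3)) = 3 ^ (if n mod 3 = 1 then 1 else 0)"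
proof -
  have d: "even d" using n by simp
  have Z: "(a, b, c) \<in> cocyc p d \<longleftrightarrow>
      homog d a \<and> homog d b \<and> homog d c \<and> actS a = - a \<and> normR b = 0" for a b c
    using p cocyc_even(2)[OF d(1)] by simp
  have quad: "scale3 4 (a, b, c) \<in> cobs p d"
    if z: "(a, b, c) \<in> cocyc p d" and ev: "3 dvd ev 1 1 b \<or> n mod 3 \<noteq> 1" for a b c
  proof -
    have ab: "homog d a" "homog d b" "homog d c" "actS a = - a" "normR b = 0" using z by (simp_all add: Z)
    have "3 dvd ev 1 1 b \<or> d mod 3 \<noteq> 1" using ev n by presburger
    then obtain \<beta> where \<beta>: "homog d \<beta>" "b = actR \<beta> - \<beta>" using normR_kernel[OF ab(2,5)] by blast
    have "(4 * a, 4 * b, 4 * c) \<in> cobs False d"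
    proof (rule cobs_evenI(2)[OF d])
      show "homog d (- (2 * a))" "homog d (4 * \<beta>)" "homog d (- a - 2 * \<beta> - 2 * c)"
        by (intro homog_intros ab(1-3) \<beta>(1))+
    qed (simp_all add: ab(4) \<beta>(2) algebra_simps)
    then show ?thesis using p by (simp add: scale3_numeral)
  qed
  show ?thesis
  proof (cases "n mod 3 = 1")
    case False
    have "card (carrier (H Mod nat_powers H 3)) = 3 ^ 0"
    proof (rule card_mod_p_trivial)
      fix z assume z: "z \<in> cocyc p d"
      obtain a b c where "z = (a, b, c)" by (cases z)
      then show "\<exists>w\<in>cocyc p d. z - scale3 3 w \<in> cobs p d"
        using quad[of a b c] z False by (intro minus_cocycle_witness) auto
    qed
    then show ?thesis using False by simp
  next
    case True
    let ?f = "\<lambda>(a, b, c). of_int (ev 1 1 b) :: 3"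
    have "card (carrier (H Mod nat_powers H 3)) = 3 ^ 1"
    proof (rule card_mod_p[where f = ?f and Q = UNIV and Y = "{0}"])
      show "?f (z + w) = ?f z + ?f w" for z w
        by (cases z; cases w) simp
      show "?f ` cocyc p d = UNIV"
      proof (intro equalityI subset_UNIV subsetI)
        fix t :: 3
        obtain j where j: "t = of_int j" using mod_3_representative by blast
        let ?m = "n div 3"
        let ?b = "PD ^ ?m * (PK (j * 2 ^ ?m) * PX) :: int poly poly"
        have "n = 1 + 3 * ?m" using True by presburger
        then have hb: "homog d ?b" using n(2) by (intro homog_PD_power[OF homog_PK_mult[OF homog_vars(1)]]) linarith
        have "normR ?b = 0" by (simp add: normR_def flip: distrib_left)
        then have "(0, ?b, 0) \<in> cocyc p d" unfolding Z using hb by simp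
        moreover have "of_int (ev 1 1 ?b) = (t :: 3)"
        proof -
          have "ev 1 1 ?b = j * 4 ^ ?m"
            by (simp add: ev_PD four_power)
          then show ?thesis by (simp only: j of_int_mult of_int_power of_int_numeral four_mod_3 power_one mult_1_right)
        qed
        ultimately show "t \<in> ?f ` cocyc p d" by (intro image_eqI[of _ _ "(0, ?b, 0)"]) simp_all
      qed
      fix z assume z: "z \<in> cocyc p d"
      obtain a b c where abc: "z = (a, b, c)" by (cases z)
      show "?f z \<in> {0} \<longleftrightarrow> (\<exists>w\<in>cocyc p d. z - scale3 3 w \<in> cobs p d)"
      proof
        assume "?f z \<in> {0}"
        then show "\<exists>w\<in>cocyc p d. z - scale3 3 w \<in> cobs p d"
          using quad[of a b c] z by (intro minus_cocycle_witness) (auto simp: abc of_int_3_eq_0)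
      next
        assume "\<exists>w\<in>cocyc p d. z - scale3 3 w \<in> cobs p d"
        then obtain w where w: "z - scale3 3 w \<in> cobs p d" by auto
        obtain w1 w2 w3 where w': "w = (w1, w2, w3)" by (cases w)
        have "(a - 3 * w1, b - 3 * w2, c - 3 * w3) \<in> cobs p d" using w by (simp add: abc w' scale3_numeral)
        then obtain \<beta> where \<beta>: "b - 3 * w2 = actR \<beta> - \<beta>"
          using p by (elim cobs_evenE[OF d(1)]) auto
        have "b = actR \<beta> - \<beta> + 3 * w2" using \<beta> by (simp add: algebra_simps)
        then have "ev 1 1 b = (ev 1 1 (actR \<beta>) - ev 1 1 \<beta>) + 3 * ev 1 1 w2" by simp
        then have "3 dvd ev 1 1 b" using ev_actR_mod_3[of \<beta>] by simp
        then show "?f z \<in> {0}" by (simp add: abc of_int_3_eq_0)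
      qed
    qed (auto simp: add_subgroup_def)
    then show ?thesis using True by simp
  qed
qed

end

section \<open>The cyclic summand of order 4\<close>

text \<open>Two elements of the 4-torsion in one coset of the squares differ by a square of some g
  with trivial eighth power. Then g is killed by 4 and its square is 1 or \<open>u\<close>, so each
  of the finitely many cosets contains at most two such elements.\<close>

lemma finite_roots_of_unity_4:
  assumes A: "comm_group A" and fin: "finite (carrier (A Mod nat_powers A 2))"
    and exp: "\<And>a k. a \<in> carrier A \<Longrightarrow> a [^]\<^bsub>A\<^esub> (2 ^ k :: nat) = \<one>\<^bsub>A\<^esub> \<Longrightarrow> a [^]\<^bsub>A\<^esub> (4::nat) = \<one>\<^bsub>A\<^esub>"
    and sq: "\<And>a. a \<in> carrier A \<Longrightarrow> a [^]\<^bsub>A\<^esub> (4::nat) = \<one>\<^bsub>A\<^esub> \<Longrightarrow> a [^]\<^bsub>A\<^esub> (2::nat) \<in> {\<one>\<^bsub>A\<^esub>, u}"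
    and u: "u \<in> carrier A"
  shows "finite {a \<in> carrier A. a [^]\<^bsub>A\<^esub> (4::nat) = \<one>\<^bsub>A\<^esub>}"
proof -
  interpret A: comm_group A by fact
  let ?P = "nat_powers A 2" and ?S = "{a \<in> carrier A. a [^]\<^bsub>A\<^esub> (4::nat) = \<one>\<^bsub>A\<^esub>}"
  interpret P: normal ?P A using A.subgroup_nat_powers by (rule A.subgroup_imp_normal)
  have fiber: "finite {b \<in> ?S. ?P #>\<^bsub>A\<^esub> b = C}" if C: "C \<in> carrier (A Mod ?P)" for C
  proof (cases "\<exists>a. a \<in> ?S \<and> ?P #>\<^bsub>A\<^esub> a = C")
    case True
    then obtain a where a: "a \<in> ?S" "?P #>\<^bsub>A\<^esub> a = C" by blast
    have "{b \<in> ?S. ?P #>\<^bsub>A\<^esub> b = C} \<subseteq> {a, u \<otimes>\<^bsub>A\<^esub> a}"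
    proof
      fix b assume b: "b \<in> {b \<in> ?S. ?P #>\<^bsub>A\<^esub> b = C}"
      then have "b \<in> ?P #>\<^bsub>A\<^esub> a" using A.rcos_self[of b] A.subgroup_nat_powers a by auto
      then obtain g where g: "g \<in> carrier A" "b = g [^]\<^bsub>A\<^esub> (2::nat) \<otimes>\<^bsub>A\<^esub> a"
        by (auto simp: r_coset_def nat_powers_def)
      have "b [^]\<^bsub>A\<^esub> (4::nat) = g [^]\<^bsub>A\<^esub> (8::nat)"
        using a g by (simp add: A.nat_pow_distrib A.nat_pow_pow)
      then have "g [^]\<^bsub>A\<^esub> (2 ^ 3 :: nat) = \<one>\<^bsub>A\<^esub>" using b by simp
      then have "g [^]\<^bsub>A\<^esub> (2::nat) \<in> {\<one>\<^bsub>A\<^esub>, u}" by (intro sq exp[of g 3] g)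
      then show "b \<in> {a, u \<otimes>\<^bsub>A\<^esub> a}" using a g(2) by auto
    qed
    then show ?thesis by (rule finite_subset) simp
  next
    case False
    then have "{b \<in> ?S. ?P #>\<^bsub>A\<^esub> b = C} = {}" by blast
    then show ?thesis by (simp only: finite.emptyI)
  qed
  have "?S = (\<Union>C\<in>carrier (A Mod ?P). {b \<in> ?S. ?P #>\<^bsub>A\<^esub> b = C})"
    by (auto simp: carrier_FactGroup)
  moreover have "finite (\<Union>C\<in>carrier (A Mod ?P). {b \<in> ?S. ?P #>\<^bsub>A\<^esub> b = C})"
    using fin fiber by (rule finite_UN_I)
  ultimately show ?thesis by (rule ssubst)
qed

context cohomology_presentation
begin

text \<open>For a class killed by 4, \<open>b\<close> is a norm, and the double depends only on the
  parity of the coefficient of the middle monomial in \<open>a\<close>: it is the class of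
  \<open>?u\<close> if that is odd and trivial otherwise. The class of \<open>?u\<close> is not
  trivial because the middle monomial modulo 2 is not a norm, and \<open>generator_cocycle\<close>
  shows that it is a double.\<close>

lemma order_4_summand:
  assumes p: "p" and d: "d = int (4 * m)"
  shows "cyclic_summand_count H 2 2 1"
proof -
  interpret H: comm_group H by (rule H)
  have "nat d div 2 = 2 * m" using d by simp
  then have e: "even d" "0 \<le> d" "even (nat d div 2)" using d by simp_all
  have Z: "(a, b, c) \<in> cocyc p d \<longleftrightarrow>
      homog d a \<and> homog d b \<and> homog d c \<and> actS a = a \<and> actR b = b \<and> a - b = 2 * c" for a b c
    using p cocyc_even(1)[OF e(1)] by simp
  obtain \<pi> where \<pi>: "\<pi> \<in> hom (add_group (cocyc p d)) H" "\<pi> ` cocyc p d = carrier H"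
    "\<And>z. z \<in> cocyc p d \<Longrightarrow> \<pi> z = \<one>\<^bsub>H\<^esub> \<longleftrightarrow> z \<in> cobs p d"
    using presentation by blast
  have \<pi>_closed: "\<pi> z \<in> carrier H" if "z \<in> cocyc p d" for z using \<pi>(2) that by blast
  have \<pi>_add: "\<pi> (z + w) = \<pi> z \<otimes>\<^bsub>H\<^esub> \<pi> w" if "z \<in> cocyc p d" "w \<in> cocyc p d" for z w
    using hom_mult[OF \<pi>(1)] that by simp
  have \<pi>_eq: "\<pi> z = \<pi> w" if "z \<in> cocyc p d" "w \<in> cocyc p d" "z - w \<in> cobs p d" for z w
  proof -
    have "z - w \<in> cocyc p d" using that cocyc_closed(2) by blast
    then have "\<pi> (z - w + w) = \<one>\<^bsub>H\<^esub> \<otimes>\<^bsub>H\<^esub> \<pi> w" using \<pi>_add[of "z - w" w] \<pi>(3) that by metis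
    then show ?thesis using \<pi>_closed that by simp
  qed
  have sq_eq: "\<pi> z [^]\<^bsub>H\<^esub> (2::nat) = \<pi> (z + z)" if "z \<in> cocyc p d" for z
    using \<pi>_closed \<pi>_add that by (simp add: numeral_2_eq_2)
  note middle = middle_cocycle[OF e] middle_props(1,3)[OF e(1,2)]
  have Sm: "actS (middle d) = middle d" using actS_middle[OF e(1,2)] e(3) by simp
  let ?u = "(2 * middle d, 0, middle d)"
  have uZ: "?u \<in> cocyc p d" using middle(1) p by simp
  have u1: "\<pi> ?u \<noteq> \<one>\<^bsub>H\<^esub>"
  proof
    assume "\<pi> ?u = \<one>\<^bsub>H\<^esub>"
    then have "?u \<in> cobs p d" using \<pi>(3) uZ by blast
    then obtain \<alpha> where \<alpha>: "homog d \<alpha>" "2 * middle d = 2 * (\<alpha> + actS \<alpha>)"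
      using p by (elim cobs_evenE[OF e(1)]) auto
    have "middle d = \<alpha> + actS \<alpha>" using \<alpha>(2) by (simp only: double_cancel)
    then have "red (middle d) = red \<alpha> + actS (red \<alpha>)" by simp
    then have "red (middle d) \<in> imageS d" using homog_red[OF \<alpha>(1)] by (auto simp: imageS_def forms_def)
    then show False using imageS_subset middle(3) by force
  qed
  have u2: "\<pi> ?u [^]\<^bsub>H\<^esub> (2::nat) = \<one>\<^bsub>H\<^esub>"
  proof -
    have mem: "?u + ?u \<in> cocyc True d" using cocyc_closed(4)[OF uZ uZ] p by simp
    have "?u + ?u \<in> cobs True d"
      unfolding add_Pair
      by (rule cobs_evenI(1)[OF e(1) middle(2) homog_0]) (use mem Sm in simp_all)
    then show ?thesis using sq_eq[OF uZ] \<pi>(3)[OF cocyc_closed(4)[OF uZ uZ]] p by simp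
  qed
  have \<pi>_0: "\<pi> 0 = \<one>\<^bsub>H\<^esub>" using \<pi>(3) cocyc_closed(1) cobs_closed(1) by blast
  have double: "\<pi> (a, b, c) [^]\<^bsub>H\<^esub> (2::nat) = \<pi> (y, 0, y')"
    if z: "(a, b, c) \<in> cocyc p d" and y: "(y, 0, y') \<in> cocyc p d"
      and a: "homog d \<alpha>" "2 * a - y = 2 * (\<alpha> + actS \<alpha>)" and b: "homog d \<beta>" "b = normR \<beta>"
    for a b c y y' \<alpha> \<beta>
  proof -
    have zz: "(a, b, c) + (a, b, c) \<in> cocyc p d" using cocyc_closed(4)[OF z z] .
    have mem: "(a + a - y, b + b - 0, c + c - y') \<in> cocyc True d" using cocyc_closed(2)[OF zz y] p by simp
    have "(a + a - y, b + b - 0, c + c - y') \<in> cobs True d"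
      by (rule cobs_evenI(1)[OF e(1) a(1) b(1) mem]) (use a b in simp_all)
    then have "(a, b, c) + (a, b, c) - (y, 0, y') \<in> cobs p d" using p by simp
    then show ?thesis using sq_eq[OF z] \<pi>_eq[OF zz y] by simp
  qed
  have exp: "h [^]\<^bsub>H\<^esub> (4::nat) = \<one>\<^bsub>H\<^esub>" if h: "h \<in> carrier H" "h [^]\<^bsub>H\<^esub> (2 ^ k :: nat) = \<one>\<^bsub>H\<^esub>" for h k
  proof -
    have "H.ord h dvd 12" "H.ord h dvd 2 ^ k"
      using even_degree_exponent(1)[OF e(1) h(1)] h H.pow_eq_id by blast+
    then have "H.ord h dvd 4 * 3" "coprime (H.ord h) 3"
      by (simp_all add: coprime_divisors[of _ "2 ^ k" 3 3])
    then have "H.ord h dvd 4" by (simp only: coprime_dvd_mult_left_iff)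
    then show ?thesis using h(1) H.pow_eq_id by blast
  qed
  have sq: "h [^]\<^bsub>H\<^esub> (2::nat) \<in> {\<one>\<^bsub>H\<^esub>, \<pi> ?u}" if h: "h \<in> carrier H" "h [^]\<^bsub>H\<^esub> (4::nat) = \<one>\<^bsub>H\<^esub>" for h
  proof -
    obtain a b c where z: "(a, b, c) \<in> cocyc p d" "h = \<pi> (a, b, c)" using h(1) \<pi>(2) by (metis imageE prod_cases3)
    let ?z = "(a, b, c)"
    have zz: "?z + ?z \<in> cocyc p d" using cocyc_closed(4)[OF z(1) z(1)] .
    have "\<pi> (?z + ?z + (?z + ?z)) = (h [^]\<^bsub>H\<^esub> (2::nat)) [^]\<^bsub>H\<^esub> (2::nat)"
      using sq_eq[OF zz] sq_eq[OF z(1)] z(2) by simp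
    then have "\<pi> (?z + ?z + (?z + ?z)) = \<one>\<^bsub>H\<^esub>" using h by (simp add: H.nat_pow_pow)
    then have "?z + ?z + (?z + ?z) \<in> cobs p d" using \<pi>(3) cocyc_closed(4)[OF zz zz] by blast
    then obtain \<beta> where \<beta>: "homog d \<beta>" "b + b + (b + b) = 2 * normR \<beta>"
      unfolding add_Pair using p by (elim cobs_evenE[OF e(1)]) blast+
    have ab: "homog d a" "homog d b" "actS a = a" "actR b = b" using z(1) by (simp_all add: Z)
    \<comment> \<open>Three times the invariant \<open>b\<close> is its norm, and twice
      \<open>b\<close> is a norm because four times the cocycle is a coboundary.\<close>
    have "b = 3 * b - (b + b)" by simp
    also have "b + b = normR \<beta>" using \<beta>(2) by (simp only: mult_2[symmetric] double_cancel)
    also have "3 * b - normR \<beta> = normR (b - \<beta>)" using normR_invariant[OF ab(4)] by (simp add: PK_numeral)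
    finally have b: "b = normR (b - \<beta>)" .
    have hb: "homog d (b - \<beta>)" using ab \<beta> by (intro homog_intros)
    obtain \<alpha> k where \<alpha>: "homog d \<alpha>" "a = \<alpha> + actS \<alpha> + PK k * middle d"
      using actS_invariant[OF e(1) ab(1,3)] by blast
    show ?thesis
    proof (cases "even k")
      case True
      then obtain l where "k = 2 * l" by blast
      then have "2 * a - 0 = 2 * ((\<alpha> + PK l * middle d) + actS (\<alpha> + PK l * middle d))"
        by (simp add: \<alpha>(2) Sm PK_simps PK_numeral algebra_simps)
      moreover have "homog d (\<alpha> + PK l * middle d)" using \<alpha> middle by (intro homog_intros)
      moreover have "(0, 0, 0) \<in> cocyc p d" using cocyc_closed(1) by (simp add: zero_prod_def)
      ultimately have "h [^]\<^bsub>H\<^esub> (2::nat) = \<pi> (0, 0, 0)" unfolding z(2) by (intro double[OF z(1) _ _ _ hb b])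
      then show ?thesis using \<pi>_0 by (simp add: zero_prod_def)
    next
      case False
      then obtain l where "k = 2 * l + 1" by (auto elim: oddE)
      then have "2 * a - 2 * middle d = 2 * ((\<alpha> + PK l * middle d) + actS (\<alpha> + PK l * middle d))"
        by (simp add: \<alpha>(2) Sm PK_simps PK_numeral algebra_simps)
      moreover have "homog d (\<alpha> + PK l * middle d)" using \<alpha> middle by (intro homog_intros)
      ultimately have "h [^]\<^bsub>H\<^esub> (2::nat) = \<pi> ?u" unfolding z(2) by (intro double[OF z(1) uZ _ _ hb b])
      then show ?thesis by simp
    qed
  qed
  obtain \<alpha> \<beta> c where g: "homog d \<alpha>" "homog d \<beta>" "(\<alpha> + actS \<alpha> + middle d, normR \<beta>, c) \<in> cocyc True d"
    using generator_cocycle[OF e] by blast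
  have gZ: "(\<alpha> + actS \<alpha> + middle d, normR \<beta>, c) \<in> cocyc p d" using g(3) p by simp
  have x: "\<pi> (\<alpha> + actS \<alpha> + middle d, normR \<beta>, c) [^]\<^bsub>H\<^esub> (2::nat) = \<pi> ?u"
    by (rule double[OF gZ uZ g(1) _ g(2) refl]) (simp add: algebra_simps)
  have "0 < card (carrier (H Mod nat_powers H 2))"
    using even_degree_rank_2_even[OF p, of "4 * m"] d by simp
  then have fin: "finite (carrier (H Mod nat_powers H 2))" by (rule card_ge_0_finite)
  show ?thesis
  proof (rule cyclic_summand_count_4[OF H])
    show "finite {a \<in> carrier H. a [^]\<^bsub>H\<^esub> (4::nat) = \<one>\<^bsub>H\<^esub>}"
      by (rule finite_roots_of_unity_4[OF H fin _ _ \<pi>_closed[OF uZ]]) (fact exp, fact sq)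
  qed (fact exp sq u1 u2 x \<pi>_closed[OF gZ])+
qed

end

subsection \<open>The cohomology of the graded components\<close>

text \<open>For odd \<open>n\<close> the component is zero, and so is the space of forms of degree
  -1.\<close>

definition weight :: "nat \<Rightarrow> int" where "weight n = (if even n then int (n div 2) else - 1)"

lemma carrier_graded_component: "carrier (graded_component n) = {f. homog (weight n) f}"
proof -
  have "2 * i + 2 * j = n \<longleftrightarrow> int i + int j = weight n" for i j
    unfolding weight_def by presburger
  then show ?thesis by (simp add: graded_component_def homog_def)
qed

text \<open>The bar complex is replaced by the complex of cells, and that by triples; cohomological
  degree \<open>k + 2\<close> has the parity of \<open>k\<close>. Since this parity is all that
  enters, periodicity follows at once.\<close>

lemma cohomology_component_presentation:
  "cohomology_presentation (cohomology_component (carrier SL2Z) (k + 2) n) (even k) (weight n)"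
proof -
  let ?A = "{f :: int poly poly. homog (weight n) f}" and ?G = "graded_component n"
  let ?H = "cohomology_component (carrier SL2Z) (k + 2) n"
  let ?bar = "complex_cohomology SL2Z (tuples SL2Z) (\<lambda>g. map ((\<otimes>\<^bsub>SL2Z\<^esub>) g)) (\<lambda>n. bar_boundary) ?A poly_act"
  interpret SL2Z_module ?A poly_act by (rule SL2Z_module_forms)
  have ops: "monoid.mult ?G = (+)" "one ?G = 0" by (simp_all add: graded_component_def)
  have "?G = add_group ?A"
    using ops carrier_graded_component[of n] by (simp add: graded_component_def add_group_def)
  moreover have "comm_group (add_group ?A)" by (intro comm_group_add_group) (simp add: add_subgroup_def homog_diff)
  ultimately have comm: "comm_group ?G" by simp
  have SL: "SL2Z\<lparr>carrier := carrier SL2Z\<rparr> = SL2Z" by simp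
  have "coefficient_module SL2Z (carrier ?G) poly_act"
    unfolding carrier_graded_component by (rule coefficient_module_axioms)
  from group_cohomology_eq_complex_cohomology[OF group_SL2Z comm ops this]
  have H: "?H = ?bar (Suc k)"
    by (simp add: cohomology_component_def SL carrier_graded_component)
  have bar: "free_resolution SL2Z (tuples SL2Z) (\<lambda>g. map ((\<otimes>\<^bsub>SL2Z\<^esub>) g)) (\<lambda>n. bar_boundary) [] hd"
    by (rule free_resolution_bar[OF group_SL2Z])
  interpret bar: resolution_cohomology SL2Z "tuples SL2Z" "\<lambda>g. map ((\<otimes>\<^bsub>SL2Z\<^esub>) g)" "\<lambda>n. bar_boundary" "[]" hd ?A poly_act
    using bar coefficient_module_axioms by (rule resolution_cohomology.intro)
  have "comm_group (?bar (Suc k))"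
  proof -
    interpret Z: comm_group "fun_group (tuples SL2Z (Suc (Suc (Suc k)))) (bar.Z (Suc (Suc k)))"
      by (rule bar.comm_group_cocycles)
    show ?thesis
      unfolding complex_cohomology_def
      using bar.coboundaries_normal by (intro Z.abelian_FactGroup normal_imp_subgroup)
  qed
  moreover have "?bar (Suc k) \<cong> complex_cohomology SL2Z cells cell_act cell_bd ?A poly_act (Suc k)"
    using bar free_resolution_cells coefficient_module_axioms by (rule complex_cohomology_unique)
  then have "?bar (Suc k) \<cong> stabilizer_cohomology (even k) ?A actS actT"
    using complex_cohomology_cells[of k] unfolding poly_act_matS poly_act_matT by (rule iso_trans)
  ultimately show ?thesis
    unfolding H cohomology_presentation_def stabilizer_cohomology_def by blast
qed

lemma cohomology_component_periodic:
  assumes "1 < i"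
  shows "cohomology_component (carrier SL2Z) i n \<cong> cohomology_component (carrier SL2Z) (i + 2) n"
proof -
  obtain k where k: "i = k + 2" using assms by (metis add.commute le_add_diff_inverse Suc_1 Suc_leI)
  interpret H: cohomology_presentation "cohomology_component (carrier SL2Z) (k + 2) n" "even k" "weight n"
    by (rule cohomology_component_presentation)
  interpret H2: cohomology_presentation "cohomology_component (carrier SL2Z) (k + 2 + 2) n" "even (k + 2)" "weight n"
    by (rule cohomology_component_presentation)
  have "add_group (cocyc (even k) (weight n)) Mod cobs (even k) (weight n) \<cong> cohomology_component (carrier SL2Z) (k + 2 + 2) n"
    using group.iso_sym[OF comm_group.axioms(2)[OF H2.H] H2.iso] by simp
  then show ?thesis unfolding k by (rule iso_trans[OF H.iso])
qed

context cohomology_presentation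
begin

lemma degree_exponent:
  assumes d: "d = weight n" and x: "x \<in> carrier H"
  shows "x [^]\<^bsub>H\<^esub> (12::nat) = \<one>\<^bsub>H\<^esub>"
    and "\<not> (p \<and> 8 dvd n) \<Longrightarrow> x [^]\<^bsub>H\<^esub> (6::nat) = \<one>\<^bsub>H\<^esub>"
proof -
  interpret comm_group H by (rule H)
  have mult: "x [^]\<^bsub>H\<^esub> k = \<one>\<^bsub>H\<^esub>" if "x [^]\<^bsub>H\<^esub> m = \<one>\<^bsub>H\<^esub>" "m dvd k" for m k :: nat
    using that x pow_eq_id dvd_trans by blast
  consider "odd n" | "even n" "odd d" | "even n" "even d" by blast
  then have "x [^]\<^bsub>H\<^esub> (12::nat) = \<one>\<^bsub>H\<^esub> \<and> (\<not> (p \<and> 8 dvd n) \<longrightarrow> x [^]\<^bsub>H\<^esub> (6::nat) = \<one>\<^bsub>H\<^esub>)"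
  proof cases
    case 1
    then have "x [^]\<^bsub>H\<^esub> (1::nat) = \<one>\<^bsub>H\<^esub>" using x by (intro negative_degree(2)) (simp_all add: d weight_def)
    then show ?thesis using mult[of 1] by simp
  next
    case 2
    then have "x [^]\<^bsub>H\<^esub> (2::nat) = \<one>\<^bsub>H\<^esub>" using x by (intro odd_degree_exponent)
    then show ?thesis using mult[of 2] by simp
  next
    case 3
    have "odd (nat d div 2)" if "\<not> 8 dvd n"
      using 3 that unfolding d weight_def by (simp split: if_splits) presburger
    then show ?thesis using even_degree_exponent[OF 3(2) x] by blast
  qed
  then show "x [^]\<^bsub>H\<^esub> (12::nat) = \<one>\<^bsub>H\<^esub>" "\<not> (p \<and> 8 dvd n) \<Longrightarrow> x [^]\<^bsub>H\<^esub> (6::nat) = \<one>\<^bsub>H\<^esub>" by blast+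
qed

end

section \<open>Ranks modulo 2 and 3 as functions of the grading\<close>

definition rank2 :: "bool \<Rightarrow> nat \<Rightarrow> nat" where
  "rank2 p n = (let d = n div 2 in
     if odd n then 0
     else if odd d then (if p then d div 2 + 1 + inv_dim d - tau d else inv_dim d)
     else if p then (if even (d div 2) then inv_dim d else inv_dim d - 1)
     else d div 2 + (if even (d div 2) then 0 else 1) + inv_dim d - tau d)"

definition rank3 :: "bool \<Rightarrow> nat \<Rightarrow> nat" where
  "rank3 p n = (if n mod 12 = (if p then 0 else 8) then 1 else 0)"

context cohomology_presentation
begin

lemma rank_2:
  assumes "d = weight n"
  shows "card (carrier (H Mod nat_powers H 2)) = 2 ^ rank2 p n"
proof (cases "odd n")
  case True
  then show ?thesis using negative_degree(1)[of 2] assms by (simp add: weight_def rank2_def)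
next
  case False
  then have d: "d = int (n div 2)" using assms by (simp add: weight_def)
  show ?thesis
    using False d odd_degree_rank_2_even[of "n div 2"] odd_degree_rank_2_odd[of "n div 2"]
      even_degree_rank_2_even[of "n div 2"] even_degree_rank_2_odd[of "n div 2"]
    by (cases p; cases "even (n div 2)") (simp_all add: rank2_def Let_def)
qed

lemma rank_3:
  assumes "d = weight n"
  shows "card (carrier (H Mod nat_powers H 3)) = 3 ^ rank3 p n"
proof (cases "odd n")
  case True
  then have "rank3 p n = 0" by (cases p; simp add: rank3_def; presburger)
  then show ?thesis using True negative_degree(1)[of 3] assms by (simp add: weight_def)
next
  case even: False
  then have d: "d = int (n div 2)" using assms by (simp add: weight_def)
  show ?thesis
  proof (cases "odd (n div 2)")
    case True
    then have "rank3 p n = 0" by (cases p; simp add: rank3_def; presburger)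
    then show ?thesis using odd_degree_rank_3 d True by simp
  next
    case False
    then have "3 dvd n div 2 \<longleftrightarrow> n mod 12 = 0" "n div 2 mod 3 = 1 \<longleftrightarrow> n mod 12 = 8"
      using even by presburger+
    then show ?thesis
      using even_degree_rank_3_even[of "n div 2"] even_degree_rank_3_odd[of "n div 2"] False d
      by (cases p) (simp_all add: rank3_def)
  qed
qed

end

lemma sum_group_pow:
  fixes F :: "'i \<Rightarrow> ('a, 'm) monoid_scheme"
  assumes F: "\<And>i. group (F i)" and k: "\<And>i x. x \<in> carrier (F i) \<Longrightarrow> x [^]\<^bsub>F i\<^esub> (k::nat) = \<one>\<^bsub>F i\<^esub>"
    and x: "x \<in> carrier (sum_group UNIV F)"
  shows "x [^]\<^bsub>sum_group UNIV F\<^esub> k = \<one>\<^bsub>sum_group UNIV F\<^esub>"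
proof -
  have "x [^]\<^bsub>sum_group UNIV F\<^esub> m = (\<lambda>i. x i [^]\<^bsub>F i\<^esub> m)" for m :: nat
    by (induction m) (simp_all add: fun_eq_iff)
  moreover have "x i \<in> carrier (F i)" for i using x F by (auto simp: carrier_sum_group)
  ultimately show ?thesis using k by (simp add: fun_eq_iff)
qed

lemma cohomology_total_exponent:
  assumes "1 < i"
  shows "group (cohomology_total (carrier SL2Z) i)"
    and "x \<in> carrier (cohomology_total (carrier SL2Z) i) \<Longrightarrow>
      x [^]\<^bsub>cohomology_total (carrier SL2Z) i\<^esub> (12::nat) = \<one>\<^bsub>cohomology_total (carrier SL2Z) i\<^esub>"
proof -
  obtain k where k: "i = k + 2" using assms by (metis add.commute le_add_diff_inverse Suc_1 Suc_leI)
  note pres = cohomology_component_presentation[of k]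
  have grp: "group (cohomology_component (carrier SL2Z) i n)" for n
    using comm_group.axioms(2)[OF cohomology_presentation.H[OF pres]] unfolding k .
  show "group (cohomology_total (carrier SL2Z) i)" unfolding cohomology_total_def using grp by simp
  show "x [^]\<^bsub>cohomology_total (carrier SL2Z) i\<^esub> (12::nat) = \<one>\<^bsub>cohomology_total (carrier SL2Z) i\<^esub>"
    if "x \<in> carrier (cohomology_total (carrier SL2Z) i)"
    unfolding cohomology_total_def
  proof (rule sum_group_pow[OF grp])
    show "x [^]\<^bsub>cohomology_component (carrier SL2Z) i n\<^esub> (12::nat) = \<one>\<^bsub>cohomology_component (carrier SL2Z) i n\<^esub>"
      if "x \<in> carrier (cohomology_component (carrier SL2Z) i n)" for n x
      using cohomology_presentation.degree_exponent(1)[OF pres refl] that unfolding k by blast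
  qed (use that in \<open>simp add: cohomology_total_def\<close>)
qed

lemma free_part_trivial:
  assumes "group A" and k: "0 < k" "\<And>x. x \<in> carrier A \<Longrightarrow> x [^]\<^bsub>A\<^esub> (k::nat) = \<one>\<^bsub>A\<^esub>"
  shows "trivial_group (free_part A)"
proof -
  interpret group A by fact
  interpret N: normal "carrier A" A by (rule normal_self)
  have "torsion_subgroup A = carrier A" using k by (auto simp: torsion_subgroup_def)
  moreover have "carrier (A Mod carrier A) = {carrier A}"
    using coset_join2[OF _ subgroup_self] one_closed by (auto simp: carrier_FactGroup)
  ultimately show ?thesis using N.factorgroup_is_group by (simp add: free_part_def trivial_group_def)
qed

lemma order_dvd_exponent:
  assumes "group A" "\<And>x. x \<in> carrier A \<Longrightarrow> x [^]\<^bsub>A\<^esub> (k::nat) = \<one>\<^bsub>A\<^esub>" "has_element_of_order A m"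
  shows "m dvd k"
  using assms group.pow_eq_id[OF assms(1)] by (auto simp: has_element_of_order_def)

subsection \<open>The Poincare series\<close>

lemma fps_eq_divideI: "F * D = N \<Longrightarrow> fps_nth D 0 \<noteq> 0 \<Longrightarrow> F = N / (D :: rat fps)"
  by (metis fps_zero_nth nonzero_mult_div_cancel_right)

text \<open>The dimension formulas are linear on residue classes of the polynomial degree modulo 12,
  hence of \<open>n\<close> modulo 24. Truncated subtraction is harmless by \<open>tau_le\<close>
  and because \<open>inv_dim\<close> is positive in even degrees.\<close>

lemma rank2_shift:
  "rank2 p (n + 24) = rank2 p n + (if odd n then 0 else if odd (n div 2) = p then 4 else 2)"
proof -
  have "(n + 24) div 2 = n div 2 + 12" by simp
  moreover have "tau (d + 12) = tau d + 4" for d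
  proof -
    have "(d + 12 + 3) div 3 = (d + 3) div 3 + 4" "(d + 12) mod 3 = d mod 3" "1 \<le> (d + 3) div 3" by presburger+
    then show ?thesis unfolding tau_def by simp
  qed
  moreover have "inv_dim (d + 12) = inv_dim d + 2" for d
  proof -
    have "(d + 12) div 6 = d div 6 + 2" "(d + 12 + 3) div 6 = (d + 3) div 6 + 2" by presburger+
    then show ?thesis unfolding inv_dim_def by simp
  qed
  moreover have "(d + 12) div 2 = d div 2 + 6" for d :: nat by simp
  moreover have "inv_dim d \<noteq> 0" "tau d \<le> d div 2 + inv_dim d" if "even d" for d
    using that tau_le[of d] by (simp_all add: inv_dim_def)
  then have "even (n div 2) \<Longrightarrow> inv_dim (n div 2) \<noteq> 0" "even (n div 2) \<Longrightarrow> tau (n div 2) \<le> n div 2 div 2 + inv_dim (n div 2)"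
    by blast+
  ultimately show ?thesis
    using tau_le[of "n div 2"] by (auto simp: rank2_def Let_def)
qed

definition shifted :: "(nat \<Rightarrow> rat) \<Rightarrow> nat \<Rightarrow> nat \<Rightarrow> rat" where
  "shifted a k n = (if n < k then 0 else a (n - k))"

definition recurrence :: "(nat \<Rightarrow> rat) \<Rightarrow> nat \<Rightarrow> rat" where
  "recurrence a n = a n - shifted a 2 n + shifted a 6 n - 2 * shifted a 8 n + shifted a 10 n
     - shifted a 14 n + shifted a 16 n"

text \<open>The increments over a shift by 24 depend only on \<open>p\<close> and parities. The
  coefficients of the recurrence sum to zero over the shifts 0, 8, 16 and also over the shifts 2, 6,
  10, 14, so the increments cancel. The bound 40 is 24 + 16 and keeps all terms clear of the
  truncation in \<open>shifted\<close>.\<close>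

lemma recurrence_rank2:
  assumes "40 \<le> n"
  shows "recurrence (\<lambda>n. of_nat (rank2 p n)) n = recurrence (\<lambda>n. of_nat (rank2 p n)) (n - 24)"
proof -
  obtain m where m: "n = m + 16 + 24" using le_Suc_ex[OF assms] by auto
  have expand: "recurrence a (m + 16 + k) = a (m + 16 + k) - a (m + 14 + k) + a (m + 10 + k) - 2 * a (m + 8 + k) + a (m + 6 + k) - a (m + 2 + k) + a (m + k)" for a k
    by (simp add: recurrence_def shifted_def add_ac)
  have half: "(m + 2 * j) div 2 = m div 2 + j" for j by simp
  have "recurrence (\<lambda>n. of_nat (rank2 p n)) (m + 16 + 24) = recurrence (\<lambda>n. of_nat (rank2 p n)) (m + 16 + 0)"
    unfolding expand
    unfolding rank2_shift add_0_right of_nat_add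
    using half[of 8] half[of 7] half[of 5] half[of 4] half[of 3] half[of 1] by simp
  then show ?thesis unfolding m by (simp add: add.commute)
qed

lemma poincare_denominator:
  fixes a :: "nat \<Rightarrow> rat"
  shows "Abs_fps a * ((1 - fps_X ^ 2) * (1 + fps_X ^ 6) * (1 - fps_X ^ 8)) = Abs_fps (recurrence a)"
proof -
  have eq: "(1 - fps_X ^ 2) * (1 + fps_X ^ 6) * (1 - fps_X ^ 8) =
    (1 - fps_X ^ 2 + fps_X ^ 6 - fps_X ^ 8 - fps_X ^ 8 + fps_X ^ 10 - fps_X ^ 14 + fps_X ^ 16 :: rat fps)"
    by (simp add: algebra_simps flip: power_add)
  show ?thesis
    unfolding eq
    unfolding distrib_left right_diff_distrib
    by (simp add: fps_eq_iff recurrence_def shifted_def fps_X_power_mult_right_nth)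
qed

lemma poincare_series_eq:
  assumes "i = k + 2"
  shows "poincare_series (carrier SL2Z) i 2 = Abs_fps (\<lambda>n. of_nat (rank2 (even k) n))" (is ?s2)
    and "poincare_series (carrier SL2Z) i 3 = Abs_fps (\<lambda>n. of_nat (rank3 (even k) n))" (is ?s3)
    and "p \<in> {2, 3} \<Longrightarrow> has_poincare_series (carrier SL2Z) i p"
proof -
  note pres = cohomology_component_presentation[of k]
  have H: "comm_group (cohomology_component (carrier SL2Z) i n)" for n
    using cohomology_presentation.H[OF pres] assms by blast
  have 2: "vectorspace.fin_dim (residue_ring (int 2)) (tensor_Fp (cohomology_component (carrier SL2Z) i n) 2) \<and>
    vectorspace.dim (residue_ring (int 2)) (tensor_Fp (cohomology_component (carrier SL2Z) i n) 2) = rank2 (even k) n" for n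
    using cohomology_presentation.rank_2[OF pres refl] assms by (intro tensor_Fp_dim H) auto
  have 3: "vectorspace.fin_dim (residue_ring (int 3)) (tensor_Fp (cohomology_component (carrier SL2Z) i n) 3) \<and>
    vectorspace.dim (residue_ring (int 3)) (tensor_Fp (cohomology_component (carrier SL2Z) i n) 3) = rank3 (even k) n" for n
    using cohomology_presentation.rank_3[OF pres refl] assms by (intro tensor_Fp_dim H) auto
  show ?s2 ?s3 using 2 3 by (simp_all add: poincare_series_def)
  show "has_poincare_series (carrier SL2Z) i p" if "p \<in> {2, 3}"
    using 2 3 that by (auto simp: has_poincare_series_def)
qed

lemma fps_numeral_mult: "numeral k * (F :: rat fps) = fps_const (numeral k) * F"
  by (simp add: numeral_fps_const)

lemma all_less_40: "(\<forall>n<40. P n) \<longleftrightarrow> list_all P [0, 1, 2, 3, 4, 5, 6, 7, 8, 9, 10, 11, 12, 13, 14, 15, 16, 17, 18, 19,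
    20, 21, 22, 23, 24, 25, 26, 27, 28, 29, 30, 31, 32, 33, 34, 35, 36, 37, 38, 39]" for P :: "nat \<Rightarrow> bool"
proof -
  have "[0, 1, 2, 3, 4, 5, 6, 7, 8, 9, 10, 11, 12, 13, 14, 15, 16, 17, 18, 19,
    20, 21, 22, 23, 24, 25, 26, 27, 28, 29, 30, 31, 32, 33, 34, 35, 36, 37, 38, 39] = [0::nat..<40]"
    by (simp add: upt_conv_Cons)
  then show ?thesis by (simp only: list_all_iff set_upt atLeastLessThan_iff) auto
qed

lemma recurrence_rank2_base:
  assumes "n < 40"
  shows "recurrence (\<lambda>n. of_nat (rank2 True n)) n = fps_nth (1 - fps_X ^ 4 + 2 * fps_X ^ 6 - fps_X ^ 8 + fps_X ^ 12 :: rat fps) n"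
    and "recurrence (\<lambda>n. of_nat (rank2 False n)) n =
      fps_nth (fps_X ^ 4 * (2 - fps_X ^ 2 + fps_X ^ 4 + fps_X ^ 6 - fps_X ^ 8) :: rat fps) n"
proof -
  have "fps_X ^ 4 * (2 - fps_X ^ 2 + fps_X ^ 4 + fps_X ^ 6 - fps_X ^ 8) =
    (2 * fps_X ^ 4 - fps_X ^ 6 + fps_X ^ 8 + fps_X ^ 10 - fps_X ^ 12 :: rat fps)"
    by (simp add: algebra_simps flip: power_add)
  moreover have "\<forall>n<40. recurrence (\<lambda>n. of_nat (rank2 True n)) n = fps_nth (1 - fps_X ^ 4 + 2 * fps_X ^ 6 - fps_X ^ 8 + fps_X ^ 12 :: rat fps) n"
    unfolding all_less_40
    by (simp add: fps_numeral_mult recurrence_def shifted_def rank2_def tau_def inv_dim_def)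
  moreover have "\<forall>n<40. recurrence (\<lambda>n. of_nat (rank2 False n)) n = fps_nth (2 * fps_X ^ 4 - fps_X ^ 6 + fps_X ^ 8 + fps_X ^ 10 - fps_X ^ 12 :: rat fps) n"
    unfolding all_less_40
    by (simp add: fps_numeral_mult recurrence_def shifted_def rank2_def tau_def inv_dim_def)
  ultimately show "recurrence (\<lambda>n. of_nat (rank2 True n)) n = fps_nth (1 - fps_X ^ 4 + 2 * fps_X ^ 6 - fps_X ^ 8 + fps_X ^ 12 :: rat fps) n"
    "recurrence (\<lambda>n. of_nat (rank2 False n)) n =
      fps_nth (fps_X ^ 4 * (2 - fps_X ^ 2 + fps_X ^ 4 + fps_X ^ 6 - fps_X ^ 8) :: rat fps) n"
    using assms by (blast, metis)
qed

text \<open>Below 40 the coefficients are compared by direct computation. They vanish from 13 on,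
  and the period 24 carries this to all larger indices.\<close>

lemma recurrence_rank2_series:
  "Abs_fps (recurrence (\<lambda>n. of_nat (rank2 True n))) = 1 - fps_X ^ 4 + 2 * fps_X ^ 6 - fps_X ^ 8 + fps_X ^ 12" (is "_ = ?N2")
  "Abs_fps (recurrence (\<lambda>n. of_nat (rank2 False n))) = fps_X ^ 4 * (2 - fps_X ^ 2 + fps_X ^ 4 + fps_X ^ 6 - fps_X ^ 8)" (is "_ = ?N3")
proof -
  have N: "fps_nth ?N2 n = 0" "fps_nth ?N3 n = 0" if "12 < n" for n
    using that by (simp_all add: fps_numeral_mult fps_X_power_mult_nth fps_numeral_nth) arith
  have zero: "recurrence (\<lambda>n. of_nat (rank2 p n)) n = 0" if "12 < n" for p n
    using that
  proof (induction n rule: less_induct)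
    case (less n)
    show ?case
    proof (cases "n < 40")
      case True
      then show ?thesis using recurrence_rank2_base[OF True] N[OF less.prems] by (cases p) (simp_all only:)
    next
      case False
      then show ?thesis using recurrence_rank2[of n p] less.IH[of "n - 24"] by simp
    qed
  qed
  have "recurrence (\<lambda>n. of_nat (rank2 True n)) n = fps_nth ?N2 n"
    "recurrence (\<lambda>n. of_nat (rank2 False n)) n = fps_nth ?N3 n" for n
  proof (atomize (full), cases "n < 40")
    case False
    then have "12 < n" by simp
    then show "recurrence (\<lambda>n. of_nat (rank2 True n)) n = fps_nth ?N2 n \<and>
        recurrence (\<lambda>n. of_nat (rank2 False n)) n = fps_nth ?N3 n"
      using zero N by (simp only:)
  qed (intro conjI recurrence_rank2_base)
  then show "Abs_fps (recurrence (\<lambda>n. of_nat (rank2 True n))) = ?N2" "Abs_fps (recurrence (\<lambda>n. of_nat (rank2 False n))) = ?N3"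
    by (simp_all only: fps_eq_iff fps_nth_Abs_fps simp_thms)
qed

lemma rank3_series:
  "Abs_fps (\<lambda>n. of_nat (rank3 True n)) * (1 - fps_X ^ 12) = (1 :: rat fps)"
  "Abs_fps (\<lambda>n. of_nat (rank3 False n)) * (1 - fps_X ^ 12) = (fps_X ^ 8 :: rat fps)"
proof -
  have "rank3 p n = (if n < 12 then if n = (if p then 0 else 8) then 1 else 0 else rank3 p (n - 12))" for p n
    by (simp add: rank3_def mod_if)
  then have eq: "(of_nat (rank3 p n) :: rat) = (if n < 12 then if n = (if p then 0 else 8) then 1 else 0 else of_nat (rank3 p (n - 12)))" for p n
    by simp
  show "Abs_fps (\<lambda>n. of_nat (rank3 True n)) * (1 - fps_X ^ 12) = (1 :: rat fps)"
    "Abs_fps (\<lambda>n. of_nat (rank3 False n)) * (1 - fps_X ^ 12) = (fps_X ^ 8 :: rat fps)"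
    using eq[of True] eq[of False]
    by (auto simp: fps_eq_iff right_diff_distrib fps_X_power_mult_right_nth)
qed

theorem theorem3p8:
  shows
    "(\<forall>i>1. \<forall>n. cohomology_component (carrier SL2Z) i n \<cong> cohomology_component (carrier SL2Z) (i + 2) n) \<and>
     (\<forall>i>1. trivial_group (free_part (cohomology_total (carrier SL2Z) i))) \<and>
     (\<forall>i>1. \<forall>p::nat. Factorial_Ring.prime p \<and> p \<noteq> 2 \<and> p \<noteq> 3 \<longrightarrow>
        \<not> has_element_of_order (cohomology_total (carrier SL2Z) i) p) \<and>
     (\<forall>i>1. \<forall>k>2. \<not> has_element_of_order (cohomology_total (carrier SL2Z) i) (2 ^ k)) \<and>
     (\<forall>i>1. \<forall>k>1. \<not> has_element_of_order (cohomology_total (carrier SL2Z) i) (3 ^ k)) \<and>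
     (\<forall>j\<ge>1. \<forall>m. cyclic_summand_count (cohomology_component (carrier SL2Z) (2 * j) (8 * m)) 2 2 1) \<and>
     (\<forall>i>1. \<forall>n. \<not> (\<exists>j\<ge>1. \<exists>m. i = 2 * j \<and> n = 8 * m) \<longrightarrow>
        \<not> has_element_of_order (cohomology_component (carrier SL2Z) i n) 4) \<and>
     (\<forall>i\<in>{2, 3}. \<forall>p\<in>{2, 3}. has_poincare_series (carrier SL2Z) i p) \<and>
     poincare_series (carrier SL2Z) 2 2 =
       (1 - fps_X ^ 4 + 2 * fps_X ^ 6 - fps_X ^ 8 + fps_X ^ 12) /
       ((1 - fps_X ^ 2) * (1 + fps_X ^ 6) * (1 - fps_X ^ 8)) \<and>
     poincare_series (carrier SL2Z) 3 2 =
       fps_X ^ 4 * (2 - fps_X ^ 2 + fps_X ^ 4 + fps_X ^ 6 - fps_X ^ 8) /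
       ((1 - fps_X ^ 2) * (1 + fps_X ^ 6) * (1 - fps_X ^ 8)) \<and>
     poincare_series (carrier SL2Z) 2 3 = 1 / (1 - fps_X ^ 12) \<and>
     poincare_series (carrier SL2Z) 3 3 = fps_X ^ 8 / (1 - fps_X ^ 12)"
proof (intro conjI allI impI)
  let ?T = "cohomology_total (carrier SL2Z)" and ?C = "cohomology_component (carrier SL2Z)"
  have den: "fps_nth ((1 - fps_X ^ 2) * (1 + fps_X ^ 6) * (1 - fps_X ^ 8) :: rat fps) 0 \<noteq> 0"
    "fps_nth (1 - fps_X ^ 12 :: rat fps) 0 \<noteq> 0"
    by simp_all
  show "?C i n \<cong> ?C (i + 2) n" if "1 < i" for i n
    using that by (rule cohomology_component_periodic)
  note total = cohomology_total_exponent
  show "trivial_group (free_part (?T i))" if "1 < i" for i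
    by (rule free_part_trivial[OF total(1)[OF that] _ total(2)[OF that]]) simp
  \<comment> \<open>Every order divides 12, the product of 4 and 3, which excludes other primes as
    well as 8 and 9.\<close>
  have dvd: "m dvd 12" if "1 < i" "has_element_of_order (?T i) m" for i m
    using order_dvd_exponent[OF total(1)[OF that(1)] total(2)[OF that(1)] that(2)] .
  show "\<not> has_element_of_order (?T i) p" if i: "1 < i" and p: "Factorial_Ring.prime p \<and> p \<noteq> 2 \<and> p \<noteq> 3" for i p
  proof
    assume "has_element_of_order (?T i) p"
    then have "p dvd 2 * 2 * 3" using dvd[OF i] by simp
    then have "p dvd 2 \<or> p dvd 3" using p prime_dvd_multD by blast
    then show False using p primes_dvd_imp_eq[of p 2] primes_dvd_imp_eq[of p 3] by auto
  qed
  show "\<not> has_element_of_order (?T i) (2 ^ k)" if i: "1 < i" and k: "2 < k" for i k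
  proof
    assume "has_element_of_order (?T i) (2 ^ k)"
    then have "2 ^ k dvd (12::nat)" by (rule dvd[OF i])
    moreover have "2 ^ 3 dvd (2 ^ k :: nat)" using k by (intro le_imp_power_dvd) simp
    ultimately have "2 ^ 3 dvd (12::nat)" by (rule dvd_trans[rotated])
    then show False by simp
  qed
  show "\<not> has_element_of_order (?T i) (3 ^ k)" if i: "1 < i" and k: "1 < k" for i k
  proof
    assume "has_element_of_order (?T i) (3 ^ k)"
    then have "3 ^ k dvd (12::nat)" by (rule dvd[OF i])
    moreover have "3 ^ 2 dvd (3 ^ k :: nat)" using k by (intro le_imp_power_dvd) simp
    ultimately have "3 ^ 2 dvd (12::nat)" by (rule dvd_trans[rotated])
    then show False by simp
  qed
  show "cyclic_summand_count (?C (2 * j) (8 * m)) 2 2 1" if j: "1 \<le> j" for j m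
  proof -
    have "2 * j = 2 * (j - 1) + 2" using j by simp
    then interpret cohomology_presentation "?C (2 * j) (8 * m)" "even (2 * (j - 1))" "weight (8 * m)"
      using cohomology_component_presentation[of "2 * (j - 1)" "8 * m"] by simp
    show ?thesis by (rule order_4_summand[of m]) (simp_all add: weight_def)
  qed
  show "\<not> has_element_of_order (?C i n) 4" if i: "1 < i" and n: "\<not> (\<exists>j\<ge>1. \<exists>m. i = 2 * j \<and> n = 8 * m)" for i n
  proof
    assume ord: "has_element_of_order (?C i n) 4"
    define k where "k = i - 2"
    have k: "i = k + 2" using i by (simp add: k_def)
    interpret cohomology_presentation "?C i n" "even k" "weight n"
      unfolding k by (rule cohomology_component_presentation)
    have "\<not> (even k \<and> 8 dvd n)"
    proof
      assume "even k \<and> 8 dvd n"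
      then obtain l m where "k = 2 * l" "n = 8 * m" by (auto elim!: evenE dvdE)
      then have "1 \<le> l + 1 \<and> i = 2 * (l + 1) \<and> n = 8 * m" using k by simp
      then show False using n by blast
    qed
    \<comment> \<open>In all cases other than even cohomological degree with 8 dividing
      \<open>n\<close>, the group is killed by 6.\<close>
    then have "4 dvd (6::nat)"
      using order_dvd_exponent[OF comm_group.axioms(2)[OF H] degree_exponent(2)[OF refl] ord] by blast
    then show False by simp
  qed
  note series2 = poincare_series_eq[of 2 0, simplified] and series3 = poincare_series_eq[of 3 1, simplified]
  show "\<forall>i\<in>{2, 3}. \<forall>p\<in>{2, 3}. has_poincare_series (carrier SL2Z) i p"
    using series2(3) series3(3) by auto
  show "poincare_series (carrier SL2Z) 2 2 =
       (1 - fps_X ^ 4 + 2 * fps_X ^ 6 - fps_X ^ 8 + fps_X ^ 12) /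
       ((1 - fps_X ^ 2) * (1 + fps_X ^ 6) * (1 - fps_X ^ 8))"
    unfolding series2(1) by (intro fps_eq_divideI den(1)) (simp only: poincare_denominator recurrence_rank2_series)
  show "poincare_series (carrier SL2Z) 3 2 =
       fps_X ^ 4 * (2 - fps_X ^ 2 + fps_X ^ 4 + fps_X ^ 6 - fps_X ^ 8) /
       ((1 - fps_X ^ 2) * (1 + fps_X ^ 6) * (1 - fps_X ^ 8))"
    unfolding series3(1) by (intro fps_eq_divideI den(1)) (simp only: poincare_denominator recurrence_rank2_series)
  show "poincare_series (carrier SL2Z) 2 3 = 1 / (1 - fps_X ^ 12)"
    unfolding series2(2) by (intro fps_eq_divideI den(2) rank3_series)
  show "poincare_series (carrier SL2Z) 3 3 = fps_X ^ 8 / (1 - fps_X ^ 12)"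
    unfolding series3(2) by (intro fps_eq_divideI den(2) rank3_series)
qed

end
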